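(* Let $m\in\mathbb{N}$, let $x_0<0$, and fix $R>0$. For any $A>0$ and any $k\in\mathbb{N}$, there exist $T>0$ and data $u_0,u_1\in C^\infty(M_{x_0})$, supported in $\{x_0\le x<R\}$ and vanishing when $x=x_0$, such that the solution $u$ of $$\Box_{\mathfrak g}u=0\ \text{ on }\mathbb{R}_+\times\{x\ge x_0\}\times\mathbb{S}^2,\qquad u(t,x_0,\omega)=0,\qquad u(0,\cdot)=u_0,\quad\partial_tu(0,\cdot)=u_1$$ satisfies $$\|u\|_{LE^1[0,T]}>A\,\|(u_0,u_1)\|_{D(B^k)} .$$
   Context: Let $m\in\mathbb{N}$, $m\ge1$, $a(x)=(x^{2m}+1)^{1/(2m)}$, and let $(\mathbb{S}^2,d\sigma^2_{\mathbb{S}^2})$ be the round unit sphere. $M_{x_0}$ denotes $(x_0,\infty)\times\mathbb{S}^2$ with metric $dx^2+a(x)^2\,d\sigma_{\mathbb{S}^2}^2$ and volume form $dV=a(x)^2\,dx\,d\sigma_{\mathbb{S}^2}$; spatial $L^2$ norms are with respect to $dV$. Its Laplacian is $\Delta_{\mathfrak g}u=a(x)^{-2}\partial_x[a(x)^2\partial_xu]+a(x)^{-2}\Delta_{\mathbb{S}^2}u$, and $\Box_{\mathfrak g}=-\partial_t^2+\Delta_{\mathfrak g}$. $\nabla_0$ denotes the gradient tangent to the unit sphere, and $|\nabla_{\mathfrak g}f|^2=|\partial_xf|^2+a(x)^{-2}|\nabla_0f|^2$. Here $C^\infty(M_{x_0})$ means (complex-valued) functions smooth up to the boundary $\{x=x_0\}$.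 Write $\langle x\rangle=(1+x^2)^{1/2}$, and let $\langle x\rangle\approx2^j$ denote the dyadic region $2^j\le\langle x\rangle\le2^{j+1}$. Set $$\|u\|_{LE[0,T]}=\sup_{j\ge0}2^{-j/2}\Big(\int_0^T\int_{\{\langle x\rangle\approx2^j\}\cap\{x\ge x_0\}}\int_{\mathbb{S}^2}|u(t,x,\omega)|^2a(x)^2\,d\sigma(\omega)\,dx\,dt\Big)^{1/2},$$ $$\|u\|_{LE^1[0,T]}=\|(\partial u,\langle x\rangle^{-1}u)\|_{LE[0,T]},\qquad\partial u=(\partial_tu,\partial_xu,a(x)^{-1}\nabla_0u).$$ $\dot H^1_0(M_{x_0})$ is the completion of smooth functions compactly supported in the open set $(x_0,\infty)\times\mathbb{S}^2$ in the norm $\|\nabla_{\mathfrak g}f\|_{L^2(M_{x_0})}$. Set $H_{x_0}=\dot H_0^1(M_{x_0})\oplus L^2(M_{x_0})$ and $$B=\begin{bmatrix}0&iI\\ i\Delta_{\mathfrak g}&0\end{bmatrix},\qquad \|(u_0,u_1)\|_{D(B^k)}=\|(u_0,u_1)\|_{H_{x_0}}+\|B^k(u_0,u_1)\|_{H_{x_0}} .$$ $B$ is regarded as an unbounded operator on $H_{x_0}$ with Dirichlet boundary conditions, i.e. with domain $\{(u_0,u_1)\in H_{x_0}:\Delta_{\mathfrak g}u_0\in L^2(M_{x_0}),\ u_1\in\dot H^1_0(M_{x_0})\cap L^2(M_{x_0})\}$; if $(u_0,u_1)$ is not in the domain of $B^k$, then $\|(u_0,u_1)\|_{D(B^k)}$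 is taken to be $+\infty$. *)

theory Defs
  imports "HOL-Analysis.Analysis"
begin

type_synonym point = "real \<times> (real^3)"

text \<open>A point of \<open>(x\<^sub>0, \<infinity>) \<times> S\<^sup>2\<close> is a pair \<open>(x, \<omega>)\<close> with \<open>\<omega>\<close> a unit vector of \<open>real^3\<close>.
  Functions on the manifold are total functions on \<open>point\<close>; everything below depends only
  on their values at points with \<open>x \<ge> x\<^sub>0\<close> and \<open>norm \<omega> = 1\<close>.\<close>

abbreviation S2 :: "(real^3) set" where
  "S2 \<equiv> sphere 0 1"

definition warp :: "nat \<Rightarrow> real \<Rightarrow> real" where
  "warp m x = (x ^ (2 * m) + 1) powr (1 / real (2 * m))"

definition japanese :: "real \<Rightarrow> real" where
  "japanese x = sqrt (1 + x\<^sup>2)"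


subsection \<open>Regularity\<close>

text \<open>\<open>C_on n U f\<close> is meant for open \<open>U\<close>.\<close>

fun C_on :: "nat \<Rightarrow> 'a::euclidean_space set \<Rightarrow> ('a \<Rightarrow> 'b::real_normed_vector) \<Rightarrow> bool" where
  "C_on 0 U f \<longleftrightarrow> continuous_on U f"
| "C_on (Suc n) U f \<longleftrightarrow>
     (\<forall>x\<in>U. f differentiable (at x)) \<and> (\<forall>v. C_on n U (\<lambda>x. frechet_derivative f (at x) v))"

text \<open>For sets \<open>D\<close> that are not open, such as \<open>{x\<^sub>0..} \<times> S2\<close>, regularity (up to the boundary) means
  that \<open>f\<close> is the restriction to \<open>D\<close> of a function of that regularity on an open neighbourhood of
  \<open>D\<close> in the ambient Euclidean space.\<close>

definition C_upto :: "nat \<Rightarrow> 'a::euclidean_space set \<Rightarrow> ('a \<Rightarrow> 'b::real_normed_vector) \<Rightarrow> bool" where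
  "C_upto n D f \<longleftrightarrow> (\<exists>U F. open U \<and> D \<subseteq> U \<and> C_on n U F \<and> (\<forall>p\<in>D. F p = f p))"

definition smooth_upto :: "'a::euclidean_space set \<Rightarrow> ('a \<Rightarrow> 'b::real_normed_vector) \<Rightarrow> bool" where
  "smooth_upto D f \<longleftrightarrow> (\<exists>U F. open U \<and> D \<subseteq> U \<and> (\<forall>n. C_on n U F) \<and> (\<forall>p\<in>D. F p = f p))"


subsection \<open>Differential operators\<close>

text \<open>The gradient tangent to the sphere, as a vector of \<open>complex^3\<close>: the Euclidean gradient of the
  extension \<open>y \<mapsto> f (y / norm y)\<close> of \<open>f\<close> that is constant along rays.\<close>

definition sphere_grad :: "(real^3 \<Rightarrow> complex) \<Rightarrow> real^3 \<Rightarrow> complex^3" where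
  "sphere_grad f \<omega> = (\<chi> i. frechet_derivative (\<lambda>y. f (sgn y)) (at \<omega>) (axis i 1))"

text \<open>The Laplace-Beltrami operator of the sphere is the divergence of the gradient. The divergence of
  a tangential field \<open>V\<close> is the trace of its tangential derivative, that is, the sum over \<open>i\<close>
  of the \<open>i\<close>-th component of the tangential gradient of \<open>V $ i\<close>.\<close>

definition sphere_lap :: "(real^3 \<Rightarrow> complex) \<Rightarrow> real^3 \<Rightarrow> complex" where
  "sphere_lap f \<omega> = (\<Sum>i\<in>UNIV. sphere_grad (\<lambda>\<eta>. sphere_grad f \<eta> $ i) \<omega> $ i)"

text \<open>The derivatives in \<open>x\<close> and \<open>t\<close> are one-sided at \<open>x = x\<^sub>0\<close> and \<open>t = 0\<close>.\<close>

definition dx :: "real \<Rightarrow> (point \<Rightarrow> complex) \<Rightarrow> point \<Rightarrow> complex" where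
  "dx x0 f = (\<lambda>(x, \<omega>). vector_derivative (\<lambda>s. f (s, \<omega>)) (at x within {x0..}))"

definition dt :: "(real \<Rightarrow> point \<Rightarrow> complex) \<Rightarrow> real \<Rightarrow> point \<Rightarrow> complex" where
  "dt u t p = vector_derivative (\<lambda>s. u s p) (at t within {0..})"

definition lap :: "nat \<Rightarrow> real \<Rightarrow> (point \<Rightarrow> complex) \<Rightarrow> point \<Rightarrow> complex" where
  "lap m x0 f = (\<lambda>(x, \<omega>).
     (1 / (warp m x)\<^sup>2) *\<^sub>R dx x0 (\<lambda>q. (warp m (fst q))\<^sup>2 *\<^sub>R dx x0 f q) (x, \<omega>)
     + (1 / (warp m x)\<^sup>2) *\<^sub>R sphere_lap (\<lambda>\<eta>. f (x, \<eta>)) \<omega>)"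

text \<open>The components of the gradient in an orthonormal frame, so that the product norm of
  \<open>grad m x0 f (x, \<omega>)\<close> is the Riemannian length of the gradient.\<close>

definition grad :: "nat \<Rightarrow> real \<Rightarrow> (point \<Rightarrow> complex) \<Rightarrow> point \<Rightarrow> complex \<times> (complex^3)" where
  "grad m x0 f = (\<lambda>(x, \<omega>).
     (dx x0 f (x, \<omega>), (1 / warp m x) *\<^sub>R sphere_grad (\<lambda>\<eta>. f (x, \<eta>)) \<omega>))"


subsection \<open>Measures and norms\<close>

text \<open>Surface measure: a Borel subset \<open>E\<close> of the sphere has area three times the volume
  of the cone \<open>{r \<omega> | 0 < r < 1, \<omega> \<in> E}\<close>.\<close>

definition sphere_measure :: "(real^3) measure" where
  "sphere_measure = scale_measure 3
     (distr (restrict_space lborel (ball 0 1 - {0})) (restrict_space borel S2) sgn)"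

lemma measurable_sgn_sphere: "sgn \<in> restrict_space lborel (ball 0 1 - {0::real^3}) \<rightarrow>\<^sub>M restrict_space borel S2"
  apply (rule measurable_restrict_space2)
   apply (auto simp: norm_sgn space_restrict_space)[1]
  apply (rule measurable_restrict_space1)
  unfolding sgn_div_norm by simp

lemma emeasure_sphere_measure: "emeasure sphere_measure S2 = ennreal (4 * pi)"
proof -
  have *: "emeasure lborel (ball 0 1 - {0::real^3}) = emeasure lborel (ball 0 1::(real^3) set)"
    by (rule emeasure_Diff_null_set) auto
  have "emeasure (distr (restrict_space lborel (ball 0 1 - {0::real^3})) (restrict_space borel S2) sgn) S2
     = emeasure (restrict_space lborel (ball 0 1 - {0::real^3})) (sgn -` S2 \<inter> space (restrict_space lborel (ball 0 1 - {0::real^3})))"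
    by (rule emeasure_distr[OF measurable_sgn_sphere]) (auto simp: sets_restrict_space)
  also have "sgn -` S2 \<inter> space (restrict_space lborel (ball 0 1 - {0::real^3})) = ball 0 1 - {0::real^3}"
    by (auto simp: space_restrict_space norm_sgn)
  also have "emeasure (restrict_space lborel (ball 0 1 - {0::real^3})) (ball 0 1 - {0::real^3}) = emeasure lborel (ball 0 1 - {0::real^3})"
    by (rule emeasure_restrict_space) auto
  also have "\<dots> = ennreal (4/3 * pi)"
    unfolding * by (subst emeasure_ball) (auto simp: unit_ball_vol_3)
  finally show ?thesis unfolding sphere_measure_def
    by (simp add: ennreal_mult[symmetric] flip: ennreal_numeral)
qed

definition vol :: "nat \<Rightarrow> real \<Rightarrow> point measure" where
  "vol m x0 = density (restrict_space lborel {x0<..} \<Otimes>\<^sub>M sphere_measure)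
     (\<lambda>(x, \<omega>). ennreal ((warp m x)\<^sup>2))"

text \<open>All norms take values in \<open>ennreal\<close>.\<close>

definition esqrt :: "ennreal \<Rightarrow> ennreal" where
  "esqrt r = (if r = \<infinity> then \<infinity> else ennreal (sqrt (enn2real r)))"

definition L2_norm :: "'a measure \<Rightarrow> ('a \<Rightarrow> 'b::real_normed_vector) \<Rightarrow> ennreal" where
  "L2_norm M f = esqrt (\<integral>\<^sup>+ p. ennreal ((norm (f p))\<^sup>2) \<partial>M)"

definition L2 :: "'a measure \<Rightarrow> ('a \<Rightarrow> 'b::real_normed_vector) set" where
  "L2 M = {f \<in> borel_measurable M. L2_norm M f < \<infinity>}"

definition LE_norm :: "nat \<Rightarrow> real \<Rightarrow> real \<Rightarrow> (real \<Rightarrow> point \<Rightarrow> 'b::real_normed_vector) \<Rightarrow> ennreal" where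
  "LE_norm m x0 T g = (SUP j::nat. ennreal (2 powr (- real j / 2)) *
     esqrt (\<integral>\<^sup>+ t. (\<integral>\<^sup>+ p. ennreal ((norm (g t p))\<^sup>2)
         * indicator {p. 2 ^ j \<le> japanese (fst p) \<and> japanese (fst p) \<le> 2 ^ (j + 1)} p \<partial>vol m x0)
       * indicator {0..T} t \<partial>lborel))"

definition LE1_norm :: "nat \<Rightarrow> real \<Rightarrow> real \<Rightarrow> (real \<Rightarrow> point \<Rightarrow> complex) \<Rightarrow> ennreal" where
  "LE1_norm m x0 T u = LE_norm m x0 T
     (\<lambda>t p. (dt u t p, grad m x0 (u t) p, (1 / japanese (fst p)) *\<^sub>R u t p))"


subsection \<open>The energy space and the generator\<close>

definition test_fun :: "real \<Rightarrow> (point \<Rightarrow> complex) \<Rightarrow> bool" where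
  "test_fun x0 \<phi> \<longleftrightarrow> smooth_upto ({x0<..} \<times> S2) \<phi> \<and>
     (\<exists>K. compact K \<and> K \<subseteq> {x0<..} \<times> S2 \<and> (\<forall>p \<in> {x0<..} \<times> S2 - K. \<phi> p = 0))"

text \<open>The completion of the test functions in the norm \<open>L2_norm (grad \<phi>)\<close>, realized as a space of
  functions. Since test functions vanish near \<open>x = x\<^sub>0\<close>, the \<open>L\<^sup>2\<close> norm of \<open>\<phi>\<close> over
  \<open>{x\<^sub>0 < x < X}\<close> is bounded by a constant (depending on \<open>X\<close>) times the \<open>L\<^sup>2\<close> norm of its gradient.
  Hence sequences that are Cauchy in the gradient norm converge in \<open>L\<^sup>2\<close> over each such set, and
  elements of the completion correspond to the limits \<open>f\<close>. In
  \<open>H10_grad m x0 f G\<close>, \<open>f\<close> is such a limit and \<open>G\<close> is the \<open>L\<^sup>2\<close> limit of the gradients, which \<open>f\<close>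
  determines almost everywhere.\<close>

definition H10_grad ::
  "nat \<Rightarrow> real \<Rightarrow> (point \<Rightarrow> complex) \<Rightarrow> (point \<Rightarrow> complex \<times> (complex^3)) \<Rightarrow> bool" where
  "H10_grad m x0 f G \<longleftrightarrow> f \<in> borel_measurable (vol m x0) \<and> G \<in> L2 (vol m x0) \<and>
     (\<exists>\<phi>::nat \<Rightarrow> point \<Rightarrow> complex. (\<forall>n. test_fun x0 (\<phi> n)) \<and>
       (\<lambda>n. L2_norm (vol m x0) (\<lambda>p. grad m x0 (\<phi> n) p - G p)) \<longlonglongrightarrow> 0 \<and>
       (\<forall>X. (\<lambda>n. L2_norm (vol m x0) (\<lambda>p. indicator {q. fst q < X} p *\<^sub>R (\<phi> n p - f p))) \<longlonglongrightarrow> 0))"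

definition H10 :: "nat \<Rightarrow> real \<Rightarrow> (point \<Rightarrow> complex) set" where
  "H10 m x0 = {f. \<exists>G. H10_grad m x0 f G}"

text \<open>The infimum is over functions \<open>G\<close> that agree almost everywhere; it is \<open>\<infinity>\<close> outside \<open>H10\<close>.\<close>

definition H10_norm :: "nat \<Rightarrow> real \<Rightarrow> (point \<Rightarrow> complex) \<Rightarrow> ennreal" where
  "H10_norm m x0 f = (INF G \<in> {G. H10_grad m x0 f G}. L2_norm (vol m x0) G)"

definition energy_norm ::
  "nat \<Rightarrow> real \<Rightarrow> (point \<Rightarrow> complex) \<times> (point \<Rightarrow> complex) \<Rightarrow> ennreal" where
  "energy_norm m x0 = (\<lambda>(f, g). esqrt ((H10_norm m x0 f)\<^sup>2 + (L2_norm (vol m x0) g)\<^sup>2))"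

text \<open>\<open>w\<close> is the Laplacian of \<open>f\<close> in the sense of distributions.\<close>

definition weak_lap ::
  "nat \<Rightarrow> real \<Rightarrow> (point \<Rightarrow> complex) \<Rightarrow> (point \<Rightarrow> complex) \<Rightarrow> bool" where
  "weak_lap m x0 f w \<longleftrightarrow> (\<forall>\<phi>. test_fun x0 \<phi> \<longrightarrow>
     (\<integral>p. f p * lap m x0 \<phi> p \<partial>vol m x0) = (\<integral>p. w p * \<phi> p \<partial>vol m x0))"

text \<open>The graph of the operator \<open>B\<close> with Dirichlet boundary conditions. The relation is
  single-valued up to null sets.\<close>

definition B_graph :: "nat \<Rightarrow> real \<Rightarrow>
    (((point \<Rightarrow> complex) \<times> (point \<Rightarrow> complex)) \<times>
     ((point \<Rightarrow> complex) \<times> (point \<Rightarrow> complex))) set" where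
  "B_graph m x0 = {((f, g), (\<lambda>p. \<i> * g p, \<lambda>p. \<i> * w p)) | f g w.
     f \<in> H10 m x0 \<and> g \<in> H10 m x0 \<inter> L2 (vol m x0) \<and> w \<in> L2 (vol m x0) \<and> weak_lap m x0 f w}"

text \<open>The second summand is \<open>\<infinity>\<close> if \<open>U\<close> is not in the domain of the \<open>k\<close>-th power of \<open>B\<close>.\<close>

definition DB_norm ::
  "nat \<Rightarrow> real \<Rightarrow> nat \<Rightarrow> (point \<Rightarrow> complex) \<times> (point \<Rightarrow> complex) \<Rightarrow> ennreal" where
  "DB_norm m x0 k U =
     energy_norm m x0 U + (INF V \<in> {V. (U, V) \<in> B_graph m x0 ^^ k}. energy_norm m x0 V)"


subsection \<open>Data and solutions\<close>

definition admissible_datum :: "real \<Rightarrow> real \<Rightarrow> (point \<Rightarrow> complex) \<Rightarrow> bool" where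
  "admissible_datum x0 R f \<longleftrightarrow> smooth_upto ({x0..} \<times> S2) f \<and>
     closure {p \<in> {x0..} \<times> S2. f p \<noteq> 0} \<subseteq> {x0..<R} \<times> S2 \<and>
     (\<forall>\<omega>\<in>S2. f (x0, \<omega>) = 0)"

text \<open>Solutions are classical: twice continuously differentiable up to the boundary.\<close>

definition wave_solution ::
  "nat \<Rightarrow> real \<Rightarrow> (point \<Rightarrow> complex) \<Rightarrow> (point \<Rightarrow> complex)
     \<Rightarrow> (real \<Rightarrow> point \<Rightarrow> complex) \<Rightarrow> bool" where
  "wave_solution m x0 u0 u1 u \<longleftrightarrow>
     C_upto 2 ({0..} \<times> {x0..} \<times> S2) (\<lambda>(t, p). u t p) \<and>
     (\<forall>t\<ge>0. \<forall>p \<in> {x0..} \<times> S2. - dt (dt u) t p + lap m x0 (u t) p = 0) \<and>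
     (\<forall>t\<ge>0. \<forall>\<omega>\<in>S2. u t (x0, \<omega>) = 0) \<and>
     (\<forall>p \<in> {x0..} \<times> S2. u 0 p = u0 p \<and> dt u 0 p = u1 p)"

end

theory Submission imports Defs begin

text \<open>The cross sections of the manifold are smallest at \<open>x = 0\<close>, and the reflecting sphere at
 \<open>x\<^sub>0 < 0\<close> lies beyond that neck. Waves of high angular momentum between the wall and the neck are
 trapped for a time that is exponential in their frequency, so no estimate with a fixed loss of
 derivatives can hold.

 In detail, let \<open>Y\<close> be an eigenfunction on the sphere with eigenvalue \<open>- L\<close>, \<open>L = l (l + 1)\<close>. On
 functions \<open>h(x) Y(\<omega>) / a(x)\<close> the Laplacian acts on \<open>h\<close> as \<open>- P = \<partial>\<^sub>x\<^sup>2 - V\<close>, where \<open>V = a''/a +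
 L/a\<^sup>2\<close>. For large \<open>L\<close> the potential \<open>V\<close> is a barrier with its summit near \<open>x = 0\<close>, and with the
 wall at \<open>x\<^sub>0\<close> it forms a well. Shooting from \<open>0\<close> yields an energy \<open>\<mu>\<close> of size \<open>L\<close>, lower than the
 barrier by a multiple of \<open>L\<close>, and a solution \<open>\<psi>\<close> of \<open>P \<psi> = \<mu> \<psi>\<close> that vanishes at \<open>x\<^sub>0\<close>
 (\<open>trapped_mode\<close>). Under the barrier \<open>\<psi>\<close> decays like \<open>exp (- c \<surd>L)\<close> (\<open>trapped_mode_estimates\<close>).
 Cutting \<open>\<psi>\<close> off there gives a function \<open>q\<close>, supported in \<open>x < 0\<close>, with \<open>(P - \<mu>) q\<close> exponentially
 small.

 The data are \<open>u\<^sub>0 = q Y / a\<close> and \<open>u\<^sub>1 = 0\<close>. Two applications of \<open>B\<close> amount to one of \<open>P\<close>, and the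
 functions \<open>P\<^sup>j q\<close> are combinations of \<open>\<psi>\<close> and \<open>\<psi>'\<close> whose coefficients grow polynomially in \<open>L\<close>.
 Hence \<open>\<parallel>(u\<^sub>0, u\<^sub>1)\<parallel>\<close> in \<open>D(B\<^sup>k)\<close> is at most a power of \<open>L\<close> (\<open>DB_norm_quasimode\<close>).

 The lower bound concerns an arbitrary classical solution \<open>u\<close> with these data. By Green's formula
 its moment \<open>c(t) = \<integral> u(t) q \<^bold>Y / a dV\<close>, where \<open>\<^bold>Y\<close> is the conjugate of \<open>Y\<close>, satisfies \<open>c'' + \<mu> c
 = e\<close>, and \<open>\<bar>e\<bar>\<close> is at most an exponentially small multiple of one plus the energy of \<open>u\<close> in \<open>x <
 0\<close>. With \<open>\<omega> = \<surd>\<mu>\<close>, the amplitude \<open>exp (- \<i> \<omega> t) (c' + \<i> \<omega> c)\<close> hence stays close to its initial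
 value, whose modulus is at least \<open>\<omega>\<close>; so the energy in \<open>x < 0\<close>, integrated over \<open>[0, T]\<close>, grows
 linearly in \<open>T\<close> (\<open>trapped_observability\<close>). If the local energy norm were at most \<open>A\<close> times the
 norm of the data, this integral would be bounded by a power \<open>K\<close> of \<open>L\<close> (\<open>inner_energy_LE1\<close>). A
 time \<open>T\<close> that is a larger power of \<open>L\<close> contradicts this as soon as the exponentially small error
 beats all powers.

 A classical solution does exist (\<open>wave_existence\<close>): \<open>u = v(t, x) Y(\<omega>) / a(x)\<close>, where \<open>v\<close> solves
 the wave equation with potential \<open>V\<close> on the half line. Reflection at the wall and a fixed point
 argument in characteristic coordinates construct \<open>v\<close>.\<close>

section \<open>Calculus of the regularity classes\<close>

lemma C_on_cong:
 assumes "open U" "\<And>x. x \<in> U \<Longrightarrow> f x = g x" "C_on n U f"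
 shows "C_on n U g"
 using assms(2,3)
proof (induction n arbitrary: f g)
 case 0
 then show ?case by (metis C_on.simps(1) continuous_on_eq)
next
 case (Suc n)
 have d: "(g has_derivative frechet_derivative f (at x)) (at x)" if "x \<in> U" for x
 proof (rule has_derivative_transform_within_open[OF _ assms(1) that])
  show "(f has_derivative frechet_derivative f (at x)) (at x)"
   using Suc.prems(2) that frechet_derivative_works by (metis C_on.simps(2))
 qed (rule Suc.prems(1))
 have e: "frechet_derivative g (at x) = frechet_derivative f (at x)" if "x \<in> U" for x
  using frechet_derivative_at[OF d[OF that]] by simp
 show ?case
  unfolding C_on.simps
 proof (intro conjI ballI allI)
  fix x assume "x \<in> U" then show "g differentiable (at x)" using d differentiable_def by blast
 next
  fix v
  have "C_on n U (\<lambda>x. frechet_derivative f (at x) v)" using Suc.prems by auto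
  then show "C_on n U (\<lambda>x. frechet_derivative g (at x) v)"
   by (rule Suc.IH[rotated]) (simp add: e)
 qed
qed

lemma C_on_SucI:
 assumes "open U" "\<And>x. x \<in> U \<Longrightarrow> (f has_derivative f' x) (at x)" "\<And>v. C_on n U (\<lambda>x. f' x v)"
 shows "C_on (Suc n) U f"
proof -
 have e: "frechet_derivative f (at x) = f' x" if "x \<in> U" for x
  using frechet_derivative_at[OF assms(2)[OF that]] by simp
 show ?thesis unfolding C_on.simps
  using assms e by (auto simp: differentiable_def intro: C_on_cong[OF assms(1) _ assms(3)])
qed

lemma C_on_SucD: "C_on (Suc n) U f \<Longrightarrow> C_on n U f"
proof (induction n arbitrary: f)
 case 0
 then show ?case
  by (simp add: continuous_at_imp_continuous_on differentiable_imp_continuous_within)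
qed auto

lemma C_on_mono: "n \<le> N \<Longrightarrow> C_on N U f \<Longrightarrow> C_on n U f"
 by (induction N) (auto simp: le_Suc_eq dest: C_on_SucD simp del: C_on.simps)

lemma C_on_imp_continuous: "C_on n U f \<Longrightarrow> continuous_on U f"
 using C_on_mono[of 0 n] by auto

lemma C_on_subset: "V \<subseteq> U \<Longrightarrow> C_on n U f \<Longrightarrow> C_on n V f"
 by (induction n arbitrary: f) (auto intro: continuous_on_subset)

lemma C_on_Un:
 "open U \<Longrightarrow> open V \<Longrightarrow> C_on n U f \<Longrightarrow> C_on n V f \<Longrightarrow> C_on n (U \<union> V) f"
 by (induction n arbitrary: f) (auto intro: continuous_on_open_Un)

lemma C_on_const: "open U \<Longrightarrow> C_on n U (\<lambda>x. c)"
proof (induction n arbitrary: c)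
 case (Suc n)
 then show ?case by (intro C_on_SucI[where f'="\<lambda>_ _. 0"]) auto
qed auto

lemma C_on_bounded_linear:
 assumes "open U" "bounded_linear f" shows "C_on n U f"
proof (cases n)
 case 0
 then show ?thesis using assms by (auto simp: linear_continuous_on)
next
 case (Suc k)
 have "C_on (Suc k) U f"
  using assms by (intro C_on_SucI[where f'="\<lambda>_. f"])
   (auto intro: bounded_linear_imp_has_derivative C_on_const)
 then show ?thesis using Suc by simp
qed

lemma C_on_id: "open U \<Longrightarrow> C_on n U (\<lambda>x. x)"
 by (rule C_on_bounded_linear) (auto simp: bounded_linear_ident)

lemma C_on_has_derivative:
 "C_on (Suc n) U f \<Longrightarrow> x \<in> U \<Longrightarrow> (f has_derivative frechet_derivative f (at x)) (at x)"
 by (auto simp: frechet_derivative_works)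

lemma C_on_add:
 assumes "open U" shows "C_on n U f \<Longrightarrow> C_on n U g \<Longrightarrow> C_on n U (\<lambda>x. f x + g x)"
proof (induction n arbitrary: f g)
 case 0
 then show ?case by (auto intro: continuous_intros)
next
 case (Suc n)
 show ?case
  using Suc by (intro C_on_SucI[OF assms has_derivative_add[OF C_on_has_derivative C_on_has_derivative]]) auto
qed

lemma C_on_linear_comp:
 assumes "open U" "bounded_linear L" shows "C_on n U f \<Longrightarrow> C_on n U (\<lambda>x. L (f x))"
proof (induction n arbitrary: f)
 case 0
 then show ?case using assms by (auto intro: bounded_linear.continuous_on)
next
 case (Suc n)
 show ?case
  using Suc by (intro C_on_SucI[OF assms(1) bounded_linear.has_derivative[OF assms(2) C_on_has_derivative]]) auto
qed

text \<open>One bilinear rule serves all products: the derivative of a product is a sum of two products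
 of the same kind.\<close>

lemma C_on_bilinear:
 assumes "open U" "bounded_bilinear B"
 shows "C_on n U f \<Longrightarrow> C_on n U g \<Longrightarrow> C_on n U (\<lambda>x. B (f x) (g x))"
proof (induction n arbitrary: f g)
 case 0
 then show ?case using assms by (auto intro: bounded_bilinear.continuous_on)
next
 case (Suc n)
 have "C_on n U f" "C_on n U g" using Suc.prems C_on_SucD by blast+
 then show ?case
  using Suc assms by (intro C_on_SucI[OF assms(1) bounded_bilinear.FDERIV[OF assms(2) C_on_has_derivative C_on_has_derivative]])
   (auto intro!: C_on_add)
qed

lemmas C_on_scaleR = C_on_bilinear[OF _ bounded_bilinear_scaleR]
lemmas C_on_mult = C_on_bilinear[OF _ bounded_bilinear_mult]
lemmas C_on_inner = C_on_bilinear[OF _ bounded_bilinear_inner]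
lemmas C_on_of_real = C_on_linear_comp[OF _ bounded_linear_of_real]
lemmas C_on_minus = C_on_linear_comp[OF _ bounded_linear_minus[OF bounded_linear_ident]]

lemma C_on_diff:
 assumes "open U" "C_on n U f" "C_on n U g" shows "C_on n U (\<lambda>x. f x - g x)"
 using C_on_add[OF assms(1,2) C_on_minus[OF assms(1,3)]] by simp

lemma C_on_sum:
 assumes "open U" "\<And>i. i \<in> I \<Longrightarrow> C_on n U (f i)" shows "C_on n U (\<lambda>x. \<Sum>i\<in>I. f i x)"
 using assms(2) by (induction I rule: infinite_finite_induct) (auto intro: C_on_const C_on_add assms(1))

lemma C_on_power:
 fixes f :: "'a::euclidean_space \<Rightarrow> 'b::real_normed_algebra_1"
 assumes "open U" "C_on n U f" shows "C_on n U (\<lambda>x. f x ^ k)"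
 by (induction k) (auto intro: C_on_const C_on_mult assms)

text \<open>By induction on \<open>n\<close>: the chain rule writes \<open>D(g \<circ> f)\<close> as a sum over a basis of products of
 components of \<open>Df\<close> with partial derivatives of \<open>g\<close> composed with \<open>f\<close>.\<close>

lemma C_on_compose:
 fixes f :: "'a::euclidean_space \<Rightarrow> 'b::euclidean_space"
 assumes "open U" "f ` U \<subseteq> V"
 shows "C_on n U f \<Longrightarrow> C_on n V g \<Longrightarrow> C_on n U (\<lambda>x. g (f x))"
proof (induction n arbitrary: g)
 case 0
 then show ?case using assms(2) by (auto intro: continuous_on_compose2)
next
 case (Suc n)
 let ?f' = "\<lambda>x. frechet_derivative f (at x)" and ?g' = "\<lambda>x. frechet_derivative g (at x)"
 have fn: "C_on n U f" using Suc.prems C_on_SucD by blast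
 have D: "((\<lambda>x. g (f x)) has_derivative (\<lambda>v. ?g' (f x) (?f' x v))) (at x)" if "x \<in> U" for x
  using diff_chain_at[OF C_on_has_derivative[OF Suc.prems(1) that] C_on_has_derivative[OF Suc.prems(2)], unfolded o_def]
   assms(2) that by blast
 have lin: "linear (?g' (f x))" if "x \<in> U" for x
  using C_on_has_derivative[OF Suc.prems(2), of "f x"] assms(2) that has_derivative_linear by blast
 have eq: "?g' (f x) w = (\<Sum>b\<in>Basis. (w \<bullet> b) *\<^sub>R ?g' (f x) b)" if "x \<in> U" for x w
  by (subst euclidean_representation[of w, symmetric], subst linear_sum[OF lin[OF that]])
    (simp add: linear_cmul[OF lin[OF that]])
 show ?case
 proof (rule C_on_SucI[OF assms(1) D])
  fix v
  have "C_on n U (\<lambda>x. \<Sum>b\<in>Basis. (?f' x v \<bullet> b) *\<^sub>R ?g' (f x) b)"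
  proof (intro C_on_sum C_on_scaleR assms(1))
   fix b :: 'b
   show "C_on n U (\<lambda>x. ?f' x v \<bullet> b)"
    using Suc.prems by (intro C_on_inner C_on_const assms(1)) auto
   show "C_on n U (\<lambda>x. ?g' (f x) b)" using Suc.prems by (intro Suc.IH fn) auto
  qed
  then show "C_on n U (\<lambda>x. ?g' (f x) (?f' x v))"
   by (rule C_on_cong[OF assms(1), rotated]) (simp add: eq[symmetric])
 qed auto
qed

lemma C_on_Pair:
 assumes "open U" shows "C_on n U f \<Longrightarrow> C_on n U g \<Longrightarrow> C_on n U (\<lambda>x. (f x, g x))"
proof (induction n arbitrary: f g)
 case 0
 then show ?case by (auto intro: continuous_intros)
next
 case (Suc n)
 show ?case
  using Suc by (intro C_on_SucI[OF assms has_derivative_Pair[OF C_on_has_derivative C_on_has_derivative]]) auto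
qed

lemma C_on_fst: "open U \<Longrightarrow> C_on n U fst" and C_on_snd: "open U \<Longrightarrow> C_on n U snd"
 by (auto intro: C_on_bounded_linear bounded_linear_fst bounded_linear_snd)

subsection \<open>Functions of one real variable\<close>

lemma C_on_Suc_vector:
 fixes f :: "real \<Rightarrow> 'b::real_normed_vector"
 assumes "open U" "\<And>x. x \<in> U \<Longrightarrow> (f has_vector_derivative f' x) (at x)" "C_on n U f'"
 shows "C_on (Suc n) U f"
 using assms
 by (intro C_on_SucI[where f'="\<lambda>x v. v *\<^sub>R f' x"])
   (auto simp: has_vector_derivative_def intro: C_on_scaleR C_on_const)

lemma C_on_powr: "C_on n {0<..} (\<lambda>r::real. r powr s)"
proof (induction n arbitrary: s)
 case 0
 then show ?case by (auto intro!: continuous_intros)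
next
 case (Suc n)
 show ?case
 proof (rule C_on_Suc_vector)
  show "((\<lambda>r. r powr s) has_vector_derivative s * x powr (s - 1)) (at x)" if "x \<in> {0<..}" for x
   unfolding has_real_derivative_iff_has_vector_derivative[symmetric]
   using that by (auto intro!: derivative_eq_intros)
 qed (auto intro!: C_on_mult C_on_const Suc)
qed

text \<open>Needed since the tangential gradient is defined through the extension \<open>y \<mapsto> f (sgn y)\<close>.\<close>

lemma C_on_sgn: "C_on n (- {0}) (sgn :: 'a::euclidean_space \<Rightarrow> 'a)"
proof -
 have op: "open (- {0::'a})" by auto
 have "C_on n (- {0}) (\<lambda>x::'a. (x \<bullet> x) powr (-1/2))"
  by (rule C_on_compose[where V="{0<..}" and f="\<lambda>x. x \<bullet> x"])
    (auto intro!: op C_on_inner C_on_id C_on_powr)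
 then have "C_on n (- {0}) (\<lambda>x::'a. ((x \<bullet> x) powr (-1/2)) *\<^sub>R x)"
  by (intro C_on_scaleR C_on_id op)
 then show ?thesis
 proof (rule C_on_cong[OF op, rotated])
  fix x :: 'a assume "x \<in> - {0}"
  then have "(x \<bullet> x) powr (-1/2) = inverse (norm x)"
   by (simp add: norm_eq_sqrt_inner powr_minus powr_half_sqrt)
  then show "((x \<bullet> x) powr (-1/2)) *\<^sub>R x = sgn x" by (simp add: sgn_div_norm)
 qed
qed

subsection \<open>Regularity up to the boundary\<close>

lemma C_uptoI: "open U \<Longrightarrow> D \<subseteq> U \<Longrightarrow> C_on n U F \<Longrightarrow> (\<And>p. p \<in> D \<Longrightarrow> F p = f p) \<Longrightarrow> C_upto n D f"
 unfolding C_upto_def by blast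

lemma C_upto_mono: "n \<le> N \<Longrightarrow> C_upto N D f \<Longrightarrow> C_upto n D f"
 unfolding C_upto_def using C_on_mono by blast

lemma C_upto_imp_continuous: "C_upto n D f \<Longrightarrow> continuous_on D f"
 unfolding C_upto_def by (metis C_on_imp_continuous continuous_on_subset continuous_on_cong)

lemma C_upto_cong: "(\<And>p. p \<in> D \<Longrightarrow> f p = g p) \<Longrightarrow> C_upto n D f \<Longrightarrow> C_upto n D g"
 unfolding C_upto_def by metis

lemma C_upto_bilinear:
 assumes "bounded_bilinear B" "C_upto n D f" "C_upto n D g"
 shows "C_upto n D (\<lambda>x. B (f x) (g x))"
proof -
 obtain U F where F: "open U" "D \<subseteq> U" "C_on n U F" "\<forall>p\<in>D. F p = f p"
  using assms(2) unfolding C_upto_def by blast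
 obtain V G where G: "open V" "D \<subseteq> V" "C_on n V G" "\<forall>p\<in>D. G p = g p"
  using assms(3) unfolding C_upto_def by blast
 have "C_on n (U \<inter> V) F" "C_on n (U \<inter> V) G"
  by (rule C_on_subset[OF _ F(3)] C_on_subset[OF _ G(3)]; simp)+
 from C_on_bilinear[OF open_Int[OF F(1) G(1)] assms(1) this]
 show ?thesis by (rule C_uptoI[OF open_Int[OF F(1) G(1)], rotated]) (use F G in auto)
qed

lemmas C_upto_mult = C_upto_bilinear[OF bounded_bilinear_mult]
lemmas C_upto_scaleR = C_upto_bilinear[OF bounded_bilinear_scaleR]

text \<open>Extensions of \<open>f\<close> pull back along \<open>h\<close>, which only has to be regular near \<open>D'\<close>.\<close>

lemma C_upto_compose:
 fixes h :: "'a::euclidean_space \<Rightarrow> 'b::euclidean_space"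
 assumes "C_upto n D f" "open W" "D' \<subseteq> W" "C_on n W h" "h ` D' \<subseteq> D"
 shows "C_upto n D' (\<lambda>x. f (h x))"
proof -
 obtain U F where U: "open U" "D \<subseteq> U" "C_on n U F" "\<forall>p\<in>D. F p = f p"
  using assms unfolding C_upto_def by blast
 have o: "open (W \<inter> h -` U)"
  by (rule continuous_open_preimage[OF C_on_imp_continuous[OF assms(4)] assms(2) U(1)])
 have "C_on n (W \<inter> h -` U) h" using assms(4) by (rule C_on_subset[rotated]) auto
 from C_on_compose[OF o _ this U(3)] have "C_on n (W \<inter> h -` U) (\<lambda>x. F (h x))" by auto
 then show ?thesis
  by (rule C_uptoI[OF o, rotated]) (use U(2,4) assms(3,5) in \<open>auto simp: image_subset_iff subset_iff\<close>)
qed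

lemma C_upto_of_C_on: "C_on n UNIV f \<Longrightarrow> C_upto n D f"
 by (rule C_uptoI[where U=UNIV]) auto

text \<open>Along segments inside \<open>D\<close> the extension coincides with \<open>f\<close>, so its directional derivatives
 are derivatives of \<open>f\<close>, also one-sided ones at the boundary.\<close>

lemma C_upto_directional:
 assumes "C_upto (Suc n) D f"
 shows "\<exists>g. (\<forall>v. C_upto n D (\<lambda>p. g p v)) \<and>
   (\<forall>p v S (s::real). p \<in> D \<longrightarrow> s \<in> S \<longrightarrow> (\<forall>r\<in>S. p + (r - s) *\<^sub>R v \<in> D) \<longrightarrow>
    ((\<lambda>r. f (p + (r - s) *\<^sub>R v)) has_vector_derivative g p v) (at s within S))"
proof -
 obtain U F where U: "open U" "D \<subseteq> U" "C_on (Suc n) U F" "\<forall>p\<in>D. F p = f p"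
  using assms unfolding C_upto_def by blast
 let ?g = "\<lambda>p v. frechet_derivative F (at p) v"
 show ?thesis
 proof (rule exI[of _ ?g], intro conjI allI impI)
  show "C_upto n D (\<lambda>p. ?g p v)" for v
   using U(3) by (intro C_uptoI[OF U(1,2)]) auto
 next
  fix p v S and s :: real assume a: "p \<in> D" "s \<in> S" "\<forall>r\<in>S. p + (r - s) *\<^sub>R v \<in> D"
  have F: "(F has_derivative ?g p) (at p)"
   using U(2) a(1) by (intro C_on_has_derivative[OF U(3)]) auto
  have "((\<lambda>r. F (p + (r - s) *\<^sub>R v)) has_derivative (\<lambda>r. ?g p (r *\<^sub>R v))) (at s within S)"
  proof (rule has_derivative_compose[where f="\<lambda>r. p + (r - s) *\<^sub>R v" and g=F])
   show "((\<lambda>r. p + (r - s) *\<^sub>R v) has_derivative (\<lambda>r. r *\<^sub>R v)) (at s within S)"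
    by (auto intro!: derivative_eq_intros)
  qed (use F in simp)
  then have "((\<lambda>r. F (p + (r - s) *\<^sub>R v)) has_vector_derivative ?g p v) (at s within S)"
   unfolding has_vector_derivative_def
   using has_derivative_linear[OF F] by (simp add: linear_cmul)
  then show "((\<lambda>r. f (p + (r - s) *\<^sub>R v)) has_vector_derivative ?g p v) (at s within S)"
   by (rule has_vector_derivative_transform[rotated 2]) (use a U in auto)
 qed
qed

section \<open>Integral equations in the plane\<close>

text \<open>Banach's theorem in the space of continuous functions \<open>F\<close> with \<open>F/w\<close> bounded. An exponential
 weight makes Volterra operators on an unbounded domain contract.\<close>

lemma weighted_fixpoint:
 fixes T :: "('a::metric_space \<Rightarrow> real) \<Rightarrow> 'a \<Rightarrow> real"
 assumes w: "continuous_on UNIV w" "\<And>x. w x > 0" and c: "0 \<le> c" "c < 1"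
  and cont: "\<And>F. continuous_on UNIV F \<Longrightarrow> continuous_on UNIV (T F)"
  and T0: "\<And>x. \<bar>T (\<lambda>_. 0) x\<bar> \<le> C * w x"
  and contr: "\<And>F G B x. continuous_on UNIV F \<Longrightarrow> continuous_on UNIV G \<Longrightarrow> (\<And>x. \<bar>F x - G x\<bar> \<le> B * w x)
    \<Longrightarrow> \<bar>T F x - T G x\<bar> \<le> c * B * w x"
 shows "\<exists>F. continuous_on UNIV F \<and> T F = F"
proof -
 define W where "W f = (\<lambda>x. w x * apply_bcontfun f x)" for f :: "'a \<Rightarrow>\<^sub>C real"
 have Wc: "continuous_on UNIV (W f)" for f unfolding W_def by (intro continuous_intros w) auto
 have w0: "w x \<noteq> 0" for x using w(2)[of x] by simp
 have Tb: "(\<lambda>x. T (W f) x / w x) \<in> bcontfun" for f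
 proof (rule bcontfun_normI)
  show "continuous_on UNIV (\<lambda>x. T (W f) x / w x)"
   by (intro continuous_intros w cont Wc) (use w0 in auto)
  fix x
  have "\<bar>W f x - 0\<bar> \<le> norm f * w x" for x
   using norm_bounded[of f x] w(2)[of x] by (simp add: W_def abs_mult mult.commute)
  then have "\<bar>T (W f) x - T (\<lambda>_. 0) x\<bar> \<le> c * norm f * w x" by (intro contr Wc) auto
  then have "\<bar>T (W f) x\<bar> \<le> (c * norm f + C) * w x" using T0[of x] by (simp add: algebra_simps)
  then show "norm (T (W f) x / w x) \<le> c * norm f + C" using w(2)[of x] by (simp add: field_simps)
 qed
 define \<Phi> where "\<Phi> f = Bcontfun (\<lambda>x. T (W f) x / w x)" for f
 have ap: "apply_bcontfun (\<Phi> f) x = T (W f) x / w x" for f x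
  unfolding \<Phi>_def using Bcontfun_inverse[OF Tb] by simp
 have "\<forall>f g. dist (\<Phi> f) (\<Phi> g) \<le> c * dist f g"
 proof (intro allI dist_bound)
  fix f g x
  have "\<bar>W f x - W g x\<bar> \<le> dist f g * w x" for x
  proof -
   have "\<bar>apply_bcontfun f x - apply_bcontfun g x\<bar> \<le> dist f g" using dist_bounded[of f x g] by (simp add: dist_real_def)
   then have "w x * \<bar>apply_bcontfun f x - apply_bcontfun g x\<bar> \<le> w x * dist f g"
    using w(2)[of x] by (intro mult_left_mono) auto
   then show ?thesis using w(2)[of x]
    by (simp add: W_def right_diff_distrib[symmetric] abs_mult mult.commute)
  qed
  then have "\<bar>T (W f) x - T (W g) x\<bar> \<le> c * dist f g * w x" by (intro contr Wc)
  then show "dist (apply_bcontfun (\<Phi> f) x) (apply_bcontfun (\<Phi> g) x) \<le> c * dist f g"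
   unfolding ap dist_real_def diff_divide_distrib[symmetric] abs_divide abs_of_pos[OF w(2)] pos_divide_le_eq[OF w(2)] .
 qed
 from banach_fix_type[OF c this] obtain f where f: "\<Phi> f = f" by auto
 have "T (W f) = W f"
 proof
  fix x show "T (W f) x = W f x" using ap[of f x] w0[of x] unfolding f by (simp add: W_def field_simps)
 qed
 then show ?thesis using Wc by blast
qed

text \<open>The oriented integral of \<open>f\<close> from \<open>a\<close> to \<open>b\<close>, for \<open>a\<close> and \<open>b\<close> in any order; scaling to \<open>[0,
 1]\<close> makes its continuity in parameters immediate.\<close>

definition sint :: "(real \<Rightarrow> real) \<Rightarrow> real \<Rightarrow> real \<Rightarrow> real" where
 "sint f a b = (b - a) * integral {0..1} (\<lambda>\<sigma>. f (a + \<sigma> * (b - a)))"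

lemma sint_FTC:
 assumes "\<And>x. x \<in> closed_segment a b \<Longrightarrow> (\<Phi> has_real_derivative f x) (at x within closed_segment a b)"
 shows "sint f a b = \<Phi> b - \<Phi> a"
proof -
 let ?s = "\<lambda>\<sigma>. a + \<sigma> * (b - a)"
 have img: "?s \<sigma> \<in> closed_segment a b" if "\<sigma> \<in> {0..1}" for \<sigma>
  using that by (auto simp: closed_segment_def algebra_simps intro!: exI[of _ \<sigma>])
 have "((\<lambda>\<sigma>. (b - a) * f (?s \<sigma>)) has_integral (\<Phi> (?s 1) - \<Phi> (?s 0))) {0..1}"
 proof (rule fundamental_theorem_of_calculus)
  fix \<sigma> :: real assume \<sigma>: "\<sigma> \<in> {0..1}"
  have "(?s has_real_derivative (b - a)) (at \<sigma> within {0..1})" by (auto intro!: derivative_eq_intros)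
  moreover have "(\<Phi> has_real_derivative f (?s \<sigma>)) (at (?s \<sigma>) within ?s ` {0..1})"
   by (rule DERIV_subset[OF assms[OF img[OF \<sigma>]]]) (use img in auto)
  ultimately have "((\<lambda>\<sigma>. \<Phi> (?s \<sigma>)) has_real_derivative f (?s \<sigma>) * (b - a)) (at \<sigma> within {0..1})"
   using DERIV_image_chain[of \<Phi> "f (?s \<sigma>)" ?s \<sigma> "{0..1}" "b - a"] by (simp add: o_def)
  then show "((\<lambda>\<sigma>. \<Phi> (?s \<sigma>)) has_vector_derivative (b - a) * f (?s \<sigma>)) (at \<sigma> within {0..1})"
   by (simp add: has_real_derivative_iff_has_vector_derivative mult.commute)
 qed simp
 then have "integral {0..1} (\<lambda>\<sigma>. (b - a) * f (?s \<sigma>)) = \<Phi> (?s 1) - \<Phi> (?s 0)" by (rule integral_unique)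
 then show ?thesis unfolding sint_def integral_mult_right by simp
qed

lemma sint_refl [simp]: "sint f a a = 0" by (simp add: sint_def)

lemma sint_has_derivative:
 assumes "continuous_on UNIV f"
 shows "DERIV (\<lambda>b. sint f a b) b :> f b"
proof -
 define N where "N = \<bar>a\<bar> + \<bar>b\<bar> + 1"
 have "continuous_on {-N..N} f" using assms continuous_on_subset by blast
 then obtain g where g: "\<And>x. x \<in> {-N..N} \<Longrightarrow> (g has_vector_derivative f x) (at x within {-N..N})"
  using antiderivative_continuous by blast
 have s: "sint f a y = g y - g a" if "y \<in> {-N<..<N}" for y
 proof (rule sint_FTC)
  have sub: "closed_segment a y \<subseteq> {-N..N}"
   using that by (intro closed_segment_subset) (auto simp: N_def)
  fix x assume "x \<in> closed_segment a y"
  then show "(g has_real_derivative f x) (at x within closed_segment a y)"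
   using sub has_vector_derivative_within_subset[OF g sub]
   by (auto simp: has_real_derivative_iff_has_vector_derivative)
 qed
 have b: "b \<in> {-N<..<N}" by (auto simp: N_def)
 have "(g has_real_derivative f b) (at b within {-N..N})"
  using g[of b] b by (simp add: has_real_derivative_iff_has_vector_derivative)
 then have "DERIV g b :> f b"
  using b at_within_Icc_at[of "-N" b N] by simp
 then have "DERIV (\<lambda>y. g y - g a) b :> f b" by (auto intro!: derivative_eq_intros)
 then show ?thesis
  by (rule has_field_derivative_transform_within_open[OF _ open_greaterThanLessThan b]) (simp add: s)
qed

text \<open>Each integration gains the reciprocal of the rate of the exponential weight.\<close>

lemma sint_bound:
 assumes f: "continuous_on UNIV f" and k: "k > 0" and b: "\<And>x. x \<in> closed_segment a y \<Longrightarrow> \<bar>f x\<bar> \<le> B * exp (k * \<bar>x - a\<bar>)"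
 shows "\<bar>sint f a y\<bar> \<le> B / k * exp (k * \<bar>y - a\<bar>)"
proof -
 let ?F = "\<lambda>y. sint f a y"
 have B: "B \<ge> 0" using b[of a] by auto
 define sg :: real where "sg = (if y \<ge> a then 1 else -1)"
 have ab: "\<bar>x - a\<bar> = sg * (x - a)" if "x \<in> closed_segment a y" for x
  using that by (auto simp: sg_def closed_segment_eq_real_ivl split: if_splits)
 \<comment> \<open>Both \<open>sint f a\<close> and its negative are dominated by the primitive of the weight.\<close>
 have main: "s * ?F y \<le> B / k * exp (k * \<bar>y - a\<bar>)" if s: "s = 1 \<or> s = -1" for s :: real
 proof -
  let ?h = "\<lambda>r. B / k * exp (k * (r * \<bar>y - a\<bar>)) - s * ?F (a + r * (y - a))"
  have "?h 0 \<le> ?h 1"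
  proof (rule DERIV_nonneg_imp_nondecreasing[of 0 1 ?h])
   fix r :: real assume r: "0 \<le> r" "r \<le> 1"
   have x: "a + r * (y - a) \<in> closed_segment a y"
    using r by (auto simp: closed_segment_def algebra_simps intro!: exI[of _ r])
   have "DERIV (\<lambda>r. ?F (a + r * (y - a))) r :> f (a + r * (y - a)) * (y - a)"
    by (rule DERIV_chain'[of "\<lambda>r. a + r * (y - a)", OF _ sint_has_derivative[OF f]])
      (auto intro!: derivative_eq_intros)
   then have "DERIV ?h r :> B * exp (k * (r * \<bar>y - a\<bar>)) * \<bar>y - a\<bar> - s * (f (a + r * (y - a)) * (y - a))"
    using k by (auto intro!: derivative_eq_intros)
   moreover have "s * (f (a + r * (y - a)) * (y - a)) \<le> B * exp (k * (r * \<bar>y - a\<bar>)) * \<bar>y - a\<bar>"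
   proof -
    have "\<bar>f (a + r * (y - a))\<bar> \<le> B * exp (k * (r * \<bar>y - a\<bar>))" using b[OF x] r by (simp add: abs_mult)
    then have "\<bar>f (a + r * (y - a))\<bar> * \<bar>y - a\<bar> \<le> B * exp (k * (r * \<bar>y - a\<bar>)) * \<bar>y - a\<bar>"
     by (intro mult_right_mono) auto
    moreover have "\<bar>s * (f (a + r * (y - a)) * (y - a))\<bar> = \<bar>f (a + r * (y - a))\<bar> * \<bar>y - a\<bar>"
     using s by (auto simp: abs_mult)
    ultimately show ?thesis by linarith
   qed
   ultimately show "\<exists>d. DERIV ?h r :> d \<and> 0 \<le> d"
    by (intro exI[where x="B * exp (k * (r * \<bar>y - a\<bar>)) * \<bar>y - a\<bar> - s * (f (a + r * (y - a)) * (y - a))"]) simp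
  qed auto
  moreover have "B / k \<ge> 0" using B k by simp
  ultimately show ?thesis by simp
 qed
 show ?thesis using main[of 1] main[of "-1"] by (simp add: abs_le_iff)
qed

subsection \<open>Partial derivatives\<close>

definition pd1 :: "(real \<times> real \<Rightarrow> real) \<Rightarrow> (real \<times> real \<Rightarrow> real) \<Rightarrow> bool" where
 "pd1 F F' \<longleftrightarrow> (\<forall>p y. DERIV (\<lambda>p. F (p, y)) p :> F' (p, y))"

definition pd2 :: "(real \<times> real \<Rightarrow> real) \<Rightarrow> (real \<times> real \<Rightarrow> real) \<Rightarrow> bool" where
 "pd2 F F' \<longleftrightarrow> (\<forall>p y. DERIV (\<lambda>y. F (p, y)) y :> F' (p, y))"

lemma has_derivative_of_partials:
 assumes "pd1 F F1" "pd2 F F2" "continuous_on UNIV F2"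
 shows "(F has_derivative (\<lambda>v. fst v * F1 q + snd v * F2 q)) (at q)"
proof -
 obtain x y where q: "q = (x, y)" by fastforce
 have "((\<lambda>(x, y). (\<lambda>x y. F (x, y)) x y) has_derivative (\<lambda>(tx, ty). tx * F1 (x, y) + blinfun_apply (blinfun_mult_right (F2 (x, y))) ty)) (at (x, y) within UNIV \<times> UNIV)"
 proof (rule has_derivative_partialsI)
  have "((\<lambda>x. F (x, y)) has_derivative (*) (F1 (x, y))) (at x within UNIV)"
   using assms(1) by (auto simp: pd1_def has_field_derivative_def)
  then show "((\<lambda>x. F (x, y)) has_derivative (\<lambda>tx. tx * F1 (x, y))) (at x within UNIV)"
   by (rule has_derivative_eq_rhs) (simp add: fun_eq_iff)
  show "((\<lambda>y. F (x, y)) has_derivative blinfun_apply (blinfun_mult_right (F2 (x, y)))) (at y within UNIV)" for x y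
   using assms(2) by (auto simp: pd2_def has_field_derivative_def blinfun_mult_right.rep_eq)
  have "continuous_on UNIV (\<lambda>q. blinfun_mult_right (F2 q))"
   by (intro bounded_linear.continuous_on[OF bounded_linear_blinfun_mult_right] assms)
  then show "continuous (at (x, y) within UNIV \<times> UNIV) (\<lambda>(x, y). blinfun_mult_right (F2 (x, y)))"
   by (simp add: continuous_on_eq_continuous_within case_prod_unfold)
 qed auto
 then show ?thesis by (simp add: q case_prod_unfold blinfun_mult_right.rep_eq mult.commute)
qed

lemma C_on_Suc_partials:
 assumes "pd1 F F1" "pd2 F F2" "C_on n UNIV F1" "C_on n UNIV F2"
 shows "C_on (Suc n) UNIV F"
proof (rule C_on_SucI)
 show "(F has_derivative (\<lambda>v. fst v * F1 q + snd v * F2 q)) (at q)" for q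
  using has_derivative_of_partials[OF assms(1,2) C_on_imp_continuous[OF assms(4)]] .
 show "C_on n UNIV (\<lambda>q. fst v * F1 q + snd v * F2 q)" for v
  by (intro C_on_add C_on_mult C_on_const assms) auto
qed auto

subsection \<open>Integration along the second variable\<close>

text \<open>Integration in the second variable, starting on the line \<open>y = c p\<close>: the axis for \<open>c = 0\<close>,
 the diagonal for \<open>c = 1\<close>.\<close>

definition Iop :: "real \<Rightarrow> (real \<times> real \<Rightarrow> real) \<Rightarrow> real \<times> real \<Rightarrow> real" where
 "Iop c F = (\<lambda>(p, y). sint (\<lambda>s. F (p, s)) (c * p) y)"

lemma continuous_slice2: "continuous_on UNIV F \<Longrightarrow> continuous_on UNIV (\<lambda>s. F (p, s))"
 by (rule continuous_on_compose2[where t=UNIV and g=F]) (auto intro!: continuous_intros)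

lemma continuous_Iop:
 assumes "continuous_on UNIV F" shows "continuous_on UNIV (Iop c F)"
proof -
 have "continuous_on (UNIV \<times> cbox 0 1) (\<lambda>q. F (fst (fst q), c * fst (fst q) + snd q * (snd (fst q) - c * fst (fst q))))"
  by (rule continuous_on_compose2[OF assms]) (auto intro!: continuous_intros)
 then have "continuous_on UNIV (\<lambda>q. integral (cbox 0 1) (\<lambda>\<sigma>. F (fst q, c * fst q + \<sigma> * (snd q - c * fst q))))"
  by (intro integral_continuous_on_param) (simp add: case_prod_unfold)
 then have "continuous_on UNIV (\<lambda>q. (snd q - c * fst q) * integral (cbox 0 1) (\<lambda>\<sigma>. F (fst q, c * fst q + \<sigma> * (snd q - c * fst q))))"
  by (intro continuous_intros)
 then show ?thesis by (simp add: Iop_def sint_def case_prod_unfold)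
qed

lemma pd2_Iop: "continuous_on UNIV F \<Longrightarrow> pd2 (Iop c F) F"
 unfolding pd2_def Iop_def by (auto intro!: sint_has_derivative continuous_slice2)

lemma Iop_diag [simp]: "Iop c F (p, c * p) = 0"
 by (simp add: Iop_def)

lemma Iop_bound:
 assumes "continuous_on UNIV F" "k > 0" "\<And>y. \<bar>F (p, y)\<bar> \<le> B * exp (k * \<bar>y - c * p\<bar>)"
 shows "\<bar>Iop c F (p, y)\<bar> \<le> B / k * exp (k * \<bar>y - c * p\<bar>)"
 unfolding Iop_def using sint_bound[OF continuous_slice2[OF assms(1)] assms(2,3)] by simp

lemma pd1_Iop:
 assumes F: "continuous_on UNIV F" "pd1 F F1" "continuous_on UNIV F1"
 shows "pd1 (Iop c F) (\<lambda>(p, y). Iop c F1 (p, y) - c * F (p, c * p))"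
 unfolding pd1_def
proof (intro allI)
 fix p y :: real
 have H1: "pd1 (Iop 0 F) (Iop 0 F1)"
  unfolding pd1_def
 proof (intro allI)
  fix p y :: real
  have "((\<lambda>p. integral (cbox 0 1) (\<lambda>\<sigma>. F (p, \<sigma> * y))) has_field_derivative integral (cbox 0 1) (\<lambda>\<sigma>. F1 (p, \<sigma> * y))) (at p within UNIV)"
  proof (rule leibniz_rule_field_derivative)
   show "((\<lambda>p. F (p, \<sigma> * y)) has_field_derivative F1 (p, \<sigma> * y)) (at p within UNIV)" for p \<sigma>
    using F(2) by (simp add: pd1_def)
   show "(\<lambda>\<sigma>. F (p, \<sigma> * y)) integrable_on cbox 0 1" for p
    by (intro integrable_continuous continuous_on_compose2[OF F(1)]) (auto intro!: continuous_intros)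
   show "continuous_on (UNIV \<times> cbox 0 1) (\<lambda>(p, \<sigma>). F1 (p, \<sigma> * y))"
    unfolding case_prod_unfold by (rule continuous_on_compose2[OF F(3)]) (auto intro!: continuous_intros)
  qed auto
  then show "DERIV (\<lambda>p. Iop 0 F (p, y)) p :> Iop 0 F1 (p, y)"
   by (auto simp: Iop_def sint_def intro!: DERIV_cmult)
 qed
 have eq: "Iop c G (p, y) = Iop 0 G (p, y) - Iop 0 G (p, c * p)" if "continuous_on UNIV G" for G p y
  unfolding Iop_def split_conv mult_zero_left
  by (rule sint_FTC[where \<Phi>="\<lambda>y. sint (\<lambda>s. G (p, s)) 0 y"]) (auto intro!: has_field_derivative_at_within sint_has_derivative continuous_slice2 that)
 have diag: "DERIV (\<lambda>p. Iop 0 F (p, c * p)) p :> Iop 0 F1 (p, c * p) + c * F (p, c * p)"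
 proof -
  have 1: "((\<lambda>p. (p, c * p)) has_derivative (\<lambda>r. (r, c * r))) (at p)" by (auto intro!: derivative_eq_intros)
  have 2: "(Iop 0 F has_derivative (\<lambda>v. fst v * Iop 0 F1 (p, c * p) + snd v * F (p, c * p))) (at (p, c * p))"
   by (rule has_derivative_of_partials[OF H1 pd2_Iop[OF F(1)] F(1)])
  from has_derivative_compose[OF 1 2] show ?thesis
   unfolding has_field_derivative_def
   by (rule has_derivative_eq_rhs) (simp add: fun_eq_iff algebra_simps)
 qed
 have "DERIV (\<lambda>p. Iop 0 F (p, y) - Iop 0 F (p, c * p)) p :> Iop 0 F1 (p, y) - (Iop 0 F1 (p, c * p) + c * F (p, c * p))"
  using H1 diag by (intro DERIV_diff) (auto simp: pd1_def)
 then show "DERIV (\<lambda>p. Iop c F (p, y)) p :> (case (p, y) of (p, y) \<Rightarrow> Iop c F1 (p, y) - c * F (p, c * p))"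
  by (simp add: eq[OF F(1)] eq[OF F(3)] algebra_simps)
qed

lemma Iop_diff:
 assumes "continuous_on UNIV F" "continuous_on UNIV G"
 shows "Iop c F q - Iop c G q = Iop c (\<lambda>q. F q - G q) q"
proof -
 obtain p y where q: "q = (p, y)" by fastforce
 let ?f = "\<lambda>s. F (p, s)" and ?g = "\<lambda>s. G (p, s)"
 have d: "((\<lambda>y. sint ?f (c * p) y - sint ?g (c * p) y) has_real_derivative ?f x - ?g x) (at x within A)" for x A
  by (rule has_field_derivative_at_within[OF DERIV_diff[OF
    sint_has_derivative[OF continuous_slice2[OF assms(1)]] sint_has_derivative[OF continuous_slice2[OF assms(2)]]]])
 have "sint (\<lambda>s. F (p, s) - G (p, s)) (c * p) y
  = (sint ?f (c * p) y - sint ?g (c * p) y) - (sint ?f (c * p) (c * p) - sint ?g (c * p) (c * p))"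
  by (rule sint_FTC[OF d])
 then show ?thesis by (simp add: q Iop_def)
qed

subsection \<open>A family of initial value problems\<close>

lemma Iop_zero [simp]: "Iop c (\<lambda>_. 0) = (\<lambda>_. 0)"
 by (auto simp: Iop_def sint_def)

text \<open>The parameter of the family is the first coordinate. Solving for all parameters at once in
 the space of continuous functions of both variables gives joint continuity, which the shooting
 argument needs.\<close>

lemma ode_family:
 fixes Q :: "real \<times> real \<Rightarrow> real"
 assumes Q: "continuous_on UNIV Q" "\<And>q. \<bar>Q q\<bar> \<le> M"
 obtains \<psi> \<psi>' where "continuous_on UNIV \<psi>" "continuous_on UNIV \<psi>'" "pd2 \<psi> \<psi>'" "pd2 \<psi>' (\<lambda>q. Q q * \<psi> q)"
  "\<And>p. \<psi> (p, 0) = 0" "\<And>p. \<psi>' (p, 0) = -1"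
proof -
 have M: "M \<ge> 0" using Q(2)[of 0] by simp
 define k where "k = sqrt (2 * (M + 1))"
 have k: "k > 0" "k * k = 2 * (M + 1)" "k \<ge> 1" using M by (auto simp: k_def)
 \<comment> \<open>With \<open>k\<^sup>2 = 2 (M + 1)\<close> the double integration contracts by \<open>M / k\<^sup>2 \<le> 1/2\<close>.\<close>
 define w where "w q = exp (k * \<bar>snd q\<bar>)" for q :: "real \<times> real"
 define T where "T F = (\<lambda>q. - snd q + Iop 0 (Iop 0 (\<lambda>q. Q q * F q)) q)" for F
 have "\<exists>F. continuous_on UNIV F \<and> T F = F"
 proof (rule weighted_fixpoint[where w=w and C=1 and c="1/2"])
  show "continuous_on UNIV w" unfolding w_def by (intro continuous_intros)
  show "w q > 0" for q by (simp add: w_def)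
  show "continuous_on UNIV (T F)" if "continuous_on UNIV F" for F
   unfolding T_def by (intro continuous_intros continuous_Iop Q that)
  show "\<bar>T (\<lambda>_. 0) q\<bar> \<le> 1 * w q" for q
  proof -
   have z: "Iop 0 (\<lambda>q. Q q * 0) = (\<lambda>_. 0)" by auto
   have "1 * \<bar>snd q\<bar> \<le> k * \<bar>snd q\<bar>" by (rule mult_right_mono[OF k(3)]) simp
   then have "\<bar>snd q\<bar> \<le> exp (k * \<bar>snd q\<bar>)"
    using exp_ge_add_one_self[of "k * \<bar>snd q\<bar>"] by linarith
   then show ?thesis by (simp add: T_def z w_def)
  qed
  fix F G B and q :: "real \<times> real" assume FG: "continuous_on UNIV F" "continuous_on UNIV G" and b: "\<And>q. \<bar>F q - G q\<bar> \<le> B * w q"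
  have cF: "continuous_on UNIV (\<lambda>q. Q q * F q)" "continuous_on UNIV (\<lambda>q. Q q * G q)"
   by (intro continuous_intros Q FG)+
  have cd: "continuous_on UNIV (\<lambda>q. Q q * F q - Q q * G q)" by (intro continuous_intros cF)
  have B: "B \<ge> 0" using order_trans[OF abs_ge_zero b[of 0]] by (simp add: w_def)
  obtain p y where q: "q = (p, y)" by fastforce
  have "T F q - T G q = Iop 0 (\<lambda>q. Iop 0 (\<lambda>q. Q q * F q) q - Iop 0 (\<lambda>q. Q q * G q) q) q"
   by (simp add: T_def Iop_diff continuous_Iop cF)
  also have "\<dots> = Iop 0 (Iop 0 (\<lambda>q. Q q * F q - Q q * G q)) q"
   using Iop_diff[OF cF] by simp
  finally have e: "T F q - T G q = Iop 0 (Iop 0 (\<lambda>q. Q q * F q - Q q * G q)) (p, y)" by (simp add: q)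
  have "\<bar>Q (p, y) * F (p, y) - Q (p, y) * G (p, y)\<bar> \<le> (M * B) * exp (k * \<bar>y - 0 * p\<bar>)" for y
  proof -
   have "\<bar>Q (p, y)\<bar> * \<bar>F (p, y) - G (p, y)\<bar> \<le> M * (B * w (p, y))"
    by (intro mult_mono Q b M) auto
   then show ?thesis by (simp add: w_def right_diff_distrib[symmetric] abs_mult)
  qed
  from Iop_bound[OF cd k(1) this]
  have "\<bar>Iop 0 (\<lambda>q. Q q * F q - Q q * G q) (p, y)\<bar> \<le> (M * B) / k * exp (k * \<bar>y - 0 * p\<bar>)" for y .
  from Iop_bound[OF continuous_Iop[OF cd] k(1) this, of y]
  have "\<bar>T F q - T G q\<bar> \<le> (M * B) / k / k * exp (k * \<bar>y - 0 * p\<bar>)" unfolding e .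
  also have "\<dots> = (M / (k * k)) * B * w q" by (simp add: w_def q)
  also have "\<dots> \<le> 1/2 * B * w q"
   using M B unfolding k(2) by (intro mult_right_mono) (auto simp: w_def field_simps)
  finally show "\<bar>T F q - T G q\<bar> \<le> 1/2 * B * w q" .
 qed auto
 then obtain \<psi> where \<psi>: "continuous_on UNIV \<psi>" "T \<psi> = \<psi>" by blast
 have c: "continuous_on UNIV (\<lambda>q. Q q * \<psi> q)" by (intro continuous_intros Q \<psi>)
 define \<psi>' where "\<psi>' = (\<lambda>q. - 1 + Iop 0 (\<lambda>q. Q q * \<psi> q) q)"
 have e: "\<psi> q = - snd q + Iop 0 (Iop 0 (\<lambda>q. Q q * \<psi> q)) q" for q
  using fun_cong[OF \<psi>(2), of q] by (simp add: T_def)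
 show ?thesis
 proof (rule that[of \<psi> \<psi>'])
  show "continuous_on UNIV \<psi>'" unfolding \<psi>'_def by (intro continuous_intros continuous_Iop c)
  show "pd2 \<psi> \<psi>'" unfolding pd2_def
  proof (intro allI)
   fix p y
   have "DERIV (\<lambda>y. - y + Iop 0 (Iop 0 (\<lambda>q. Q q * \<psi> q)) (p, y)) y :> - 1 + Iop 0 (\<lambda>q. Q q * \<psi> q) (p, y)"
    using pd2_Iop[OF continuous_Iop[OF c]] by (intro DERIV_add) (auto simp: pd2_def intro!: derivative_eq_intros)
   then show "DERIV (\<lambda>y. \<psi> (p, y)) y :> \<psi>' (p, y)"
    unfolding \<psi>'_def by (rule has_field_derivative_transform_within_open[OF _ open_UNIV UNIV_I]) (subst e, simp)
  qed
  show "pd2 \<psi>' (\<lambda>q. Q q * \<psi> q)" unfolding pd2_def \<psi>'_def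
  proof (intro allI)
   fix p y
   show "DERIV (\<lambda>y. - 1 + Iop 0 (\<lambda>q. Q q * \<psi> q) (p, y)) y :> Q (p, y) * \<psi> (p, y)"
    using pd2_Iop[OF c] by (auto simp: pd2_def intro!: derivative_eq_intros)
  qed
  show "\<psi> (p, 0) = 0" for p using e[of "(p, 0)"] Iop_diag[of 0 _ p] by simp
  show "\<psi>' (p, 0) = - 1" for p using Iop_diag[of 0 _ p] by (simp add: \<psi>'_def)
 qed (rule \<psi>)
qed

subsection \<open>The wave equation on the half line\<close>

definition Sw :: "(real \<times> real \<Rightarrow> real) \<Rightarrow> real \<times> real \<Rightarrow> real" where "Sw F = (\<lambda>(p, y). F (y, p))"

text \<open>The reflection \<open>x \<mapsto> - x\<close> in characteristic coordinates.\<close>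

definition Rf :: "(real \<times> real \<Rightarrow> real) \<Rightarrow> real \<times> real \<Rightarrow> real" where "Rf F = (\<lambda>(p, y). F (- y, - p))"

text \<open>In the characteristic coordinates \<open>p = x + t\<close> and \<open>y = x - t\<close> the wave operator is a
 multiple of \<open>\<partial>\<^sub>p \<partial>\<^sub>y\<close>; \<open>Kop F\<close> solves \<open>\<partial>\<^sub>p \<partial>\<^sub>y w = F\<close> with vanishing Cauchy data on the diagonal
 \<open>t = 0\<close>.\<close>

definition Kop :: "(real \<times> real \<Rightarrow> real) \<Rightarrow> real \<times> real \<Rightarrow> real" where
 "Kop F = Sw (Iop 1 (Sw (Iop 1 F)))"

lemma continuous_Sw: "continuous_on UNIV F \<Longrightarrow> continuous_on UNIV (Sw F)"
 unfolding Sw_def case_prod_unfold by (rule continuous_on_compose2[where t=UNIV]) (auto intro!: continuous_intros)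

lemma continuous_Rf: "continuous_on UNIV F \<Longrightarrow> continuous_on UNIV (Rf F)"
 unfolding Rf_def case_prod_unfold by (rule continuous_on_compose2[where t=UNIV]) (auto intro!: continuous_intros)

lemma Sw_Sw [simp]: "Sw (Sw F) = F" by (auto simp: Sw_def)

lemma pd_Sw: "pd1 F F' \<Longrightarrow> pd2 (Sw F) (Sw F')" "pd2 F F' \<Longrightarrow> pd1 (Sw F) (Sw F')"
 by (auto simp: pd1_def pd2_def Sw_def)

lemma pd_Rf:
 "pd2 F F' \<Longrightarrow> pd1 (Rf F) (\<lambda>q. - Rf F' q)"
 "pd1 F F' \<Longrightarrow> pd2 (Rf F) (\<lambda>q. - Rf F' q)"
proof -
 show "pd1 (Rf F) (\<lambda>q. - Rf F' q)" if "pd2 F F'"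
  unfolding pd1_def
 proof (intro allI)
  fix p y
  have "DERIV (\<lambda>s. F (- y, s)) (- p) :> F' (- y, - p)" using that by (simp add: pd2_def)
  moreover have "DERIV uminus p :> - 1" by (auto intro!: derivative_eq_intros)
  ultimately show "DERIV (\<lambda>p. Rf F (p, y)) p :> - Rf F' (p, y)"
   using DERIV_chain2[of "\<lambda>s. F (- y, s)" "F' (- y, - p)" uminus p "-1" UNIV] by (simp add: Rf_def)
 qed
 show "pd2 (Rf F) (\<lambda>q. - Rf F' q)" if "pd1 F F'"
  unfolding pd2_def
 proof (intro allI)
  fix p y
  have "DERIV (\<lambda>s. F (s, - p)) (- y) :> F' (- y, - p)" using that by (simp add: pd1_def)
  moreover have "DERIV uminus y :> - 1" by (auto intro!: derivative_eq_intros)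
  ultimately show "DERIV (\<lambda>y. Rf F (p, y)) y :> - Rf F' (p, y)"
   using DERIV_chain2[of "\<lambda>s. F (s, - p)" "F' (- y, - p)" uminus y "-1" UNIV] by (simp add: Rf_def)
 qed
qed

lemma pd_add:
 "pd1 F F' \<Longrightarrow> pd1 G G' \<Longrightarrow> pd1 (\<lambda>q. F q + G q) (\<lambda>q. F' q + G' q)"
 "pd2 F F' \<Longrightarrow> pd2 G G' \<Longrightarrow> pd2 (\<lambda>q. F q + G q) (\<lambda>q. F' q + G' q)"
 by (auto simp: pd1_def pd2_def intro!: DERIV_add)

lemma pd_diff:
 "pd1 F F' \<Longrightarrow> pd1 G G' \<Longrightarrow> pd1 (\<lambda>q. F q - G q) (\<lambda>q. F' q - G' q)"
 "pd2 F F' \<Longrightarrow> pd2 G G' \<Longrightarrow> pd2 (\<lambda>q. F q - G q) (\<lambda>q. F' q - G' q)"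
 by (auto simp: pd1_def pd2_def intro!: DERIV_diff)

lemma pd_cmult:
 "pd1 F F' \<Longrightarrow> pd1 (\<lambda>q. c * F q) (\<lambda>q. c * F' q)"
 "pd2 F F' \<Longrightarrow> pd2 (\<lambda>q. c * F q) (\<lambda>q. c * F' q)"
 by (auto simp: pd1_def pd2_def intro!: DERIV_cmult)

lemma pd_fst: "(\<And>x. DERIV f x :> f' x) \<Longrightarrow> pd1 (\<lambda>q. f (fst q)) (\<lambda>q. f' (fst q))" "pd2 (\<lambda>q. f (fst q)) (\<lambda>_. 0)"
 by (auto simp: pd1_def pd2_def)

lemma pd_snd: "(\<And>x. DERIV f x :> f' x) \<Longrightarrow> pd2 (\<lambda>q. f (snd q)) (\<lambda>q. f' (snd q))" "pd1 (\<lambda>q. f (snd q)) (\<lambda>_. 0)"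
 by (auto simp: pd1_def pd2_def)

lemma pd1_Iop_diagonal:
 assumes "continuous_on UNIV F" "pd1 F F1" "continuous_on UNIV F1"
 shows "pd1 (Iop 1 F) (\<lambda>q. Iop 1 F1 q - F (fst q, fst q))"
 using pd1_Iop[OF assms, of 1] by (simp add: case_prod_unfold)

lemma pd_Kop:
 assumes "continuous_on UNIV F"
 shows "pd1 (Kop F) (Iop 1 F)" "pd2 (Kop F) (Sw (Iop 1 (Sw F)))"
proof -
 have c: "continuous_on UNIV (Sw (Iop 1 F))" "continuous_on UNIV (Sw F)"
  by (intro continuous_Sw continuous_Iop assms)+
 show "pd1 (Kop F) (Iop 1 F)" unfolding Kop_def using pd_Sw(2)[OF pd2_Iop[OF c(1)]] by simp
 have "pd1 (Sw (Iop 1 F)) (Sw F)" by (intro pd_Sw pd2_Iop assms)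
 from pd1_Iop_diagonal[OF c(1) this c(2)]
 have "pd1 (Iop 1 (Sw (Iop 1 F))) (Iop 1 (Sw F))"
  using Iop_diag[of 1 F] by (simp add: Sw_def case_prod_unfold)
 then show "pd2 (Kop F) (Sw (Iop 1 (Sw F)))" unfolding Kop_def by (rule pd_Sw)
qed

lemma continuous_Kop: "continuous_on UNIV F \<Longrightarrow> continuous_on UNIV (Kop F)"
 unfolding Kop_def by (intro continuous_Sw continuous_Iop)

lemma Kop_diff:
 assumes "continuous_on UNIV F" "continuous_on UNIV G"
 shows "Kop F q - Kop G q = Kop (\<lambda>q. F q - G q) q"
proof -
 have "Sw (Iop 1 F) q - Sw (Iop 1 G) q = Sw (Iop 1 (\<lambda>q. F q - G q)) q" for q
  using Iop_diff[OF assms] by (simp add: Sw_def case_prod_unfold)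
 then show ?thesis
  using Iop_diff[OF continuous_Sw[OF continuous_Iop[OF assms(1)]] continuous_Sw[OF continuous_Iop[OF assms(2)]], where c=1]
  by (simp add: Kop_def Sw_def case_prod_unfold)
qed

lemma Kop_bound:
 assumes "continuous_on UNIV F" "k > 0" "\<And>p y. \<bar>F (p, y)\<bar> \<le> B * exp (k * \<bar>y - p\<bar>)"
 shows "\<bar>Kop F (p, y)\<bar> \<le> B / (k * k) * exp (k * \<bar>y - p\<bar>)"
proof -
 have "\<bar>Iop 1 F (p, y)\<bar> \<le> B / k * exp (k * \<bar>y - 1 * p\<bar>)" for p y
  using assms by (intro Iop_bound) auto
 then have "\<bar>Sw (Iop 1 F) (p, y)\<bar> \<le> B / k * exp (k * \<bar>y - 1 * p\<bar>)" for p y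
  by (simp add: Sw_def abs_minus_commute[of y p])
 then have "\<bar>Iop 1 (Sw (Iop 1 F)) (p, y)\<bar> \<le> B / k / k * exp (k * \<bar>y - 1 * p\<bar>)" for p y
  using assms by (intro Iop_bound continuous_Sw continuous_Iop) auto
 then show ?thesis by (simp add: Kop_def Sw_def abs_minus_commute[of y p])
qed

text \<open>The solution is a fixed point of D'Alembert's formula. The iteration is antisymmetrized
 under the reflection to make the fixed point odd. Regularity of the source \<open>G v\<close> is a hypothesis
 on odd \<open>v\<close>, because an evenly reflected \<open>G\<close> has a kink on the axis of reflection that only the
 zero of \<open>v\<close> compensates.\<close>

lemma goursat:
 fixes G :: "real \<times> real \<Rightarrow> real" and v0 v0' v0'' :: "real \<Rightarrow> real"
 assumes G: "continuous_on UNIV G" "\<And>q. \<bar>G q\<bar> \<le> M" "Rf G = G"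
  and v0: "\<And>x. DERIV v0 x :> v0' x" "\<And>x. DERIV v0' x :> v0'' x"
   "continuous_on UNIV v0''" "\<And>x. \<bar>v0 x\<bar> \<le> C" "\<And>x. v0 (- x) = - v0 x"
  and reg: "\<forall>v v1 v2. pd1 v v1 \<longrightarrow> pd2 v v2 \<longrightarrow> continuous_on UNIV v \<longrightarrow> continuous_on UNIV v1 \<longrightarrow> continuous_on UNIV v2
    \<longrightarrow> Rf v = (\<lambda>q. - v q) \<longrightarrow>
    (\<exists>F1 F2. pd1 (\<lambda>q. G q * v q) F1 \<and> pd2 (\<lambda>q. G q * v q) F2 \<and> continuous_on UNIV F1 \<and> continuous_on UNIV F2)"
 shows "\<exists>v v1 v2 v11 v22. pd1 v v1 \<and> pd2 v v2 \<and> pd1 v1 v11 \<and> pd2 v1 (\<lambda>q. G q * v q) \<and>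
  pd1 v2 (\<lambda>q. G q * v q) \<and> pd2 v2 v22 \<and>
  continuous_on UNIV v \<and> continuous_on UNIV v1 \<and> continuous_on UNIV v2 \<and> continuous_on UNIV v11 \<and> continuous_on UNIV v22 \<and>
  Rf v = (\<lambda>q. - v q) \<and> (\<forall>x. v (x, x) = v0 x) \<and> (\<forall>x. v1 (x, x) = v2 (x, x))"
proof -
 have M: "M \<ge> 0" using G(2)[of 0] by simp
 define k where "k = sqrt (2 * (M + 1))"
 have k: "k > 0" "k * k = 2 * (M + 1)" using M by (auto simp: k_def)
 define w where "w q = exp (k * \<bar>snd q - fst q\<bar>)" for q :: "real \<times> real"
 \<comment> \<open>The half difference with the reflection keeps the iterates odd.\<close>
 define T where "T F = (\<lambda>q. (v0 (fst q) + v0 (snd q)) / 2 + (Kop (\<lambda>q. G q * F q) q - Rf (Kop (\<lambda>q. G q * F q)) q) / 2)" for F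
 have cv0: "continuous_on UNIV v0" "continuous_on UNIV v0'"
  using DERIV_isCont[OF v0(1)] DERIV_isCont[OF v0(2)] by (auto intro!: continuous_at_imp_continuous_on)
 have cc: "continuous_on UNIV (\<lambda>q::real\<times>real. v0 (fst q))" "continuous_on UNIV (\<lambda>q::real\<times>real. v0 (snd q))"
   "continuous_on UNIV (\<lambda>q::real\<times>real. v0' (fst q))" "continuous_on UNIV (\<lambda>q::real\<times>real. v0' (snd q))"
   "continuous_on UNIV (\<lambda>q::real\<times>real. v0'' (fst q))" "continuous_on UNIV (\<lambda>q::real\<times>real. v0'' (snd q))"
  using continuous_on_compose2[OF cv0(1) continuous_on_fst[OF continuous_on_id]] continuous_on_compose2[OF cv0(1) continuous_on_snd[OF continuous_on_id]]
   continuous_on_compose2[OF cv0(2) continuous_on_fst[OF continuous_on_id]] continuous_on_compose2[OF cv0(2) continuous_on_snd[OF continuous_on_id]]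
   continuous_on_compose2[OF v0(3) continuous_on_fst[OF continuous_on_id]] continuous_on_compose2[OF v0(3) continuous_on_snd[OF continuous_on_id]]
  by simp_all
 have "\<exists>F. continuous_on UNIV F \<and> T F = F"
 proof (rule weighted_fixpoint[where w=w and C=C and c="1/2"])
  show "continuous_on UNIV w" unfolding w_def by (intro continuous_intros)
  show "w q > 0" for q by (simp add: w_def)
  show "continuous_on UNIV (T F)" if "continuous_on UNIV F" for F
   unfolding T_def by (intro continuous_intros continuous_Kop continuous_Rf cc G that) auto
  have C: "C \<ge> 0" using v0(4)[of 0] by simp
  show "\<bar>T (\<lambda>_. 0) q\<bar> \<le> C * w q" for q
  proof -
   have I0: "Iop 1 (\<lambda>_. 0) = (\<lambda>_. 0)" by auto
   have "Kop (\<lambda>q. G q * 0) = (\<lambda>_. 0)"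
    by (simp add: Kop_def I0) (simp add: Sw_def case_prod_unfold I0)
   then have "\<bar>T (\<lambda>_. 0) q\<bar> \<le> C" using v0(4)[of "fst q"] v0(4)[of "snd q"] by (simp add: T_def Rf_def case_prod_unfold)
   also have "C \<le> C * w q" using C k by (simp add: w_def mult_le_cancel_left1)
   finally show ?thesis .
  qed
  fix F H B and q :: "real \<times> real" assume FH: "continuous_on UNIV F" "continuous_on UNIV H" and b: "\<And>q. \<bar>F q - H q\<bar> \<le> B * w q"
  have cF: "continuous_on UNIV (\<lambda>q. G q * F q)" "continuous_on UNIV (\<lambda>q. G q * H q)"
   by (intro continuous_intros G FH)+
  have cd: "continuous_on UNIV (\<lambda>q. G q * F q - G q * H q)" by (intro continuous_intros cF)
  have B: "B \<ge> 0" using order_trans[OF abs_ge_zero b[of 0]] by (simp add: w_def)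
  let ?D = "\<lambda>q. G q * F q - G q * H q"
  have bd: "\<bar>?D (p, y)\<bar> \<le> (M * B) * exp (k * \<bar>y - p\<bar>)" for p y
  proof -
   have "\<bar>G (p, y)\<bar> * \<bar>F (p, y) - H (p, y)\<bar> \<le> M * (B * w (p, y))"
    by (intro mult_mono G b M) auto
   then show ?thesis by (simp add: w_def right_diff_distrib[symmetric] abs_mult)
  qed
  have Kb: "\<bar>Kop ?D q\<bar> \<le> 1/2 * B * w q" for q
  proof -
   have "\<bar>Kop ?D q\<bar> \<le> (M * B) / (k * k) * exp (k * \<bar>snd q - fst q\<bar>)"
    using Kop_bound[OF cd k(1) bd, of "fst q" "snd q"] by simp
   also have "\<dots> = (M / (k * k)) * B * w q" by (simp add: w_def)
   also have "\<dots> \<le> 1/2 * B * w q"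
    using M B unfolding k(2) by (intro mult_right_mono) (auto simp: w_def field_simps)
   finally show ?thesis .
  qed
  have aux: "\<bar>X\<bar> \<le> c \<Longrightarrow> \<bar>Y\<bar> \<le> c \<Longrightarrow> \<bar>(X - Y) / 2\<bar> \<le> c" for X Y c :: real
   unfolding abs_le_iff by (simp add: field_simps)
  have e: "T F q - T H q = (Kop ?D q - Kop ?D (- snd q, - fst q)) / 2"
   unfolding Kop_diff[OF cF, symmetric] by (simp add: T_def Rf_def case_prod_unfold field_simps)
  have wq: "w (- snd q, - fst q) = w q" by (simp add: w_def)
  show "\<bar>T F q - T H q\<bar> \<le> 1/2 * B * w q"
   unfolding e by (rule aux[OF Kb Kb[of "(- snd q, - fst q)", unfolded wq]])
 qed auto
 then obtain v where v: "continuous_on UNIV v" "T v = v" by blast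
 define F where "F = (\<lambda>q. G q * v q)"
 have cF: "continuous_on UNIV F" unfolding F_def by (intro continuous_intros G v)
 have e: "v = (\<lambda>q. 1/2 * (v0 (fst q) + v0 (snd q)) + 1/2 * (Kop F q + (-1) * Rf (Kop F) q))"
  using fun_cong[OF v(2)] by (auto simp: T_def F_def fun_eq_iff)
 have odd: "Rf v = (\<lambda>q. - v q)"
 proof
  fix q
  have ev: "v q = 1/2 * (v0 (fst q) + v0 (snd q)) + 1/2 * (Kop F q + (-1) * Rf (Kop F) q)" for q
   using fun_cong[OF e, of q] .
  show "Rf v q = - v q"
   using ev[of q] ev[of "(- snd q, - fst q)"] by (simp add: Rf_def case_prod_unfold v0(5) field_simps)
 qed
 have Fodd: "Rf F = (\<lambda>q. - F q)"
  using fun_cong[OF odd] fun_cong[OF G(3)] by (auto simp: F_def Rf_def case_prod_unfold fun_eq_iff)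
 define J where "J = Sw (Iop 1 (Sw F))"
 note cIJ = continuous_Iop[OF cF, of 1] continuous_Sw[OF continuous_Iop[OF continuous_Sw[OF cF]], of 1, folded J_def]
 define v1 where "v1 = (\<lambda>q. 1/2 * (v0' (fst q) + 0) + 1/2 * (Iop 1 F q + (-1) * (- Rf J q)))"
 define v2 where "v2 = (\<lambda>q. 1/2 * (0 + v0' (snd q)) + 1/2 * (J q + (-1) * (- Rf (Iop 1 F) q)))"
 have p1: "pd1 v v1" unfolding v1_def
  by (subst e) (intro pd_add pd_cmult pd_fst pd_snd v0 pd_Kop cF pd_Rf pd_Kop(2)[OF cF, folded J_def])
 have p2: "pd2 v v2" unfolding v2_def
  by (subst e) (intro pd_add pd_cmult pd_fst pd_snd v0 pd_Kop cF pd_Rf pd_Kop(2)[OF cF, folded J_def])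
 have c1: "continuous_on UNIV v1" unfolding v1_def by (intro continuous_intros cc continuous_Rf cIJ)
 have c2: "continuous_on UNIV v2" unfolding v2_def by (intro continuous_intros cc continuous_Rf cIJ)
 obtain F1 F2 where F12: "pd1 F F1" "pd2 F F2" "continuous_on UNIV F1" "continuous_on UNIV F2"
  using reg[rule_format, OF p1 p2 v(1) c1 c2 odd] unfolding F_def by blast
 define A1 where "A1 = (\<lambda>q. Iop 1 F1 q - F (fst q, fst q))"
 define A2 where "A2 = Sw (\<lambda>q. Iop 1 (Sw F2) q - Sw F (fst q, fst q))"
 have a1: "pd1 (Iop 1 F) A1" "pd2 (Iop 1 F) F"
  unfolding A1_def by (intro pd1_Iop_diagonal cF F12 pd2_Iop)+
 have a2: "pd2 J A2" "pd1 J F"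
 proof -
  show "pd2 J A2" unfolding J_def A2_def by (intro pd_Sw pd1_Iop_diagonal continuous_Sw cF F12)
  have "pd1 (Sw (Iop 1 (Sw F))) (Sw (Sw F))" by (intro pd_Sw pd2_Iop continuous_Sw cF)
  then show "pd1 J F" by (simp add: J_def)
 qed
 have cdiag: "continuous_on UNIV (\<lambda>q::real\<times>real. H (fst q, fst q))" if "continuous_on UNIV H" for H :: "real \<times> real \<Rightarrow> real"
  by (rule continuous_on_compose2[OF that]) (auto intro!: continuous_intros)
 have cA: "continuous_on UNIV A1" "continuous_on UNIV A2"
  unfolding A1_def A2_def by (intro continuous_intros continuous_Iop continuous_Sw F12 cF cdiag)+
 define v11 where "v11 = (\<lambda>q. 1/2 * (v0'' (fst q) + 0) + 1/2 * (A1 q + (-1) * ((-1) * (- Rf A2 q))))"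
 define v22 where "v22 = (\<lambda>q. 1/2 * (0 + v0'' (snd q)) + 1/2 * (A2 q + (-1) * ((-1) * (- Rf A1 q))))"
 have v1': "v1 = (\<lambda>q. 1/2 * (v0' (fst q) + 0) + 1/2 * (Iop 1 F q + (-1) * ((-1) * Rf J q)))" by (simp add: v1_def)
 have v2': "v2 = (\<lambda>q. 1/2 * (0 + v0' (snd q)) + 1/2 * (J q + (-1) * ((-1) * Rf (Iop 1 F) q)))" by (simp add: v2_def)
 have const: "pd1 (\<lambda>_. 0) (\<lambda>_. 0)" "pd2 (\<lambda>_. 0) (\<lambda>_. 0)" by (auto simp: pd1_def pd2_def)
 have q11: "pd1 v1 v11" unfolding v1' v11_def
  by (intro pd_add pd_cmult pd_fst v0 a1 a2 pd_Rf const)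
 have q22: "pd2 v2 v22" unfolding v2' v22_def
  by (intro pd_add pd_cmult pd_snd v0 a1 a2 pd_Rf const)
 have "pd2 v1 (\<lambda>q. 1/2 * (0 + 0) + 1/2 * (F q + (-1) * ((-1) * (- Rf F q))))" unfolding v1'
  by (intro pd_add pd_cmult pd_fst v0 a1 a2 pd_Rf const)
 then have q12: "pd2 v1 F" by (simp add: Fodd)
 have "pd1 v2 (\<lambda>q. 1/2 * (0 + 0) + 1/2 * (F q + (-1) * ((-1) * (- Rf F q))))" unfolding v2'
  by (intro pd_add pd_cmult pd_snd v0 a1 a2 pd_Rf const)
 then have q21: "pd1 v2 F" by (simp add: Fodd)
 have d: "Iop 1 H (x, x) = 0" "Kop H (x, x) = 0" for H x
  using Iop_diag[of 1 _ x] by (simp_all add: Kop_def Sw_def)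
 show ?thesis
 proof (rule exI[of _ v], rule exI[of _ v1], rule exI[of _ v2], rule exI[of _ v11], rule exI[of _ v22], intro conjI allI
   p1 p2 q11 q12[unfolded F_def] q21[unfolded F_def] q22 v(1) c1 c2 odd)
  show "continuous_on UNIV v11" "continuous_on UNIV v22" unfolding v11_def v22_def
   by (intro continuous_intros cc cA continuous_Rf)+
  show "v (x, x) = v0 x" for x by (subst e) (simp add: d Rf_def)
  show "v1 (x, x) = v2 (x, x)" for x by (simp add: v1_def v2_def d Rf_def J_def Sw_def)
 qed
qed

subsection \<open>Reflection at the boundary\<close>

lemma continuous_on_sgn_mult:
 fixes h l :: "'a::topological_space \<Rightarrow> real"
 assumes "continuous_on UNIV h" "continuous_on UNIV l" "\<And>q. l q = 0 \<Longrightarrow> h q = 0"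
 shows "continuous_on UNIV (\<lambda>q. sgn (l q) * h q)"
proof -
 have "continuous_on UNIV (\<lambda>q. if l q \<le> 0 then - h q else h q)"
  by (rule continuous_on_cases_le) (use assms in \<open>auto intro!: continuous_intros continuous_on_subset[OF assms(1)]\<close>)
 moreover have "(\<lambda>q. if l q \<le> 0 then - h q else h q) = (\<lambda>q. sgn (l q) * h q)"
  using assms(3) by (auto simp: fun_eq_iff sgn_if)
 ultimately show ?thesis by (simp only:)
qed

text \<open>At a zero of \<open>f\<close> the difference quotient of the product is \<open>g\<close> times that of \<open>f\<close>.\<close>

lemma DERIV_mult_vanishing:
 fixes f g :: "real \<Rightarrow> real"
 assumes "DERIV f a :> D" "f a = 0" "isCont g a"
 shows "DERIV (\<lambda>x. g x * f x) a :> g a * D"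
proof -
 obtain h where h: "\<And>z. f z - f a = h z * (z - a)" "isCont h a" "h a = D"
  using assms(1) CARAT_DERIV[of f D a] by blast
 have "\<exists>h'. (\<forall>z. g z * f z - g a * f a = h' z * (z - a)) \<and> isCont h' a \<and> h' a = g a * D"
  by (rule exI[of _ "\<lambda>z. g z * h z"]) (use h assms in \<open>auto intro!: isCont_mult\<close>)
 then show ?thesis using CARAT_DERIV[of "\<lambda>x. g x * f x" "g a * D" a] by blast
qed

lemma DERIV_abs_comp:
 fixes f :: "real \<Rightarrow> real"
 assumes "\<And>x. DERIV f x :> f' x" "x \<noteq> 0"
 shows "DERIV (\<lambda>x. f \<bar>x\<bar>) x :> sgn x * f' \<bar>x\<bar>"
proof -
 have "DERIV (\<lambda>y. f (sgn x * y)) x :> f' (sgn x * x) * sgn x"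
  by (rule DERIV_chain2[OF assms(1)]) (auto intro!: derivative_eq_intros)
 then have d: "DERIV (\<lambda>y. f (sgn x * y)) x :> sgn x * f' \<bar>x\<bar>"
  by (simp add: abs_sgn mult.commute)
 show ?thesis
 proof (rule has_field_derivative_transform_within[OF d, of "\<bar>x\<bar>"])
  fix y assume "dist y x < \<bar>x\<bar>"
  then have "sgn x * y = \<bar>y\<bar>" using assms(2) by (auto simp: dist_real_def sgn_if abs_if split: if_splits)
  then show "f (sgn x * y) = f \<bar>y\<bar>" by simp
 qed (use assms in auto)
qed

lemma odd_extension:
 fixes f :: "real \<Rightarrow> real"
 assumes f: "\<And>x. DERIV f x :> f' x" "f 0 = 0"
 shows "DERIV (\<lambda>x. sgn x * f \<bar>x\<bar>) x :> f' \<bar>x\<bar>"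
proof (cases "x = 0")
 case False
 have "DERIV (\<lambda>y. sgn x * f \<bar>y\<bar>) x :> sgn x * (sgn x * f' \<bar>x\<bar>)"
  by (intro DERIV_cmult DERIV_abs_comp f False)
 moreover have "sgn x * (sgn x * f' \<bar>x\<bar>) = f' \<bar>x\<bar>" using False by (simp add: sgn_if)
 ultimately have d: "DERIV (\<lambda>y. sgn x * f \<bar>y\<bar>) x :> f' \<bar>x\<bar>" by (simp only:)
 show ?thesis
 proof (rule has_field_derivative_transform_within[OF d, of "\<bar>x\<bar>"])
  fix y assume "dist y x < \<bar>x\<bar>"
  then have "sgn y = sgn x" using False by (auto simp: dist_real_def sgn_if abs_if split: if_splits)
  then show "sgn x * f \<bar>y\<bar> = sgn y * f \<bar>y\<bar>" by simp
 qed (use False in auto)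
next
 case True
 obtain h where h: "\<And>z. f z - f 0 = h z * (z - 0)" "isCont h 0" "h 0 = f' 0"
  using f(1)[of 0] CARAT_DERIV[of f "f' 0" 0] by blast
 have "isCont (\<lambda>z. h \<bar>z\<bar>) 0" by (rule isCont_o2[where g=h and f=abs]) (use h in \<open>auto intro!: continuous_intros\<close>)
 moreover have "sgn z * f \<bar>z\<bar> = h \<bar>z\<bar> * z" for z
  using h(1)[of "\<bar>z\<bar>"] f(2) by (auto simp: sgn_if)
 ultimately have "\<exists>h'. (\<forall>z. sgn z * f \<bar>z\<bar> - sgn 0 * f \<bar>0\<bar> = h' z * (z - 0)) \<and> isCont h' 0 \<and> h' 0 = f' 0"
  by (intro exI[of _ "\<lambda>z. h \<bar>z\<bar>"]) (auto simp: h)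
 then show ?thesis using CARAT_DERIV[of "\<lambda>z. sgn z * f \<bar>z\<bar>" "f' 0" 0] True by simp
qed

lemma even_extension_vanishing:
 fixes f :: "real \<Rightarrow> real"
 assumes f: "\<And>x. DERIV f x :> f' x" "f' 0 = 0"
 shows "DERIV (\<lambda>x. f \<bar>x\<bar>) x :> sgn x * f' \<bar>x\<bar>"
proof (cases "x = 0")
 case False then show ?thesis by (intro DERIV_abs_comp f)
next
 case True
 obtain h where h: "\<And>z. f z - f 0 = h z * (z - 0)" "isCont h 0" "h 0 = f' 0"
  using f(1)[of 0] CARAT_DERIV[of f "f' 0" 0] by blast
 have c: "isCont (\<lambda>z. h \<bar>z\<bar>) 0" by (rule isCont_o2[where g=h and f=abs]) (use h in \<open>auto intro!: continuous_intros\<close>)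
 have "isCont (\<lambda>z. sgn z * h \<bar>z\<bar>) 0"
 proof -
  have "((\<lambda>z. h \<bar>z\<bar>) \<longlongrightarrow> 0) (at 0)" using c h(3) f(2) by (simp add: isCont_def)
  then have "((\<lambda>z. \<bar>h \<bar>z\<bar>\<bar>) \<longlongrightarrow> 0) (at 0)" by (rule tendsto_rabs_zero)
  then have "((\<lambda>z. sgn z * h \<bar>z\<bar>) \<longlongrightarrow> 0) (at 0)"
   by (rule Lim_null_comparison[rotated]) (auto simp: abs_mult sgn_if intro!: always_eventually)
  then show ?thesis by (simp add: isCont_def)
 qed
 moreover have "f \<bar>z\<bar> - f 0 = sgn z * h \<bar>z\<bar> * z" for z
  using h(1)[of "\<bar>z\<bar>"] by (auto simp: sgn_if)
 ultimately have "\<exists>h'. (\<forall>z. f \<bar>z\<bar> - f \<bar>0\<bar> = h' z * (z - 0)) \<and> isCont h' 0 \<and> h' 0 = 0"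
  by (intro exI[of _ "\<lambda>z. sgn z * h \<bar>z\<bar>"]) auto
 then show ?thesis using CARAT_DERIV[of "\<lambda>z. f \<bar>z\<bar>" 0 0] True f(2) by simp
qed

text \<open>The even reflection of \<open>V\<close> has a kink at the origin; the factor \<open>v\<close> vanishes there and
 restores continuity of the derivative.\<close>

lemma reflected_potential_regular:
 fixes V :: "real \<Rightarrow> real" and v :: "real \<times> real \<Rightarrow> real"
 assumes V: "\<And>x. DERIV V x :> V' x" "continuous_on UNIV V'"
  and v: "pd1 v v1" "continuous_on UNIV v" "continuous_on UNIV v1" "\<And>x. v (- x, x) = 0"
 defines "G \<equiv> \<lambda>q::real\<times>real. V \<bar>(fst q + snd q) / 2\<bar>"
 shows "\<exists>F1. pd1 (\<lambda>q. G q * v q) F1 \<and> continuous_on UNIV F1"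
proof (intro exI conjI)
 let ?s = "\<lambda>q::real\<times>real. (fst q + snd q) / 2"
 let ?F = "\<lambda>q. sgn (?s q) * (V' \<bar>?s q\<bar> / 2 * v q) + G q * v1 q"
 have cV: "continuous_on UNIV V" using DERIV_isCont[OF V(1)] by (auto intro!: continuous_at_imp_continuous_on)
 have cG: "continuous_on UNIV G" unfolding G_def by (intro continuous_on_compose2[OF cV] continuous_intros) auto
 show "continuous_on UNIV ?F"
 proof (rule continuous_on_add[OF continuous_on_sgn_mult continuous_on_mult[OF cG v(3)]])
  show "continuous_on UNIV ?s" by (intro continuous_intros) auto
  then have "continuous_on UNIV (\<lambda>q. V' \<bar>?s q\<bar>)"
   by (intro continuous_on_compose2[OF V(2)] continuous_on_rabs) auto
  then show "continuous_on UNIV (\<lambda>q. V' \<bar>?s q\<bar> / 2 * v q)" by (intro continuous_intros v(2)) auto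
  fix q :: "real \<times> real" assume "?s q = 0"
  then have "q = (- snd q, snd q)" by (cases q) auto
  then show "V' \<bar>?s q\<bar> / 2 * v q = 0" using v(4)[of "snd q"] by simp
 qed
 show "pd1 (\<lambda>q. G q * v q) ?F"
  unfolding pd1_def
 proof (intro allI)
  fix p y
  have dv: "DERIV (\<lambda>p. v (p, y)) p :> v1 (p, y)" using v(1) by (simp add: pd1_def)
  show "DERIV (\<lambda>p. G (p, y) * v (p, y)) p :> ?F (p, y)"
  proof (cases "(p + y) / 2 = 0")
   case True
   then have "p = - y" by simp
   then have "v (p, y) = 0" using v(4) by simp
   moreover have "isCont (\<lambda>p. G (p, y)) p"
    using continuous_on_compose2[OF cG, of UNIV "\<lambda>p. (p, y)"]
    by (auto simp: continuous_on_eq_continuous_at intro!: continuous_intros)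
   ultimately show ?thesis using DERIV_mult_vanishing[OF dv] True by simp
  next
   case False
   have "DERIV (\<lambda>p. (p + y) / 2) p :> 1/2" by (auto intro!: derivative_eq_intros)
   from DERIV_chain2[OF DERIV_abs_comp[OF V(1) False] this]
   have "DERIV (\<lambda>p. G (p, y)) p :> sgn ((p + y) / 2) * V' \<bar>(p + y) / 2\<bar> * (1/2)"
    by (simp add: G_def)
   from DERIV_mult[OF this dv] show ?thesis by (simp add: algebra_simps)
  qed
 qed
qed

text \<open>Reflecting the potential evenly and the datum oddly turns the Dirichlet problem into a
 Cauchy problem on the line whose solution is odd, hence zero at the origin. The conditions on \<open>f\<close>
 and \<open>f''\<close> at \<open>0\<close> make the reflected datum twice continuously differentiable.\<close>

lemma wave_half_line:
 fixes V f :: "real \<Rightarrow> real"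
 assumes V: "\<And>x. DERIV V x :> V' x" "continuous_on UNIV V'" "\<And>x. \<bar>V x\<bar> \<le> M"
  and f: "\<And>x. DERIV f x :> f' x" "\<And>x. DERIV f' x :> f'' x"
   "continuous_on UNIV f''" "\<And>x. x \<ge> 0 \<Longrightarrow> \<bar>f x\<bar> \<le> C" "f 0 = 0" "f'' 0 = 0"
 obtains u ut utt ux uxx where "C_on 2 UNIV u" "pd1 u ut" "pd1 ut utt" "pd2 u ux" "pd2 ux uxx"
  "\<And>t x. x \<ge> 0 \<Longrightarrow> utt (t, x) = uxx (t, x) - V x * u (t, x)"
  "\<And>t. u (t, 0) = 0" "\<And>x. x \<ge> 0 \<Longrightarrow> u (0, x) = f x" "\<And>x. ut (0, x) = 0"
proof -
 define G where "G q = V \<bar>(fst q + snd q) / 2\<bar> / 4" for q :: "real \<times> real"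
 define V4 where "V4 x = V x / 4" for x
 have G4: "G = (\<lambda>q. V4 \<bar>(fst q + snd q) / 2\<bar>)" by (simp add: G_def V4_def fun_eq_iff)
 have V4: "DERIV V4 x :> V' x / 4" for x unfolding V4_def by (intro DERIV_cdivide V)
 have cV: "continuous_on UNIV V" using DERIV_isCont[OF V(1)] by (auto intro!: continuous_at_imp_continuous_on)
 have cG: "continuous_on UNIV G" unfolding G_def by (intro continuous_on_compose2[OF cV] continuous_intros) auto
 have cV4: "continuous_on UNIV (\<lambda>x. V' x / 4)" by (intro continuous_intros V) auto
 have RG: "Rf G = G"
 proof
  fix q :: "real \<times> real"
  have "(- snd q + - fst q) / 2 = - ((fst q + snd q) / 2)" by (simp add: field_simps)
  then have "\<bar>(- snd q + - fst q) / 2\<bar> = \<bar>(fst q + snd q) / 2\<bar>" by (simp only: abs_minus_cancel)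
  then show "Rf G q = G q" by (simp only: Rf_def G_def case_prod_unfold fst_conv snd_conv)
 qed
 define v0 where "v0 x = sgn x * f \<bar>x\<bar>" for x
 have bG: "\<bar>G q\<bar> \<le> M / 4" for q using V(3)[of "\<bar>(fst q + snd q) / 2\<bar>"] by (simp add: G_def)
 have d0: "DERIV v0 x :> f' \<bar>x\<bar>" for x unfolding v0_def by (rule odd_extension[OF f(1) f(5)])
 have d1: "DERIV (\<lambda>x. f' \<bar>x\<bar>) x :> sgn x * f'' \<bar>x\<bar>" for x
  by (rule even_extension_vanishing[OF f(2) f(6)])
 have c2: "continuous_on UNIV (\<lambda>x. sgn x * f'' \<bar>x\<bar>)"
  by (intro continuous_on_sgn_mult continuous_on_compose2[OF f(3)] continuous_intros) (use f(6) in auto)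
 have b0: "\<bar>v0 x\<bar> \<le> C" for x using f(4)[of "\<bar>x\<bar>"] f(4)[of 0] by (auto simp: v0_def sgn_if abs_mult)
 have o0: "v0 (- x) = - v0 x" for x by (simp add: v0_def sgn_minus)
 have reg: "\<exists>F1 F2. pd1 (\<lambda>q. G q * v q) F1 \<and> pd2 (\<lambda>q. G q * v q) F2 \<and> continuous_on UNIV F1 \<and> continuous_on UNIV F2"
  if v: "pd1 v v1" "pd2 v v2" "continuous_on UNIV v" "continuous_on UNIV v1" "continuous_on UNIV v2" "Rf v = (\<lambda>q. - v q)" for v v1 v2
 proof -
  have z: "v (- x, x) = 0" "v (x, - x) = 0" for x
   using fun_cong[OF v(6), of "(-x, x)"] fun_cong[OF v(6), of "(x, -x)"] by (simp_all add: Rf_def)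
  obtain F1 where F1: "pd1 (\<lambda>q. G q * v q) F1" "continuous_on UNIV F1"
   using reflected_potential_regular[OF V4 cV4 v(1,3,4) z(1)] unfolding G4 by blast
  have "pd1 (Sw v) (Sw v2)" using v(2) by (rule pd_Sw)
  from reflected_potential_regular[OF V4 cV4 this continuous_Sw[OF v(3)] continuous_Sw[OF v(5)]]
  obtain F2 where F2: "pd1 (\<lambda>q. G q * Sw v q) F2" "continuous_on UNIV F2" unfolding G4 using z(2) by (auto simp: Sw_def)
  have "Sw (\<lambda>q. G q * Sw v q) = (\<lambda>q. G q * v q)" by (simp add: Sw_def G_def case_prod_unfold fun_eq_iff add.commute)
  then have "pd2 (\<lambda>q. G q * v q) (Sw F2)" using pd_Sw(1)[OF F2(1)] by simp
  then show ?thesis using F1 continuous_Sw[OF F2(2)] by blast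
 qed
 have regO: "\<forall>v v1 v2. pd1 v v1 \<longrightarrow> pd2 v v2 \<longrightarrow> continuous_on UNIV v \<longrightarrow> continuous_on UNIV v1 \<longrightarrow> continuous_on UNIV v2
    \<longrightarrow> Rf v = (\<lambda>q. - v q) \<longrightarrow>
    (\<exists>F1 F2. pd1 (\<lambda>q. G q * v q) F1 \<and> pd2 (\<lambda>q. G q * v q) F2 \<and> continuous_on UNIV F1 \<and> continuous_on UNIV F2)"
  by (intro allI impI) (rule reg)
 from goursat[OF cG bG RG d0 d1 c2 b0 o0 regO]
 obtain v v1 v2 v11 v22 where conj: "pd1 v v1 \<and> pd2 v v2 \<and> pd1 v1 v11 \<and> pd2 v1 (\<lambda>q. G q * v q) \<and>
  pd1 v2 (\<lambda>q. G q * v q) \<and> pd2 v2 v22 \<and>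
  continuous_on UNIV v \<and> continuous_on UNIV v1 \<and> continuous_on UNIV v2 \<and> continuous_on UNIV v11 \<and> continuous_on UNIV v22 \<and>
  Rf v = (\<lambda>q. - v q) \<and> (\<forall>x. v (x, x) = v0 x) \<and> (\<forall>x. v1 (x, x) = v2 (x, x))"
  by (elim exE)
 then have v: "pd1 v v1" "pd2 v v2" "pd1 v1 v11" "pd2 v1 (\<lambda>q. G q * v q)"
  "pd1 v2 (\<lambda>q. G q * v q)" "pd2 v2 v22"
  "continuous_on UNIV v" "continuous_on UNIV v1" "continuous_on UNIV v2" "continuous_on UNIV v11" "continuous_on UNIV v22"
  "Rf v = (\<lambda>q. - v q)" "\<And>x. v (x, x) = v0 x" "\<And>x. v1 (x, x) = v2 (x, x)"
  by simp_all
 define F where "F = (\<lambda>q. G q * v q)"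
 have cF: "continuous_on UNIV F" unfolding F_def by (intro continuous_intros cG v)
 note v' = v(3) v(4,5)[folded F_def] v(6)
 define ch where "ch = (\<lambda>q::real\<times>real. (snd q + fst q, snd q - fst q))"
 have c0: "C_on 0 UNIV F" "C_on 0 UNIV v11" "C_on 0 UNIV v22" using cF v by auto
 have "C_on (Suc (Suc 0)) UNIV v"
  by (intro C_on_Suc_partials[OF v(1,2)] C_on_Suc_partials[OF v'(1,2)] C_on_Suc_partials[OF v'(3,4)] c0)
 then have cv2: "C_on 2 UNIV v" by (simp only: numeral_2_eq_2)
 have chl: "bounded_linear ch" unfolding ch_def
  by (intro bounded_linear_Pair bounded_linear_add bounded_linear_sub bounded_linear_fst bounded_linear_snd)
 have C2: "C_on 2 UNIV (\<lambda>q. v (ch q))"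
  by (rule C_on_compose[OF open_UNIV subset_UNIV C_on_bounded_linear[OF open_UNIV chl] cv2])
 have ch1: "((\<lambda>t. ch (t, x)) has_derivative (\<lambda>r. (r, - r))) (at t)" for t x
  unfolding ch_def by (auto intro!: derivative_eq_intros)
 have ch2: "((\<lambda>x. ch (t, x)) has_derivative (\<lambda>r. (r, r))) (at x)" for t x
  unfolding ch_def by (auto intro!: derivative_eq_intros)
 have D1: "pd1 (\<lambda>q. H (ch q)) (\<lambda>q. H1 (ch q) - H2 (ch q))" if H: "pd1 H H1" "pd2 H H2" "continuous_on UNIV H2" for H H1 H2
  unfolding pd1_def
 proof (intro allI)
  fix t x
  from has_derivative_compose[OF ch1 has_derivative_of_partials[OF H]]
  show "DERIV (\<lambda>t. H (ch (t, x))) t :> H1 (ch (t, x)) - H2 (ch (t, x))"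
   unfolding has_field_derivative_def by (rule has_derivative_eq_rhs) (simp add: fun_eq_iff algebra_simps)
 qed
 have D2: "pd2 (\<lambda>q. H (ch q)) (\<lambda>q. H1 (ch q) + H2 (ch q))" if H: "pd1 H H1" "pd2 H H2" "continuous_on UNIV H2" for H H1 H2
  unfolding pd2_def
 proof (intro allI)
  fix t x
  from has_derivative_compose[OF ch2 has_derivative_of_partials[OF H]]
  show "DERIV (\<lambda>x. H (ch (t, x))) x :> H1 (ch (t, x)) + H2 (ch (t, x))"
   unfolding has_field_derivative_def by (rule has_derivative_eq_rhs) (simp add: fun_eq_iff algebra_simps)
 qed
 note D12 = D1[OF v'(1,2) cF] D1[OF v'(3,4) v(11)] D2[OF v'(1,2) cF] D2[OF v'(3,4) v(11)]
 show ?thesis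
 proof (rule that[OF C2 D1[OF v(1,2,9)] _ D2[OF v(1,2,9)]])
  show "pd1 (\<lambda>q. v1 (ch q) - v2 (ch q)) (\<lambda>q. (v11 (ch q) - F (ch q)) - (F (ch q) - v22 (ch q)))"
   by (rule pd_diff(1)[OF D12(1,2)])
  show "pd2 (\<lambda>q. v1 (ch q) + v2 (ch q)) (\<lambda>q. (v11 (ch q) + F (ch q)) + (F (ch q) + v22 (ch q)))"
   by (rule pd_add(2)[OF D12(3,4)])
  show "v11 (ch (t, x)) - F (ch (t, x)) - (F (ch (t, x)) - v22 (ch (t, x)))
    = v11 (ch (t, x)) + F (ch (t, x)) + (F (ch (t, x)) + v22 (ch (t, x))) - V x * v (ch (t, x))" if "x \<ge> 0" for t x
   using that by (simp add: F_def G_def ch_def)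
  show "v (ch (t, 0)) = 0" for t using fun_cong[OF v(12), of "(t, - t)"] by (simp add: Rf_def ch_def)
  show "v (ch (0, x)) = f x" if "x \<ge> 0" for x using that f(5) by (auto simp: ch_def v v0_def sgn_if)
  show "v1 (ch (0, x)) - v2 (ch (0, x)) = 0" for x by (simp add: ch_def v)
 qed
qed

section \<open>Integration over compact sets\<close>

lemma integrable_continuous_compact:
 fixes f :: "'a::metric_space \<Rightarrow> 'b::{banach, second_countable_topology}"
 assumes "finite_measure M" "(\<lambda>p. p) \<in> M \<rightarrow>\<^sub>M borel" "space M \<subseteq> K" "compact K" "continuous_on K f"
 shows "integrable M f"
proof -
 have "(\<lambda>p. indicator K p *\<^sub>R f p) \<in> borel_measurable borel"
  by (rule borel_measurable_continuous_on_indicator[OF borel_compact[OF assms(4)] assms(5)])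
 from measurable_compose[OF assms(2) this]
 have m: "f \<in> borel_measurable M"
  by (rule measurable_cong[THEN iffD1, rotated]) (use assms(3) in \<open>auto simp: indicator_def\<close>)
 have "bounded (f ` K)" using assms(4,5) compact_continuous_image compact_imp_bounded by blast
 then obtain B where "\<And>p. p \<in> K \<Longrightarrow> norm (f p) \<le> B" unfolding bounded_iff by auto
 then show ?thesis
  using assms(3) by (intro finite_measure.integrable_const_bound[OF assms(1), where B=B] m) (auto intro!: AE_I2)
qed

text \<open>Uniform continuity of \<open>g'\<close> on compact sets bounds the difference quotients uniformly in \<open>p\<close>.
 The set \<open>S\<close> is a half line in the applications, with one-sided derivatives at its end.\<close>

lemma has_vector_derivative_integral_compact:
 fixes g :: "real \<Rightarrow> 'a::metric_space \<Rightarrow> 'b::{banach, second_countable_topology}"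
 assumes M: "finite_measure M" "(\<lambda>p. p) \<in> M \<rightarrow>\<^sub>M borel" "space M \<subseteq> K" "compact K"
  and S: "closed S" "convex S" "t \<in> S"
  and D: "\<And>s p. s \<in> S \<Longrightarrow> p \<in> K \<Longrightarrow> ((\<lambda>s. g s p) has_vector_derivative g' s p) (at s within S)"
  and c: "continuous_on (S \<times> K) (\<lambda>(s, p). g' s p)" "\<And>s. s \<in> S \<Longrightarrow> continuous_on K (g s)"
 shows "((\<lambda>s. \<integral>p. g s p \<partial>M) has_vector_derivative (\<integral>p. g' t p \<partial>M)) (at t within S)"
 unfolding has_vector_derivative_def has_derivative_within_alt
proof (intro conjI allI impI)
 show "bounded_linear (\<lambda>x. x *\<^sub>R (\<integral>p. g' t p \<partial>M))" by (rule bounded_linear_scaleR_left)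
 fix e :: real assume e: "e > 0"
 define m where "m = measure M (space M) + 1"
 have m: "m > 0" using measure_nonneg[of M "space M"] unfolding m_def by linarith
 have "compact ((S \<inter> cball t 1) \<times> K)"
  using S(1) M(4) by (intro compact_Times closed_Int_compact) auto
 from compact_uniformly_continuous[OF continuous_on_subset[OF c(1)] this]
 have "uniformly_continuous_on ((S \<inter> cball t 1) \<times> K) (\<lambda>(s, p). g' s p)" by auto
 then obtain d where d: "d > 0" "\<And>x y. x \<in> (S \<inter> cball t 1) \<times> K \<Longrightarrow> y \<in> (S \<inter> cball t 1) \<times> K \<Longrightarrow>
   dist x y < d \<Longrightarrow> dist ((\<lambda>(s, p). g' s p) x) ((\<lambda>(s, p). g' s p) y) < e / m"
  unfolding uniformly_continuous_on_def using divide_pos_pos[OF e m] by metis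
 have c't: "continuous_on K (g' s)" if "s \<in> S" for s
 proof -
  have "continuous_on K (\<lambda>p. (\<lambda>(s, p). g' s p) (s, p))"
   using that by (intro continuous_on_compose2[OF c(1)] continuous_intros) auto
  then show ?thesis by simp
 qed
 note int = integrable_continuous_compact[OF M]
 show "\<exists>d>0. \<forall>y\<in>S. norm (y - t) < d \<longrightarrow>
   norm ((\<integral>p. g y p \<partial>M) - (\<integral>p. g t p \<partial>M) - (y - t) *\<^sub>R (\<integral>p. g' t p \<partial>M)) \<le> e * norm (y - t)"
 proof (intro exI[of _ "min d 1"] conjI ballI impI)
  show "min d 1 > 0" using d by auto
  fix y assume y: "y \<in> S" "norm (y - t) < min d 1"
  have bd: "norm (g y p - g t p - (y - t) *\<^sub>R g' t p) \<le> norm (y - t) * (e / m)" if p: "p \<in> K" for p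
  proof (rule vector_differentiable_bound_linearization[where S="closed_segment t y"])
   have sub: "closed_segment t y \<subseteq> S" using S y by (simp add: closed_segment_subset)
   fix s assume s: "s \<in> closed_segment t y"
   show "((\<lambda>s. g s p) has_vector_derivative g' s p) (at s within closed_segment t y)"
    using D[of s p] sub s p has_vector_derivative_within_subset by blast
   have "norm (s - t) \<le> norm (y - t)" using s segment_bound1 by blast
   then have "dist s t < d" "dist s t \<le> 1" using y by (auto simp: dist_norm)
   then show "norm (g' s p - g' t p) \<le> e / m"
    using d(2)[of "(s, p)" "(t, p)"] s sub p S(3)
    by (auto simp: dist_Pair_Pair dist_commute subset_iff) (auto simp: dist_norm)
  qed auto
  have "(\<integral>p. g y p \<partial>M) - (\<integral>p. g t p \<partial>M) - (y - t) *\<^sub>R (\<integral>p. g' t p \<partial>M) =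
    (\<integral>p. g y p - g t p - (y - t) *\<^sub>R g' t p \<partial>M)"
   using S(3) y c(2) c't by (simp add: int)
  also have "norm \<dots> \<le> (\<integral>p. norm (g y p - g t p - (y - t) *\<^sub>R g' t p) \<partial>M)" by simp
  also have "\<dots> \<le> (\<integral>p. norm (y - t) * (e / m) \<partial>M)"
  proof (rule integral_mono)
   have "continuous_on K (\<lambda>p. g y p - g t p - (y - t) *\<^sub>R g' t p)"
    using S(3) y c(2) c't by (intro continuous_intros) auto
   then show "integrable M (\<lambda>p. norm (g y p - g t p - (y - t) *\<^sub>R g' t p))"
    by (rule integrable_norm[OF int])
  qed (use bd M in \<open>auto simp: finite_measure.integrable_const\<close>)
  also have "\<dots> = (e * norm (y - t)) * (measure M (space M) / m)" by simp
  also have "measure M (space M) / m \<le> 1"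
   unfolding divide_le_eq_1_pos[OF m] by (simp add: m_def)
  then have "(e * norm (y - t)) * (measure M (space M) / m) \<le> (e * norm (y - t)) * 1"
   using e by (intro mult_left_mono) auto
  finally show "norm ((\<integral>p. g y p \<partial>M) - (\<integral>p. g t p \<partial>M) - (y - t) *\<^sub>R (\<integral>p. g' t p \<partial>M)) \<le> e * norm (y - t)"
   by simp
 qed
qed

section \<open>Calculus on the sphere\<close>

abbreviation "\<sigma> \<equiv> sphere_measure"

lemma space_sphere_measure [simp]: "space sphere_measure = S2"
 by (simp add: sphere_measure_def space_scale_measure space_restrict_space)

lemma sets_sphere_measure: "sets sphere_measure = sets (restrict_space borel S2)"
 by (simp add: sphere_measure_def)

lemma finite_sphere_measure: "finite_measure sphere_measure"
 by (rule finite_measureI) (simp add: emeasure_sphere_measure)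

lemma measurable_ident_sphere: "(\<lambda>p. p) \<in> sphere_measure \<rightarrow>\<^sub>M borel"
 using measurable_ident_sets[OF sets_sphere_measure] measurable_restrict_space1[OF measurable_ident]
 by (simp add: measurable_cong_sets[OF sets_sphere_measure refl] id_def)

lemmas integrable_sphere = integrable_continuous_compact[OF finite_sphere_measure measurable_ident_sphere, of S2, simplified]

text \<open>Both measures agree on boxes.\<close>

lemma distr_lborel_orthogonal:
 fixes R :: "real^3 \<Rightarrow> real^3"
 assumes R: "orthogonal_transformation R"
 shows "distr lborel borel R = lborel"
proof (rule lborel_eqI[symmetric])
 have lin: "linear R" using R orthogonal_transformation_linear by blast
 have Rm: "R \<in> borel_measurable borel"
  using lin by (simp add: borel_measurable_continuous_onI linear_continuous_on linear_linear)
 fix l u :: "real^3" assume lu: "\<And>b. b \<in> Basis \<Longrightarrow> l \<bullet> b \<le> u \<bullet> b"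
 have img: "R -` box l u = inv R ` box l u"
  using R orthogonal_transformation_bij bij_vimage_eq_inv_image by blast
 have o: "orthogonal_transformation (inv R)" using R orthogonal_transformation_inv by blast
 have L: "inv R ` box l u \<in> lmeasurable" by (rule measurable_orthogonal_image[OF o]) auto
 have op: "open (R -` box l u)"
  using lin by (intro open_vimage) (auto simp: linear_continuous_on linear_linear)
 have "emeasure (distr lborel borel R) (box l u) = emeasure lborel (R -` box l u)"
  using Rm by (subst emeasure_distr) auto
 also have "\<dots> = emeasure lebesgue (R -` box l u)"
  using op by (simp add: borel_open)
 also have "\<dots> = ennreal (measure lebesgue (inv R ` box l u))"
  unfolding img using L by (simp add: emeasure_eq_measure2)
 also have "\<dots> = ennreal (measure lebesgue (box l u))"
  using measure_orthogonal_image[OF o, of "box l u"] by simp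
 also have "\<dots> = (\<Prod>b\<in>Basis. (u - l) \<bullet> b)"
  using lu by simp
 finally show "emeasure (distr lborel borel R) (box l u) = (\<Prod>b\<in>Basis. (u - l) \<bullet> b)" .
qed simp

text \<open>An orthogonal map commutes with \<open>sgn\<close> and preserves the unit ball and its volume.\<close>

lemma integral_sphere_orthogonal:
 fixes f :: "real^3 \<Rightarrow> 'b::{banach, second_countable_topology}"
 assumes R: "orthogonal_transformation R" and f: "f \<in> borel_measurable sphere_measure"
 shows "(\<integral>\<omega>. f (R \<omega>) \<partial>\<sigma>) = (\<integral>\<omega>. f \<omega> \<partial>\<sigma>)"
proof -
 let ?B = "ball 0 1 - {0::real^3}"
 have lin: "linear R" using R orthogonal_transformation_linear by blast
 have Rm: "R \<in> borel_measurable borel"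
  using lin by (simp add: borel_measurable_continuous_onI linear_continuous_on linear_linear)
 have nR: "norm (R y) = norm y" for y using R orthogonal_transformation_norm by blast
 have sR: "sgn (R y) = R (sgn y)" for y
  by (simp add: sgn_div_norm nR linear_cmul[OF lin])
 have RS: "R \<in> sphere_measure \<rightarrow>\<^sub>M sphere_measure"
  unfolding measurable_cong_sets[OF sets_sphere_measure sets_sphere_measure]
  by (intro measurable_restrict_space2 measurable_restrict_space1 Rm) (auto simp: space_restrict_space nR)
 have em: "emeasure sphere_measure E = 3 * emeasure lborel (sgn -` E \<inter> ?B)" if "E \<in> sets sphere_measure" for E
 proof -
  have E: "E \<in> sets (restrict_space borel S2)" using that sets_sphere_measure by blast
  show ?thesis
   unfolding sphere_measure_def
   using E by (simp add: emeasure_distr[OF measurable_sgn_sphere] space_restrict_space emeasure_restrict_space)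
 qed
 have "distr sphere_measure sphere_measure R = sphere_measure"
 proof (rule measure_eqI)
  fix E assume "E \<in> sets (distr sphere_measure sphere_measure R)"
  then have E: "E \<in> sets sphere_measure" by simp
  have E': "R -` E \<inter> S2 \<in> sets sphere_measure" using measurable_sets[OF RS E] by simp
  have Eb: "E \<in> sets (restrict_space borel S2)" using E sets_sphere_measure by blast
  have Es: "sgn -` E \<inter> ?B \<in> sets borel"
   using measurable_sets[OF measurable_sgn_sphere Eb]
   by (auto simp: space_restrict_space sets_restrict_space_iff)
  have "emeasure (distr sphere_measure sphere_measure R) E = emeasure sphere_measure (R -` E \<inter> S2)"
   using emeasure_distr[OF RS E] by simp
  also have "\<dots> = 3 * emeasure lborel (sgn -` (R -` E \<inter> S2) \<inter> ?B)" by (rule em[OF E'])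
  also have "sgn -` (R -` E \<inter> S2) \<inter> ?B = R -` (sgn -` E \<inter> ?B)"
  proof -
   have "R y = 0 \<longleftrightarrow> y = 0" for y using nR[of y] by (metis norm_eq_zero)
   then show ?thesis unfolding set_eq_iff by (simp add: sR nR norm_sgn)
  qed
  also have "emeasure lborel \<dots> = emeasure (distr lborel borel R) (sgn -` E \<inter> ?B)"
   using Rm Es by (subst emeasure_distr) auto
  also have "\<dots> = emeasure lborel (sgn -` E \<inter> ?B)" by (simp add: distr_lborel_orthogonal[OF R])
  also have "3 * \<dots> = emeasure sphere_measure E" by (rule em[OF E, symmetric])
  finally show "emeasure (distr sphere_measure sphere_measure R) E = emeasure sphere_measure E" .
 qed simp
 then show ?thesis using integral_distr[OF RS f] by simp
qed

lemma sgn_has_derivative: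
 fixes \<omega> :: "'a::real_inner"
 assumes "norm \<omega> = 1"
 shows "(sgn has_derivative (\<lambda>v. v - (\<omega> \<bullet> v) *\<^sub>R \<omega>)) (at \<omega>)"
proof -
 have "\<omega> \<noteq> 0" using assms by auto
 then have "((\<lambda>y. inverse (norm y) *\<^sub>R y) has_derivative (\<lambda>v. v - (\<omega> \<bullet> v) *\<^sub>R \<omega>)) (at \<omega>)"
  using assms GDERIV_norm[of \<omega>, unfolded gderiv_def]
  by (auto intro!: derivative_eq_intros simp: sgn_div_norm inner_commute)
 then show ?thesis by (simp add: sgn_div_norm[abs_def])
qed

lemma sphere_grad_eqI:
 assumes "((\<lambda>y. f (sgn y)) has_derivative f') (at \<omega>)"
 shows "sphere_grad f \<omega> $ i = f' (axis i 1)"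
 unfolding sphere_grad_def by (simp add: frechet_derivative_at[OF assms, symmetric])

text \<open>The chain rule with the derivative of \<open>sgn\<close>, the projection onto the tangent plane.\<close>

lemma sphere_grad_explicit:
 assumes "(f has_derivative f') (at \<omega>)" "norm \<omega> = 1"
 shows "sphere_grad f \<omega> $ i = f' (axis i 1 - (\<omega> $ i) *\<^sub>R \<omega>)"
proof -
 have "sgn \<omega> = \<omega>" using assms by (simp add: sgn_div_norm)
 then have "((\<lambda>y. f (sgn y)) has_derivative (\<lambda>v. f' (v - (\<omega> \<bullet> v) *\<^sub>R \<omega>))) (at \<omega>)"
  using diff_chain_at[OF sgn_has_derivative[OF assms(2)], of f f'] assms(1) by (simp add: o_def)
 from sphere_grad_eqI[OF this] show ?thesis by (simp add: inner_axis)
qed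

lemma sphere_grad_cong:
 assumes "\<And>\<eta>. \<eta> \<in> S2 \<Longrightarrow> f \<eta> = g \<eta>" "\<omega> \<in> S2"
 shows "sphere_grad f \<omega> = sphere_grad g \<omega>"
proof -
 have imp: "((\<lambda>y. f (sgn y)) has_derivative f') (at \<omega>) \<Longrightarrow> ((\<lambda>y. g (sgn y)) has_derivative f') (at \<omega>)"
  if "\<And>\<eta>. \<eta> \<in> S2 \<Longrightarrow> f \<eta> = g \<eta>" for f' and f g :: "real^3 \<Rightarrow> complex"
 proof (rule has_derivative_transform_within_open[where s="-{0}"])
  show "\<omega> \<in> -{0}" using assms(2) by auto
  show "f (sgn y) = g (sgn y)" if "y \<in> -{0}" for y
   using that by (intro \<open>\<And>\<eta>. \<eta> \<in> S2 \<Longrightarrow> f \<eta> = g \<eta>\<close>) (simp add: norm_sgn)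
 qed auto
 have iff: "((\<lambda>y. f (sgn y)) has_derivative f') (at \<omega>) \<longleftrightarrow> ((\<lambda>y. g (sgn y)) has_derivative f') (at \<omega>)" for f'
  using imp[of f g f'] imp[of g f f'] assms(1) by auto
 then have "frechet_derivative (\<lambda>y. f (sgn y)) (at \<omega>) = frechet_derivative (\<lambda>y. g (sgn y)) (at \<omega>)"
  by (simp add: frechet_derivative_def)
 then show ?thesis by (simp add: sphere_grad_def)
qed

text \<open>Composing an extension of \<open>f\<close> with \<open>(x, y) \<mapsto> (x, sgn y)\<close> gives a function near \<open>I \<times> S\<^sup>2\<close>
 whose ordinary derivatives are the tangential ones; carrying the parameter \<open>x\<close> along yields joint
 regularity.\<close>

lemma sphere_ext_param:
 fixes f :: "'a::euclidean_space \<times> (real^3) \<Rightarrow> complex"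
 assumes "C_upto (Suc n) (I \<times> S2) f"
 shows "C_upto n (I \<times> S2) (\<lambda>(x, \<omega>). sphere_grad (\<lambda>\<eta>. f (x, \<eta>)) \<omega> $ i)"
  and "x \<in> I \<Longrightarrow> \<omega> \<in> S2 \<Longrightarrow> (\<lambda>y. f (x, sgn y)) differentiable (at \<omega>)"
proof -
 define W where "W = (UNIV :: 'a set) \<times> (- {0::real^3})"
 have W: "open W" "I \<times> S2 \<subseteq> W" by (simp_all add: W_def open_Times open_Compl) auto
 have h: "C_on (Suc n) W (\<lambda>p. (fst p, sgn (snd p)))"
  by (intro C_on_Pair W C_on_fst C_on_compose[where f=snd and V="-{0}" and g=sgn] C_on_snd C_on_sgn) (auto simp: W_def)
 have "C_upto (Suc n) ((I \<times> S2) \<inter> W) (\<lambda>p. f (fst p, sgn (snd p)))"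
  by (rule C_upto_compose[OF assms W(1) _ h]) (auto simp: norm_sgn W_def)
 obtain U F where U: "open U" "I \<times> S2 \<subseteq> U" "C_on (Suc n) U F" "\<forall>p\<in>I \<times> S2. F p = f p"
  using assms unfolding C_upto_def by blast
 define U' where "U' = W \<inter> (\<lambda>p. (fst p, sgn (snd p))) -` U"
 have oU': "open U'" unfolding U'_def
  by (rule continuous_open_preimage[OF C_on_imp_continuous[OF h] W(1) U(1)])
 have sub: "I \<times> S2 \<subseteq> U'" using U(2) W(2) by (auto simp: U'_def sgn_div_norm)
 define G where "G = (\<lambda>p. F (fst p, sgn (snd p)))"
 have "C_on (Suc n) U' (\<lambda>p. (fst p, sgn (snd p)))" by (rule C_on_subset[OF _ h]) (simp add: U'_def)
 from C_on_compose[OF oU' _ this U(3)] have G: "C_on (Suc n) U' G" by (auto simp: G_def U'_def)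
 have D: "((\<lambda>y. f (x, sgn y)) has_derivative (\<lambda>v. frechet_derivative G (at (x, \<omega>)) (0, v))) (at \<omega>)"
  if x: "x \<in> I" "\<omega> \<in> S2" for x \<omega>
 proof (rule has_derivative_transform_within_open)
  have "(G has_derivative frechet_derivative G (at (x, \<omega>))) (at (x, \<omega>))"
   using x sub by (intro C_on_has_derivative[OF G]) auto
  moreover have "(Pair x has_derivative (\<lambda>v. (0, v))) (at \<omega>)" by (auto intro!: derivative_eq_intros)
  ultimately show "((\<lambda>y. G (x, y)) has_derivative (\<lambda>v. frechet_derivative G (at (x, \<omega>)) (0, v))) (at \<omega>)"
   using has_derivative_compose by blast
  show "open (- {0::real^3})" "\<omega> \<in> - {0}" using x by auto
  fix y :: "real^3" assume "y \<in> -{0}"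
  then have "(x, sgn y) \<in> I \<times> S2" using x by (auto simp: norm_sgn)
  then show "G (x, y) = f (x, sgn y)" using U(4) by (auto simp: G_def)
 qed
 show "C_upto n (I \<times> S2) (\<lambda>(x, \<omega>). sphere_grad (\<lambda>\<eta>. f (x, \<eta>)) \<omega> $ i)"
 proof (rule C_uptoI[OF oU' sub])
  show "C_on n U' (\<lambda>p. frechet_derivative G (at p) (0, axis i 1))" using G by simp
  show "frechet_derivative G (at p) (0, axis i 1) = (\<lambda>(x, \<omega>). sphere_grad (\<lambda>\<eta>. f (x, \<eta>)) \<omega> $ i) p"
   if "p \<in> I \<times> S2" for p
   using that sphere_grad_eqI[OF D] by auto
 qed
 show "x \<in> I \<Longrightarrow> \<omega> \<in> S2 \<Longrightarrow> (\<lambda>y. f (x, sgn y)) differentiable (at \<omega>)"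
  using D differentiable_def by blast
qed

lemma C_upto_const_param:
 fixes f :: "real^3 \<Rightarrow> complex"
 assumes "C_upto n S2 f"
 shows "C_upto n (({0::real}) \<times> S2) (\<lambda>p. f (snd p))"
 by (rule C_upto_compose[OF assms, where W=UNIV]) (auto intro: C_on_snd)

lemma C_upto_slice:
 fixes f :: "'a::euclidean_space \<times> 'c::euclidean_space \<Rightarrow> complex"
 assumes "C_upto n (I \<times> J) f" "x \<in> I"
 shows "C_upto n J (\<lambda>y. f (x, y))"
 by (rule C_upto_compose[OF assms(1), where W=UNIV]) (use assms(2) in \<open>auto intro!: C_on_Pair C_on_const C_on_id\<close>)

lemma C_upto_sphere_grad:
 assumes "C_upto (Suc n) S2 f"
 shows "C_upto n S2 (\<lambda>\<omega>. sphere_grad f \<omega> $ i)"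
 using C_upto_slice[OF sphere_ext_param(1)[OF C_upto_const_param[OF assms]], of 0 i] by simp

lemma sphere_grad_derivative:
 assumes "C_upto (Suc n) S2 f" "\<omega> \<in> S2"
 shows "((\<lambda>y. f (sgn y)) has_derivative (\<lambda>v. \<Sum>k\<in>UNIV. (v $ k) *\<^sub>R sphere_grad f \<omega> $ k)) (at \<omega>)"
proof -
 have "(\<lambda>y. f (sgn y)) differentiable (at \<omega>)"
  using sphere_ext_param(2)[OF C_upto_const_param[OF assms(1)], of 0 \<omega>] assms(2) by simp
 then obtain f' where f': "((\<lambda>y. f (sgn y)) has_derivative f') (at \<omega>)" by (auto simp: differentiable_def)
 have "f' v = (\<Sum>k\<in>UNIV. (v $ k) *\<^sub>R sphere_grad f \<omega> $ k)" for v
 proof -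
  have lin: "linear f'" using f' has_derivative_linear by blast
  have "v = (\<Sum>k\<in>UNIV. (v $ k) *\<^sub>R axis k 1)" by (simp add: basis_expansion scalar_mult_eq_scaleR[symmetric])
  then have "f' v = f' (\<Sum>k\<in>UNIV. (v $ k) *\<^sub>R axis k 1)" by simp
  also have "\<dots> = (\<Sum>k\<in>UNIV. (v $ k) *\<^sub>R f' (axis k 1))"
   by (simp add: linear_sum[OF lin] linear_cmul[OF lin])
  finally show ?thesis by (simp add: sphere_grad_eqI[OF f'])
 qed
 then have "f' = (\<lambda>v. \<Sum>k\<in>UNIV. (v $ k) *\<^sub>R sphere_grad f \<omega> $ k)" by auto
 with f' show ?thesis by simp
qed

text \<open>The gradient is tangential, because the extension is constant along rays.\<close>

lemma sphere_grad_radial: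
 assumes "C_upto (Suc n) S2 f" "\<omega> \<in> S2"
 shows "(\<Sum>k\<in>UNIV. (\<omega> $ k) *\<^sub>R sphere_grad f \<omega> $ k) = 0"
proof -
 have "((\<lambda>y. f (sgn y)) has_derivative (\<lambda>v. \<Sum>k\<in>UNIV. (v $ k) *\<^sub>R sphere_grad f \<omega> $ k)) (at ((\<lambda>r::real. r *\<^sub>R \<omega>) 1))"
  using sphere_grad_derivative[OF assms] by simp
 moreover have "((\<lambda>r::real. r *\<^sub>R \<omega>) has_derivative (\<lambda>r. r *\<^sub>R \<omega>)) (at 1)" by (auto intro!: derivative_eq_intros)
 ultimately have "((\<lambda>r::real. f (sgn (r *\<^sub>R \<omega>))) has_derivative (\<lambda>r. \<Sum>k\<in>UNIV. ((r *\<^sub>R \<omega>) $ k) *\<^sub>R sphere_grad f \<omega> $ k)) (at 1)"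
  by (rule has_derivative_compose[rotated])
 moreover have "((\<lambda>r::real. f (sgn (r *\<^sub>R \<omega>))) has_derivative (\<lambda>r. 0)) (at 1)"
 proof (rule has_derivative_transform_within_open[where s="{0<..}"])
  show "((\<lambda>r::real. f \<omega>) has_derivative (\<lambda>r. 0)) (at 1)" by simp
  fix r :: real assume "r \<in> {0<..}"
  then show "f \<omega> = f (sgn (r *\<^sub>R \<omega>))" using assms(2) by (simp add: sgn_scaleR) (simp add: sgn_div_norm)
 qed auto
 ultimately have "(\<lambda>r. \<Sum>k\<in>UNIV. ((r *\<^sub>R \<omega>) $ k) *\<^sub>R sphere_grad f \<omega> $ k) = (\<lambda>r::real. 0)"
  by (rule has_derivative_unique)
 from fun_cong[OF this, of 1] show ?thesis by simp
qed

lemma sphere_grad_mult: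
 assumes "C_upto (Suc n) S2 f" "C_upto (Suc n') S2 g" "\<omega> \<in> S2"
 shows "sphere_grad (\<lambda>\<eta>. f \<eta> * g \<eta>) \<omega> $ i = sphere_grad f \<omega> $ i * g \<omega> + f \<omega> * sphere_grad g \<omega> $ i"
proof -
 have s: "sgn \<omega> = \<omega>" using assms by (simp add: sgn_div_norm)
 show ?thesis
  using sphere_grad_eqI[OF has_derivative_mult[OF sphere_grad_derivative[OF assms(1,3)] sphere_grad_derivative[OF assms(2,3)]], of i]
  by (simp add: s axis_def if_distrib[of "\<lambda>x. x *\<^sub>R _"] sum.delta cong: if_cong)
qed

text \<open>The rotation by the angle \<open>\<theta>\<close> in the plane of the \<open>i\<close>-th and \<open>j\<close>-th coordinate axes.\<close>

definition rot :: "3 \<Rightarrow> 3 \<Rightarrow> real \<Rightarrow> real^3 \<Rightarrow> real^3" where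
 "rot i j \<theta> y = y + ((cos \<theta> - 1) * y $ i - sin \<theta> * y $ j) *\<^sub>R axis i 1
          + (sin \<theta> * y $ i + (cos \<theta> - 1) * y $ j) *\<^sub>R axis j 1"

definition rot' :: "3 \<Rightarrow> 3 \<Rightarrow> real \<Rightarrow> real^3 \<Rightarrow> real^3" where
 "rot' i j \<theta> y = (- sin \<theta> * y $ i - cos \<theta> * y $ j) *\<^sub>R axis i 1
          + (cos \<theta> * y $ i - sin \<theta> * y $ j) *\<^sub>R axis j 1"

lemma orthogonal_rot:
 assumes "i \<noteq> j" shows "orthogonal_transformation (rot i j \<theta>)"
 unfolding orthogonal_transformation
proof (intro conjI allI)
 show "linear (rot i j \<theta>)"
  by (rule linearI) (simp_all add: rot_def algebra_simps)
 fix v :: "real^3"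
 have ij: "axis i (1::real) $ j = 0" "axis j (1::real) $ i = 0"
  using assms by (simp_all add: axis_def)
 have ii: "axis i (1::real) \<bullet> axis i 1 = 1" "axis j (1::real) \<bullet> axis j 1 = 1" "axis i (1::real) \<bullet> axis j 1 = 0"
  using assms by (simp_all add: inner_axis_axis)
 define a b u w where "a = v $ i" "b = v $ j" "u = (cos \<theta> - 1) * a - sin \<theta> * b" "w = sin \<theta> * a + (cos \<theta> - 1) * b"
 note d = this
 have "rot i j \<theta> v \<bullet> rot i j \<theta> v = v \<bullet> v + 2 * u * a + 2 * w * b + u\<^sup>2 + w\<^sup>2"
  unfolding rot_def d[symmetric] using ii
  by (simp add: inner_add_left inner_add_right inner_axis inner_commute[of "axis j 1" v] inner_commute[of "axis i 1" v]
    inner_commute[of "axis j 1" "axis i 1"] d ij power2_eq_square algebra_simps)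
 also have "2 * u * a + 2 * w * b + u\<^sup>2 + w\<^sup>2 = ((sin \<theta>)\<^sup>2 + (cos \<theta>)\<^sup>2 - 1) * (a\<^sup>2 + b\<^sup>2)"
  unfolding d(3,4) by algebra
 then have "v \<bullet> v + 2 * u * a + 2 * w * b + u\<^sup>2 + w\<^sup>2 = v \<bullet> v" by simp
 finally show "norm (rot i j \<theta> v) = norm v" by (simp add: norm_eq_sqrt_inner)
qed

lemma norm_rot [simp]: "i \<noteq> j \<Longrightarrow> norm (rot i j \<theta> y) = norm y"
 using orthogonal_rot orthogonal_transformation_norm by blast

lemma rot_has_vector_derivative: "((\<lambda>\<theta>. rot i j \<theta> y) has_vector_derivative rot' i j \<theta> y) (at \<theta>)"
 unfolding rot_def rot'_def has_vector_derivative_def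
 by (auto intro!: derivative_eq_intros simp: algebra_simps)

lemma rot_zero [simp]: "rot i j 0 y = y"
 by (simp add: rot_def)

lemma continuous_on_rot: "continuous_on A (\<lambda>p. rot i j (fst p) (snd p))" "continuous_on A (\<lambda>p. rot' i j (fst p) (snd p))"
 unfolding rot_def rot'_def by (intro continuous_intros)+

lemma measurable_continuous_sphere:
 fixes f :: "real^3 \<Rightarrow> 'b::{banach, second_countable_topology}"
 shows "continuous_on S2 f \<Longrightarrow> f \<in> borel_measurable sphere_measure"
 using integrable_sphere borel_measurable_integrable by blast

text \<open>The integral of \<open>G\<close> over the sphere is invariant under rotations; differentiate in the angle
 at \<open>0\<close>.\<close>

lemma integral_sphere_rot_generator:
 assumes "C_upto 1 S2 G" "i \<noteq> j"
 shows "(\<integral>\<omega>. (\<Sum>k\<in>UNIV. (rot' i j 0 \<omega> $ k) *\<^sub>R sphere_grad G \<omega> $ k) \<partial>\<sigma>) = 0"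
proof -
 have G1: "C_upto (Suc 0) S2 G" using assms(1) by simp
 have cont: "continuous_on S2 G" by (rule C_upto_imp_continuous[OF assms(1)])
 have contg: "continuous_on S2 (\<lambda>\<omega>. sphere_grad G \<omega> $ k)" for k
  using C_upto_imp_continuous[OF C_upto_sphere_grad[OF G1]] .
 let ?h = "\<lambda>\<theta> \<omega>. \<Sum>k\<in>UNIV. (rot' i j \<theta> \<omega> $ k) *\<^sub>R sphere_grad G (rot i j \<theta> \<omega>) $ k"
 have "((\<lambda>\<theta>. \<integral>\<omega>. G (rot i j \<theta> \<omega>) \<partial>\<sigma>) has_vector_derivative (\<integral>\<omega>. ?h 0 \<omega> \<partial>\<sigma>)) (at 0 within UNIV)"
 proof (rule has_vector_derivative_integral_compact[OF finite_sphere_measure measurable_ident_sphere, where K=S2])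
  fix \<theta> :: real and \<omega> :: "real^3" assume \<omega>: "\<omega> \<in> S2"
  have r: "rot i j \<theta> \<omega> \<in> S2" using \<omega> assms(2) by simp
  have s: "sgn (rot i j \<theta> \<omega>) = rot i j \<theta> \<omega>" for \<theta> using \<omega> assms(2) by (simp add: sgn_div_norm)
  have "((\<lambda>\<theta>. rot i j \<theta> \<omega>) has_derivative (\<lambda>r. r *\<^sub>R rot' i j \<theta> \<omega>)) (at \<theta>)"
   using rot_has_vector_derivative by (simp add: has_vector_derivative_def)
  from has_derivative_compose[OF this sphere_grad_derivative[OF G1 r]]
  show "((\<lambda>\<theta>. G (rot i j \<theta> \<omega>)) has_vector_derivative ?h \<theta> \<omega>) (at \<theta> within UNIV)"
   unfolding has_vector_derivative_def by (simp add: s scaleR_sum_right)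
 next
  have "continuous_on (UNIV \<times> S2) (\<lambda>p. \<Sum>k\<in>UNIV. (rot' i j (fst p) (snd p) $ k) *\<^sub>R sphere_grad G (rot i j (fst p) (snd p)) $ k)"
   by (intro continuous_intros continuous_on_rot continuous_on_compose2[OF contg continuous_on_rot(1)])
     (use assms(2) in auto)
  then show "continuous_on (UNIV \<times> S2) (\<lambda>(\<theta>, \<omega>). ?h \<theta> \<omega>)" by (simp add: case_prod_unfold)
  fix \<theta> :: real
  have "continuous_on S2 (\<lambda>\<omega>. rot i j (fst (\<theta>, \<omega>)) (snd (\<theta>, \<omega>)))"
   by (rule continuous_on_compose2[OF continuous_on_rot(1)[of UNIV]]) (auto intro!: continuous_intros)
  then show "continuous_on S2 (\<lambda>\<omega>. G (rot i j \<theta> \<omega>))"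
   by (intro continuous_on_compose2[OF cont]) (use assms(2) in auto)
 qed auto
 moreover have "(\<lambda>\<theta>. \<integral>\<omega>. G (rot i j \<theta> \<omega>) \<partial>\<sigma>) = (\<lambda>\<theta>. \<integral>\<omega>. G \<omega> \<partial>\<sigma>)"
  using integral_sphere_orthogonal[OF orthogonal_rot[OF assms(2)] measurable_continuous_sphere[OF cont]] by auto
 ultimately have "((\<lambda>\<theta>::real. \<integral>\<omega>. G \<omega> \<partial>\<sigma>) has_vector_derivative (\<integral>\<omega>. ?h 0 \<omega> \<partial>\<sigma>)) (at 0)"
  by simp
 moreover have "((\<lambda>\<theta>::real. \<integral>\<omega>. G \<omega> \<partial>\<sigma>) has_vector_derivative 0) (at 0)" by simp
 ultimately have "(\<integral>\<omega>. ?h 0 \<omega> \<partial>\<sigma>) = 0" using vector_derivative_unique_at by blast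
 then show ?thesis by simp
qed

lemma C_upto_coord: "C_upto n S2 (\<lambda>\<omega>. complex_of_real (\<omega> $ j))"
 by (intro C_upto_of_C_on C_on_bounded_linear)
   (auto intro: bounded_linear_compose[OF bounded_linear_of_real bounded_linear_vec_nth])

lemma sphere_grad_coord:
 "\<omega> \<in> S2 \<Longrightarrow> sphere_grad (\<lambda>\<eta>. complex_of_real (\<eta> $ j)) \<omega> $ i = of_real ((if i = j then 1 else 0) - \<omega> $ i * \<omega> $ j)"
 by (subst sphere_grad_explicit[where f'="\<lambda>v. complex_of_real (v $ j)"])
   (auto intro!: bounded_linear_imp_has_derivative bounded_linear_compose[OF bounded_linear_of_real bounded_linear_vec_nth]
    simp: axis_def)

text \<open>The divergence theorem for constant fields: the tangential part of the \<open>i\<close>-th unit vector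
 has divergence \<open>- 2 \<omega>\<^sub>i\<close>. That tangential part is a combination of rotation fields with
 coefficients \<open>\<omega>\<^sub>j\<close>, so the claim is a sum over \<open>j\<close> of \<open>integral_sphere_rot_generator\<close> for \<open>\<omega>\<^sub>j
 G\<close>.\<close>

lemma integral_sphere_grad:
 assumes "C_upto 1 S2 G"
 shows "(\<integral>\<omega>. sphere_grad G \<omega> $ i \<partial>\<sigma>) = 2 * (\<integral>\<omega>. of_real (\<omega> $ i) * G \<omega> \<partial>\<sigma>)"
proof -
 have G1: "C_upto (Suc 0) S2 G" using assms by simp
 have contg: "continuous_on S2 (\<lambda>\<omega>. sphere_grad G \<omega> $ k)" for k
  using C_upto_imp_continuous[OF C_upto_sphere_grad[OF G1]] .
 have cont: "continuous_on S2 G" by (rule C_upto_imp_continuous[OF assms(1)])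
 let ?H = "\<lambda>j \<eta>. complex_of_real (\<eta> $ j) * G \<eta>"
 have H: "C_upto 1 S2 (?H j)" for j by (intro C_upto_mult C_upto_coord assms)
 have pt: "(\<Sum>j\<in>UNIV-{i}. \<Sum>k\<in>UNIV. (rot' i j 0 \<omega> $ k) *\<^sub>R sphere_grad (?H j) \<omega> $ k)
   = 2 * (of_real (\<omega> $ i) * G \<omega>) - sphere_grad G \<omega> $ i" if \<omega>: "\<omega> \<in> S2" for \<omega>
 proof -
  have h: "sphere_grad (?H j) \<omega> $ k = of_real ((if k = j then 1 else 0) - \<omega> $ k * \<omega> $ j) * G \<omega> + of_real (\<omega> $ j) * sphere_grad G \<omega> $ k" for j k
   using sphere_grad_mult[OF C_upto_coord G1 \<omega>] sphere_grad_coord[OF \<omega>] by simp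
  have r: "rot' i j 0 \<omega> $ k = (if k = i then - \<omega> $ j else if k = j then \<omega> $ i else 0)" if "j \<noteq> i" for j k
   using that by (auto simp: rot'_def axis_def)
  have s: "(\<Sum>k\<in>UNIV. (rot' i j 0 \<omega> $ k) *\<^sub>R sphere_grad (?H j) \<omega> $ k)
    = of_real (\<omega> $ i) * sphere_grad (?H j) \<omega> $ j - of_real (\<omega> $ j) * sphere_grad (?H j) \<omega> $ i" if "j \<noteq> i" for j
  proof -
   have "(\<Sum>k\<in>UNIV. (rot' i j 0 \<omega> $ k) *\<^sub>R sphere_grad (?H j) \<omega> $ k)
    = (\<Sum>k\<in>{i,j}. (rot' i j 0 \<omega> $ k) *\<^sub>R sphere_grad (?H j) \<omega> $ k)"
    using r[OF that] by (intro sum.mono_neutral_right) auto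
   also have "\<dots> = of_real (\<omega> $ i) * sphere_grad (?H j) \<omega> $ j - of_real (\<omega> $ j) * sphere_grad (?H j) \<omega> $ i"
    using that by (simp add: r[OF that] scaleR_conv_of_real)
   finally show ?thesis .
  qed
  have sq: "(\<Sum>j\<in>UNIV-{i}. (\<omega> $ j)\<^sup>2) = 1 - (\<omega> $ i)\<^sup>2"
  proof -
   have "(\<Sum>j\<in>UNIV. (\<omega> $ j)\<^sup>2) = 1" using \<omega> by (simp add: norm_vec_def L2_set_def)
   then show ?thesis by (simp add: sum_diff1)
  qed
  have rad: "(\<Sum>j\<in>UNIV-{i}. of_real (\<omega> $ j) * sphere_grad G \<omega> $ j) = - of_real (\<omega> $ i) * sphere_grad G \<omega> $ i"
   using sphere_grad_radial[OF G1 \<omega>] by (simp add: sum_diff1 scaleR_conv_of_real)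
  have c2: "(\<Sum>j\<in>UNIV-{i}. 1::complex) = 2" by (simp add: card_Diff_singleton)
  have "(\<Sum>j\<in>UNIV-{i}. \<Sum>k\<in>UNIV. (rot' i j 0 \<omega> $ k) *\<^sub>R sphere_grad (?H j) \<omega> $ k)
    = (\<Sum>j\<in>UNIV-{i}. of_real (\<omega> $ i) * G \<omega> * 1 + of_real (\<omega> $ i) * (of_real (\<omega> $ j) * sphere_grad G \<omega> $ j)
      - of_real ((\<omega> $ j)\<^sup>2) * sphere_grad G \<omega> $ i)"
  proof (rule sum.cong[OF refl])
   fix j assume "j \<in> UNIV - {i}"
   then have ji: "j \<noteq> i" "i \<noteq> j" by auto
   show "(\<Sum>k\<in>UNIV. (rot' i j 0 \<omega> $ k) *\<^sub>R sphere_grad (?H j) \<omega> $ k) = of_real (\<omega> $ i) * G \<omega> * 1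
     + of_real (\<omega> $ i) * (of_real (\<omega> $ j) * sphere_grad G \<omega> $ j) - of_real ((\<omega> $ j)\<^sup>2) * sphere_grad G \<omega> $ i"
    by (subst s[OF ji(1)], simp only: h) (use ji in \<open>simp add: power2_eq_square algebra_simps\<close>)
  qed
  also have "\<dots> = of_real (\<omega> $ i) * G \<omega> * 2 + of_real (\<omega> $ i) * (- of_real (\<omega> $ i) * sphere_grad G \<omega> $ i)
      - of_real (1 - (\<omega> $ i)\<^sup>2) * sphere_grad G \<omega> $ i"
   by (simp only: sum.distrib sum_subtractf sum_distrib_left[symmetric] sum_distrib_right[symmetric] rad c2 of_real_sum[symmetric] sq)
  also have "\<dots> = 2 * (of_real (\<omega> $ i) * G \<omega>) - sphere_grad G \<omega> $ i"
   by (simp add: power2_eq_square algebra_simps)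
  finally show ?thesis .
 qed
 have int: "integrable sphere_measure (\<lambda>\<omega>. \<Sum>k\<in>UNIV. (rot' i j 0 \<omega> $ k) *\<^sub>R sphere_grad (?H j) \<omega> $ k)" for j
 proof -
  have "continuous_on S2 (\<lambda>\<omega>. sphere_grad (?H j) \<omega> $ k)" for k
   using C_upto_imp_continuous[OF C_upto_sphere_grad, of 0 "?H j"] H[of j] by simp
  moreover have "continuous_on S2 (\<lambda>\<omega>. rot' i j 0 \<omega> $ k)" for k unfolding rot'_def by (intro continuous_intros)
  ultimately show ?thesis by (intro integrable_sphere continuous_on_sum continuous_on_scaleR)
 qed
 have "0 = (\<Sum>j\<in>UNIV-{i}. \<integral>\<omega>. (\<Sum>k\<in>UNIV. (rot' i j 0 \<omega> $ k) *\<^sub>R sphere_grad (?H j) \<omega> $ k) \<partial>\<sigma>)"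
  using integral_sphere_rot_generator[OF H] by (intro sum.neutral[symmetric]) auto
 also have "\<dots> = (\<integral>\<omega>. (\<Sum>j\<in>UNIV-{i}. \<Sum>k\<in>UNIV. (rot' i j 0 \<omega> $ k) *\<^sub>R sphere_grad (?H j) \<omega> $ k) \<partial>\<sigma>)"
  by (rule Bochner_Integration.integral_sum[symmetric]) (rule int)
 also have "\<dots> = (\<integral>\<omega>. 2 * (of_real (\<omega> $ i) * G \<omega>) - sphere_grad G \<omega> $ i \<partial>\<sigma>)"
  by (rule Bochner_Integration.integral_cong) (auto simp: pt)
 also have "\<dots> = 2 * (\<integral>\<omega>. of_real (\<omega> $ i) * G \<omega> \<partial>\<sigma>) - (\<integral>\<omega>. sphere_grad G \<omega> $ i \<partial>\<sigma>)"
 proof -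
  have "integrable sphere_measure (\<lambda>\<omega>. of_real (\<omega> $ i) * G \<omega>)" "integrable sphere_measure (\<lambda>\<omega>. sphere_grad G \<omega> $ i)"
   by (intro integrable_sphere continuous_intros cont contg)+
  then show ?thesis by simp
 qed
 finally show ?thesis by simp
qed

text \<open>Apply \<open>integral_sphere_grad\<close> to the products \<open>(\<nabla>f)\<^sub>i g\<close> and sum over \<open>i\<close>; the right hand
 sides cancel as the gradient is tangential.\<close>

lemma sphere_green:
 assumes "C_upto 2 S2 f" "C_upto 1 S2 g"
 shows "(\<integral>\<omega>. sphere_lap f \<omega> * g \<omega> \<partial>\<sigma>)
   = - (\<integral>\<omega>. (\<Sum>i\<in>UNIV. sphere_grad f \<omega> $ i * sphere_grad g \<omega> $ i) \<partial>\<sigma>)"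
proof -
 have f2: "C_upto (Suc 1) S2 f" "C_upto (Suc 0) S2 f" and g1: "C_upto (Suc 0) S2 g"
  using assms C_upto_mono[of 1 2] by (simp_all add: numeral_2_eq_2)
 note fi = C_upto_sphere_grad[OF f2(1)]
 have fi1: "C_upto (Suc 0) S2 (\<lambda>\<omega>. sphere_grad f \<omega> $ i)" for i using fi by simp
 have c: "continuous_on S2 g" "continuous_on S2 (\<lambda>\<omega>. sphere_grad f \<omega> $ i)"
   "continuous_on S2 (\<lambda>\<omega>. sphere_grad g \<omega> $ i)" "continuous_on S2 (\<lambda>\<omega>. sphere_grad (\<lambda>\<eta>. sphere_grad f \<eta> $ i) \<omega> $ i)" for i
  using C_upto_imp_continuous[OF assms(2)] C_upto_imp_continuous[OF fi]
   C_upto_imp_continuous[OF C_upto_sphere_grad[OF g1]] C_upto_imp_continuous[OF C_upto_sphere_grad[OF fi1]] by auto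
 have "(\<integral>\<omega>. sphere_lap f \<omega> * g \<omega> \<partial>\<sigma>) + (\<integral>\<omega>. (\<Sum>i\<in>UNIV. sphere_grad f \<omega> $ i * sphere_grad g \<omega> $ i) \<partial>\<sigma>)
   = (\<integral>\<omega>. sphere_lap f \<omega> * g \<omega> + (\<Sum>i\<in>UNIV. sphere_grad f \<omega> $ i * sphere_grad g \<omega> $ i) \<partial>\<sigma>)"
  unfolding sphere_lap_def
  by (intro Bochner_Integration.integral_add[symmetric] integrable_sphere continuous_on_mult continuous_on_sum c)
 also have "\<dots> = (\<integral>\<omega>. (\<Sum>i\<in>UNIV. sphere_grad (\<lambda>\<eta>. sphere_grad f \<eta> $ i * g \<eta>) \<omega> $ i) \<partial>\<sigma>)"
  by (rule Bochner_Integration.integral_cong)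
    (simp_all add: sphere_lap_def sphere_grad_mult[OF fi1 g1] sum.distrib sum_distrib_right)
 also have "\<dots> = (\<Sum>i\<in>UNIV. \<integral>\<omega>. sphere_grad (\<lambda>\<eta>. sphere_grad f \<eta> $ i * g \<eta>) \<omega> $ i \<partial>\<sigma>)"
 proof (rule Bochner_Integration.integral_sum, rule integrable_sphere)
  fix i :: 3
  have "C_upto (Suc 0) S2 (\<lambda>\<eta>. sphere_grad f \<eta> $ i * g \<eta>)" by (intro C_upto_mult fi1 g1)
  from C_upto_imp_continuous[OF C_upto_sphere_grad[OF this]]
  show "continuous_on S2 (\<lambda>\<omega>. sphere_grad (\<lambda>\<eta>. sphere_grad f \<eta> $ i * g \<eta>) \<omega> $ i)" .
 qed
 also have "\<dots> = (\<Sum>i\<in>UNIV. 2 * (\<integral>\<omega>. of_real (\<omega> $ i) * (sphere_grad f \<omega> $ i * g \<omega>) \<partial>\<sigma>))"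
  by (intro sum.cong integral_sphere_grad C_upto_mult fi assms refl)
 also have "\<dots> = 2 * (\<integral>\<omega>. (\<Sum>i\<in>UNIV. of_real (\<omega> $ i) * (sphere_grad f \<omega> $ i * g \<omega>)) \<partial>\<sigma>)"
  unfolding sum_distrib_left[symmetric]
  by (subst Bochner_Integration.integral_sum)
    (auto intro!: integrable_sphere continuous_on_mult continuous_on_of_real continuous_on_component continuous_on_id c)
 also have "\<dots> = 2 * (\<integral>\<omega>. 0 \<partial>\<sigma>)"
 proof -
  have "(\<Sum>i\<in>UNIV. of_real (\<omega> $ i) * (sphere_grad f \<omega> $ i * g \<omega>)) = 0" if "\<omega> \<in> S2" for \<omega>
   using sphere_grad_radial[OF f2(2) that]
   by (simp add: scaleR_conv_of_real mult.assoc[symmetric] sum_distrib_right[symmetric])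
  then have "(\<integral>\<omega>. (\<Sum>i\<in>UNIV. of_real (\<omega> $ i) * (sphere_grad f \<omega> $ i * g \<omega>)) \<partial>\<sigma>) = (\<integral>\<omega>. 0 \<partial>\<sigma>)"
   by (intro Bochner_Integration.integral_cong) auto
  then show ?thesis by simp
 qed
 finally show ?thesis by (simp add: eq_neg_iff_add_eq_0)
qed

section \<open>The spherical harmonics of highest weight\<close>

definition zc :: "real^3 \<Rightarrow> complex" where "zc \<omega> = of_real (\<omega> $ 1) + \<i> * of_real (\<omega> $ 2)"

text \<open>The powers \<open>(\<omega>\<^sub>1 + \<i> \<omega>\<^sub>2)\<^sup>l\<close> are restrictions of harmonic homogeneous polynomials, hence
 spherical harmonics of degree \<open>l\<close>, with an explicit formula.\<close>

definition sph_harm :: "nat \<Rightarrow> real^3 \<Rightarrow> complex" where "sph_harm l \<omega> = zc \<omega> ^ l"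

text \<open>The gradient of \<open>zc\<close>; its bilinear square is zero, which is why all powers of \<open>zc\<close> are
 harmonic.\<close>

definition nullvec :: "3 \<Rightarrow> complex" where "nullvec i = (if i = 1 then 1 else if i = 2 then \<i> else 0)"

lemma zc_linear: "bounded_linear zc"
 unfolding zc_def[abs_def]
 by (intro bounded_linear_add bounded_linear_compose[OF bounded_linear_mult_right]
   bounded_linear_compose[OF bounded_linear_of_real bounded_linear_vec_nth])

lemma zc_axis: "zc (axis i 1) = nullvec i"
 using exhaust_3[of i] by (auto simp: zc_def nullvec_def axis_def)

lemma zc_scaleR: "zc (r *\<^sub>R y) = of_real r * zc y" and zc_diff: "zc (x - y) = zc x - zc y"
 by (simp_all add: zc_def algebra_simps)

lemma zc_has_derivative: "(zc has_derivative zc) (at \<omega>)"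
 by (rule bounded_linear_imp_has_derivative[OF zc_linear])

lemma C_upto_harm: "C_upto n D (sph_harm l)"
 unfolding sph_harm_def[abs_def] by (intro C_upto_of_C_on C_on_power C_on_bounded_linear zc_linear) auto

lemma sphere_grad_harm:
 assumes "\<omega> \<in> S2"
 shows "sphere_grad (sph_harm l) \<omega> $ i = of_nat l * zc \<omega> ^ (l - 1) * (nullvec i - of_real (\<omega> $ i) * zc \<omega>)"
proof -
 have "(sph_harm l has_derivative (\<lambda>v. of_nat l * zc v * zc \<omega> ^ (l - 1))) (at \<omega>)"
  unfolding sph_harm_def[abs_def] by (rule has_derivative_power[OF zc_has_derivative])
 from sphere_grad_explicit[OF this] assms show ?thesis by (simp add: zc_diff zc_scaleR zc_axis)
qed

lemma sphere_lap_harm: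
 assumes "\<omega> \<in> S2" "l \<ge> 2"
 shows "sphere_lap (sph_harm l) \<omega> = - of_nat (l * (l + 1)) * sph_harm l \<omega>"
proof -
 obtain n where n: "l = Suc (Suc n)" using assms(2) by (metis add_2_eq_Suc le_Suc_ex)
 define z where "z = zc \<omega>"
 have D: "((\<lambda>\<eta>. of_nat l * zc \<eta> ^ (l - 1) * (nullvec i - of_real (\<eta> $ i) * zc \<eta>)) has_derivative
   (\<lambda>v. of_nat l * (of_nat (l - 1) * zc v * z ^ n) * (nullvec i - of_real (\<omega> $ i) * z)
    - of_nat l * z ^ (l - 1) * (of_real (v $ i) * z + of_real (\<omega> $ i) * zc v))) (at \<omega>)" for i
  unfolding z_def n
  by (auto intro!: derivative_eq_intros zc_has_derivative bounded_linear_imp_has_derivative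
     bounded_linear_compose[OF bounded_linear_of_real bounded_linear_vec_nth] simp: algebra_simps simp del: of_nat_Suc power_Suc)
 have gg: "sphere_grad (\<lambda>\<eta>. sphere_grad (sph_harm l) \<eta> $ i) \<omega> $ i =
   of_nat l * (of_nat (l - 1) * (nullvec i - of_real (\<omega> $ i) * z) * z ^ n) * (nullvec i - of_real (\<omega> $ i) * z)
    - of_nat l * z ^ (l - 1) * (of_real (1 - (\<omega> $ i)\<^sup>2) * z + of_real (\<omega> $ i) * (nullvec i - of_real (\<omega> $ i) * z))" for i
 proof -
  have "sphere_grad (\<lambda>\<eta>. sphere_grad (sph_harm l) \<eta> $ i) \<omega> $ i
    = sphere_grad (\<lambda>\<eta>. of_nat l * zc \<eta> ^ (l - 1) * (nullvec i - of_real (\<eta> $ i) * zc \<eta>)) \<omega> $ i"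
   using sphere_grad_cong[of "\<lambda>\<eta>. sphere_grad (sph_harm l) \<eta> $ i", OF sphere_grad_harm assms(1)] by simp
  then show ?thesis
   using sphere_grad_explicit[OF D, of i i] assms
   by (simp add: zc_diff zc_scaleR zc_axis z_def power2_eq_square)
 qed
 have e: "z = of_real (\<omega> $ 1) + \<i> * of_real (\<omega> $ 2)" by (simp add: z_def zc_def)
 have "(\<omega> $ 1)\<^sup>2 + (\<omega> $ 2)\<^sup>2 + (\<omega> $ 3)\<^sup>2 = 1"
  using assms(1) by (simp add: norm_vec_def L2_set_def sum_3)
 then have sq: "complex_of_real ((\<omega> $ 3)\<^sup>2) = 1 - of_real ((\<omega> $ 1)\<^sup>2) - of_real ((\<omega> $ 2)\<^sup>2)"
  by (metis add.commute add_diff_cancel_left' diff_diff_add of_real_1 of_real_diff)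
 have s1: "(\<Sum>i\<in>UNIV. (nullvec i - of_real (\<omega> $ i) * z) * (nullvec i - of_real (\<omega> $ i) * z)) = - (z\<^sup>2)"
 proof -
  have "(\<Sum>i\<in>UNIV. (nullvec i - of_real (\<omega> $ i) * z) * (nullvec i - of_real (\<omega> $ i) * z))
    = - 2 * z * (of_real (\<omega> $ 1) + \<i> * of_real (\<omega> $ 2)) + z\<^sup>2 * (of_real ((\<omega> $ 1)\<^sup>2) + of_real ((\<omega> $ 2)\<^sup>2) + of_real ((\<omega> $ 3)\<^sup>2))"
   by (simp add: sum_3 nullvec_def power2_eq_square algebra_simps)
  also have "\<dots> = - (z\<^sup>2)" unfolding e[symmetric] sq by (simp add: power2_eq_square algebra_simps)
  finally show ?thesis .
 qed
 have s2: "(\<Sum>i\<in>UNIV. of_real (1 - (\<omega> $ i)\<^sup>2) * z + of_real (\<omega> $ i) * (nullvec i - of_real (\<omega> $ i) * z)) = 2 * z"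
 proof -
  have "(\<Sum>i\<in>UNIV. of_real (1 - (\<omega> $ i)\<^sup>2) * z + of_real (\<omega> $ i) * (nullvec i - of_real (\<omega> $ i) * z))
    = 3 * z + (of_real (\<omega> $ 1) + \<i> * of_real (\<omega> $ 2)) - 2 * z * (of_real ((\<omega> $ 1)\<^sup>2) + of_real ((\<omega> $ 2)\<^sup>2) + of_real ((\<omega> $ 3)\<^sup>2))"
   by (simp add: sum_3 nullvec_def power2_eq_square algebra_simps)
  also have "\<dots> = 2 * z" unfolding e[symmetric] sq by (simp add: algebra_simps)
  finally show ?thesis .
 qed
 have "sphere_lap (sph_harm l) \<omega> = of_nat l * of_nat (l - 1) * z ^ n * (\<Sum>i\<in>UNIV. (nullvec i - of_real (\<omega> $ i) * z) * (nullvec i - of_real (\<omega> $ i) * z))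
   - of_nat l * z ^ (l - 1) * (\<Sum>i\<in>UNIV. of_real (1 - (\<omega> $ i)\<^sup>2) * z + of_real (\<omega> $ i) * (nullvec i - of_real (\<omega> $ i) * z))"
  unfolding sphere_lap_def gg sum_subtractf sum_distrib_left
  by (intro arg_cong2[where f="(-)"] sum.cong) (auto simp: algebra_simps)
 also have "\<dots> = - of_nat (l * (l + 1)) * z ^ l"
  unfolding s1 s2 n by (simp add: power2_eq_square algebra_simps)
 finally show ?thesis by (simp add: sph_harm_def z_def)
qed

lemma C_upto_cnj: "C_upto n D f \<Longrightarrow> C_upto n D (\<lambda>\<omega>. cnj (f \<omega>))"
 unfolding C_upto_def using C_on_linear_comp[OF _ bounded_linear_cnj] by metis

lemma sphere_grad_cnj:
 assumes "C_upto (Suc n) S2 f" "\<omega> \<in> S2"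
 shows "sphere_grad (\<lambda>\<eta>. cnj (f \<eta>)) \<omega> $ i = cnj (sphere_grad f \<omega> $ i)"
 using sphere_grad_eqI[OF bounded_linear.has_derivative[OF bounded_linear_cnj sphere_grad_derivative[OF assms]], of i]
 by (simp add: axis_def if_distrib[of "\<lambda>x. x *\<^sub>R _"] if_distrib[of cnj] sum.delta cong: if_cong)

lemma sphere_lap_cnj:
 assumes "C_upto 2 S2 f" "\<omega> \<in> S2"
 shows "sphere_lap (\<lambda>\<eta>. cnj (f \<eta>)) \<omega> = cnj (sphere_lap f \<omega>)"
proof -
 have f: "C_upto (Suc 1) S2 f" using assms by (simp add: numeral_2_eq_2)
 have g: "C_upto (Suc 0) S2 (\<lambda>\<eta>. sphere_grad f \<eta> $ i)" for i using C_upto_sphere_grad[OF f] by simp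
 have "sphere_grad (\<lambda>\<eta>. sphere_grad (\<lambda>\<zeta>. cnj (f \<zeta>)) \<eta> $ i) \<omega> = sphere_grad (\<lambda>\<eta>. cnj (sphere_grad f \<eta> $ i)) \<omega>" for i
  by (rule sphere_grad_cong[OF sphere_grad_cnj[OF f] assms(2)])
 then show ?thesis by (simp add: sphere_lap_def sphere_grad_cnj[OF g assms(2)])
qed

lemma sphere_green_eigen:
 assumes "C_upto 2 S2 f" "C_upto 2 S2 Y" "\<And>\<omega>. \<omega> \<in> S2 \<Longrightarrow> sphere_lap Y \<omega> = c * Y \<omega>"
 shows "(\<integral>\<omega>. sphere_lap f \<omega> * Y \<omega> \<partial>\<sigma>) = c * (\<integral>\<omega>. f \<omega> * Y \<omega> \<partial>\<sigma>)"
proof -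
 have 1: "C_upto 1 S2 f" "C_upto 1 S2 Y" using assms C_upto_mono[of 1 2] by auto
 have "(\<integral>\<omega>. sphere_lap f \<omega> * Y \<omega> \<partial>\<sigma>) = (\<integral>\<omega>. sphere_lap Y \<omega> * f \<omega> \<partial>\<sigma>)"
  unfolding sphere_green[OF assms(1) 1(2)] sphere_green[OF assms(2) 1(1)] by (simp add: mult.commute)
 also have "\<dots> = (\<integral>\<omega>. c * (f \<omega> * Y \<omega>) \<partial>\<sigma>)"
  by (rule Bochner_Integration.integral_cong) (auto simp: assms(3))
 finally show ?thesis by simp
qed

lemma integral_norm_grad_harm:
 assumes "l \<ge> 2"
 shows "(\<integral>\<omega>. (norm (sphere_grad (sph_harm l) \<omega>))\<^sup>2 \<partial>\<sigma>)
  = real (l * (l + 1)) * (\<integral>\<omega>. (norm (sph_harm l \<omega>))\<^sup>2 \<partial>\<sigma>)"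
proof -
 have n: "complex_of_real ((norm z)\<^sup>2) = z * cnj z" for z by (metis complex_norm_square of_real_power)
 have "complex_of_real (\<integral>\<omega>. (norm (sphere_grad (sph_harm l) \<omega>))\<^sup>2 \<partial>\<sigma>) =
  (\<integral>\<omega>. of_real ((norm (sphere_grad (sph_harm l) \<omega>))\<^sup>2) \<partial>\<sigma>)" by (rule integral_complex_of_real[symmetric])
 also have "\<dots> = (\<integral>\<omega>. (\<Sum>i\<in>UNIV. sphere_grad (sph_harm l) \<omega> $ i * sphere_grad (\<lambda>\<eta>. cnj (sph_harm l \<eta>)) \<omega> $ i) \<partial>\<sigma>)"
  by (rule Bochner_Integration.integral_cong)
    (auto simp: sphere_grad_cnj[OF C_upto_harm] norm_vec_def L2_set_def sum_nonneg n[unfolded of_real_power])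
 also have "\<dots> = - (\<integral>\<omega>. sphere_lap (sph_harm l) \<omega> * cnj (sph_harm l \<omega>) \<partial>\<sigma>)"
  by (subst sphere_green) (auto intro: C_upto_harm C_upto_cnj)
 also have "\<dots> = - (\<integral>\<omega>. - of_nat (l * (l + 1)) * of_real ((norm (sph_harm l \<omega>))\<^sup>2) \<partial>\<sigma>)"
  by (intro arg_cong[where f=uminus] Bochner_Integration.integral_cong)
    (auto simp: sphere_lap_harm[OF _ assms] n[unfolded of_real_power])
 also have "\<dots> = of_real (real (l * (l + 1)) * (\<integral>\<omega>. (norm (sph_harm l \<omega>))\<^sup>2 \<partial>\<sigma>))"
  by (subst integral_mult_right_zero) (simp add: algebra_simps flip: of_real_power)
 finally show ?thesis using of_real_eq_iff by blast
qed

text \<open>Otherwise \<open>\<omega>\<^sub>1\<close> would vanish almost everywhere, by rotation every coordinate would, and the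
 area of the sphere would be zero.\<close>

lemma integral_harm_pos: "(\<integral>\<omega>. (norm (sph_harm l \<omega>))\<^sup>2 \<partial>\<sigma>) > 0"
proof (rule ccontr)
 assume "\<not> ?thesis"
 moreover have "(\<integral>\<omega>. (norm (sph_harm l \<omega>))\<^sup>2 \<partial>\<sigma>) \<ge> 0" by simp
 ultimately have z: "(\<integral>\<omega>. (norm (sph_harm l \<omega>))\<^sup>2 \<partial>\<sigma>) = 0" by linarith
 have c: "continuous_on S2 (sph_harm l)" by (rule C_upto_imp_continuous[OF C_upto_harm[of 0]])
 have ae0: "AE \<omega> in sphere_measure. (norm (sph_harm l \<omega>))\<^sup>2 = 0"
  by (rule integral_nonneg_eq_0_iff_AE[THEN iffD1, OF _ _ z]) (auto intro!: integrable_sphere continuous_intros c)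
 have re: "\<omega> $ 1 = Re (zc \<omega>)" for \<omega> by (simp add: zc_def)
 have ae: "AE \<omega> in sphere_measure. \<omega> $ 1 = 0"
  by (rule AE_mp[OF ae0 AE_I2]) (auto simp: sph_harm_def re)
 have sq: "(\<integral>\<omega>. (\<omega> $ j)\<^sup>2 \<partial>\<sigma>) = 0" for j :: 3
 proof (cases "j = 1")
  case True
  have "(\<integral>\<omega>. (\<omega> $ 1)\<^sup>2 \<partial>\<sigma>) = (\<integral>\<omega>. 0 \<partial>\<sigma>)"
   by (rule integral_cong_AE) (auto intro!: measurable_continuous_sphere continuous_intros AE_mp[OF ae AE_I2])
  then show ?thesis using True by simp
 next
  case False
  then have "(\<integral>\<omega>. (rot j 1 (pi / 2) \<omega> $ 1)\<^sup>2 \<partial>\<sigma>) = (\<integral>\<omega>. (\<omega> $ 1)\<^sup>2 \<partial>\<sigma>)"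
   by (intro integral_sphere_orthogonal orthogonal_rot measurable_continuous_sphere continuous_intros)
  moreover have "(\<integral>\<omega>. (\<omega> $ 1)\<^sup>2 \<partial>\<sigma>) = (\<integral>\<omega>. 0 \<partial>\<sigma>)"
   by (rule integral_cong_AE) (auto intro!: measurable_continuous_sphere continuous_intros AE_mp[OF ae AE_I2])
  ultimately show ?thesis using False by (simp add: rot_def axis_def)
 qed
 have "(\<integral>\<omega>. 1 \<partial>\<sigma>) = (\<integral>\<omega>. (\<Sum>j\<in>UNIV. (\<omega> $ j)\<^sup>2) \<partial>\<sigma>)"
  by (rule Bochner_Integration.integral_cong) (auto simp: norm_vec_def L2_set_def)
 also have "\<dots> = 0"
  by (subst Bochner_Integration.integral_sum) (auto intro!: integrable_sphere continuous_intros simp: sq)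
 finally show False by (simp add: measure_def emeasure_sphere_measure)
qed

section \<open>A smooth step\<close>

text \<open>The functions \<open>exp (- 1/x) / x\<^sup>k\<close>, extended by zero. The family is closed under
 differentiation, so each member is smooth.\<close>

definition flat :: "nat \<Rightarrow> real \<Rightarrow> real" where
 "flat k x = (if x > 0 then exp (- 1 / x) / x ^ k else 0)"

lemma exp_ge_monomial:
 fixes y :: real assumes "y \<ge> 0" shows "y ^ n / fact n \<le> exp y"
proof -
 have "(\<Sum>k\<in>{n}. inverse (fact k) * y ^ k) \<le> (\<Sum>k. inverse (fact k) * y ^ k)"
  using assms by (intro sum_le_suminf summable_exp) auto
 then show ?thesis by (simp add: exp_def field_simps)
qed

lemma flat_bound: "\<bar>flat k x\<bar> \<le> fact (k + 2) * x\<^sup>2"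
proof (cases "x > 0")
 case True
 have "(1 / x) ^ (k + 2) / fact (k + 2) \<le> exp (1 / x)"
  using True by (intro exp_ge_monomial) simp
 moreover have "1 \<le> E * c * X" if "1 / X / c \<le> E" "X > 0" "c > 0" for E c X :: real
  using that by (simp add: field_simps)
 ultimately have "1 \<le> exp (1 / x) * fact (k + 2) * x ^ (k + 2)"
  using True by (simp only: power_one_over zero_less_power fact_gt_zero)
 then have "exp (- 1 / x) * 1 \<le> exp (- 1 / x) * (exp (1 / x) * fact (k + 2) * x ^ (k + 2))"
  by (intro mult_left_mono) auto
 also have "\<dots> = fact (k + 2) * x ^ (k + 2)"
  by (simp add: mult.assoc[symmetric] exp_add[symmetric])
 finally have "exp (- 1 / x) \<le> fact (k + 2) * x\<^sup>2 * x ^ k" by (simp add: power_add power2_eq_square mult_ac)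
 then have "exp (- 1 / x) / x ^ k \<le> fact (k + 2) * x\<^sup>2"
  using True by (subst pos_divide_le_eq) auto
 moreover have "0 \<le> exp (- 1 / x) / x ^ k" using True by simp
 ultimately show ?thesis using True by (simp add: flat_def)
qed (simp add: flat_def)

lemma flat_has_derivative:
 "DERIV (flat k) x :> flat (k + 2) x - of_nat k * flat (k + 1) x"
proof -
 consider "x > 0" | "x < 0" | "x = 0" by linarith
 then show ?thesis
 proof cases
  case 1
  have d1: "DERIV (\<lambda>x. - 1 / x) x :> 1 / x\<^sup>2"
   using DERIV_minus[OF DERIV_inverse[of x UNIV]] 1 by (simp add: divide_inverse power2_eq_square)
  have d3: "DERIV (\<lambda>x. x ^ k) x :> of_nat k * x ^ (k - 1)"
   using DERIV_pow[of k x UNIV] by simp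
  have "((\<lambda>x. exp (- 1 / x) / x ^ k) has_real_derivative
    (exp (- 1 / x) * (1 / x\<^sup>2) * x ^ k - exp (- 1 / x) * (of_nat k * x ^ (k - 1))) / (x ^ k * x ^ k)) (at x)"
   by (rule DERIV_divide[OF DERIV_chain2[OF DERIV_exp d1] d3]) (use 1 in simp)
  moreover have "(exp (- 1 / x) * (1 / x\<^sup>2) * x ^ k - exp (- 1 / x) * (of_nat k * x ^ (k - 1))) / (x ^ k * x ^ k)
    = flat (k + 2) x - of_nat k * flat (k + 1) x"
   using 1 by (cases k) (auto simp: flat_def power2_eq_square field_simps)
  ultimately have "DERIV (\<lambda>x. exp (- 1 / x) / x ^ k) x :> flat (k + 2) x - of_nat k * flat (k + 1) x"
   by simp
  then show ?thesis
   by (rule has_field_derivative_transform_within_open[where S="{0<..}"]) (use 1 in \<open>auto simp: flat_def\<close>)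
 next
  case 2
  have "DERIV (\<lambda>x. 0) x :> flat (k + 2) x - of_nat k * flat (k + 1) x"
   using 2 by (simp add: flat_def)
  then show ?thesis
   by (rule has_field_derivative_transform_within_open[where S="{..<0}"]) (use 2 in \<open>auto simp: flat_def\<close>)
 next
  case 3
  have "DERIV (flat k) 0 :> 0"
   unfolding has_field_derivative_def has_derivative_at_alt
  proof (intro conjI allI impI)
   fix e :: real assume e: "e > 0"
   show "\<exists>d>0. \<forall>y. norm (y - 0) < d \<longrightarrow> norm (flat k y - flat k 0 - 0 * (y - 0)) \<le> e * norm (y - 0)"
   proof (intro exI[of _ "e / fact (k + 2)"] conjI allI impI)
    fix y :: real assume y: "norm (y - 0) < e / fact (k + 2)"
    have "\<bar>flat k y\<bar> \<le> (fact (k + 2) * \<bar>y\<bar>) * \<bar>y\<bar>"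
     using flat_bound[of k y] by (simp add: power2_eq_square mult.assoc abs_mult_self_eq)
    also have "\<dots> \<le> e * \<bar>y\<bar>"
     using y by (intro mult_right_mono) (auto simp: less_divide_eq mult.commute)
    finally show "norm (flat k y - flat k 0 - 0 * (y - 0)) \<le> e * norm (y - 0)" by (simp add: flat_def)
   qed (use e in simp)
  qed (rule bounded_linear_mult_right)
  then show ?thesis using 3 by (simp add: flat_def)
 qed
qed

lemma C_on_flat: "C_on n UNIV (flat k)"
proof (induction n arbitrary: k)
 case 0
 show ?case using DERIV_isCont[OF flat_has_derivative] by (auto intro!: continuous_at_imp_continuous_on)
next
 case (Suc n)
 show ?case
  by (rule C_on_Suc_vector[OF open_UNIV])
    (auto intro!: flat_has_derivative[unfolded has_real_derivative_iff_has_vector_derivative] C_on_diff C_on_mult C_on_const Suc)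
qed

definition step :: "real \<Rightarrow> real" where
 "step x = flat 0 x / (flat 0 x + flat 0 (1 - x))"

lemma flat_nonneg: "flat k x \<ge> 0" by (simp add: flat_def)

lemma step_denominator_pos: "flat 0 x + flat 0 (1 - x) > 0"
 by (cases "x > 0") (auto simp: flat_def add_pos_nonneg)

lemma step_0 [simp]: "x \<le> 0 \<Longrightarrow> step x = 0" by (simp add: step_def flat_def)

lemma step_1 [simp]: "x \<ge> 1 \<Longrightarrow> step x = 1" by (simp add: step_def flat_def)

lemma step_range: "0 \<le> step x" "step x \<le> 1"
 using step_denominator_pos[of x] flat_nonneg[of 0 x] flat_nonneg[of 0 "1 - x"] by (auto simp: step_def)

lemma C_on_inverse:
 fixes f :: "'a::euclidean_space \<Rightarrow> real"
 assumes "open U" "\<And>x. x \<in> U \<Longrightarrow> f x > 0" "C_on n U f"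
 shows "C_on n U (\<lambda>x. 1 / f x)"
proof -
 have "C_on n U (\<lambda>x. f x powr (- 1))"
  by (rule C_on_compose[OF assms(1) _ assms(3) C_on_powr]) (use assms(2) in auto)
 then show ?thesis
 proof (rule C_on_cong[OF assms(1), rotated])
  fix x assume "x \<in> U"
  then show "f x powr (- 1) = 1 / f x" using assms(2)[of x] by (simp add: powr_minus_divide)
 qed
qed

lemma C_on_step: "C_on n UNIV step"
proof -
 have f: "C_on n UNIV (\<lambda>x. flat 0 (1 - x))"
  by (rule C_on_compose[where V=UNIV]) (auto intro!: C_on_diff C_on_const C_on_id C_on_flat)
 have "C_on n UNIV (\<lambda>x. flat 0 x * (1 / (flat 0 x + flat 0 (1 - x))))"
  by (intro C_on_mult C_on_inverse C_on_add C_on_flat f step_denominator_pos) auto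
 then show ?thesis by (simp add: step_def[abs_def])
qed

section \<open>The warping function and the potential\<close>

text \<open>The derivative of the warping function \<open>a\<close>.\<close>

definition warp1 :: "nat \<Rightarrow> real \<Rightarrow> real" where
 "warp1 m x = x ^ (2 * m - 1) * (x ^ (2 * m) + 1) powr (1 / real (2 * m) - 1)"

text \<open>The quotient \<open>a'' / a\<close>.\<close>

definition curv :: "nat \<Rightarrow> real \<Rightarrow> real" where
 "curv m x = real (2 * m - 1) * x ^ (2 * m - 2) * (x ^ (2 * m) + 1) powr (- 2)"

text \<open>The barrier \<open>1/a\<^sup>2\<close>, largest at the neck \<open>x = 0\<close>.\<close>

definition bar :: "nat \<Rightarrow> real \<Rightarrow> real" where
 "bar m x = (x ^ (2 * m) + 1) powr (- 2 / real (2 * m))"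

text \<open>The potential that the Laplacian induces on functions \<open>h(x) Y(\<omega>) / a(x)\<close> for an eigenvalue
 \<open>- L\<close> on the sphere.\<close>

definition pot :: "nat \<Rightarrow> real \<Rightarrow> real \<Rightarrow> real" where
 "pot m L x = curv m x + L * bar m x"

lemma warp_base_pos: "(x::real) ^ (2 * m) + 1 > 0"
proof -
 have "0 \<le> x ^ (2 * m)" by (rule zero_le_even_power) simp
 then show ?thesis by linarith
qed

lemma warp_pos [simp]: "warp m x > 0"
 using warp_base_pos[of x m] by (simp add: warp_def)

lemma warp_nonzero [simp]: "warp m x \<noteq> 0" using warp_pos[of m x] by linarith

lemma C_on_warp_base: "C_on n UNIV (\<lambda>x. ((x::real) ^ (2 * m) + 1) powr s)"
 by (rule C_on_compose[where V="{0<..}" and f="\<lambda>x. x ^ (2 * m) + 1"])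
   (auto intro!: C_on_add C_on_power C_on_id C_on_const C_on_powr simp: warp_base_pos)

lemma C_on_warp: "C_on n UNIV (warp m)"
 using C_on_warp_base by (simp add: warp_def[abs_def])

lemma C_on_bar: "C_on n UNIV (bar m)"
 using C_on_warp_base by (simp add: bar_def[abs_def])

lemma C_on_curv: "C_on n UNIV (curv m)"
 unfolding curv_def[abs_def] by (intro C_on_mult C_on_const C_on_power C_on_id C_on_warp_base) auto

lemma C_on_pot: "C_on n UNIV (pot m L)"
 unfolding pot_def[abs_def] by (intro C_on_add C_on_mult C_on_const C_on_curv C_on_bar) auto

lemma bar_warp: "m \<ge> 1 \<Longrightarrow> bar m x = 1 / (warp m x)\<^sup>2"
 using warp_base_pos[of x m]
 by (simp add: bar_def warp_def powr_minus_divide powr_power)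

lemma DERIV_warp_base: "DERIV (\<lambda>x. x ^ (2 * m) + 1) x :> real (2 * m) * x ^ (2 * m - 1)"
 using DERIV_add[OF DERIV_pow[of "2 * m" x UNIV] DERIV_const[of 1]] by simp

lemma DERIV_warp:
 assumes "m \<ge> 1"
 shows "DERIV (warp m) x :> warp1 m x"
proof -
 have "((\<lambda>x. (x ^ (2 * m) + 1) powr (1 / real (2 * m))) has_real_derivative
   (1 / real (2 * m)) * (x ^ (2 * m) + 1) powr (1 / real (2 * m) - 1) * (real (2 * m) * x ^ (2 * m - 1))) (at x)"
  by (rule DERIV_chain2[OF has_real_derivative_powr[OF warp_base_pos] DERIV_warp_base])
 then show ?thesis using assms by (simp add: warp_def[abs_def] warp1_def mult.commute)
qed

lemma DERIV_warp1:
 assumes "m \<ge> 1"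
 shows "DERIV (warp1 m) x :> curv m x * warp m x"
proof -
 define q where "q = x ^ (2 * m) + 1"
 define s where "s = 1 / real (2 * m)"
 have q: "q > 0" using warp_base_pos by (simp add: q_def)
 have "((\<lambda>x. x ^ (2 * m - 1) * (x ^ (2 * m) + 1) powr (s - 1)) has_real_derivative
   real (2 * m - 1) * x ^ (2 * m - 1 - 1) * q powr (s - 1) + ((s - 1) * q powr (s - 1 - 1) * (real (2 * m) * x ^ (2 * m - 1))) * x ^ (2 * m - 1)) (at x)"
  unfolding q_def using DERIV_mult[OF DERIV_pow[of "2 * m - 1" x UNIV] DERIV_chain2[OF has_real_derivative_powr[OF warp_base_pos, where r="s - 1"] DERIV_warp_base]]
  by (simp add: add.commute)
 moreover have "real (2 * m - 1) * x ^ (2 * m - 1 - 1) * q powr (s - 1) + ((s - 1) * q powr (s - 1 - 1) * (real (2 * m) * x ^ (2 * m - 1))) * x ^ (2 * m - 1)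
   = curv m x * warp m x"
 proof -
  obtain n where n: "m = Suc n" using assms by (cases m) auto
  have p1: "q powr (s - 1) = q * q powr (s - 2)"
   using q powr_mult_base[of q "s - 2"] by simp
  have p2: "q powr (- 2) * q powr s = q powr (s - 2)" by (simp add: powr_add[symmetric])
  have k: "(s - 1) * real (2 * m) = - real (2 * m - 1)" using assms by (simp add: s_def field_simps of_nat_diff)
  have f1: "((s - 1) * q powr (s - 1 - 1) * (real (2 * m) * x ^ (2 * m - 1))) * x ^ (2 * m - 1)
    = - real (2 * m - 1) * q powr (s - 2) * (x ^ (2 * m - 1) * x ^ (2 * m - 1))"
   unfolding k[symmetric] by simp
  have f2: "x ^ (2 * m - 1) * x ^ (2 * m - 1) = x ^ (2 * m - 2) * x ^ (2 * m)"
   by (simp add: n power_add[symmetric])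
  have f3: "curv m x * warp m x = real (2 * m - 1) * x ^ (2 * m - 2) * q powr (s - 2)"
   unfolding curv_def warp_def q_def[symmetric] s_def[symmetric] p2[symmetric] by simp
  have e0: "x ^ (2 * m - 1 - 1) = x ^ (2 * m - 2)" by (simp add: n)
  have alg: "N * X * ((y + 1) * P) + - N * P * (X * y) = N * X * P" for N X y P :: real by algebra
  show ?thesis unfolding f1 f2 f3 e0 p1
   using alg[of "real (2 * m - 1)" "x ^ (2 * m - 2)" "x ^ (2 * m)" "q powr (s - 2)"] by (simp only: q_def)
 qed
 ultimately show ?thesis by (simp add: warp1_def[abs_def] s_def)
qed

lemma curv_nonneg: "curv m x \<ge> 0"
proof -
 have "x ^ (2 * m - 2) \<ge> 0" by (rule zero_le_even_power) simp
 then show ?thesis by (simp add: curv_def)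
qed

lemma curv_le:
 assumes "m \<ge> 1" shows "curv m x \<le> real (2 * m - 1)"
proof -
 define q where "q = x ^ (2 * m) + 1"
 have q: "q \<ge> 1" by (simp add: q_def)
 have "x ^ (2 * m - 2) \<le> q\<^sup>2"
 proof (cases "\<bar>x\<bar> \<le> 1")
  case True
  then have "\<bar>x\<bar> ^ (2 * m - 2) \<le> 1" by (intro power_le_one) auto
  moreover have "x ^ (2 * m - 2) = \<bar>x\<bar> ^ (2 * m - 2)" by (simp add: power_even_abs)
  moreover have "1 \<le> q\<^sup>2" using q by (simp add: one_le_power)
  ultimately show ?thesis by linarith
 next
  case False
  then have "\<bar>x\<bar> ^ (2 * m - 2) \<le> \<bar>x\<bar> ^ (2 * m)" by (intro power_increasing) auto
  moreover have "x ^ (2 * m - 2) = \<bar>x\<bar> ^ (2 * m - 2)" "\<bar>x\<bar> ^ (2 * m) = x ^ (2 * m)" by (simp_all add: power_even_abs)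
  moreover have "q \<le> q\<^sup>2" using q by (simp add: power2_eq_square)
  ultimately show ?thesis by (simp add: q_def)
 qed
 then have "x ^ (2 * m - 2) * q powr (- 2) \<le> 1"
  using q by (simp add: powr_minus_divide powr_numeral)
 then have "real (2 * m - 1) * (x ^ (2 * m - 2) * q powr (- 2)) \<le> real (2 * m - 1) * 1"
  by (intro mult_left_mono) auto
 then show ?thesis by (simp add: curv_def q_def mult.assoc)
qed

lemma bar_pos: "bar m x > 0" using warp_base_pos[of x m] by (simp add: bar_def)

lemma bar_le_1: "bar m x \<le> 1"
proof -
 have "0 \<le> x ^ (2 * m)" by (rule zero_le_even_power) simp
 then have "(x ^ (2 * m) + 1) powr (- 2 / real (2 * m)) \<le> (x ^ (2 * m) + 1) powr 0"
  by (intro powr_mono) auto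
 then show ?thesis using warp_base_pos[of x m] by (simp add: bar_def)
qed

lemma bar_strict_mono:
 assumes "m \<ge> 1" "x < y" "y \<le> 0" shows "bar m x < bar m y"
proof -
 have "\<bar>y\<bar> ^ (2 * m) < \<bar>x\<bar> ^ (2 * m)" using assms by (intro power_strict_mono) auto
 then have "y ^ (2 * m) + 1 < x ^ (2 * m) + 1" by (simp add: power_even_abs)
 then show ?thesis unfolding bar_def using assms(1) warp_base_pos[of y m]
  by (intro powr_less_mono2_neg) auto
qed

section \<open>Trapped modes\<close>

text \<open>A Gronwall argument for \<open>f\<^sup>2 + f'\<^sup>2\<close>.\<close>

lemma ode_unique_forward:
 fixes f f' q :: "real \<Rightarrow> real"
 assumes d: "\<And>x. DERIV f x :> f' x" "\<And>x. DERIV f' x :> q x * f x"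
  and q: "\<And>x. \<bar>q x\<bar> \<le> M" and z: "f a = 0" "f' a = 0" and ab: "a \<le> b"
 shows "f' b = 0"
proof -
 let ?E = "\<lambda>x. ((f x)\<^sup>2 + (f' x)\<^sup>2) * exp (- (1 + M) * x)"
 have "?E b \<le> ?E a"
 proof (rule DERIV_nonpos_imp_nonincreasing[OF ab])
  fix x
  let ?D = "(2 * f x * f' x * (1 + q x) - (1 + M) * ((f x)\<^sup>2 + (f' x)\<^sup>2)) * exp (- (1 + M) * x)"
  have e: "DERIV (\<lambda>x. exp (- (1 + M) * x)) x :> exp (- (1 + M) * x) * (- (1 + M))"
   by (rule DERIV_chain2[OF DERIV_exp]) (auto intro!: derivative_eq_intros)
  have p: "DERIV (\<lambda>x. (f x)\<^sup>2 + (f' x)\<^sup>2) x :> 2 * f x * f' x + 2 * f' x * (q x * f x)"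
   using DERIV_add[OF DERIV_power[OF d(1), of 2 x] DERIV_power[OF d(2), of 2 x]] by (simp add: mult_ac)
  have "DERIV ?E x :> ?D"
   using DERIV_mult[OF p e] by (simp add: algebra_simps)
  moreover have "?D \<le> 0"
  proof -
   have "2 * f x * f' x * (1 + q x) \<le> \<bar>2 * f x * f' x\<bar> * \<bar>1 + q x\<bar>" by (metis abs_ge_self abs_mult)
   also have "\<dots> \<le> ((f x)\<^sup>2 + (f' x)\<^sup>2) * (1 + M)"
   proof (rule mult_mono)
    have "2 * (\<bar>f x\<bar> * \<bar>f' x\<bar>) \<le> \<bar>f x\<bar>\<^sup>2 + \<bar>f' x\<bar>\<^sup>2"
     using sum_squares_bound[of "\<bar>f x\<bar>" "\<bar>f' x\<bar>"] by simp
    then show "\<bar>2 * f x * f' x\<bar> \<le> (f x)\<^sup>2 + (f' x)\<^sup>2" by (simp add: abs_mult)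
    show "\<bar>1 + q x\<bar> \<le> 1 + M" using q[of x] by linarith
   qed auto
   finally show ?thesis by (intro mult_nonpos_nonneg) (auto simp: mult.commute)
  qed
  ultimately show "\<exists>y. DERIV ?E x :> y \<and> y \<le> 0" by blast
 qed
 then have "((f b)\<^sup>2 + (f' b)\<^sup>2) * exp (- (1 + M) * b) \<le> 0" by (simp add: z)
 then have "(f b)\<^sup>2 + (f' b)\<^sup>2 \<le> 0" by (simp add: mult_le_0_iff not_le[symmetric])
 then show ?thesis by (simp add: sum_power2_le_zero_iff)
qed

text \<open>Where the coefficient \<open>q\<close> is nonnegative, going left from \<open>0\<close>, the product \<open>f f'\<close> and the
 quantity \<open>f'\<^sup>2 - k\<^sup>2 f\<^sup>2\<close> are monotone. They keep their signs from the initial values at \<open>0\<close>, so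
 \<open>f\<close> cannot turn back to zero.\<close>

lemma forbidden_zone:
 fixes f f' q :: "real \<Rightarrow> real"
 assumes d: "\<And>x. DERIV f x :> f' x" "\<And>x. DERIV f' x :> q x * f x"
  and q: "\<And>x. x \<in> {c..0} \<Longrightarrow> k\<^sup>2 \<le> q x" and k: "k \<ge> 0" and z: "f 0 = 0" "f' 0 = -1"
  and x: "x \<in> {c..0}"
 shows "f' x \<le> -1" "f x \<ge> 0" "x < 0 \<Longrightarrow> f x > 0" "k * f x \<le> - f' x"
proof -
 have ff: "f x * f' x \<le> 0" if x: "x \<in> {c..0}" for x
 proof -
  have "f x * f' x \<le> f 0 * f' 0"
  proof (rule DERIV_nonneg_imp_nondecreasing[of x 0 "\<lambda>x. f x * f' x"])
   fix y assume y: "x \<le> y" "y \<le> 0"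
   have "y \<in> {c..0}" using x y by auto
   from q[OF this] have "0 \<le> q y" using zero_le_power2[of k] by linarith
   moreover have "DERIV (\<lambda>x. f x * f' x) y :> (f' y)\<^sup>2 + q y * (f y)\<^sup>2"
    using DERIV_mult[OF d] by (simp add: power2_eq_square algebra_simps)
   ultimately show "\<exists>D. DERIV (\<lambda>x. f x * f' x) y :> D \<and> 0 \<le> D" by (meson add_nonneg_nonneg mult_nonneg_nonneg zero_le_power2)
  qed (use x in auto)
  then show ?thesis by (simp add: z)
 qed
 have E: "1 \<le> (f' x)\<^sup>2 - k\<^sup>2 * (f x)\<^sup>2" if x: "x \<in> {c..0}" for x
 proof -
  let ?E = "\<lambda>x. (f' x)\<^sup>2 - k\<^sup>2 * (f x)\<^sup>2"
  have "?E 0 \<le> ?E x"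
  proof (rule DERIV_nonpos_imp_nonincreasing[of x 0 ?E])
   fix y assume y: "x \<le> y" "y \<le> 0"
   have yc: "y \<in> {c..0}" using x y by auto
   have h1: "DERIV ?E y :> 2 * f' y * (q y * f y) - k\<^sup>2 * (2 * f y * f' y)"
    using DERIV_diff[OF DERIV_power[OF d(2), of 2 y] DERIV_cmult[OF DERIV_power[OF d(1), of 2 y], where c="k\<^sup>2"]] by (simp add: mult_ac)
   have h2: "2 * f' y * (q y * f y) - k\<^sup>2 * (2 * f y * f' y) = 2 * ((f y * f' y) * (q y - k\<^sup>2))"
    by (simp add: algebra_simps)
   have h3: "2 * ((f y * f' y) * (q y - k\<^sup>2)) \<le> 0"
    using mult_nonpos_nonneg[OF ff[OF yc], of "q y - k\<^sup>2"] q[OF yc] by simp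
   show "\<exists>D. DERIV ?E y :> D \<and> D \<le> 0" by (rule exI[of _ "2 * f' y * (q y * f y) - k\<^sup>2 * (2 * f y * f' y)"], rule conjI, rule h1, subst h2, rule h3)
  qed (use x in auto)
  then show ?thesis by (simp add: z)
 qed
 have neg: "f' x \<le> -1" if x: "x \<in> {c..0}" for x
 proof -
  have nz: "f' y \<noteq> 0" if "y \<in> {c..0}" for y
  proof
   assume "f' y = 0"
   then have "1 \<le> - (k\<^sup>2 * (f y)\<^sup>2)" using E[OF that] by simp
   moreover have "0 \<le> k\<^sup>2 * (f y)\<^sup>2" by simp
   ultimately show False by linarith
  qed
  have "f' x < 0"
  proof (rule ccontr)
   assume "\<not> f' x < 0"
   then have "\<exists>y\<ge>x. y \<le> 0 \<and> f' y = 0"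
    using IVT2[of f' 0 0 x] x z(2) DERIV_isCont[OF d(2)] by auto
   then show False using nz x by auto
  qed
  moreover have "1\<^sup>2 \<le> (- f' x)\<^sup>2"
  proof -
   have "0 \<le> k\<^sup>2 * (f x)\<^sup>2" by simp
   then have "1 \<le> (f' x)\<^sup>2" using E[OF x] by linarith
   then show ?thesis by simp
  qed
  ultimately show ?thesis using power2_le_imp_le[of 1 "- f' x"] by linarith
 qed
 show "f' x \<le> -1" by (rule neg[OF x])
 show pos: "f x > 0" if "x < 0"
 proof -
  have "f 0 < f x"
  proof (rule DERIV_neg_imp_decreasing[OF that])
   fix y assume "x \<le> y" "y \<le> 0"
   then have "f' y \<le> -1" using x neg[of y] by simp
   then show "\<exists>D. DERIV f y :> D \<and> D < 0" using d(1)[of y] by (intro exI[of _ "f' y"]) auto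
  qed
  then show ?thesis by (simp add: z)
 qed
 show nn: "f x \<ge> 0" using pos x z by (cases "x = 0") auto
 have "(k * f x)\<^sup>2 \<le> (- f' x)\<^sup>2" using E[OF x] by (simp add: power_mult_distrib)
 moreover have "0 \<le> - f' x" using neg[OF x] by linarith
 ultimately show "k * f x \<le> - f' x" by (rule power2_le_imp_le)
qed

text \<open>The function \<open>f(t) exp (k t)\<close> is decreasing because \<open>k f \<le> - f'\<close>.\<close>

lemma forbidden_zone_decay:
 fixes f f' q :: "real \<Rightarrow> real"
 assumes d: "\<And>x. DERIV f x :> f' x" "\<And>x. DERIV f' x :> q x * f x"
  and q: "\<And>x. x \<in> {c..0} \<Longrightarrow> k\<^sup>2 \<le> q x" and k: "k \<ge> 0" and z: "f 0 = 0" "f' 0 = -1"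
  and xy: "c \<le> x" "x \<le> y" "y \<le> 0"
 shows "f y \<le> exp (- k * (y - x)) * f x"
proof -
 have "f y * exp (k * y) \<le> f x * exp (k * x)"
 proof (rule DERIV_nonpos_imp_nonincreasing[OF xy(2)])
  fix t assume t: "x \<le> t" "t \<le> y"
  have "DERIV (\<lambda>t. exp (k * t)) t :> exp (k * t) * k"
   by (rule DERIV_chain2[OF DERIV_exp]) (auto intro!: derivative_eq_intros)
  from DERIV_mult[OF d(1) this]
  have "DERIV (\<lambda>t. f t * exp (k * t)) t :> (f' t + k * f t) * exp (k * t)"
   by (simp add: algebra_simps)
  moreover have "(f' t + k * f t) * exp (k * t) \<le> 0"
   using forbidden_zone(4)[OF d q k z, of c t] t xy by (intro mult_nonpos_nonneg) auto
  ultimately show "\<exists>D. DERIV (\<lambda>t. f t * exp (k * t)) t :> D \<and> D \<le> 0" by blast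
 qed
 then have "f y * exp (k * y) * exp (- k * y) \<le> f x * exp (k * x) * exp (- k * y)"
  by (rule mult_right_mono) simp
 then show ?thesis by (simp add: mult.assoc exp_add[symmetric] algebra_simps)
qed

lemma diff_nonneg_le: "0 \<le> b \<Longrightarrow> a - b \<le> (a::real)" by simp

text \<open>A solution of a strongly oscillating equation cannot stay positive on a long interval. This
 is Picone's identity \<open>(s\<^sup>2 f'/f)' = q s\<^sup>2 + s'\<^sup>2 - (s' - s f'/f)\<^sup>2\<close> with \<open>s = (x - a) (b - x)\<close>,
 integrated over \<open>[a, b]\<close>; the constant is \<open>\<integral> s'\<^sup>2 / \<integral> s\<^sup>2 = 10 / (b - a)\<^sup>2\<close>.\<close>

lemma positive_solution_bound:
 fixes f f' q :: "real \<Rightarrow> real"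
 assumes d: "\<And>x. DERIV f x :> f' x" "\<And>x. DERIV f' x :> q x * f x"
  and q: "\<And>x. x \<in> {a..b} \<Longrightarrow> q x \<le> - N" and ab: "a < b" and pos: "\<And>x. x \<in> {a..b} \<Longrightarrow> f x > 0"
 shows "N * (b - a)\<^sup>2 \<le> 10"
proof -
 define l where "l = b - a"
 define s where "s x = (x - a) * (b - x)" for x
 define s' where "s' x = b + a - 2 * x" for x
 \<comment> \<open>The primitive of \<open>30 (s'\<^sup>2 - N s\<^sup>2)\<close> that vanishes at \<open>a\<close>.\<close>
 define P where "P x = 30 * l\<^sup>2 * (x - a) - 60 * l * (x - a)^2 + 40 * (x - a)^3 - N * (10 * l\<^sup>2 * (x - a)^3 - 15 * l * (x - a)^4 + 6 * (x - a)^5)" for x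
 have ds: "DERIV s x :> s' x" for x
  unfolding s_def[abs_def] s'_def by (auto intro!: derivative_eq_intros simp: algebra_simps)
 have dP: "DERIV P x :> 30 * ((s' x)\<^sup>2 - N * (s x)\<^sup>2)" for x
 proof -
  have "DERIV P x :> 30 * l\<^sup>2 - 60 * l * (2 * (x - a)) + 40 * (3 * (x - a)^2) - N * (10 * l\<^sup>2 * (3 * (x - a)^2) - 15 * l * (4 * (x - a)^3) + 6 * (5 * (x - a)^4))"
   unfolding P_def[abs_def] by (auto intro!: derivative_eq_intros)
  moreover have "30 * l\<^sup>2 - 60 * l * (2 * (x - a)) + 40 * (3 * (x - a)^2) - N * (10 * l\<^sup>2 * (3 * (x - a)^2) - 15 * l * (4 * (x - a)^3) + 6 * (5 * (x - a)^4))
    = 30 * ((s' x)\<^sup>2 - N * (s x)\<^sup>2)"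
   unfolding s_def s'_def l_def by algebra
  ultimately show ?thesis by (simp only:)
 qed
 let ?F = "\<lambda>x. 30 * ((s x)\<^sup>2 * f' x / f x) - P x"
 have "?F b \<le> ?F a"
 proof (rule DERIV_nonpos_imp_nonincreasing[of a b ?F])
  fix x assume x: "a \<le> x" "x \<le> b"
  have f: "f x > 0" using pos x by auto
  have "DERIV (\<lambda>x. (s x)\<^sup>2 * f' x) x :> (2 * s x * s' x) * f' x + (q x * f x) * (s x)\<^sup>2"
   using DERIV_mult[OF DERIV_power[OF ds, of 2 x] d(2)[of x]] by (simp add: mult_ac)
  from DERIV_diff[OF DERIV_cmult[OF DERIV_divide[OF this d(1)], where c=30] dP]
  have hA: "DERIV ?F x :> 30 * ((((2 * s x * s' x) * f' x + (q x * f x) * (s x)\<^sup>2) * f x - (s x)\<^sup>2 * f' x * f' x) / (f x * f x))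
    - 30 * ((s' x)\<^sup>2 - N * (s x)\<^sup>2)" using f by simp
  have hB: "30 * ((((2 * s x * s' x) * f' x + (q x * f x) * (s x)\<^sup>2) * f x - (s x)\<^sup>2 * f' x * f' x) / (f x * f x))
    - 30 * ((s' x)\<^sup>2 - N * (s x)\<^sup>2) = 30 * ((q x + N) * (s x)\<^sup>2 - (s' x - s x * f' x / f x)\<^sup>2)"
   using f by (simp add: field_simps power2_eq_square)
  have hC: "30 * ((q x + N) * (s x)\<^sup>2 - (s' x - s x * f' x / f x)\<^sup>2) \<le> 0"
  proof -
   have "q x + N \<le> 0" using q[of x] x by auto
   then have "(q x + N) * (s x)\<^sup>2 \<le> 0" by (rule mult_nonpos_nonneg) simp
   then have "(q x + N) * (s x)\<^sup>2 - (s' x - s x * f' x / f x)\<^sup>2 \<le> 0" by (rule order_trans[OF diff_nonneg_le[OF zero_le_power2]])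
   then show "30 * ((q x + N) * (s x)\<^sup>2 - (s' x - s x * f' x / f x)\<^sup>2) \<le> 0" by (simp add: mult_nonneg_nonpos)
  qed
  show "\<exists>D. DERIV ?F x :> D \<and> D \<le> 0"
   by (rule exI, rule conjI, rule hA, subst hB, rule hC)
 qed (use ab in simp)
 then have "0 \<le> P b" by (simp add: s_def P_def)
 also have "P b = l ^ 3 * (10 - N * l\<^sup>2)"
  unfolding P_def l_def by algebra
 finally have "0 \<le> l ^ 3 * (10 - N * l\<^sup>2)" .
 moreover have "l ^ 3 > 0" using ab by (simp add: l_def)
 ultimately show ?thesis by (simp add: zero_le_mult_iff l_def)
qed

lemma bar_mono: "m \<ge> 1 \<Longrightarrow> x \<le> y \<Longrightarrow> y \<le> 0 \<Longrightarrow> bar m x \<le> bar m y"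
 using bar_strict_mono[of m x y] by (cases "x = y") auto

text \<open>Shoot from \<open>0\<close> to the left. For \<open>\<mu> = L bar x\<^sub>0\<close> the whole interval is forbidden and the
 solution is positive. For \<open>\<mu>\<close> halfway between the barrier at \<open>7/8 x\<^sub>0\<close> and at \<open>6/8 x\<^sub>0\<close> it
 oscillates so fast near \<open>x\<^sub>0\<close> that it has a zero. At the least \<open>\<mu>\<close> with a zero in the well the
 solution is nonnegative, and a zero in the interior would be a double zero; hence the zero is at
 \<open>x\<^sub>0\<close>. The eighths of \<open>x\<^sub>0\<close> leave room for the decay estimate and for the cutoff.\<close>

lemma trapped_mode:
 assumes m: "m \<ge> 1" and x0: "x0 < 0"
 shows "\<exists>\<delta> L0. \<delta> > 0 \<and> L0 \<ge> 1 \<and> (\<forall>L\<ge>L0. \<exists>\<mu> \<psi> \<psi>'. L * bar m x0 \<le> \<mu> \<and> \<mu> \<le> L \<and>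
   (\<forall>x. DERIV \<psi> x :> \<psi>' x) \<and> (\<forall>x. DERIV \<psi>' x :> (pot m L x - \<mu>) * \<psi> x) \<and>
   \<psi> x0 = 0 \<and> \<psi> 0 = 0 \<and> \<psi>' 0 = -1 \<and> (\<forall>x\<in>{6/8*x0..0}. \<delta> * L \<le> pot m L x - \<mu>))"
proof -
 define b1 b2 where "b1 = 7/8*x0" and "b2 = 6/8*x0"
 have b: "x0 < b1" "b1 < b2" "b2 < 0" using x0 by (auto simp: b1_def b2_def)
 define \<delta> where "\<delta> = (bar m b2 - bar m b1) / 2"
 have \<delta>: "\<delta> > 0" using bar_strict_mono[OF m, of b1 b2] b by (simp add: \<delta>_def)
 define l where "l = b1 - x0"
 have l: "l > 0" using b by (simp add: l_def)
 define L0 where "L0 = max 1 ((real (2 * m) + 10 / l\<^sup>2) / \<delta>)"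
 have "\<exists>\<mu> \<psi> \<psi>'. L * bar m x0 \<le> \<mu> \<and> \<mu> \<le> L \<and>
   (\<forall>x. DERIV \<psi> x :> \<psi>' x) \<and> (\<forall>x. DERIV \<psi>' x :> (pot m L x - \<mu>) * \<psi> x) \<and>
   \<psi> x0 = 0 \<and> \<psi> 0 = 0 \<and> \<psi>' 0 = -1 \<and> (\<forall>x\<in>{6/8*x0..0}. \<delta> * L \<le> pot m L x - \<mu>)" if L: "L \<ge> L0" for L
 proof -
  have L1: "L \<ge> 1" and L2: "real (2 * m) + 10 / l\<^sup>2 \<le> L * \<delta>"
   using L \<delta> by (auto simp: L0_def divide_le_eq)
  \<comment> \<open>Clipping the parameter to \<open>[0, L]\<close> keeps the coefficient bounded on the whole plane.\<close>
  define Q where "Q q = pot m L (snd q) - max 0 (min (fst q) L)" for q :: "real \<times> real"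
  have cpot: "continuous_on UNIV (pot m L)" using C_on_imp_continuous[OF C_on_pot[of 0]] .
  have cQ: "continuous_on UNIV Q" unfolding Q_def
   by (intro continuous_intros continuous_on_compose2[OF cpot]) auto
  have potb: "0 \<le> pot m L x" "pot m L x \<le> real (2 * m - 1) + L" for x
  proof -
   have "L * bar m x \<le> L * 1" "0 \<le> L * bar m x"
    using L1 bar_le_1[of m x] bar_pos[of m x] by (auto intro!: mult_left_mono simp: less_imp_le)
   then show "0 \<le> pot m L x" "pot m L x \<le> real (2 * m - 1) + L"
    using curv_nonneg[of m x] curv_le[OF m, of x] by (simp_all add: pot_def)
  qed
  have bQ: "\<bar>Q q\<bar> \<le> real (2 * m - 1) + L" for q
   using potb[of "snd q"] L1 by (auto simp: Q_def abs_le_iff)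
  obtain \<psi> \<psi>' where \<psi>: "continuous_on UNIV \<psi>" "continuous_on UNIV \<psi>'" "pd2 \<psi> \<psi>'" "pd2 \<psi>' (\<lambda>q. Q q * \<psi> q)"
   "\<And>p. \<psi> (p, 0) = 0" "\<And>p. \<psi>' (p, 0) = -1"
   using ode_family[OF cQ bQ] by blast
  define \<mu>1 \<mu>2 where "\<mu>1 = L * bar m x0" and "\<mu>2 = L * ((bar m b1 + bar m b2) / 2)"
  have bm: "bar m x0 < bar m b1" "bar m b1 < bar m b2" using bar_strict_mono[OF m] b by auto
  have \<mu>: "0 \<le> \<mu>1" "\<mu>1 \<le> \<mu>2" "\<mu>2 \<le> L"
   using L1 bm bar_pos[of m x0] bar_le_1[of m b2] by (auto simp: \<mu>1_def \<mu>2_def)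
  have d1: "DERIV (\<lambda>y. \<psi> (\<mu>, y)) x :> \<psi>' (\<mu>, x)" for \<mu> x
   using \<psi>(3) by (simp add: pd2_def)
  have d2: "DERIV (\<lambda>y. \<psi>' (\<mu>, y)) x :> (pot m L x - \<mu>) * \<psi> (\<mu>, x)" if "\<mu> \<in> {\<mu>1..\<mu>2}" for \<mu> x
  proof -
   have "Q (\<mu>, x) = pot m L x - \<mu>" using that \<mu> by (simp add: Q_def)
   moreover have "DERIV (\<lambda>y. \<psi>' (\<mu>, y)) x :> Q (\<mu>, x) * \<psi> (\<mu>, x)"
    using \<psi>(4) by (simp add: pd2_def)
   ultimately show ?thesis by (simp only:)
  qed
  have gap: "\<delta> * L \<le> pot m L x - \<mu>" if "\<mu> \<in> {\<mu>1..\<mu>2}" "x \<in> {b2..0}" for \<mu> x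
  proof -
   have "L * bar m b2 \<le> L * bar m x" using L1 bar_mono[OF m, of b2 x] that by (intro mult_left_mono) auto
   then have "L * bar m b2 - \<mu>2 \<le> pot m L x - \<mu>" using curv_nonneg[of m x] that by (simp add: pot_def)
   then show ?thesis by (simp add: \<mu>2_def \<delta>_def field_simps)
  qed
  have pos_right: "\<psi> (\<mu>, x) > 0" if "\<mu> \<in> {\<mu>1..\<mu>2}" "x \<in> {b2..<0}" for \<mu> x
  proof (rule forbidden_zone(3)[OF d1 d2[OF that(1)], where c=b2 and k=0])
   fix y assume "y \<in> {b2..0}"
   from gap[OF that(1) this] have "\<delta> * L \<le> pot m L y - \<mu>" .
   moreover have "0 \<le> \<delta> * L" using \<delta> L1 by simp
   ultimately show "0\<^sup>2 \<le> pot m L y - \<mu>" by simp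
  qed (use that \<psi> in auto)
  have pos1: "\<psi> (\<mu>1, x) > 0" if "x \<in> {x0..<0}" for x
  proof (rule forbidden_zone(3)[OF d1 d2, where c=x0 and k=0])
   fix y assume "y \<in> {x0..0}"
   then have "L * bar m x0 \<le> L * bar m y" using L1 bar_mono[OF m, of x0 y] by (intro mult_left_mono) auto
   then show "0\<^sup>2 \<le> pot m L y - \<mu>1" using curv_nonneg[of m y] by (simp add: pot_def \<mu>1_def)
  qed (use that \<psi> \<mu> in auto)
  \<comment> \<open>Compactness of the set of parameters whose solution has a zero (or is negative) in the well yields a least one.\<close>
  define S where "S = {\<mu> \<in> {\<mu>1..\<mu>2}. \<exists>x\<in>{x0..b2}. \<psi> (\<mu>, x) \<le> 0}"
  have "compact S"
  proof -
   have "closed (\<psi> -` {..0})" using \<psi>(1) by (intro closed_vimage) auto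
   then have "compact (({\<mu>1..\<mu>2} \<times> {x0..b2}) \<inter> \<psi> -` {..0})"
    by (intro compact_Int_closed compact_Times) auto
   then have "compact (fst ` (({\<mu>1..\<mu>2} \<times> {x0..b2}) \<inter> \<psi> -` {..0}))"
    by (rule compact_continuous_image[rotated]) (intro continuous_intros)
   also have "fst ` (({\<mu>1..\<mu>2} \<times> {x0..b2}) \<inter> \<psi> -` {..0}) = S"
    unfolding S_def by force
   finally show ?thesis .
  qed
  moreover have "S \<noteq> {}"
  proof -
   have "\<mu>2 \<in> S"
   proof (rule ccontr)
    assume "\<mu>2 \<notin> S"
    then have pos: "\<psi> (\<mu>2, x) > 0" if "x \<in> {x0..b1}" for x
     using that \<mu> b unfolding S_def by force
    have "(L * \<delta> - real (2 * m - 1)) * (b1 - x0)\<^sup>2 \<le> 10"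
    proof (rule positive_solution_bound[OF d1 d2])
     fix x assume x: "x \<in> {x0..b1}"
     then have "L * bar m x \<le> L * bar m b1" using L1 bar_mono[OF m, of x b1] b by (intro mult_left_mono) auto
     then have "pot m L x \<le> real (2 * m - 1) + L * bar m b1" using curv_le[OF m, of x] by (simp add: pot_def)
     then show "pot m L x - \<mu>2 \<le> - (L * \<delta> - real (2 * m - 1))" by (simp add: \<mu>2_def \<delta>_def field_simps)
    qed (use pos \<mu> b in auto)
    moreover have "1 + 10 / l\<^sup>2 \<le> L * \<delta> - real (2 * m - 1)" using L2 m by (simp add: of_nat_diff)
    then have "(1 + 10 / l\<^sup>2) * l\<^sup>2 \<le> (L * \<delta> - real (2 * m - 1)) * l\<^sup>2" by (intro mult_right_mono) auto
    moreover have "(1 + 10 / l\<^sup>2) * l\<^sup>2 > 10" using l by (simp add: field_simps)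
    ultimately show False unfolding l_def by linarith
   qed
   then show ?thesis by blast
  qed
  ultimately obtain \<mu> where \<mu>S: "\<mu> \<in> S" and least: "\<And>t. t \<in> S \<Longrightarrow> \<mu> \<le> t"
   using compact_attains_inf by metis
  have \<mu>I: "\<mu> \<in> {\<mu>1..\<mu>2}" using \<mu>S by (simp add: S_def)
  obtain x where x: "x \<in> {x0..b2}" "\<psi> (\<mu>, x) \<le> 0" using \<mu>S by (auto simp: S_def)
  have nonneg: "\<psi> (\<mu>, y) \<ge> 0" if y: "y \<in> {x0..b2}" for y
  proof (rule ccontr)
   assume n: "\<not> \<psi> (\<mu>, y) \<ge> 0"
   have c: "isCont (\<lambda>r. \<psi> (r, y)) r" for r
    using continuous_on_compose2[OF \<psi>(1), of UNIV "\<lambda>r. (r, y)"]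
    by (auto simp: continuous_on_eq_continuous_at intro!: continuous_intros)
   have "\<exists>r\<ge>\<mu>1. r \<le> \<mu> \<and> \<psi> (r, y) = 0"
    using IVT2[of "\<lambda>r. \<psi> (r, y)" \<mu> 0 \<mu>1] n pos1[of y] y b \<mu>I c by auto
   then obtain r where r: "\<mu>1 \<le> r" "r \<le> \<mu>" "\<psi> (r, y) = 0" by auto
   moreover have "\<psi> (r, y) \<le> 0" using r(3) by simp
   ultimately have "r \<in> S" using y \<mu>I unfolding S_def by (auto intro!: bexI[of _ y])
   then have "r = \<mu>" using least r(2) by force
   then show False using r n by simp
  qed
  have x_zero: "\<psi> (\<mu>, x) = 0" using nonneg[OF x(1)] x(2) by linarith
  have "x = x0"
  proof (rule ccontr)
   assume "x \<noteq> x0"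
   then have x': "x0 < x" "x < b2" using x(1) pos_right[OF \<mu>I, of b2] x_zero b by (auto simp: order.order_iff_strict)
   have x_crit: "\<psi>' (\<mu>, x) = 0"
   proof (rule DERIV_local_min[OF d1])
    show "0 < min (x - x0) (b2 - x)" using x' by simp
    show "\<forall>y. \<bar>x - y\<bar> < min (x - x0) (b2 - x) \<longrightarrow> \<psi> (\<mu>, x) \<le> \<psi> (\<mu>, y)"
     using nonneg x_zero by (auto simp: abs_less_iff)
   qed
   have "\<psi>' (\<mu>, 0) = 0"
   proof (rule ode_unique_forward[OF d1 d2[OF \<mu>I], where a=x and M="real (2 * m - 1) + L"])
    show "\<bar>pot m L y - \<mu>\<bar> \<le> real (2 * m - 1) + L" for y
     using bQ[of "(\<mu>, y)"] \<mu>I \<mu> by (simp add: Q_def)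
   qed (use x_zero x_crit x b in auto)
   then show False using \<psi>(6) by simp
  qed
  then show ?thesis
   using \<mu>I \<mu> d1 d2[OF \<mu>I] x_zero \<psi>(5,6) gap[OF \<mu>I]
   by (intro exI[of _ \<mu>] exI[of _ "\<lambda>x. \<psi> (\<mu>, x)"] exI[of _ "\<lambda>x. \<psi>' (\<mu>, x)"]) (auto simp: \<mu>1_def b2_def)
 qed
 then show ?thesis using \<delta> by (intro exI[of _ \<delta>] exI[of _ L0]) (auto simp: L0_def)
qed

lemma pot_nonneg: "L \<ge> 0 \<Longrightarrow> pot m L x \<ge> 0"
 using curv_nonneg[of m x] bar_pos[of m x] by (simp add: pot_def)

text \<open>The mass \<open>M\<close> of the mode to the left of the cutoff region bounds everything: on \<open>[6/8 x\<^sub>0,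
 5/8 x\<^sub>0]\<close>, inside the forbidden zone, monotonicity bounds values by \<open>\<surd>M\<close>, and further right they
 decay at the rate \<open>k\<close>. Multiplying the equation by \<open>f\<close> and integrating bounds the derivative.\<close>

lemma trapped_mode_estimates:
 fixes f f' q :: "real \<Rightarrow> real"
 assumes d: "\<And>x. DERIV f x :> f' x" "\<And>x. DERIV f' x :> (q x - \<mu>) * f x"
  and k: "k \<ge> 0" "\<And>x. x \<in> {6/8*x0..0} \<Longrightarrow> k\<^sup>2 \<le> q x - \<mu>" and q: "\<And>x. q x \<ge> 0" "continuous_on UNIV q" and \<mu>: "\<mu> \<ge> 0"
  and z: "f 0 = 0" "f' 0 = -1" "f x0 = 0" and x0: "x0 < 0"
 defines "s \<equiv> - x0 / 8"
 defines "M \<equiv> integral {x0..3/8*x0} (\<lambda>x. (f x)\<^sup>2)"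
 shows "M > 0"
  and "\<And>y. y \<in> {3/8*x0..2/8*x0} \<Longrightarrow> \<bar>f y\<bar> + \<bar>f' y\<bar> \<le> (1 + 1 / s) / sqrt s * exp (- k * s) * sqrt M"
  and "integral {x0..0} (\<lambda>x. (f x)\<^sup>2) \<le> 4 * M"
  and "integral {x0..0} (\<lambda>x. (f' x)\<^sup>2) \<le> 4 * \<mu> * M"
proof -
 have s: "s > 0" using x0 by (simp add: s_def)
 have fz1: "f' x \<le> -1" if "x \<in> {6/8*x0..0}" for x by (rule forbidden_zone(1)[OF d k(2) k(1) z(1,2) that])
 have fz2: "f x \<ge> 0" if "x \<in> {6/8*x0..0}" for x by (rule forbidden_zone(2)[OF d k(2) k(1) z(1,2) that])
 have fz3: "f x > 0" if "x \<in> {6/8*x0..0}" "x < 0" for x by (rule forbidden_zone(3)[OF d k(2) k(1) z(1,2) that])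
 have decay: "f y \<le> exp (- k * (y - x)) * f x" if "6/8*x0 \<le> x" "x \<le> y" "y \<le> 0" for x y
  by (rule forbidden_zone_decay[OF d k(2) k(1) z(1,2) that])
 have cf: "continuous_on A f" "continuous_on A f'" for A
  using DERIV_isCont[OF d(1)] DERIV_isCont[OF d(2)] by (auto intro!: continuous_at_imp_continuous_on)
 have int: "(\<lambda>x. (f x)\<^sup>2) integrable_on {a..b}" "(\<lambda>x. (f' x)\<^sup>2) integrable_on {a..b}" for a b
  by (intro integrable_continuous_real continuous_intros cf)+
 define D where "D = f (5/8*x0)"
 have D: "D > 0" unfolding D_def using x0 by (intro fz3) auto
 have mono: "f y \<le> f x" if "6/8*x0 \<le> x" "x \<le> y" "y \<le> 0" for x y
 proof -
  have "exp (- k * (y - x)) * f x \<le> 1 * f x"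
   using k(1) that fz2[of x] by (intro mult_right_mono) auto
  then show ?thesis using decay[OF that] by simp
 qed
 have nn: "f x \<ge> 0" if "6/8*x0 \<le> x" "x \<le> 0" for x using fz2[of x] that by simp
 have MD: "s * D\<^sup>2 \<le> M"
 proof -
  have "integral {6/8*x0..5/8*x0} (\<lambda>x. D\<^sup>2) \<le> integral {6/8*x0..5/8*x0} (\<lambda>x. (f x)\<^sup>2)"
  proof (rule integral_le)
   show "(\<lambda>x. D\<^sup>2) integrable_on {6/8*x0..5/8*x0}" by (rule integrable_continuous_real) (rule continuous_on_const)
   fix x assume "x \<in> {6/8*x0..5/8*x0}"
   then show "D\<^sup>2 \<le> (f x)\<^sup>2" using mono[of x "5/8*x0"] D x0 by (intro power_mono) (auto simp: D_def)
  qed (rule int)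
  also have "\<dots> \<le> M" unfolding M_def
   by (rule integral_subset_le) (use x0 int in auto)
  finally show ?thesis using x0 by (simp add: s_def)
 qed
 then show M: "M > 0" using s D by (meson less_le_trans mult_pos_pos zero_less_power)
 have DM: "D \<le> sqrt M / sqrt s"
 proof -
  have "D\<^sup>2 \<le> M / s" using MD s by (simp add: field_simps)
  then have "D \<le> sqrt (M / s)" by (rule real_le_rsqrt)
  then show ?thesis by (simp add: real_sqrt_divide)
 qed
 have fe: "f (4/8*x0) \<le> exp (- k * s) * D"
  using decay[of "5/8*x0" "4/8*x0"] x0 by (simp add: s_def D_def)
 show "\<bar>f y\<bar> + \<bar>f' y\<bar> \<le> (1 + 1 / s) / sqrt s * exp (- k * s) * sqrt M" if y: "y \<in> {3/8*x0..2/8*x0}" for y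
 proof -
  have y0: "6/8*x0 \<le> y" "y \<le> 0" "4/8*x0 < y" "s \<le> y - 4/8*x0" using y x0 by (auto simp: s_def)
  have "f y \<le> f (4/8*x0)" using x0 y0 by (intro mono) auto
  have "\<exists>\<xi>>4/8*x0. \<xi> < y \<and> f y - f (4/8*x0) = (y - 4/8*x0) * f' \<xi>"
   by (rule MVT2) (use y0 d(1) in auto)
  then obtain \<xi> where \<xi>: "4/8*x0 < \<xi>" "\<xi> < y" "f y - f (4/8*x0) = (y - 4/8*x0) * f' \<xi>" by auto
  have "f' \<xi> \<le> f' y"
  proof (rule DERIV_nonneg_imp_nondecreasing[of \<xi> y f'])
   fix x assume x: "\<xi> \<le> x" "x \<le> y"
   have "x \<in> {6/8*x0..0}" using x \<xi> y0 x0 by auto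
   from k(2)[OF this] have "0 \<le> q x - \<mu>" using zero_le_power2[of k] by linarith
   then have "0 \<le> (q x - \<mu>) * f x" using nn[of x] x \<xi> y0 x0 by (intro mult_nonneg_nonneg) auto
   with d(2)[of x] show "\<exists>D. DERIV f' x :> D \<and> 0 \<le> D" by (intro exI conjI)
  qed (use \<xi> in simp)
  then have "(y - 4/8*x0) * (- f' y) \<le> (y - 4/8*x0) * (- f' \<xi>)" using y0 by (intro mult_left_mono) auto
  also have "\<dots> \<le> f (4/8*x0)" using \<xi>(3) nn[of y] y0 by (simp add: algebra_simps)
  finally have 1: "(y - 4/8*x0) * (- f' y) \<le> f (4/8*x0)" .
  have f'y: "f' y \<le> -1" using fz1[of y] y0 by simp
  have "s * (- f' y) \<le> (y - 4/8*x0) * (- f' y)" using f'y y0 by (intro mult_right_mono) auto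
  then have "- f' y \<le> f (4/8*x0) / s" using 1 s by (simp add: field_simps)
  then have "\<bar>f y\<bar> + \<bar>f' y\<bar> \<le> (1 + 1 / s) * f (4/8*x0)"
   using f'y nn[of y] y0 \<open>f y \<le> f (4/8*x0)\<close> by (simp add: algebra_simps)
  also have "\<dots> \<le> (1 + 1 / s) * (exp (- k * s) * (sqrt M / sqrt s))"
  proof (rule mult_left_mono)
   have "exp (- k * s) * D \<le> exp (- k * s) * (sqrt M / sqrt s)" by (rule mult_left_mono[OF DM]) simp
   then show "f (4/8*x0) \<le> exp (- k * s) * (sqrt M / sqrt s)" using fe by linarith
  qed (use s in simp)
  finally show ?thesis by (simp add: mult_ac)
 qed
 have tail: "integral {3/8*x0..0} (\<lambda>x. (f x)\<^sup>2) \<le> 3 * M"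
 proof -
  have "integral {3/8*x0..0} (\<lambda>x. (f x)\<^sup>2) \<le> integral {3/8*x0..0} (\<lambda>x. D\<^sup>2)"
  proof (rule integral_le)
   show "(\<lambda>x. D\<^sup>2) integrable_on {3/8*x0..0}" by (rule integrable_continuous_real) (rule continuous_on_const)
   fix x assume "x \<in> {3/8*x0..0}"
   then show "(f x)\<^sup>2 \<le> D\<^sup>2" using mono[of "5/8*x0" x] nn[of x] x0 by (intro power_mono) (auto simp: D_def)
  qed (rule int)
  then show ?thesis using MD x0 by (simp add: s_def)
 qed
 have "integral {x0..0} (\<lambda>x. (f x)\<^sup>2) = M + integral {3/8*x0..0} (\<lambda>x. (f x)\<^sup>2)"
  unfolding M_def by (rule Henstock_Kurzweil_Integration.integral_combine[symmetric]) (use x0 int in auto)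
 then show tot: "integral {x0..0} (\<lambda>x. (f x)\<^sup>2) \<le> 4 * M" using tail by simp
 have "((\<lambda>x. (f' x)\<^sup>2 + (q x - \<mu>) * (f x)\<^sup>2) has_integral (f 0 * f' 0 - f x0 * f' x0)) {x0..0}"
 proof (rule fundamental_theorem_of_calculus)
  fix x
  have "DERIV (\<lambda>x. f x * f' x) x :> (f' x)\<^sup>2 + (q x - \<mu>) * (f x)\<^sup>2"
   using DERIV_mult[OF d] by (simp add: power2_eq_square algebra_simps)
  then show "((\<lambda>x. f x * f' x) has_vector_derivative (f' x)\<^sup>2 + (q x - \<mu>) * (f x)\<^sup>2) (at x within {x0..0})"
   unfolding has_real_derivative_iff_has_vector_derivative by (rule has_vector_derivative_at_within)
 qed (use x0 in simp)
 then have I: "((\<lambda>x. (f' x)\<^sup>2 + (q x - \<mu>) * (f x)\<^sup>2) has_integral 0) {x0..0}" by (simp add: z)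
 have Iq: "((\<lambda>x. (f' x)\<^sup>2) has_integral integral {x0..0} (\<lambda>x. (f' x)\<^sup>2)) {x0..0}"
  "((\<lambda>x. (f x)\<^sup>2) has_integral integral {x0..0} (\<lambda>x. (f x)\<^sup>2)) {x0..0}" using int by blast+
 have "integral {x0..0} (\<lambda>x. (f' x)\<^sup>2) - \<mu> * integral {x0..0} (\<lambda>x. (f x)\<^sup>2) \<le> 0"
  by (rule has_integral_le[OF has_integral_diff[OF Iq(1) has_integral_mult_right[OF Iq(2)]] I])
    (use q(1) in \<open>auto simp: algebra_simps\<close>)
 moreover have "\<mu> * integral {x0..0} (\<lambda>x. (f x)\<^sup>2) \<le> \<mu> * (4 * M)" by (rule mult_left_mono[OF tot \<mu>])
 ultimately have "integral {x0..0} (\<lambda>x. (f' x)\<^sup>2) \<le> \<mu> * (4 * M)" by linarith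
 then show "integral {x0..0} (\<lambda>x. (f' x)\<^sup>2) \<le> 4 * \<mu> * M" by simp
qed

text \<open>The rate \<open>k\<close> in \<open>trapped_mode_estimates\<close> is \<open>\<surd>(\<delta> L)\<close>; the minimum that defines \<open>c\<close> makes one
 constant serve both bounds.\<close>

lemma normalized_trapped_mode:
 assumes m: "m \<ge> 1" and x0: "x0 < 0"
 shows "\<exists>c C L0. c > 0 \<and> C > 0 \<and> L0 \<ge> 1 \<and> (\<forall>L\<ge>L0. \<exists>\<mu> \<psi> \<psi>'. c \<le> \<mu> \<and> \<mu> \<le> L \<and>
   (\<forall>x. DERIV \<psi> x :> \<psi>' x) \<and> (\<forall>x. DERIV \<psi>' x :> (pot m L x - \<mu>) * \<psi> x) \<and>
   \<psi> x0 = 0 \<and> integral {x0..3/8*x0} (\<lambda>x. (\<psi> x)\<^sup>2) = 1 \<and>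
   integral {x0..0} (\<lambda>x. (\<psi> x)\<^sup>2) \<le> 4 \<and> integral {x0..0} (\<lambda>x. (\<psi>' x)\<^sup>2) \<le> 4 * L \<and>
   (\<forall>y\<in>{3/8*x0..2/8*x0}. \<bar>\<psi> y\<bar> + \<bar>\<psi>' y\<bar> \<le> C * exp (- c * sqrt L)))"
proof -
 obtain \<delta> L0 where \<delta>: "\<delta> > 0" "L0 \<ge> 1" and mode: "\<forall>L\<ge>L0. \<exists>\<mu> \<psi> \<psi>'. L * bar m x0 \<le> \<mu> \<and> \<mu> \<le> L \<and>
   (\<forall>x. DERIV \<psi> x :> \<psi>' x) \<and> (\<forall>x. DERIV \<psi>' x :> (pot m L x - \<mu>) * \<psi> x) \<and>
   \<psi> x0 = 0 \<and> \<psi> 0 = 0 \<and> \<psi>' 0 = -1 \<and> (\<forall>x\<in>{6/8*x0..0}. \<delta> * L \<le> pot m L x - \<mu>)"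
  using trapped_mode[OF assms] by metis
 define s where "s = - x0 / 8"
 have s: "s > 0" using x0 by (simp add: s_def)
 define c where "c = min (bar m x0) (sqrt \<delta> * s)"
 define C where "C = (1 + 1 / s) / sqrt s"
 have c: "c > 0" using bar_pos[of m x0] \<delta> s by (simp add: c_def)
 have C: "C > 0" using s by (auto simp: C_def intro!: divide_pos_pos add_pos_pos)
 have "\<exists>\<mu> \<psi> \<psi>'. c \<le> \<mu> \<and> \<mu> \<le> L \<and>
   (\<forall>x. DERIV \<psi> x :> \<psi>' x) \<and> (\<forall>x. DERIV \<psi>' x :> (pot m L x - \<mu>) * \<psi> x) \<and>
   \<psi> x0 = 0 \<and> integral {x0..3/8*x0} (\<lambda>x. (\<psi> x)\<^sup>2) = 1 \<and>
   integral {x0..0} (\<lambda>x. (\<psi> x)\<^sup>2) \<le> 4 \<and> integral {x0..0} (\<lambda>x. (\<psi>' x)\<^sup>2) \<le> 4 * L \<and>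
   (\<forall>y\<in>{3/8*x0..2/8*x0}. \<bar>\<psi> y\<bar> + \<bar>\<psi>' y\<bar> \<le> C * exp (- c * sqrt L))" if L: "L \<ge> L0" for L
 proof -
  have L1: "L \<ge> 1" using L \<delta> by simp
  obtain \<mu> \<psi> \<psi>' where \<mu>: "L * bar m x0 \<le> \<mu>" "\<mu> \<le> L" and
   d: "\<And>x. DERIV \<psi> x :> \<psi>' x" "\<And>x. DERIV \<psi>' x :> (pot m L x - \<mu>) * \<psi> x" and
   z: "\<psi> x0 = 0" "\<psi> 0 = 0" "\<psi>' 0 = -1" and gap: "\<And>x. x \<in> {6/8*x0..0} \<Longrightarrow> \<delta> * L \<le> pot m L x - \<mu>"
   using mode[rule_format, OF L] by blast
  define k where "k = sqrt (\<delta> * L)"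
  have k: "k \<ge> 0" "k\<^sup>2 = \<delta> * L" using \<delta> L1 by (auto simp: k_def)
  have \<mu>0: "\<mu> \<ge> 0" "c \<le> \<mu>"
  proof -
   have "1 * bar m x0 \<le> L * bar m x0" using bar_pos[of m x0] by (intro mult_right_mono[OF L1]) simp
   then show "c \<le> \<mu>" using \<mu> by (simp add: c_def)
   then show "\<mu> \<ge> 0" using c by simp
  qed
  have cpot: "continuous_on UNIV (pot m L)" using C_on_imp_continuous[OF C_on_pot[of 0]] .
  have L0': "0 \<le> L" using L1 by simp
  have gap': "k\<^sup>2 \<le> pot m L x - \<mu>" if "x \<in> {6/8*x0..0}" for x using gap[OF that] k by simp
  define M where "M = integral {x0..3/8*x0} (\<lambda>x. (\<psi> x)\<^sup>2)"
  note est = trapped_mode_estimates[OF d k(1) gap' pot_nonneg[OF L0'] cpot \<mu>0(1) z(2,3,1) x0, folded M_def s_def]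
  define r where "r = sqrt M"
  have r: "r > 0" "r\<^sup>2 = M" using est(1) by (auto simp: r_def)
  show ?thesis
  proof (rule exI[of _ \<mu>], rule exI[of _ "\<lambda>x. \<psi> x / r"], rule exI[of _ "\<lambda>x. \<psi>' x / r"], intro conjI allI ballI \<mu>0 \<mu>)
   show "DERIV (\<lambda>x. \<psi> x / r) x :> \<psi>' x / r" for x by (intro DERIV_cdivide d)
   show "DERIV (\<lambda>x. \<psi>' x / r) x :> (pot m L x - \<mu>) * (\<psi> x / r)" for x
    using DERIV_cdivide[OF d(2), where c=r] by simp
   show "\<psi> x0 / r = 0" by (simp add: z)
   have e: "integral A (\<lambda>x. (h x / r)\<^sup>2) = integral A (\<lambda>x. (h x)\<^sup>2) / M" for A h
    using Henstock_Kurzweil_Integration.integral_divide[of A "\<lambda>x. (h x)\<^sup>2" M] by (simp add: power_divide r)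
   show "integral {x0..3/8*x0} (\<lambda>x. (\<psi> x / r)\<^sup>2) = 1" unfolding e M_def[symmetric] using est(1) by simp
   show "integral {x0..0} (\<lambda>x. (\<psi> x / r)\<^sup>2) \<le> 4" unfolding e using est(1,3) by (simp add: divide_le_eq)
   have "4 * \<mu> * M \<le> 4 * L * M" using est(1) \<mu> by (intro mult_right_mono) auto
   with est(4) have "integral {x0..0} (\<lambda>x. (\<psi>' x)\<^sup>2) \<le> 4 * L * M" by (rule order_trans)
   then show "integral {x0..0} (\<lambda>x. (\<psi>' x / r)\<^sup>2) \<le> 4 * L" unfolding e using est(1) by (simp add: divide_le_eq)
   fix y assume y: "y \<in> {3/8*x0..2/8*x0}"
   have est2: "\<bar>\<psi> y\<bar> + \<bar>\<psi>' y\<bar> \<le> (1 + 1 / s) / sqrt s * exp (- k * s) * sqrt M" by (rule est(2)[OF _ y])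
   have "\<bar>\<psi> y / r\<bar> + \<bar>\<psi>' y / r\<bar> = (\<bar>\<psi> y\<bar> + \<bar>\<psi>' y\<bar>) / r" using r by (simp add: abs_divide add_divide_distrib)
   also have "\<dots> \<le> C * exp (- k * s)"
    using est2 r by (simp add: divide_le_eq C_def r_def)
   also have "\<dots> \<le> C * exp (- c * sqrt L)"
   proof -
    have "c * sqrt L \<le> (sqrt \<delta> * s) * sqrt L" using L1 by (intro mult_right_mono) (auto simp: c_def)
    then have "c * sqrt L \<le> k * s" by (simp add: k_def real_sqrt_mult mult_ac)
    then show ?thesis using C by simp
   qed
   finally show "\<bar>\<psi> y / r\<bar> + \<bar>\<psi>' y / r\<bar> \<le> C * exp (- c * sqrt L)" .
  qed
 qed
 then show ?thesis using c C \<delta>(2) by (intro exI[of _ c] exI[of _ C] exI[of _ L0]) auto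
qed

section \<open>Integration over the manifold\<close>

abbreviation base :: "real \<Rightarrow> point measure" where
 "base x0 \<equiv> restrict_space lborel {x0<..} \<Otimes>\<^sub>M sphere_measure"

lemma sigma_finite_half_line: "sigma_finite_measure (restrict_space lborel {x0::real<..})"
 by (rule sigma_finite_measure_restrict_space) (auto intro: lborel.sigma_finite_measure_axioms)

lemma pair_sigma_finite_base: "pair_sigma_finite (restrict_space lborel {x0::real<..}) sphere_measure"
 using sigma_finite_half_line finite_sphere_measure
 by (simp add: pair_sigma_finite_def finite_measure.axioms)

lemma space_vol [simp]: "space (vol m x0) = {x0<..} \<times> S2"
 by (simp add: vol_def space_pair_measure space_restrict_space)

lemma measurable_ident_base: "(\<lambda>p. p) \<in> base x0 \<rightarrow>\<^sub>M borel"
proof -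
 have 1: "fst \<in> base x0 \<rightarrow>\<^sub>M borel"
 proof -
  have "(\<lambda>p. (\<lambda>x. x) (fst p)) \<in> base x0 \<rightarrow>\<^sub>M borel"
   by (rule measurable_compose[OF measurable_fst]) (rule measurable_restrict_space1, simp)
  then show ?thesis by simp
 qed
 have 2: "snd \<in> base x0 \<rightarrow>\<^sub>M borel"
 proof -
  have "(\<lambda>p. (\<lambda>x. x) (snd p)) \<in> base x0 \<rightarrow>\<^sub>M borel"
   by (rule measurable_compose[OF measurable_snd measurable_ident_sphere])
  then show ?thesis by simp
 qed
 have "(\<lambda>p. (fst p, snd p)) \<in> base x0 \<rightarrow>\<^sub>M borel \<Otimes>\<^sub>M borel" by (rule measurable_Pair[OF 1 2])
 then show ?thesis by (simp add: borel_prod)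
qed

lemma sets_vol: "sets (vol m x0) = sets (base x0)" by (simp add: vol_def)

lemma measurable_ident_vol: "(\<lambda>p. p) \<in> vol m x0 \<rightarrow>\<^sub>M borel"
 using measurable_ident_base by (simp add: measurable_cong_sets[OF sets_vol refl])

lemma measurable_base_continuous:
 fixes f :: "point \<Rightarrow> 'b::{second_countable_topology, real_normed_vector}"
 assumes "continuous_on ({x0<..} \<times> S2) f"
 shows "f \<in> borel_measurable (base x0)"
proof -
 have "{x0<..} \<times> S2 \<in> sets (borel :: point measure)"
 proof -
  have "{x0<..} \<times> S2 = (({x0<..} \<times> UNIV) \<inter> (UNIV \<times> S2) :: point set)" by auto
  moreover have "open ({x0<..} \<times> (UNIV :: (real^3) set))" "closed ((UNIV :: real set) \<times> S2)"
   by (auto intro!: open_Times closed_Times)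
  ultimately show ?thesis by (simp add: borel_open borel_closed)
 qed
 from borel_measurable_continuous_on_indicator[OF this assms]
 have "(\<lambda>p. indicator ({x0<..} \<times> S2) p *\<^sub>R f p) \<in> borel_measurable borel" .
 from measurable_compose[OF measurable_ident_base this]
 show ?thesis
  by (rule measurable_cong[THEN iffD1, rotated]) (auto simp: space_pair_measure space_restrict_space)
qed

lemma measurable_vol_continuous:
 fixes f :: "point \<Rightarrow> 'b::{second_countable_topology, real_normed_vector}"
 shows "continuous_on ({x0<..} \<times> S2) f \<Longrightarrow> f \<in> borel_measurable (vol m x0)"
 using measurable_base_continuous by (simp add: measurable_cong_sets[OF sets_vol refl])

lemma continuous_on_warp: "continuous_on A (warp m)"
 using C_on_imp_continuous[OF C_on_warp[of 0]] continuous_on_subset by blast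

lemma measurable_warp_base: "(\<lambda>p. (warp m (fst p))\<^sup>2) \<in> borel_measurable (base x0)"
 by (intro measurable_base_continuous continuous_intros continuous_on_compose2[OF continuous_on_warp[of UNIV]]) auto

lemma vol_density: "vol m x0 = density (base x0) (\<lambda>p. ennreal ((warp m (fst p))\<^sup>2))"
 by (simp add: vol_def case_prod_unfold)

lemma nn_integral_vol:
 assumes "f \<in> borel_measurable (vol m x0)"
 shows "(\<integral>\<^sup>+ p. f p \<partial>vol m x0) = (\<integral>\<^sup>+ x. ennreal ((warp m x)\<^sup>2) * (\<integral>\<^sup>+ \<omega>. f (x, \<omega>) \<partial>\<sigma>) * indicator {x0<..} x \<partial>lborel)"
proof -
 interpret S: finite_measure sphere_measure by (rule finite_sphere_measure)
 have f: "f \<in> borel_measurable (base x0)" using assms by (simp add: measurable_cong_sets[OF sets_vol refl])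
 have w: "(\<lambda>p. ennreal ((warp m (fst p))\<^sup>2)) \<in> borel_measurable (base x0)" using measurable_warp_base by simp
 have "(\<integral>\<^sup>+ p. f p \<partial>vol m x0) = (\<integral>\<^sup>+ p. ennreal ((warp m (fst p))\<^sup>2) * f p \<partial>base x0)"
  unfolding vol_density by (rule nn_integral_density[OF w f])
 also have "\<dots> = (\<integral>\<^sup>+ x. \<integral>\<^sup>+ \<omega>. ennreal ((warp m x)\<^sup>2) * f (x, \<omega>) \<partial>\<sigma> \<partial>restrict_space lborel {x0<..})"
  using S.nn_integral_fst[of "\<lambda>p. ennreal ((warp m (fst p))\<^sup>2) * f p", OF borel_measurable_times_ennreal[OF w f]] by simp
 also have "\<dots> = (\<integral>\<^sup>+ x. ennreal ((warp m x)\<^sup>2) * (\<integral>\<^sup>+ \<omega>. f (x, \<omega>) \<partial>\<sigma>) \<partial>restrict_space lborel {x0<..})"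
 proof (rule nn_integral_cong)
  fix x assume "x \<in> space (restrict_space lborel {x0<..})"
  then have "(\<lambda>\<omega>. f (x, \<omega>)) \<in> borel_measurable sphere_measure"
   by (intro measurable_compose[OF measurable_Pair1' f]) (simp add: space_restrict_space)
  then show "(\<integral>\<^sup>+ \<omega>. ennreal ((warp m x)\<^sup>2) * f (x, \<omega>) \<partial>\<sigma>) = ennreal ((warp m x)\<^sup>2) * (\<integral>\<^sup>+ \<omega>. f (x, \<omega>) \<partial>\<sigma>)"
   by (rule nn_integral_cmult)
 qed
 also have "\<dots> = (\<integral>\<^sup>+ x. ennreal ((warp m x)\<^sup>2) * (\<integral>\<^sup>+ \<omega>. f (x, \<omega>) \<partial>\<sigma>) * indicator {x0<..} x \<partial>lborel)"
  by (rule nn_integral_restrict_space) simp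
 finally show ?thesis .
qed

lemma integral_base_compact:
 fixes f :: "point \<Rightarrow> 'b::euclidean_space"
 assumes c: "continuous_on ({x0..} \<times> S2) f" and X: "x0 \<le> X" "\<And>x \<omega>. x \<ge> X \<Longrightarrow> \<omega> \<in> S2 \<Longrightarrow> f (x, \<omega>) = 0"
 shows "integrable (base x0) f"
  and "(\<integral>p. f p \<partial>base x0) = integral {x0..X} (\<lambda>x. \<integral>\<omega>. f (x, \<omega>) \<partial>\<sigma>)"
proof -
 interpret S: finite_measure sphere_measure by (rule finite_sphere_measure)
 interpret P: pair_sigma_finite "restrict_space lborel {x0<..}" sphere_measure by (rule pair_sigma_finite_base)
 have fm: "f \<in> borel_measurable (base x0)"
  by (rule measurable_base_continuous[OF continuous_on_subset[OF c]]) auto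
 have "compact ({x0..X} \<times> S2)" by (intro compact_Times) auto
 then have "bounded (f ` ({x0..X} \<times> S2))"
  by (intro compact_imp_bounded compact_continuous_image continuous_on_subset[OF c]) auto
 then obtain B where B: "\<And>p. p \<in> {x0..X} \<times> S2 \<Longrightarrow> norm (f p) \<le> B" unfolding bounded_iff by auto
 have A: "{x0<..X} \<in> sets (restrict_space lborel {x0<..})" by (auto simp: sets_restrict_space_iff)
 have S2m: "S2 \<in> sets sphere_measure" using sets.top[of sphere_measure] by simp
 have em: "emeasure (base x0) ({x0<..X} \<times> S2) < \<infinity>"
 proof -
  have "emeasure (restrict_space lborel {x0<..}) {x0<..X} = ennreal (X - x0)"
   using X(1) by (subst emeasure_restrict_space) auto
  then show ?thesis using S.emeasure_pair_measure_Times[OF A S2m]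
   by (simp add: emeasure_sphere_measure ennreal_mult_less_top)
 qed
 show int: "integrable (base x0) f"
 proof (rule integrableI_bounded_set[OF _ fm em, of B])
  show "{x0<..X} \<times> S2 \<in> sets (base x0)" using A S2m by simp
  show "AE p in base x0. p \<in> {x0<..X} \<times> S2 \<longrightarrow> norm (f p) \<le> B" using B by (auto intro!: AE_I2)
  show "AE p in base x0. p \<notin> {x0<..X} \<times> S2 \<longrightarrow> f p = 0"
  proof (rule AE_I2, rule impI)
   fix p assume "p \<in> space (base x0)" "p \<notin> {x0<..X} \<times> S2"
   then have "fst p \<ge> X" "snd p \<in> S2" by (auto simp: space_pair_measure space_restrict_space)
   then show "f p = 0" using X(2)[of "fst p" "snd p"] by simp
  qed
 qed
 define h where "h x = (\<integral>\<omega>. f (x, \<omega>) \<partial>\<sigma>)" for x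
 have h0: "h x = 0" if "x \<ge> X" for x
 proof -
  have "h x = (\<integral>\<omega>. 0 \<partial>\<sigma>)" unfolding h_def
   by (rule Bochner_Integration.integral_cong) (use X(2) that in auto)
  then show ?thesis by simp
 qed
 have "(\<integral>p. f p \<partial>base x0) = (\<integral>x. h x \<partial>restrict_space lborel {x0<..})"
  unfolding h_def using P.integral_fst'[OF int] by simp
 also have "\<dots> = (\<integral>x. indicator {x0<..} x *\<^sub>R h x \<partial>lborel)" by (rule integral_restrict_space) simp
 finally have e: "(\<integral>p. f p \<partial>base x0) = (\<integral>x. indicator {x0<..} x *\<^sub>R h x \<partial>lborel)" .
 have "integrable (restrict_space lborel {x0<..}) h" unfolding h_def by (rule P.integrable_fst'[OF int])
 then have i1: "integrable lborel (\<lambda>x. indicator {x0<..} x *\<^sub>R h x)" by (subst (asm) integrable_restrict_space) auto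
 have ae: "AE x in lborel. indicator {x0<..} x *\<^sub>R h x = indicator {x0..X} x *\<^sub>R h x"
  using AE_lborel_singleton[of x0] by eventually_elim (use h0 in \<open>auto simp: indicator_def\<close>)
 have hm: "(\<lambda>x. indicator {x0..X} x *\<^sub>R h x) \<in> borel_measurable lborel"
 proof -
  have "(\<lambda>x. indicator {x0..X} x *\<^sub>R h x) = (\<lambda>x. indicator {x0<..} x *\<^sub>R h x + indicator {x0} x *\<^sub>R h x0)"
   using h0 X(1) by (auto simp: indicator_def fun_eq_iff)
  then show ?thesis using borel_measurable_integrable[OF i1] by simp
 qed
 have i2: "set_integrable lborel {x0..X} h"
  unfolding set_integrable_def by (rule integrable_cong_AE[THEN iffD1, OF _ hm ae i1]) (use i1 in auto)
 have "(\<integral>x. indicator {x0<..} x *\<^sub>R h x \<partial>lborel) = (LINT x:{x0..X}|lborel. h x)"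
  unfolding set_lebesgue_integral_def by (rule integral_cong_AE[OF _ hm ae]) (use i1 in auto)
 also have "\<dots> = integral {x0..X} h" by (rule set_borel_integral_eq_integral[OF i2])
 finally show "(\<integral>p. f p \<partial>base x0) = integral {x0..X} (\<lambda>x. \<integral>\<omega>. f (x, \<omega>) \<partial>\<sigma>)"
  using e by (simp add: h_def[abs_def])
qed

text \<open>Fubini for continuous functions with bounded support, as Lebesgue integrals over the open
 half line agree with Henstock-Kurzweil integrals over the closed interval.\<close>

lemma integral_vol_compact:
 fixes f :: "point \<Rightarrow> 'b::euclidean_space"
 assumes c: "continuous_on ({x0..} \<times> S2) f" and X: "x0 \<le> X" "\<And>x \<omega>. x \<ge> X \<Longrightarrow> \<omega> \<in> S2 \<Longrightarrow> f (x, \<omega>) = 0"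
 shows "integrable (vol m x0) f"
  and "(\<integral>p. f p \<partial>vol m x0) = integral {x0..X} (\<lambda>x. (warp m x)\<^sup>2 *\<^sub>R (\<integral>\<omega>. f (x, \<omega>) \<partial>\<sigma>))"
proof -
 have fm: "f \<in> borel_measurable (base x0)"
  by (rule measurable_base_continuous[OF continuous_on_subset[OF c]]) auto
 have cw: "continuous_on ({x0..} \<times> S2) (\<lambda>p. (warp m (fst p))\<^sup>2 *\<^sub>R f p)"
  by (intro continuous_intros c continuous_on_compose2[OF continuous_on_warp[of UNIV]]) auto
 note b = integral_base_compact[OF cw X(1)]
 show "integrable (vol m x0) f" unfolding vol_density
  by (subst integrable_density[OF fm measurable_warp_base]) (use b(1) X(2) in auto)
 have "(\<integral>p. f p \<partial>vol m x0) = (\<integral>p. (warp m (fst p))\<^sup>2 *\<^sub>R f p \<partial>base x0)" unfolding vol_density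
  by (rule integral_density[OF fm measurable_warp_base]) auto
 then show "(\<integral>p. f p \<partial>vol m x0) = integral {x0..X} (\<lambda>x. (warp m x)\<^sup>2 *\<^sub>R (\<integral>\<omega>. f (x, \<omega>) \<partial>\<sigma>))"
  using b(2) X(2) by simp
qed

section \<open>The one-sided derivatives\<close>

lemma at_within_half_line_nontrivial: "x \<ge> (a::real) \<Longrightarrow> at x within {a..} \<noteq> bot"
proof -
 assume "x \<ge> a"
 then have "at x within {x..x+1} \<le> at x within {a..}" by (intro at_le) auto
 moreover have "at x within {x..x+1} \<noteq> bot" by (simp add: at_within_Icc_at_right)
 ultimately show ?thesis by (metis bot.extremum_unique)
qed

lemma vector_derivative_half_line:
 "x \<ge> (a::real) \<Longrightarrow> (f has_vector_derivative D) (at x within {a..}) \<Longrightarrow> vector_derivative f (at x within {a..}) = D"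
 by (rule vector_derivative_within[OF at_within_half_line_nontrivial])

lemma dx_eqI: "x \<ge> x0 \<Longrightarrow> ((\<lambda>s. f (s, \<omega>)) has_vector_derivative D) (at x within {x0..}) \<Longrightarrow> dx x0 f (x, \<omega>) = D"
 by (simp add: dx_def vector_derivative_half_line)

lemma dx_cong:
 assumes "x \<ge> x0" "\<And>s. s \<ge> x0 \<Longrightarrow> f (s, \<omega>) = g (s, \<omega>)"
 shows "dx x0 f (x, \<omega>) = dx x0 g (x, \<omega>)"
proof -
 have "((\<lambda>s. f (s, \<omega>)) has_vector_derivative D) (at x within {x0..}) \<longleftrightarrow> ((\<lambda>s. g (s, \<omega>)) has_vector_derivative D) (at x within {x0..})" for D
  using has_vector_derivative_transform[of x "{x0..}" "\<lambda>s. f (s, \<omega>)" "\<lambda>s. g (s, \<omega>)" D]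
   has_vector_derivative_transform[of x "{x0..}" "\<lambda>s. g (s, \<omega>)" "\<lambda>s. f (s, \<omega>)" D] assms by auto
 then show ?thesis by (simp add: dx_def vector_derivative_def)
qed

lemma C_upto_dx:
 assumes "C_upto (Suc n) ({x0..} \<times> S2) f"
 shows "C_upto n ({x0..} \<times> S2) (dx x0 f)"
  and "x \<ge> x0 \<Longrightarrow> \<omega> \<in> S2 \<Longrightarrow> ((\<lambda>s. f (s, \<omega>)) has_vector_derivative dx x0 f (x, \<omega>)) (at x within {x0..})"
proof -
 obtain g where G: "(\<forall>v. C_upto n ({x0..} \<times> S2) (\<lambda>p. g p v)) \<and>
   (\<forall>p v S (s::real). p \<in> {x0..} \<times> S2 \<longrightarrow> s \<in> S \<longrightarrow> (\<forall>r\<in>S. p + (r - s) *\<^sub>R v \<in> {x0..} \<times> S2) \<longrightarrow>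
    ((\<lambda>r. f (p + (r - s) *\<^sub>R v)) has_vector_derivative g p v) (at s within S))"
  using C_upto_directional[OF assms] by (elim exE)
 note g = conjunct1[OF G, rule_format] conjunct2[OF G, rule_format]
 have D: "((\<lambda>s. f (s, \<omega>)) has_vector_derivative g (x, \<omega>) (1, 0)) (at x within {x0..})" if "x \<ge> x0" "\<omega> \<in> S2" for x \<omega>
  using g(2)[of "(x, \<omega>)" x "{x0..}" "(1, 0)"] that by simp
 show "C_upto n ({x0..} \<times> S2) (dx x0 f)"
  by (rule C_upto_cong[OF _ g(1)[of "(1, 0)"]]) (use dx_eqI[OF _ D] in auto)
 show "((\<lambda>s. f (s, \<omega>)) has_vector_derivative dx x0 f (x, \<omega>)) (at x within {x0..})" if "x \<ge> x0" "\<omega> \<in> S2"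
  using D[OF that] dx_eqI[OF that(1) D[OF that]] by simp
qed

lemma C_upto_warp_sq: "C_upto n ({x0..} \<times> S2) (\<lambda>p::point. (warp m (fst p))\<^sup>2)"
 by (rule C_upto_of_C_on[OF C_on_power[OF open_UNIV C_on_compose[OF open_UNIV subset_UNIV C_on_fst[OF open_UNIV] C_on_warp]]])

lemma continuous_sphere_lap:
 fixes f :: "'a::euclidean_space \<times> (real^3) \<Rightarrow> complex"
 assumes "C_upto 2 (I \<times> S2) f"
 shows "continuous_on (I \<times> S2) (\<lambda>(x, \<omega>). sphere_lap (\<lambda>\<eta>. f (x, \<eta>)) \<omega>)"
proof -
 have f2: "C_upto (Suc 1) (I \<times> S2) f" using assms by (simp add: numeral_2_eq_2)
 have "C_upto (Suc 0) (I \<times> S2) (\<lambda>(x, \<omega>). sphere_grad (\<lambda>\<eta>. f (x, \<eta>)) \<omega> $ i)" for i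
  using sphere_ext_param(1)[OF f2] by simp
 from sphere_ext_param(1)[OF this]
 have "continuous_on (I \<times> S2) (\<lambda>(x, \<omega>). sphere_grad (\<lambda>\<eta>. sphere_grad (\<lambda>\<zeta>. f (x, \<zeta>)) \<eta> $ i) \<omega> $ i)" for i
  by (intro C_upto_imp_continuous) auto
 then have "continuous_on (I \<times> S2) (\<lambda>p. \<Sum>i\<in>UNIV. (\<lambda>(x, \<omega>). sphere_grad (\<lambda>\<eta>. sphere_grad (\<lambda>\<zeta>. f (x, \<zeta>)) \<eta> $ i) \<omega> $ i) p)"
  by (rule continuous_on_sum)
 then show ?thesis by (simp add: sphere_lap_def case_prod_unfold)
qed

lemma continuous_on_slice:
 "continuous_on (I \<times> J) f \<Longrightarrow> x \<in> I \<Longrightarrow> continuous_on J (\<lambda>y. f (x, y))"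
 by (rule continuous_on_compose2[where t="I \<times> J"]) (auto intro!: continuous_intros)

lemma continuous_lap:
 assumes "C_upto 2 ({x0..} \<times> S2) f"
 shows "continuous_on ({x0..} \<times> S2) (lap m x0 f)"
proof -
 have f2: "C_upto (Suc 1) ({x0..} \<times> S2) f" using assms by (simp add: numeral_2_eq_2)
 have f1: "C_upto (Suc 0) ({x0..} \<times> S2) (dx x0 f)" using C_upto_dx(1)[OF f2] by simp
 have "C_upto (Suc 0) ({x0..} \<times> S2) (\<lambda>q. (warp m (fst q))\<^sup>2 *\<^sub>R dx x0 f q)"
  by (intro C_upto_scaleR C_upto_warp_sq f1)
 from C_upto_dx(1)[OF this]
 have c: "continuous_on ({x0..} \<times> S2) (dx x0 (\<lambda>q. (warp m (fst q))\<^sup>2 *\<^sub>R dx x0 f q))"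
  by (rule C_upto_imp_continuous)
 have "continuous_on ({x0..} \<times> S2) (\<lambda>p. (1 / (warp m (fst p))\<^sup>2) *\<^sub>R dx x0 (\<lambda>q. (warp m (fst q))\<^sup>2 *\<^sub>R dx x0 f q) p
   + (1 / (warp m (fst p))\<^sup>2) *\<^sub>R (\<lambda>(x, \<omega>). sphere_lap (\<lambda>\<eta>. f (x, \<eta>)) \<omega>) p)"
  by (intro continuous_intros c continuous_sphere_lap[OF assms] continuous_on_compose2[OF continuous_on_warp[of UNIV]]) auto
 then show ?thesis by (simp add: lap_def case_prod_unfold)
qed

section \<open>Green's formula against a separated function\<close>

text \<open>The division by the warping function removes the first order term from the radial part of
 the Laplacian and the weight \<open>a\<^sup>2\<close> from the volume.\<close>

definition sep :: "nat \<Rightarrow> (real \<Rightarrow> real) \<Rightarrow> (real^3 \<Rightarrow> complex) \<Rightarrow> point \<Rightarrow> complex" where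
 "sep m h Y = (\<lambda>(x, \<omega>). of_real (h x / warp m x) * Y \<omega>)"

lemma nonzero_mult_div_cancel_left': "(a::real) \<noteq> 0 \<Longrightarrow> a * (b / a) = b" by simp

lemma sep_derivs:
 assumes m: "m \<ge> 1" and h: "\<And>x. DERIV h x :> h' x" "\<And>x. DERIV h' x :> h'' x"
 shows "DERIV (\<lambda>x. h x / warp m x) x :> (h' x * warp m x - h x * warp1 m x) / (warp m x)\<^sup>2"
  "DERIV (\<lambda>x. (warp m x)\<^sup>2 * ((h' x * warp m x - h x * warp1 m x) / (warp m x)\<^sup>2)) x :> (h'' x - curv m x * h x) * warp m x"
proof -
 show "DERIV (\<lambda>x. h x / warp m x) x :> (h' x * warp m x - h x * warp1 m x) / (warp m x)\<^sup>2"
  using DERIV_divide[OF h(1) DERIV_warp[OF m], of x] by (simp add: power2_eq_square)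
 have "((\<lambda>x. h' x * warp m x - h x * warp1 m x) has_real_derivative
   (h'' x * warp m x + warp1 m x * h' x) - (h' x * warp1 m x + (curv m x * warp m x) * h x)) (at x)"
  by (rule DERIV_diff[OF DERIV_mult[OF h(2) DERIV_warp[OF m]] DERIV_mult[OF h(1) DERIV_warp1[OF m]]])
 moreover have "(\<lambda>x. (warp m x)\<^sup>2 * ((h' x * warp m x - h x * warp1 m x) / (warp m x)\<^sup>2)) = (\<lambda>x. h' x * warp m x - h x * warp1 m x)"
  by (rule ext) (rule nonzero_mult_div_cancel_left', simp)
 moreover have "(h'' x * warp m x + warp1 m x * h' x) - (h' x * warp1 m x + (curv m x * warp m x) * h x) = (h'' x - curv m x * h x) * warp m x"
  by algebra
 ultimately show "DERIV (\<lambda>x. (warp m x)\<^sup>2 * ((h' x * warp m x - h x * warp1 m x) / (warp m x)\<^sup>2)) x :> (h'' x - curv m x * h x) * warp m x"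
  by (simp only:)
qed

lemma sphere_grad_cmult:
 assumes "C_upto (Suc n) S2 Z" "\<eta> \<in> S2"
 shows "sphere_grad (\<lambda>\<zeta>. c * Z \<zeta>) \<eta> $ i = c * sphere_grad Z \<eta> $ i"
proof -
 have "C_upto (Suc 0) S2 (\<lambda>_. c)" by (intro C_upto_of_C_on C_on_const) auto
 moreover have "sphere_grad (\<lambda>_. c) \<eta> $ i = 0"
  using sphere_grad_eqI[of "\<lambda>_. c" "\<lambda>_. 0" \<eta> i] by simp
 ultimately show ?thesis using sphere_grad_mult[of 0 "\<lambda>_. c" n Z \<eta> i] assms by simp
qed

lemma has_vector_derivative_of_real_mult:
 "DERIV f x :> D \<Longrightarrow> ((\<lambda>s. of_real (f s) * (c::complex)) has_vector_derivative of_real D * c) (at x within S)"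
 by (intro has_vector_derivative_mult_left has_vector_derivative_of_real has_vector_derivative_at_within)
   (simp add: has_real_derivative_iff_has_vector_derivative)

lemma lap_sep:
 assumes m: "m \<ge> 1" and h: "\<And>x. DERIV h x :> h' x" "\<And>x. DERIV h' x :> h'' x"
  and Y: "C_upto 2 S2 Y" "\<And>\<omega>. \<omega> \<in> S2 \<Longrightarrow> sphere_lap Y \<omega> = - of_real L * Y \<omega>" and x: "x \<ge> x0" "\<omega> \<in> S2"
 shows "lap m x0 (sep m h Y) (x, \<omega>) = sep m (\<lambda>x. h'' x - pot m L x * h x) Y (x, \<omega>)"
  and "dx x0 (sep m h Y) (x, \<omega>) = of_real ((h' x * warp m x - h x * warp1 m x) / (warp m x)\<^sup>2) * Y \<omega>"
proof -
 note sd = sep_derivs[OF m h]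
 have d1: "dx x0 (sep m h Y) (x, \<omega>) = of_real ((h' x * warp m x - h x * warp1 m x) / (warp m x)\<^sup>2) * Y \<omega>" if "x \<ge> x0" for x
  by (rule dx_eqI[OF that]) (unfold sep_def split_conv, rule has_vector_derivative_of_real_mult[OF sd(1)])
 then show "dx x0 (sep m h Y) (x, \<omega>) = of_real ((h' x * warp m x - h x * warp1 m x) / (warp m x)\<^sup>2) * Y \<omega>" using x by simp
 have "dx x0 (\<lambda>q. (warp m (fst q))\<^sup>2 *\<^sub>R dx x0 (sep m h Y) q) (x, \<omega>)
   = dx x0 (\<lambda>q. of_real ((warp m (fst q))\<^sup>2 * ((h' (fst q) * warp m (fst q) - h (fst q) * warp1 m (fst q)) / (warp m (fst q))\<^sup>2)) * Y (snd q)) (x, \<omega>)"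
  by (rule dx_cong[OF x(1)]) (unfold fst_conv snd_conv, simp only: d1 scaleR_conv_of_real of_real_mult mult.assoc)
 also have "\<dots> = of_real ((h'' x - curv m x * h x) * warp m x) * Y \<omega>"
  by (rule dx_eqI[OF x(1)]) (unfold fst_conv snd_conv, rule has_vector_derivative_of_real_mult[OF sd(2)])
 finally have d2: "dx x0 (\<lambda>q. (warp m (fst q))\<^sup>2 *\<^sub>R dx x0 (sep m h Y) q) (x, \<omega>) = of_real ((h'' x - curv m x * h x) * warp m x) * Y \<omega>" .
 have Y2: "C_upto (Suc 1) S2 Y" using Y(1) by (simp add: numeral_2_eq_2)
 note g = sphere_grad_cmult
 have gl: "sphere_grad (\<lambda>\<eta>. sphere_grad (\<lambda>\<zeta>. c * Y \<zeta>) \<eta> $ i) \<omega> $ i = c * sphere_grad (\<lambda>\<eta>. sphere_grad Y \<eta> $ i) \<omega> $ i" for c i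
 proof -
  have Y1: "C_upto (Suc 0) S2 Y" "C_upto (Suc 0) S2 (\<lambda>\<eta>. sphere_grad Y \<eta> $ i)"
   using C_upto_mono[OF _ Y(1), of "Suc 0"] C_upto_sphere_grad[OF Y2] by auto
  have "sphere_grad (\<lambda>\<eta>. sphere_grad (\<lambda>\<zeta>. c * Y \<zeta>) \<eta> $ i) \<omega> = sphere_grad (\<lambda>\<eta>. c * sphere_grad Y \<eta> $ i) \<omega>"
   by (rule sphere_grad_cong[OF g[OF Y1(1)] x(2)])
  then show ?thesis using g[OF Y1(2) x(2)] by simp
 qed
 have "sphere_lap (\<lambda>\<eta>. sep m h Y (x, \<eta>)) \<omega> = of_real (h x / warp m x) * sphere_lap Y \<omega>"
  by (simp only: sep_def split_conv sphere_lap_def gl sum_distrib_left)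
 then have sl: "sphere_lap (\<lambda>\<eta>. sep m h Y (x, \<eta>)) \<omega> = of_real (- L * (h x / warp m x)) * Y \<omega>" by (simp add: Y(2)[OF x(2)])
 have "lap m x0 (sep m h Y) (x, \<omega>) = of_real ((1 / (warp m x)\<^sup>2) * ((h'' x - curv m x * h x) * warp m x) + (1 / (warp m x)\<^sup>2) * (- L * (h x / warp m x))) * Y \<omega>"
 proof -
  have "c *\<^sub>R (of_real a * y) + c *\<^sub>R (of_real b * y) = of_real (c * a + c * b) * y" for a b c :: real and y :: complex
   by (simp add: scaleR_conv_of_real algebra_simps)
  then show ?thesis unfolding lap_def split_conv d2 sl .
 qed
 also have "(1 / (warp m x)\<^sup>2) * ((h'' x - curv m x * h x) * warp m x) + (1 / (warp m x)\<^sup>2) * (- L * (h x / warp m x)) = (h'' x - pot m L x * h x) / warp m x"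
  by (simp add: pot_def bar_warp[OF m] field_simps power2_eq_square)
 finally show "lap m x0 (sep m h Y) (x, \<omega>) = sep m (\<lambda>x. h'' x - pot m L x * h x) Y (x, \<omega>)" by (simp add: sep_def)
qed

lemma has_vector_derivative_sphere_moment:
 fixes f :: "point \<Rightarrow> complex"
 assumes f: "C_upto (Suc n) ({x0..} \<times> S2) f" and Y: "continuous_on S2 Y" and x: "x \<ge> x0"
 shows "((\<lambda>x. \<integral>\<omega>. f (x, \<omega>) * Y \<omega> \<partial>\<sigma>) has_vector_derivative (\<integral>\<omega>. dx x0 f (x, \<omega>) * Y \<omega> \<partial>\<sigma>)) (at x within {x0..})"
proof (rule has_vector_derivative_integral_compact[OF finite_sphere_measure measurable_ident_sphere, where K=S2])
 fix s \<omega> assume "s \<in> {x0..}" "\<omega> \<in> S2"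
 then show "((\<lambda>s. f (s, \<omega>) * Y \<omega>) has_vector_derivative dx x0 f (s, \<omega>) * Y \<omega>) (at s within {x0..})"
  by (intro has_vector_derivative_mult_left C_upto_dx(2)[OF f]) auto
next
 have "continuous_on ({x0..} \<times> S2) (\<lambda>p. dx x0 f p * Y (snd p))"
  by (intro continuous_intros C_upto_imp_continuous[OF C_upto_dx(1)[OF f]] continuous_on_compose2[OF Y]) auto
 then show "continuous_on ({x0..} \<times> S2) (\<lambda>(s, \<omega>). dx x0 f (s, \<omega>) * Y \<omega>)" by (simp add: case_prod_unfold)
 show "continuous_on S2 (\<lambda>\<omega>. f (s, \<omega>) * Y \<omega>)" if "s \<in> {x0..}" for s
  by (intro continuous_intros continuous_on_slice[OF C_upto_imp_continuous[OF f] that] Y)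
qed (use x in auto)

text \<open>For fixed \<open>x\<close>, the moments of \<open>f\<close> and of its radial derivative against \<open>Y\<close> turn the claim
 into one of dimension one; the difference of the two integrands is then the derivative of the
 function \<open>B\<close>, which vanishes at both ends.\<close>

lemma green_separated:
 assumes m: "m \<ge> 1" and q: "\<And>x. DERIV q x :> q' x" "\<And>x. DERIV q' x :> q'' x"
  and qc: "continuous_on UNIV q''" and q0: "q x0 = 0" "q' X = 0" "\<And>x. x \<ge> X \<Longrightarrow> q x = 0" "\<And>x. x \<ge> X \<Longrightarrow> q'' x = 0" and X: "x0 \<le> X"
  and Y: "C_upto 2 S2 Y" "\<And>\<omega>. \<omega> \<in> S2 \<Longrightarrow> sphere_lap Y \<omega> = - of_real L * Y \<omega>"
  and f: "C_upto 2 ({x0..} \<times> S2) f" "\<And>\<omega>. \<omega> \<in> S2 \<Longrightarrow> f (x0, \<omega>) = 0"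
 shows "(\<integral>p. lap m x0 f p * sep m q Y p \<partial>vol m x0) = (\<integral>p. f p * sep m (\<lambda>x. q'' x - pot m L x * q x) Y p \<partial>vol m x0)"
proof -
 have f2: "C_upto (Suc 1) ({x0..} \<times> S2) f" using f(1) by (simp add: numeral_2_eq_2)
 have f1: "C_upto (Suc 0) ({x0..} \<times> S2) f" using C_upto_mono[OF _ f(1), of "Suc 0"] by simp
 have fd1: "C_upto (Suc 0) ({x0..} \<times> S2) (dx x0 f)" using C_upto_dx(1)[OF f2] by simp
 define A where "A = (\<lambda>q. (warp m (fst q))\<^sup>2 *\<^sub>R dx x0 f q)"
 have A: "C_upto (Suc 0) ({x0..} \<times> S2) A" unfolding A_def by (intro C_upto_scaleR C_upto_warp_sq fd1)
 have cf: "continuous_on ({x0..} \<times> S2) f" by (rule C_upto_imp_continuous[OF f1])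
 have cY: "continuous_on S2 Y" by (rule C_upto_imp_continuous[OF Y(1)])
 have cq: "continuous_on UNIV q" using DERIV_isCont[OF q(1)] by (auto intro!: continuous_at_imp_continuous_on)
 have cw: "continuous_on UNIV (warp m)" by (rule continuous_on_warp)
 have cpot: "continuous_on UNIV (pot m L)" using C_on_imp_continuous[OF C_on_pot[of 0]] .
 have csep: "continuous_on ({x0..} \<times> S2) (sep m h Y)" if "continuous_on UNIV h" for h
  unfolding sep_def case_prod_unfold
  by (intro continuous_intros continuous_on_compose2[OF cY] continuous_on_compose2[OF that] continuous_on_compose2[OF cw]) auto
 define r where "r = (\<lambda>x. q'' x - pot m L x * q x)"
 have cr: "continuous_on UNIV r" unfolding r_def by (intro continuous_intros qc cpot cq)
 define F where "F x = (\<integral>\<omega>. f (x, \<omega>) * Y \<omega> \<partial>\<sigma>)" for x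
 define F1 where "F1 x = (\<integral>\<omega>. dx x0 f (x, \<omega>) * Y \<omega> \<partial>\<sigma>)" for x
 define G where "G x = (\<integral>\<omega>. dx x0 A (x, \<omega>) * Y \<omega> \<partial>\<sigma>)" for x
 have dF: "(F has_vector_derivative F1 x) (at x within {x0..})" if "x \<ge> x0" for x
  unfolding F_def[abs_def] F1_def by (rule has_vector_derivative_sphere_moment[OF f1 cY that])
 have AF: "(\<integral>\<omega>. A (x, \<omega>) * Y \<omega> \<partial>\<sigma>) = of_real ((warp m x)\<^sup>2) * F1 x" for x
  unfolding A_def F1_def by (simp add: scaleR_conv_of_real mult.assoc)
 have dA: "((\<lambda>x. of_real ((warp m x)\<^sup>2) * F1 x) has_vector_derivative G x) (at x within {x0..})" if "x \<ge> x0" for x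
  using has_vector_derivative_sphere_moment[OF A cY that] unfolding AF G_def .
 define D where "D x = of_real (q x / warp m x) * G x - of_real ((q'' x - curv m x * q x) * warp m x) * F x" for x
 define B where "B x = of_real (q x / warp m x) * (of_real ((warp m x)\<^sup>2) * F1 x)
   - of_real ((warp m x)\<^sup>2 * ((q' x * warp m x - q x * warp1 m x) / (warp m x)\<^sup>2)) * F x" for x
 have "(D has_integral (B X - B x0)) {x0..X}"
 proof (rule fundamental_theorem_of_calculus[OF X])
  fix x assume x: "x \<in> {x0..X}"
  have 1: "((\<lambda>x. complex_of_real (q x / warp m x)) has_vector_derivative of_real ((q' x * warp m x - q x * warp1 m x) / (warp m x)\<^sup>2)) (at x within {x0..})"
   using has_vector_derivative_of_real_mult[OF sep_derivs(1)[OF m q], of 1 x "{x0..}"] by simp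
  have 2: "((\<lambda>x. complex_of_real ((warp m x)\<^sup>2 * ((q' x * warp m x - q x * warp1 m x) / (warp m x)\<^sup>2))) has_vector_derivative
    of_real ((q'' x - curv m x * q x) * warp m x)) (at x within {x0..})"
   using has_vector_derivative_of_real_mult[OF sep_derivs(2)[OF m q], of 1 x "{x0..}"] by simp
  have x': "x \<ge> x0" using x by simp
  have "(B has_vector_derivative (of_real (q x / warp m x) * G x + of_real ((q' x * warp m x - q x * warp1 m x) / (warp m x)\<^sup>2) * (of_real ((warp m x)\<^sup>2) * F1 x))
   - (of_real ((warp m x)\<^sup>2 * ((q' x * warp m x - q x * warp1 m x) / (warp m x)\<^sup>2)) * F1 x + of_real ((q'' x - curv m x * q x) * warp m x) * F x)) (at x within {x0..})"
   unfolding B_def[abs_def]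
   by (rule has_vector_derivative_diff[OF has_vector_derivative_mult[OF 1 dA[OF x']] has_vector_derivative_mult[OF 2 dF[OF x']]])
  moreover have "(of_real (q x / warp m x) * G x + of_real ((q' x * warp m x - q x * warp1 m x) / (warp m x)\<^sup>2) * (of_real ((warp m x)\<^sup>2) * F1 x))
   - (of_real ((warp m x)\<^sup>2 * ((q' x * warp m x - q x * warp1 m x) / (warp m x)\<^sup>2)) * F1 x + of_real ((q'' x - curv m x * q x) * warp m x) * F x) = D x"
   unfolding D_def of_real_mult by (simp only: mult_ac) (simp add: algebra_simps)
  ultimately have "(B has_vector_derivative D x) (at x within {x0..})" by (simp only:)
  then show "(B has_vector_derivative D x) (at x within {x0..X})"
   by (rule has_vector_derivative_within_subset) auto
 qed
 moreover have "B X = 0" using q0 by (simp add: B_def)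
 moreover have "F x0 = 0"
 proof -
  have "F x0 = (\<integral>\<omega>. 0 \<partial>\<sigma>)" unfolding F_def
   by (rule Bochner_Integration.integral_cong) (use f(2) in auto)
  then show ?thesis by simp
 qed
 then have "B x0 = 0" using q0 by (simp add: B_def)
 ultimately have D0: "(D has_integral 0) {x0..X}" by simp
 have lapf: "continuous_on ({x0..} \<times> S2) (lap m x0 f)" by (rule continuous_lap[OF f(1)])
 have cA: "continuous_on ({x0..} \<times> S2) (dx x0 A)" by (rule C_upto_imp_continuous[OF C_upto_dx(1)[OF A]])
 have lhs: "(warp m x)\<^sup>2 *\<^sub>R (\<integral>\<omega>. lap m x0 f (x, \<omega>) * sep m q Y (x, \<omega>) \<partial>\<sigma>) = of_real (q x / warp m x) * (G x - of_real L * F x)"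
  if x: "x \<ge> x0" for x
 proof -
  have sl: "C_upto 2 S2 (\<lambda>\<eta>. f (x, \<eta>))" by (rule C_upto_slice[OF f(1)]) (use x in simp)
  have i: "integrable sphere_measure (\<lambda>\<omega>. dx x0 A (x, \<omega>) * Y \<omega>)" "integrable sphere_measure (\<lambda>\<omega>. sphere_lap (\<lambda>\<eta>. f (x, \<eta>)) \<omega> * Y \<omega>)"
   using continuous_on_slice[OF cA, of x] continuous_on_slice[OF continuous_sphere_lap[OF f(1)], of x] x
   by (auto intro!: integrable_sphere continuous_on_mult cY)
  have "(warp m x)\<^sup>2 *\<^sub>R (\<integral>\<omega>. lap m x0 f (x, \<omega>) * sep m q Y (x, \<omega>) \<partial>\<sigma>)
    = (\<integral>\<omega>. of_real (q x / warp m x) * (dx x0 A (x, \<omega>) * Y \<omega> + sphere_lap (\<lambda>\<eta>. f (x, \<eta>)) \<omega> * Y \<omega>) \<partial>\<sigma>)"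
   unfolding integral_scaleR_right[symmetric]
   by (rule Bochner_Integration.integral_cong) (simp_all add: lap_def sep_def A_def scaleR_add_right algebra_simps)
  also have "\<dots> = of_real (q x / warp m x) * (G x + (\<integral>\<omega>. sphere_lap (\<lambda>\<eta>. f (x, \<eta>)) \<omega> * Y \<omega> \<partial>\<sigma>))"
   unfolding integral_mult_right_zero G_def by (simp only: Bochner_Integration.integral_add[OF i])
  also have "(\<integral>\<omega>. sphere_lap (\<lambda>\<eta>. f (x, \<eta>)) \<omega> * Y \<omega> \<partial>\<sigma>) = - of_real L * F x"
   unfolding F_def by (rule sphere_green_eigen[OF sl Y])
  finally show ?thesis by simp
 qed
 have rhs: "(warp m x)\<^sup>2 *\<^sub>R (\<integral>\<omega>. f (x, \<omega>) * sep m r Y (x, \<omega>) \<partial>\<sigma>) = of_real (warp m x * r x) * F x" for x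
 proof -
  have "(warp m x)\<^sup>2 *\<^sub>R (\<integral>\<omega>. f (x, \<omega>) * sep m r Y (x, \<omega>) \<partial>\<sigma>) = (\<integral>\<omega>. of_real (warp m x * r x) * (f (x, \<omega>) * Y \<omega>) \<partial>\<sigma>)"
   unfolding integral_scaleR_right[symmetric]
   by (rule Bochner_Integration.integral_cong) (simp_all add: sep_def scaleR_conv_of_real power2_eq_square)
  then show ?thesis by (simp only: integral_mult_right_zero F_def)
 qed
 have cF: "continuous_on {x0..X} F"
  using has_vector_derivative_continuous[OF dF] continuous_on_subset[of "{x0..}" F "{x0..X}"]
  by (auto simp: continuous_on_eq_continuous_within)
 have I: "((\<lambda>x. of_real (warp m x * r x) * F x) has_integral integral {x0..X} (\<lambda>x. of_real (warp m x * r x) * F x)) {x0..X}"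
  by (intro integrable_integral integrable_continuous_real continuous_intros cF continuous_on_subset[OF cw] continuous_on_subset[OF cr]) auto
 have pt: "of_real (q x / warp m x) * (G x - of_real L * F x) = D x + of_real (warp m x * r x) * F x" for x
 proof -
  have "complex_of_real (q x / warp m x) * of_real L = of_real (warp m x * (pot m L x - curv m x) * q x)"
   unfolding of_real_mult[symmetric] by (simp add: pot_def bar_warp[OF m] power2_eq_square)
  then have e: "complex_of_real (q x / warp m x) * of_real L * F x = of_real (warp m x * (pot m L x - curv m x) * q x) * F x" by simp
  have "of_real (q x / warp m x) * (G x - of_real L * F x) = of_real (q x / warp m x) * G x - complex_of_real (q x / warp m x) * of_real L * F x"
   by (simp only: right_diff_distrib mult.assoc)
  also have "\<dots> = D x + of_real (warp m x * r x) * F x" unfolding e D_def r_def by (simp add: algebra_simps)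
  finally show ?thesis .
 qed
 have "(\<integral>p. lap m x0 f p * sep m q Y p \<partial>vol m x0) = integral {x0..X} (\<lambda>x. (warp m x)\<^sup>2 *\<^sub>R (\<integral>\<omega>. lap m x0 f (x, \<omega>) * sep m q Y (x, \<omega>) \<partial>\<sigma>))"
  by (rule integral_vol_compact(2)[OF continuous_on_mult[OF lapf csep[OF cq]] X]) (simp add: sep_def q0)
 also have "\<dots> = integral {x0..X} (\<lambda>x. D x + of_real (warp m x * r x) * F x)"
  by (rule Henstock_Kurzweil_Integration.integral_cong) (simp only: lhs atLeastAtMost_iff pt)
 also have "\<dots> = integral {x0..X} (\<lambda>x. of_real (warp m x * r x) * F x)"
  using integral_unique[OF has_integral_add[OF D0 I]] by simp
 also have "\<dots> = integral {x0..X} (\<lambda>x. (warp m x)\<^sup>2 *\<^sub>R (\<integral>\<omega>. f (x, \<omega>) * sep m r Y (x, \<omega>) \<partial>\<sigma>))"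
  by (simp only: rhs)
 also have "\<dots> = (\<integral>p. f p * sep m r Y p \<partial>vol m x0)"
  by (rule integral_vol_compact(2)[OF continuous_on_mult[OF cf csep[OF cr]] X, symmetric]) (simp add: sep_def r_def q0)
 finally show ?thesis unfolding r_def .
qed

section \<open>Powers of the radial operator\<close>

lemma C_on_Suc_real:
 assumes "C_on (Suc n) UNIV (f :: real \<Rightarrow> real)"
 shows "C_on n UNIV (deriv f)" "DERIV f x :> deriv f x"
proof -
 have d: "DERIV f x :> frechet_derivative f (at x) 1" for x
 proof -
  have fd: "(f has_derivative frechet_derivative f (at x)) (at x)" using C_on_has_derivative[OF assms] by simp
  have "frechet_derivative f (at x) v = frechet_derivative f (at x) 1 * v" for v
   using linear_cmul[OF has_derivative_linear[OF fd], of v 1] by (simp add: mult.commute)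
  then have "frechet_derivative f (at x) = (*) (frechet_derivative f (at x) 1)" by (rule ext)
  then show ?thesis unfolding has_field_derivative_def by (rule has_derivative_eq_rhs[OF fd])
 qed
 then have e: "deriv f x = frechet_derivative f (at x) 1" for x by (rule DERIV_imp_deriv)
 show "DERIV f x :> deriv f x" using d[of x] e by simp
 have "C_on n UNIV (\<lambda>x. frechet_derivative f (at x) 1)" using assms by simp
 then show "C_on n UNIV (deriv f)" by (simp add: e[abs_def])
qed

text \<open>The bounds are uniform over the modes, so the coefficients are functions of the angular
 parameter \<open>L\<close>, the energy \<open>\<mu>\<close> and \<open>x\<close>. Only the well \<open>[x\<^sub>0, 0]\<close> matters, as quasimodes vanish to
 its right.\<close>

definition poly_bdd :: "real \<Rightarrow> (real \<Rightarrow> real \<Rightarrow> real \<Rightarrow> real) \<Rightarrow> bool" where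
 "poly_bdd x0 f \<longleftrightarrow> (\<exists>C N. C \<ge> 0 \<and> (\<forall>L\<ge>1. \<forall>\<mu>\<in>{0..L}. \<forall>x\<in>{x0..0}. \<bar>f L \<mu> x\<bar> \<le> C * L ^ N))"

text \<open>Regularity in \<open>x\<close> of order \<open>n\<close> with polynomial bounds on all these derivatives.\<close>

fun tame :: "real \<Rightarrow> nat \<Rightarrow> (real \<Rightarrow> real \<Rightarrow> real \<Rightarrow> real) \<Rightarrow> bool" where
 "tame x0 0 f \<longleftrightarrow> poly_bdd x0 f \<and> (\<forall>L \<mu>. continuous_on UNIV (f L \<mu>))"
| "tame x0 (Suc n) f \<longleftrightarrow> poly_bdd x0 f \<and>
   (\<exists>f'. (\<forall>L \<mu> x. DERIV (f L \<mu>) x :> f' L \<mu> x) \<and> tame x0 n f')"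

lemma tame_poly_bdd: "tame x0 n f \<Longrightarrow> poly_bdd x0 f"
 by (cases n) auto

lemma tame_C_on: "tame x0 n f \<Longrightarrow> C_on n UNIV (f L \<mu>)"
proof (induction n arbitrary: f)
 case (Suc n)
 then obtain f' where f': "\<And>L \<mu> x. DERIV (f L \<mu>) x :> f' L \<mu> x" "tame x0 n f'" by auto
 show ?case
  by (rule C_on_Suc_vector[OF open_UNIV _ Suc.IH[OF f'(2)]])
    (use f'(1) in \<open>simp add: has_real_derivative_iff_has_vector_derivative\<close>)
qed auto

lemma tame_SucD: "tame x0 (Suc n) f \<Longrightarrow> tame x0 n f"
proof (induction n arbitrary: f)
 case 0
 then obtain f' where f': "\<And>L \<mu> x. DERIV (f L \<mu>) x :> f' L \<mu> x" "poly_bdd x0 f" by auto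
 then show ?case using DERIV_isCont[OF f'(1)] by (auto intro!: continuous_at_imp_continuous_on)
next
 case (Suc n)
 then obtain f' where f': "\<And>L \<mu> x. DERIV (f L \<mu>) x :> f' L \<mu> x" "poly_bdd x0 f" "tame x0 (Suc n) f'" by auto
 show ?case unfolding tame.simps(2)[of x0 n f] using f' Suc.IH[OF f'(3)] by blast
qed

lemma poly_bdd_add:
 assumes "poly_bdd x0 f" "poly_bdd x0 g" shows "poly_bdd x0 (\<lambda>L \<mu> x. f L \<mu> x + g L \<mu> x)"
proof -
 obtain C N where f: "C \<ge> 0" "\<And>L \<mu> x. L \<ge> 1 \<Longrightarrow> \<mu> \<in> {0..L} \<Longrightarrow> x \<in> {x0..0} \<Longrightarrow> \<bar>f L \<mu> x\<bar> \<le> C * L ^ N"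
  using assms(1) unfolding poly_bdd_def by blast
 obtain D M where g: "D \<ge> 0" "\<And>L \<mu> x. L \<ge> 1 \<Longrightarrow> \<mu> \<in> {0..L} \<Longrightarrow> x \<in> {x0..0} \<Longrightarrow> \<bar>g L \<mu> x\<bar> \<le> D * L ^ M"
  using assms(2) unfolding poly_bdd_def by blast
 show ?thesis unfolding poly_bdd_def
 proof (rule exI[of _ "C + D"], rule exI[of _ "N + M"], intro conjI allI ballI impI)
  show "0 \<le> C + D" using f g by simp
  fix L \<mu> x :: real assume a: "1 \<le> L" "\<mu> \<in> {0..L}" "x \<in> {x0..0}"
  have "C * L ^ N \<le> C * L ^ (N + M)" "D * L ^ M \<le> D * L ^ (N + M)"
   using a f(1) g(1) by (auto intro!: mult_left_mono power_increasing)
  then show "\<bar>f L \<mu> x + g L \<mu> x\<bar> \<le> (C + D) * L ^ (N + M)"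
   using f(2)[OF a] g(2)[OF a] abs_triangle_ineq[of "f L \<mu> x" "g L \<mu> x"] by (simp only: distrib_right)
 qed
qed

lemma poly_bdd_mult:
 assumes "poly_bdd x0 f" "poly_bdd x0 g" shows "poly_bdd x0 (\<lambda>L \<mu> x. f L \<mu> x * g L \<mu> x)"
proof -
 obtain C N where f: "C \<ge> 0" "\<And>L \<mu> x. L \<ge> 1 \<Longrightarrow> \<mu> \<in> {0..L} \<Longrightarrow> x \<in> {x0..0} \<Longrightarrow> \<bar>f L \<mu> x\<bar> \<le> C * L ^ N"
  using assms(1) unfolding poly_bdd_def by blast
 obtain D M where g: "D \<ge> 0" "\<And>L \<mu> x. L \<ge> 1 \<Longrightarrow> \<mu> \<in> {0..L} \<Longrightarrow> x \<in> {x0..0} \<Longrightarrow> \<bar>g L \<mu> x\<bar> \<le> D * L ^ M"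
  using assms(2) unfolding poly_bdd_def by blast
 show ?thesis unfolding poly_bdd_def
 proof (rule exI[of _ "C * D"], rule exI[of _ "N + M"], intro conjI allI ballI impI)
  show "0 \<le> C * D" using f g by simp
  fix L \<mu> x :: real assume a: "1 \<le> L" "\<mu> \<in> {0..L}" "x \<in> {x0..0}"
  have "\<bar>f L \<mu> x\<bar> * \<bar>g L \<mu> x\<bar> \<le> (C * L ^ N) * (D * L ^ M)"
   using f(1) a by (intro mult_mono f(2)[OF a] g(2)[OF a]) auto
  then show "\<bar>f L \<mu> x * g L \<mu> x\<bar> \<le> (C * D) * L ^ (N + M)" by (simp add: abs_mult power_add mult_ac)
 qed
qed

lemma tame_add: "tame x0 n f \<Longrightarrow> tame x0 n g \<Longrightarrow> tame x0 n (\<lambda>L \<mu> x. f L \<mu> x + g L \<mu> x)"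
proof (induction n arbitrary: f g)
 case 0
 then show ?case by (auto intro!: poly_bdd_add continuous_intros)
next
 case (Suc n)
 obtain f' where f': "\<And>L \<mu> x. DERIV (f L \<mu>) x :> f' L \<mu> x" "tame x0 n f'" using Suc.prems(1) by auto
 obtain g' where g': "\<And>L \<mu> x. DERIV (g L \<mu>) x :> g' L \<mu> x" "tame x0 n g'" using Suc.prems(2) by auto
 show ?case unfolding tame.simps
 proof (intro conjI exI[of _ "\<lambda>L \<mu> x. f' L \<mu> x + g' L \<mu> x"] allI)
  show "poly_bdd x0 (\<lambda>L \<mu> x. f L \<mu> x + g L \<mu> x)" by (intro poly_bdd_add tame_poly_bdd[OF Suc.prems(1)] tame_poly_bdd[OF Suc.prems(2)])
  show "DERIV (\<lambda>x. f L \<mu> x + g L \<mu> x) x :> f' L \<mu> x + g' L \<mu> x" for L \<mu> x by (rule DERIV_add[OF f'(1) g'(1)])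
  show "tame x0 n (\<lambda>L \<mu> x. f' L \<mu> x + g' L \<mu> x)" by (rule Suc.IH[OF f'(2) g'(2)])
 qed
qed

lemma tame_mult: "tame x0 n f \<Longrightarrow> tame x0 n g \<Longrightarrow> tame x0 n (\<lambda>L \<mu> x. f L \<mu> x * g L \<mu> x)"
proof (induction n arbitrary: f g)
 case 0
 then show ?case by (auto intro!: poly_bdd_mult continuous_intros)
next
 case (Suc n)
 obtain f' where f': "\<And>L \<mu> x. DERIV (f L \<mu>) x :> f' L \<mu> x" "tame x0 n f'" using Suc.prems(1) by auto
 obtain g' where g': "\<And>L \<mu> x. DERIV (g L \<mu>) x :> g' L \<mu> x" "tame x0 n g'" using Suc.prems(2) by auto
 note fg = tame_SucD[OF Suc.prems(1)] tame_SucD[OF Suc.prems(2)]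
 show ?case unfolding tame.simps
 proof (intro conjI exI[of _ "\<lambda>L \<mu> x. f' L \<mu> x * g L \<mu> x + g' L \<mu> x * f L \<mu> x"] allI)
  show "poly_bdd x0 (\<lambda>L \<mu> x. f L \<mu> x * g L \<mu> x)" by (intro poly_bdd_mult tame_poly_bdd[OF Suc.prems(1)] tame_poly_bdd[OF Suc.prems(2)])
  show "DERIV (\<lambda>x. f L \<mu> x * g L \<mu> x) x :> f' L \<mu> x * g L \<mu> x + g' L \<mu> x * f L \<mu> x" for L \<mu> x by (rule DERIV_mult[OF f'(1) g'(1)])
  show "tame x0 n (\<lambda>L \<mu> x. f' L \<mu> x * g L \<mu> x + g' L \<mu> x * f L \<mu> x)" by (rule tame_add[OF Suc.IH[OF f'(2) fg(2)] Suc.IH[OF g'(2) fg(1)]])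
 qed
qed

lemma tame_fixed: "C_on n UNIV g \<Longrightarrow> tame x0 n (\<lambda>L \<mu>. g)"
proof (induction n arbitrary: g)
 case 0
 then have c: "continuous_on UNIV g" by simp
 have "poly_bdd x0 (\<lambda>L \<mu>. g)"
 proof -
  have "bounded (g ` {x0..0})"
   by (intro compact_imp_bounded compact_continuous_image continuous_on_subset[OF c]) auto
  then obtain B where "\<And>x. x \<in> {x0..0} \<Longrightarrow> \<bar>g x\<bar> \<le> B" unfolding bounded_iff by (metis imageI real_norm_def)
  then have "\<bar>g x\<bar> \<le> \<bar>B\<bar> * L ^ 0" if "x \<in> {x0..0}" for x and L :: real using that by fastforce
  then show ?thesis unfolding poly_bdd_def by (intro exI[of _ "\<bar>B\<bar>"] exI[of _ 0]) auto
 qed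
 then show ?case using c by simp
next
 case (Suc n)
 have "poly_bdd x0 (\<lambda>L \<mu>. g)" using tame_poly_bdd[OF Suc.IH[OF C_on_SucD[OF Suc.prems]]] .
 moreover have "tame x0 n (\<lambda>L \<mu>. deriv g)" by (rule Suc.IH[OF C_on_Suc_real(1)[OF Suc.prems]])
 ultimately show ?case unfolding tame.simps
  by (intro conjI exI[of _ "\<lambda>L \<mu>. deriv g"] allI C_on_Suc_real(2)[OF Suc.prems])
qed

lemma tame_parameter:
 assumes "C \<ge> 0" "\<And>L \<mu>. L \<ge> 1 \<Longrightarrow> \<mu> \<in> {0..L} \<Longrightarrow> \<bar>c L \<mu>\<bar> \<le> C * L ^ N"
 shows "tame x0 n (\<lambda>L \<mu> x. c L \<mu>)"
proof -
 have p: "poly_bdd x0 (\<lambda>L \<mu> x. c L \<mu>)" unfolding poly_bdd_def using assms by (intro exI[of _ C] exI[of _ N]) auto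
 have "tame x0 k (\<lambda>L \<mu> x. 0)" for k by (rule tame_fixed) (rule C_on_const[OF open_UNIV])
 then show ?thesis using p by (cases n) (auto intro!: exI[of _ "\<lambda>L \<mu> x. 0"])
qed

lemma tame_pot: "tame x0 n (\<lambda>L \<mu>. pot m L)"
proof -
 have "tame x0 n (\<lambda>L \<mu> x. curv m x + L * bar m x)"
 proof (intro tame_add tame_mult)
  show "tame x0 n (\<lambda>L \<mu>. curv m)" by (rule tame_fixed[OF C_on_curv])
  show "tame x0 n (\<lambda>L \<mu>. bar m)" by (rule tame_fixed[OF C_on_bar])
  show "tame x0 n (\<lambda>L \<mu> x. L)" by (rule tame_parameter[of 1 _ 1]) auto
 qed
 then show ?thesis by (simp add: pot_def[abs_def])
qed

lemma tame_mu: "tame x0 n (\<lambda>L \<mu> x. \<mu>)" and tame_real: "tame x0 n (\<lambda>L \<mu> x. c)"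
 by (rule tame_parameter[of 1 _ 1]; auto) (rule tame_fixed[OF C_on_const[OF open_UNIV]])

definition mode :: "nat \<Rightarrow> real \<Rightarrow> real \<Rightarrow> (real \<Rightarrow> real) \<Rightarrow> (real \<Rightarrow> real) \<Rightarrow> bool" where
 "mode m L \<mu> \<psi> \<psi>' \<longleftrightarrow> (\<forall>x. DERIV \<psi> x :> \<psi>' x) \<and> (\<forall>x. DERIV \<psi>' x :> (pot m L x - \<mu>) * \<psi> x)"

lemma mode_smooth:
 assumes "mode m L \<mu> \<psi> \<psi>'" shows "C_on n UNIV \<psi> \<and> C_on n UNIV \<psi>'"
proof (induction n)
 case 0
 have "isCont \<psi> x" "isCont \<psi>' x" for x using assms DERIV_isCont unfolding mode_def by blast+
 then show ?case by (auto intro!: continuous_at_imp_continuous_on)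
next
 case (Suc n)
 have "C_on n UNIV (\<lambda>x. (pot m L x - \<mu>) * \<psi> x)"
  by (intro C_on_mult C_on_diff C_on_pot C_on_const conjunct1[OF Suc] open_UNIV)
 then show ?case using assms Suc unfolding mode_def
  by (auto intro!: C_on_Suc_vector simp: has_real_derivative_iff_has_vector_derivative simp del: C_on.simps)
qed

text \<open>Since a mode satisfies a linear equation of second order with tame coefficients,
 differentiation preserves the combinations of \<open>\<psi>\<close> and \<open>\<psi>'\<close> with tame coefficients. Here \<open>H\<close>
 assigns a function to every mode.\<close>

definition tame_comb :: "nat \<Rightarrow> real \<Rightarrow> (real \<Rightarrow> real \<Rightarrow> (real \<Rightarrow> real) \<Rightarrow> (real \<Rightarrow> real) \<Rightarrow> real \<Rightarrow> real) \<Rightarrow> bool" where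
 "tame_comb m x0 H \<longleftrightarrow> (\<exists>\<alpha> \<beta>. (\<forall>n. tame x0 n \<alpha>) \<and> (\<forall>n. tame x0 n \<beta>) \<and>
   (\<forall>L \<mu> \<psi> \<psi>'. mode m L \<mu> \<psi> \<psi>' \<longrightarrow> H L \<mu> \<psi> \<psi>' = (\<lambda>x. \<alpha> L \<mu> x * \<psi> x + \<beta> L \<mu> x * \<psi>' x)))"

lemma tame_deriv:
 assumes "\<And>n. tame x0 n f"
 shows "\<exists>f'. (\<forall>L \<mu> x. DERIV (f L \<mu>) x :> f' L \<mu> x) \<and> (\<forall>n. tame x0 n f')"
proof -
 obtain f' where f': "\<And>L \<mu> x. DERIV (f L \<mu>) x :> f' L \<mu> x" using assms[of 1] by auto
 have "tame x0 n f'" for n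
 proof -
  obtain g where g: "\<And>L \<mu> x. DERIV (f L \<mu>) x :> g L \<mu> x" "tame x0 n g" using assms[of "Suc n"] by auto
  have "g = f'" using DERIV_unique[OF g(1) f'] by (intro ext) blast
  then show ?thesis using g by simp
 qed
 then show ?thesis using f' by blast
qed

lemma tame_comb_deriv:
 assumes "tame_comb m x0 H"
 shows "tame_comb m x0 (\<lambda>L \<mu> \<psi> \<psi>'. deriv (H L \<mu> \<psi> \<psi>'))"
  and "mode m L \<mu> \<psi> \<psi>' \<Longrightarrow> DERIV (H L \<mu> \<psi> \<psi>') x :> deriv (H L \<mu> \<psi> \<psi>') x"
proof -
 obtain \<alpha> \<beta> where ab: "\<And>n. tame x0 n \<alpha>" "\<And>n. tame x0 n \<beta>" and
  H: "\<And>L \<mu> \<psi> \<psi>'. mode m L \<mu> \<psi> \<psi>' \<Longrightarrow> H L \<mu> \<psi> \<psi>' = (\<lambda>x. \<alpha> L \<mu> x * \<psi> x + \<beta> L \<mu> x * \<psi>' x)"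
  using assms unfolding tame_comb_def by blast
 obtain \<alpha>' where a': "\<And>L \<mu> x. DERIV (\<alpha> L \<mu>) x :> \<alpha>' L \<mu> x" "\<And>n. tame x0 n \<alpha>'" using tame_deriv[OF ab(1)] by blast
 obtain \<beta>' where b': "\<And>L \<mu> x. DERIV (\<beta> L \<mu>) x :> \<beta>' L \<mu> x" "\<And>n. tame x0 n \<beta>'" using tame_deriv[OF ab(2)] by blast
 let ?A = "\<lambda>L \<mu> x. \<alpha>' L \<mu> x + \<beta> L \<mu> x * (pot m L x + (-1) * \<mu>)" and ?B = "\<lambda>L \<mu> x. \<alpha> L \<mu> x + \<beta>' L \<mu> x"
 have d: "DERIV (H L \<mu> \<psi> \<psi>') x :> ?A L \<mu> x * \<psi> x + ?B L \<mu> x * \<psi>' x" if "mode m L \<mu> \<psi> \<psi>'" for L \<mu> \<psi> \<psi>' x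
 proof -
  have p: "DERIV \<psi> x :> \<psi>' x" "DERIV \<psi>' x :> (pot m L x - \<mu>) * \<psi> x"
   using that by (auto simp: mode_def)
  show ?thesis unfolding H[OF that]
   using DERIV_add[OF DERIV_mult[OF a'(1) p(1)] DERIV_mult[OF b'(1) p(2)]] by (simp add: algebra_simps)
 qed
 then have e: "deriv (H L \<mu> \<psi> \<psi>') = (\<lambda>x. ?A L \<mu> x * \<psi> x + ?B L \<mu> x * \<psi>' x)" if "mode m L \<mu> \<psi> \<psi>'" for L \<mu> \<psi> \<psi>'
  using that by (intro ext DERIV_imp_deriv) blast
 have "tame x0 n ?A" "tame x0 n ?B" for n
  by (intro tame_add tame_mult tame_pot tame_mu tame_real a' b' ab)+
 then show "tame_comb m x0 (\<lambda>L \<mu> \<psi> \<psi>'. deriv (H L \<mu> \<psi> \<psi>'))"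
  unfolding tame_comb_def using e by (intro exI[of _ ?A] exI[of _ ?B]) auto
 assume mo: "mode m L \<mu> \<psi> \<psi>'"
 show "DERIV (H L \<mu> \<psi> \<psi>') x :> deriv (H L \<mu> \<psi> \<psi>') x"
  unfolding DERIV_imp_deriv[OF d[OF mo]] by (rule d[OF mo])
qed

lemma tame_comb_smooth:
 assumes "tame_comb m x0 H" "mode m L \<mu> \<psi> \<psi>'" shows "C_on n UNIV (H L \<mu> \<psi> \<psi>')"
proof -
 obtain \<alpha> \<beta> where ab: "\<And>n. tame x0 n \<alpha>" "\<And>n. tame x0 n \<beta>" and
  H: "\<And>L \<mu> \<psi> \<psi>'. mode m L \<mu> \<psi> \<psi>' \<Longrightarrow> H L \<mu> \<psi> \<psi>' = (\<lambda>x. \<alpha> L \<mu> x * \<psi> x + \<beta> L \<mu> x * \<psi>' x)"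
  using assms(1) unfolding tame_comb_def by blast
 show ?thesis unfolding H[OF assms(2)]
  using mode_smooth[OF assms(2), of n] by (intro C_on_add C_on_mult tame_C_on[OF ab(1)] tame_C_on[OF ab(2)] open_UNIV) auto
qed

lemma tame_comb_bound:
 assumes "tame_comb m x0 H"
 shows "\<exists>C N. C \<ge> 0 \<and> (\<forall>L\<ge>1. \<forall>\<mu>\<in>{0..L}. \<forall>\<psi> \<psi>'. mode m L \<mu> \<psi> \<psi>' \<longrightarrow>
   (\<forall>x\<in>{x0..0}. (H L \<mu> \<psi> \<psi>' x)\<^sup>2 \<le> C * L ^ N * ((\<psi> x)\<^sup>2 + (\<psi>' x)\<^sup>2)))"
proof -
 obtain \<alpha> \<beta> where ab: "\<And>n. tame x0 n \<alpha>" "\<And>n. tame x0 n \<beta>" and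
  H: "\<And>L \<mu> \<psi> \<psi>'. mode m L \<mu> \<psi> \<psi>' \<Longrightarrow> H L \<mu> \<psi> \<psi>' = (\<lambda>x. \<alpha> L \<mu> x * \<psi> x + \<beta> L \<mu> x * \<psi>' x)"
  using assms unfolding tame_comb_def by blast
 have "poly_bdd x0 (\<lambda>L \<mu> x. \<alpha> L \<mu> x * \<alpha> L \<mu> x + \<beta> L \<mu> x * \<beta> L \<mu> x)"
  by (intro poly_bdd_add poly_bdd_mult tame_poly_bdd[OF ab(1)[of 0]] tame_poly_bdd[OF ab(2)[of 0]])
 then obtain C N where C: "C \<ge> 0" "\<And>L \<mu> x. L \<ge> 1 \<Longrightarrow> \<mu> \<in> {0..L} \<Longrightarrow> x \<in> {x0..0} \<Longrightarrow>
   \<bar>\<alpha> L \<mu> x * \<alpha> L \<mu> x + \<beta> L \<mu> x * \<beta> L \<mu> x\<bar> \<le> C * L ^ N"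
  unfolding poly_bdd_def by blast
 show ?thesis
 proof (rule exI[of _ C], rule exI[of _ N], intro conjI allI ballI impI)
  fix L \<mu> \<psi> \<psi>' x assume a: "L \<ge> 1" "\<mu> \<in> {0..L}" "mode m L \<mu> \<psi> \<psi>'" "x \<in> {x0..0}"
  have cs: "(a * u + b * w)\<^sup>2 \<le> (a * a + b * b) * (u\<^sup>2 + w\<^sup>2)" for a b u w :: real
   using zero_le_power2[of "a * w - b * u"] by (simp add: power2_eq_square algebra_simps)
  have "(H L \<mu> \<psi> \<psi>' x)\<^sup>2 \<le> (\<alpha> L \<mu> x * \<alpha> L \<mu> x + \<beta> L \<mu> x * \<beta> L \<mu> x) * ((\<psi> x)\<^sup>2 + (\<psi>' x)\<^sup>2)"
   unfolding H[OF a(3)] by (rule cs)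
  also have "\<dots> \<le> (C * L ^ N) * ((\<psi> x)\<^sup>2 + (\<psi>' x)\<^sup>2)"
   using C(2)[OF a(1,2,4)] by (intro mult_right_mono) auto
  finally show "(H L \<mu> \<psi> \<psi>' x)\<^sup>2 \<le> C * L ^ N * ((\<psi> x)\<^sup>2 + (\<psi>' x)\<^sup>2)" .
 qed (rule C(1))
qed

text \<open>The radial operator \<open>P\<close>: minus the Laplacian on separated functions.\<close>

definition Pop :: "nat \<Rightarrow> real \<Rightarrow> (real \<Rightarrow> real) \<Rightarrow> real \<Rightarrow> real" where
 "Pop m L h = (\<lambda>x. pot m L x * h x - deriv (deriv h) x)"

lemma tame_comb_Pop:
 assumes "tame_comb m x0 H"
 shows "tame_comb m x0 (\<lambda>L \<mu> \<psi> \<psi>'. Pop m L (H L \<mu> \<psi> \<psi>'))"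
proof -
 obtain \<alpha> \<beta> where ab: "\<And>n. tame x0 n \<alpha>" "\<And>n. tame x0 n \<beta>" and
  H: "\<And>L \<mu> \<psi> \<psi>'. mode m L \<mu> \<psi> \<psi>' \<Longrightarrow> H L \<mu> \<psi> \<psi>' = (\<lambda>x. \<alpha> L \<mu> x * \<psi> x + \<beta> L \<mu> x * \<psi>' x)"
  using assms unfolding tame_comb_def by blast
 obtain a b where ab2: "\<And>n. tame x0 n a" "\<And>n. tame x0 n b" and
  H2: "\<And>L \<mu> \<psi> \<psi>'. mode m L \<mu> \<psi> \<psi>' \<Longrightarrow> deriv (deriv (H L \<mu> \<psi> \<psi>')) = (\<lambda>x. a L \<mu> x * \<psi> x + b L \<mu> x * \<psi>' x)"
  using tame_comb_deriv(1)[OF tame_comb_deriv(1)[OF assms]] unfolding tame_comb_def by blast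
 let ?A = "\<lambda>L \<mu> x. pot m L x * \<alpha> L \<mu> x + (-1) * a L \<mu> x" and ?B = "\<lambda>L \<mu> x. pot m L x * \<beta> L \<mu> x + (-1) * b L \<mu> x"
 have "tame x0 n ?A" "tame x0 n ?B" for n by (intro tame_add tame_mult tame_pot tame_real ab ab2)+
 moreover have "Pop m L (H L \<mu> \<psi> \<psi>') = (\<lambda>x. ?A L \<mu> x * \<psi> x + ?B L \<mu> x * \<psi>' x)" if "mode m L \<mu> \<psi> \<psi>'" for L \<mu> \<psi> \<psi>'
  unfolding Pop_def by (subst H2[OF that], subst H[OF that]) (simp add: fun_eq_iff algebra_simps)
 ultimately show ?thesis unfolding tame_comb_def by (intro exI[of _ ?A] exI[of _ ?B]) auto
qed

lemma tame_comb_powers: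
 assumes "\<And>n. C_on n UNIV \<theta>"
 shows "tame_comb m x0 (\<lambda>L \<mu> \<psi> \<psi>'. (Pop m L ^^ j) (\<lambda>x. \<theta> x * \<psi> x))"
proof (induction j)
 case 0
 show ?case unfolding tame_comb_def
  by (rule exI[of _ "\<lambda>L \<mu>. \<theta>"], rule exI[of _ "\<lambda>L \<mu> x. 0"]) (use tame_fixed[OF assms] tame_real[of _ _ 0] in auto)
next
 case (Suc j)
 from tame_comb_Pop[OF this] show ?case by simp
qed

lemma Pop_local:
 assumes "open U" "x \<in> U" "\<And>y. y \<in> U \<Longrightarrow> h y = g y"
 shows "Pop m L h x = Pop m L g x"
proof -
 have d: "deriv f y = deriv k y" if "y \<in> U" "\<And>y. y \<in> U \<Longrightarrow> f y = k y" for f k :: "real \<Rightarrow> real" and y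
  by (rule deriv_cong_ev) (use assms(1) that in \<open>auto simp: eventually_nhds\<close>)
 have "deriv (deriv h) x = deriv (deriv g) x" by (rule d[OF assms(2) d[OF _ assms(3)]])
 then show ?thesis using assms(2,3) by (simp add: Pop_def)
qed

text \<open>Where the cutoff is constant, the quasimode is a multiple of the mode. This gives the
 boundary values of the powers (\<open>c = 1\<close>) and their support (\<open>c = 0\<close>).\<close>

lemma Pop_power_mode:
 assumes "mode m L \<mu> \<psi> \<psi>'" "open U" "\<And>y. y \<in> U \<Longrightarrow> h y = c * \<psi> y" "x \<in> U"
 shows "(Pop m L ^^ j) h x = \<mu> ^ j * c * \<psi> x"
 using assms(4)
proof (induction j arbitrary: x)
 case 0
 then show ?case using assms(3) by simp
next
 case (Suc j)
 have "(Pop m L ^^ Suc j) h x = Pop m L (\<lambda>y. \<mu> ^ j * c * \<psi> y) x"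
  using Pop_local[OF assms(2) Suc.prems, of "(Pop m L ^^ j) h" "\<lambda>y. \<mu> ^ j * c * \<psi> y"] Suc.IH by simp
 also have "\<dots> = \<mu> ^ Suc j * c * \<psi> x"
 proof -
  have 1: "deriv (\<lambda>y. \<mu> ^ j * c * \<psi> y) = (\<lambda>y. \<mu> ^ j * c * \<psi>' y)"
   using assms(1) by (intro ext DERIV_imp_deriv DERIV_cmult) (auto simp: mode_def)
  have 2: "deriv (\<lambda>y. \<mu> ^ j * c * \<psi>' y) = (\<lambda>y. \<mu> ^ j * c * ((pot m L y - \<mu>) * \<psi> y))"
   using assms(1) by (intro ext DERIV_imp_deriv DERIV_cmult) (auto simp: mode_def)
  show ?thesis unfolding Pop_def 1 2 by (simp add: algebra_simps)
 qed
 finally show ?case .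
qed

section \<open>Norms of separated functions\<close>

lemma continuous_on_compact_bound:
 fixes f :: "'a::metric_space \<Rightarrow> 'b::real_normed_vector"
 assumes "compact K" "continuous_on K f"
 shows "\<exists>B\<ge>0. \<forall>x\<in>K. norm (f x) \<le> B"
proof -
 have "bounded (f ` K)" by (intro compact_imp_bounded compact_continuous_image assms)
 then obtain a where "\<forall>y\<in>f ` K. norm y \<le> a" unfolding bounded_iff by blast
 then show ?thesis by (intro exI[of _ "max a 0"]) (auto intro: max.coboundedI1)
qed

lemma esqrt_le: "r \<le> ennreal b \<Longrightarrow> esqrt r \<le> ennreal (sqrt b)"
proof -
 assume r: "r \<le> ennreal b"
 then have "r \<noteq> \<infinity>" by (auto simp: top_unique)
 moreover have "enn2real r \<le> max b 0" using r by (cases r) (auto simp: ennreal_le_iff2 max_def split: if_splits)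
 then have "ennreal (sqrt (enn2real r)) \<le> ennreal (sqrt b)"
  by (cases "b \<ge> 0") (auto intro!: ennreal_leI simp: ennreal_neg)
 ultimately show ?thesis by (simp add: esqrt_def)
qed

lemma nn_integral_vol_compact:
 fixes k :: "point \<Rightarrow> real"
 assumes c: "continuous_on ({x0..} \<times> S2) k" and X: "x0 \<le> X" "\<And>x \<omega>. x \<ge> X \<Longrightarrow> \<omega> \<in> S2 \<Longrightarrow> k (x, \<omega>) = 0"
  and nn: "\<And>p. k p \<ge> 0"
 shows "(\<integral>\<^sup>+p. ennreal (k p) \<partial>vol m x0) = ennreal (integral {x0..X} (\<lambda>x. (warp m x)\<^sup>2 * (\<integral>\<omega>. k (x, \<omega>) \<partial>\<sigma>)))"
 using nn_integral_eq_integral[OF integral_vol_compact(1)[OF c X]] integral_vol_compact(2)[OF c X] nn by simp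

lemma L2_norm_le:
 assumes "(\<integral>\<^sup>+p. ennreal ((norm (f p))\<^sup>2) \<partial>M) \<le> ennreal b"
 shows "L2_norm M f \<le> ennreal (sqrt b)"
 unfolding L2_norm_def by (rule esqrt_le[OF assms])

text \<open>Used for widths \<open>d\<close> tending to zero: truncation at the boundary changes a function and its
 gradient by a bounded amount, and only on a collar.\<close>

lemma L2_norm_collar:
 fixes f :: "point \<Rightarrow> 'b::real_normed_vector"
 assumes f: "\<And>p. p \<in> {x0<..} \<times> S2 \<Longrightarrow> norm (f p) \<le> B" "\<And>p. p \<in> {x0<..} \<times> S2 \<Longrightarrow> fst p \<ge> x0 + d \<Longrightarrow> f p = 0"
  and A: "\<And>x. x \<in> {x0..x0 + 2} \<Longrightarrow> (warp m x)\<^sup>2 \<le> A" and d: "0 \<le> d" "d \<le> 2"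
 shows "L2_norm (vol m x0) f \<le> ennreal (sqrt (A * B\<^sup>2 * (4 * pi) * d))"
proof (rule L2_norm_le)
 have A0: "A \<ge> 0" using A[of x0] zero_le_power2[of "warp m x0"] by (simp only: atLeastAtMost_iff) linarith
 have m: "(\<lambda>p::point. ennreal (B\<^sup>2) * indicator {..x0 + d} (fst p)) \<in> borel_measurable (vol m x0)"
 proof -
  have "fst \<in> vol m x0 \<rightarrow>\<^sub>M borel" by (rule measurable_vol_continuous) (intro continuous_intros)
  then show ?thesis by measurable
 qed
 have "(\<integral>\<^sup>+p. ennreal ((norm (f p))\<^sup>2) \<partial>vol m x0) \<le> (\<integral>\<^sup>+p. ennreal (B\<^sup>2) * indicator {..x0 + d} (fst p) \<partial>vol m x0)"
 proof (rule nn_integral_mono)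
  fix p assume "p \<in> space (vol m x0)"
  then have p: "p \<in> {x0<..} \<times> S2" by simp
  show "ennreal ((norm (f p))\<^sup>2) \<le> ennreal (B\<^sup>2) * indicator {..x0 + d} (fst p)"
  proof (cases "fst p \<ge> x0 + d")
   case True then show ?thesis using f(2)[OF p] by simp
  next
   case False then show ?thesis using power_mono[OF f(1)[OF p], of 2] by (simp add: ennreal_leI)
  qed
 qed
 also have "\<dots> = (\<integral>\<^sup>+ x. ennreal ((warp m x)\<^sup>2) * (\<integral>\<^sup>+ \<omega>. ennreal (B\<^sup>2) * indicator {..x0 + d} x \<partial>\<sigma>) * indicator {x0<..} x \<partial>lborel)"
  using nn_integral_vol[OF m] by simp
 also have "\<dots> \<le> (\<integral>\<^sup>+ x. ennreal (A * B\<^sup>2 * (4 * pi)) * indicator {x0..x0 + d} x \<partial>lborel)"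
 proof (rule nn_integral_mono)
  fix x
  show "ennreal ((warp m x)\<^sup>2) * (\<integral>\<^sup>+ \<omega>. ennreal (B\<^sup>2) * indicator {..x0 + d} x \<partial>\<sigma>) * indicator {x0<..} x
    \<le> ennreal (A * B\<^sup>2 * (4 * pi)) * indicator {x0..x0 + d} x"
  proof (cases "x \<in> {x0<..x0 + d}")
   case True
   have "(\<integral>\<^sup>+ \<omega>. ennreal (B\<^sup>2) * indicator {..x0 + d} x \<partial>\<sigma>) = ennreal (B\<^sup>2 * (4 * pi))"
    using True by (simp add: emeasure_sphere_measure ennreal_mult)
   moreover have "(warp m x)\<^sup>2 * (B\<^sup>2 * (4 * pi)) \<le> A * (B\<^sup>2 * (4 * pi))"
    using True d by (intro mult_right_mono A) auto
   ultimately show ?thesis using True A0 by (simp add: ennreal_mult[symmetric] mult.assoc ennreal_leI)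
  qed (auto simp: indicator_def)
 qed
 also have "\<dots> = ennreal (A * B\<^sup>2 * (4 * pi) * d)"
  using d A0 by (subst nn_integral_cmult) (auto simp: ennreal_mult)
 finally show "(\<integral>\<^sup>+p. ennreal ((norm (f p))\<^sup>2) \<partial>vol m x0) \<le> ennreal (A * B\<^sup>2 * (4 * pi) * d)" .
qed

lemma warp_ge_1: "warp m x \<ge> 1"
proof -
 have "0 \<le> x ^ (2 * m)" by (rule zero_le_even_power) simp
 then have "(x ^ (2 * m) + 1) powr 0 \<le> (x ^ (2 * m) + 1) powr (1 / real (2 * m))" by (intro powr_mono) auto
 then show ?thesis using warp_base_pos[of x m] by (simp add: warp_def)
qed

lemma C_on_sep:
 assumes "C_on n UNIV h" "C_on n UNIV Y"
 shows "C_on n UNIV (\<lambda>p. c * sep m h Y p)"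
proof -
 have "C_on n UNIV (\<lambda>x. h x * (1 / warp m x))"
  by (intro C_on_mult C_on_inverse C_on_warp assms warp_pos open_UNIV)
 then have h: "C_on n UNIV (\<lambda>x. h x / warp m x)" by simp
 have "C_on n UNIV (\<lambda>p::point. complex_of_real (h (fst p) / warp m (fst p)))"
  by (rule C_on_of_real[OF open_UNIV C_on_compose[OF open_UNIV subset_UNIV C_on_fst[OF open_UNIV] h]])
 from C_on_mult[OF open_UNIV C_on_const[OF open_UNIV] C_on_mult[OF open_UNIV this C_on_compose[OF open_UNIV subset_UNIV C_on_snd[OF open_UNIV] assms(2)]]]
 show ?thesis by (simp add: sep_def case_prod_unfold)
qed

text \<open>The form of the gradient of a separated function; the functions \<open>d\<close> and \<open>e\<close> stand for its
 radial derivative and \<open>h / a\<^sup>2\<close>. Being linear in both, it also describes differences of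
 gradients.\<close>

definition sepgrad :: "complex \<Rightarrow> (real^3 \<Rightarrow> complex) \<Rightarrow> (real \<Rightarrow> real) \<Rightarrow> (real \<Rightarrow> real) \<Rightarrow> point \<Rightarrow> complex \<times> (complex^3)" where
 "sepgrad c Y d e = (\<lambda>(x, \<omega>). (c * of_real (d x) * Y \<omega>, \<chi> i. c * of_real (e x) * sphere_grad Y \<omega> $ i))"

lemma norm_sepgrad:
 "(norm (sepgrad c Y d e (x, \<omega>)))\<^sup>2 = (norm c)\<^sup>2 * ((d x)\<^sup>2 * (norm (Y \<omega>))\<^sup>2 + (e x)\<^sup>2 * (norm (sphere_grad Y \<omega>))\<^sup>2)"
proof -
 have "(\<chi> i. c * of_real (e x) * sphere_grad Y \<omega> $ i) = (\<chi> i. (c * of_real (e x)) * sphere_grad Y \<omega> $ i)" by simp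
 have "(norm (\<chi> i. c * of_real (e x) * sphere_grad Y \<omega> $ i))\<^sup>2 = (\<Sum>i\<in>UNIV. (norm (c * of_real (e x) * sphere_grad Y \<omega> $ i))\<^sup>2)"
  by (simp add: norm_vec_def L2_set_def sum_nonneg)
 also have "\<dots> = (norm c)\<^sup>2 * (e x)\<^sup>2 * (\<Sum>i\<in>UNIV. (norm (sphere_grad Y \<omega> $ i))\<^sup>2)"
  unfolding sum_distrib_left by (rule sum.cong) (auto simp: norm_mult power_mult_distrib)
 also have "(\<Sum>i\<in>UNIV. (norm (sphere_grad Y \<omega> $ i))\<^sup>2) = (norm (sphere_grad Y \<omega>))\<^sup>2"
  by (simp add: norm_vec_def L2_set_def sum_nonneg)
 finally show ?thesis
  by (simp add: sepgrad_def norm_Pair norm_mult power_mult_distrib algebra_simps)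
qed

lemma grad_sep:
 assumes m: "m \<ge> 1" and h: "\<And>x. DERIV h x :> h' x"
  and Y: "C_upto 1 S2 Y" and p: "x \<ge> x0" "\<omega> \<in> S2"
 shows "grad m x0 (\<lambda>p. c * sep m h Y p) (x, \<omega>) = sepgrad c Y (\<lambda>x. (h' x * warp m x - h x * warp1 m x) / (warp m x)\<^sup>2) (\<lambda>x. h x / (warp m x)\<^sup>2) (x, \<omega>)"
proof -
 have Y1: "C_upto (Suc 0) S2 Y" using Y by simp
 have d: "DERIV (\<lambda>x. h x / warp m x) x :> (h' x * warp m x - h x * warp1 m x) / (warp m x)\<^sup>2"
  using DERIV_divide[OF h DERIV_warp[OF m], of x] by (simp add: power2_eq_square)
 have "dx x0 (\<lambda>p. c * sep m h Y p) (x, \<omega>) = c * (of_real ((h' x * warp m x - h x * warp1 m x) / (warp m x)\<^sup>2) * Y \<omega>)"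
  by (rule dx_eqI[OF p(1)])
    (unfold sep_def split_conv, rule has_vector_derivative_mult_right, rule has_vector_derivative_of_real_mult[OF d])
 moreover have "sphere_grad (\<lambda>\<eta>. c * sep m h Y (x, \<eta>)) \<omega> $ i = c * of_real (h x / warp m x) * sphere_grad Y \<omega> $ i" for i
  using sphere_grad_cmult[OF Y1 p(2), of "c * of_real (h x / warp m x)"] by (simp add: sep_def mult.assoc)
 ultimately show ?thesis
  unfolding grad_def sepgrad_def split_conv prod.inject vec_eq_iff vector_scaleR_component vec_lambda_beta
  by (simp add: scaleR_conv_of_real power2_eq_square mult_ac)
qed

lemma C_on_step_comp: "C_on n UNIV (\<lambda>x. step (a * x + b))"
 by (rule C_on_compose[OF open_UNIV subset_UNIV _ C_on_step])
   (intro C_on_add C_on_mult C_on_const C_on_id open_UNIV)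

lemma continuous_sphere_grad:
 assumes "C_upto 1 S2 Y"
 shows "continuous_on S2 (\<lambda>\<omega>. sphere_grad Y \<omega>)"
proof -
 have "C_upto (Suc 0) S2 Y" using assms by simp
 from C_upto_imp_continuous[OF C_upto_sphere_grad[OF this]]
 have "continuous_on S2 (\<lambda>\<omega>. \<chi> i. sphere_grad Y \<omega> $ i)" by (intro continuous_on_vec_lambda)
 then show ?thesis by simp
qed

lemma continuous_sepgrad:
 assumes "continuous_on A d" "continuous_on A e" "C_upto 1 S2 Y"
 shows "continuous_on (A \<times> S2) (sepgrad c Y d e)"
proof -
 have Y1: "C_upto (Suc 0) S2 Y" using assms by simp
 have cg: "continuous_on S2 (\<lambda>\<omega>. sphere_grad Y \<omega> $ i)" for i by (rule C_upto_imp_continuous[OF C_upto_sphere_grad[OF Y1]])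
 show ?thesis unfolding sepgrad_def case_prod_unfold
  by (intro continuous_on_Pair continuous_on_mult continuous_on_of_real continuous_on_vec_lambda continuous_on_const
    continuous_on_compose2[OF assms(1)] continuous_on_compose2[OF assms(2)] continuous_on_compose2[OF cg]
    continuous_on_compose2[OF C_upto_imp_continuous[OF assms(3)]] continuous_on_fst continuous_on_snd continuous_on_id) auto
qed

lemma sepgrad_diff: "sepgrad c Y d e p - sepgrad c Y d' e' p = sepgrad c Y (\<lambda>x. d x - d' x) (\<lambda>x. e x - e' x) p"
 by (cases p) (simp add: sepgrad_def vec_eq_iff algebra_simps)

lemma L2_normI_tendsto_0:
 assumes "\<And>n. L2_norm M (f n) \<le> ennreal (sqrt (b n))" "b \<longlonglongrightarrow> 0"
 shows "(\<lambda>n. L2_norm M (f n)) \<longlonglongrightarrow> 0"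
proof (rule tendsto_sandwich[OF _ _ tendsto_const])
 have "(\<lambda>n. sqrt (b n)) \<longlonglongrightarrow> sqrt 0" by (rule tendsto_real_sqrt[OF assms(2)])
 then show "(\<lambda>n. ennreal (sqrt (b n))) \<longlonglongrightarrow> 0" using tendsto_ennrealI by fastforce
qed (use assms(1) in auto)

lemma axis_in_S2: "axis 1 1 \<in> S2"
 by (simp add: norm_axis_1)

text \<open>Approximate by \<open>h \<theta>\<^sub>n\<close> with cutoffs \<open>\<theta>\<^sub>n\<close> that vanish near \<open>x\<^sub>0\<close> and equal \<open>1\<close> outside a
 collar of width of order \<open>1/n\<close>. The derivative of \<open>\<theta>\<^sub>n\<close> is of order \<open>n\<close>, but \<open>h\<close> is of order
 \<open>1/n\<close> on the collar since \<open>h x\<^sub>0 = 0\<close>. So the gradients converge in \<open>L\<^sup>2\<close>, although not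
 uniformly.\<close>

lemma H10_grad_sep:
 assumes m: "m \<ge> 1" and h: "\<And>n. C_on n UNIV h" and h0: "h x0 = 0" "\<And>x. x \<ge> X \<Longrightarrow> h x = 0" and X: "x0 < X"
  and Y: "\<And>n. C_on n UNIV Y"
 shows "H10_grad m x0 (\<lambda>p. c * sep m h Y p)
   (sepgrad c Y (\<lambda>x. (deriv h x * warp m x - h x * warp1 m x) / (warp m x)\<^sup>2) (\<lambda>x. h x / (warp m x)\<^sup>2))"
proof -
 have dh: "DERIV h x :> deriv h x" for x using C_on_Suc_real(2)[OF h[of "Suc 0"]] .
 have Y1: "C_upto 1 S2 Y" by (rule C_upto_of_C_on[OF Y])
 define D where "D = (\<lambda>h h' x. (h' x * warp m x - h x * warp1 m x) / (warp m x)\<^sup>2)"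
 define E where "E = (\<lambda>h x. h x / (warp m x)\<^sup>2)"
 have cont: "continuous_on UNIV h" "continuous_on UNIV (deriv h)" "continuous_on UNIV (warp m)" "continuous_on UNIV (warp1 m)"
  using C_on_imp_continuous[OF h[of 0]] C_on_imp_continuous[OF C_on_Suc_real(1)[OF h[of "Suc 0"]]] continuous_on_warp
   DERIV_isCont[OF DERIV_warp1[OF m]] by (auto intro!: continuous_at_imp_continuous_on)
 have cDE: "continuous_on UNIV (D h (deriv h))" "continuous_on UNIV (E h)"
  unfolding D_def E_def by (intro continuous_intros cont; simp)+
 \<comment> \<open>Zero up to \<open>x\<^sub>0 + 1/(n + 2)\<close> and one from \<open>x\<^sub>0 + 2/(n + 2)\<close>; the shift by \<open>2\<close> keeps all collars within \<open>[x\<^sub>0, x\<^sub>0 + 2]\<close>.\<close>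
 define th where "th n x = step ((real n + 2) * x + (- (real n + 2) * x0 - 1))" for n x
 have th0: "th n x = 0" if "x \<le> x0 + 1 / (real n + 2)" for n x
 proof -
  have "(real n + 2) * (x - x0) \<le> 1" using that by (simp add: field_simps)
  then show ?thesis unfolding th_def by (intro step_0) (simp add: algebra_simps)
 qed
 have th1: "th n x = 1" if "x \<ge> x0 + 2 / (real n + 2)" for n x
 proof -
  have "(real n + 2) * (x - x0) \<ge> 2" using that by (simp add: field_simps)
  then show ?thesis unfolding th_def by (intro step_1) (simp add: algebra_simps)
 qed
 have thr: "0 \<le> th n x" "th n x \<le> 1" for n x by (simp_all add: th_def step_range)
 have thC: "C_on k UNIV (th n)" for k n unfolding th_def[abs_def] by (rule C_on_step_comp)
 have "continuous_on {-1..3} (deriv step)"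
  by (rule continuous_on_subset[OF C_on_imp_continuous[OF C_on_Suc_real(1)[OF C_on_step[of "Suc 0"]]]]) simp
 from continuous_on_compact_bound[OF compact_Icc this] obtain K where K: "\<And>y. y \<in> {-1..3} \<Longrightarrow> \<bar>deriv step y\<bar> \<le> K"
  by (auto simp del: atLeastAtMost_iff)
 have dth: "DERIV (th n) x :> deriv step ((real n + 2) * x + (- (real n + 2) * x0 - 1)) * (real n + 2)" for n x
  unfolding th_def[abs_def]
  by (rule DERIV_chain2[OF C_on_Suc_real(2)[OF C_on_step[of "Suc 0"]]]) (auto intro!: derivative_eq_intros)
 define th' where "th' n x = deriv step ((real n + 2) * x + (- (real n + 2) * x0 - 1)) * (real n + 2)" for n x
 have th'0: "th' n x = 0" if "x > x0 + 2 / (real n + 2)" for n x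
 proof -
  have "DERIV (\<lambda>x. 1) x :> th' n x"
   using dth[of n x, folded th'_def]
   by (rule has_field_derivative_transform_within_open[where S="{x0 + 2 / (real n + 2)<..}"]) (use that th1 in auto)
  then show ?thesis using DERIV_unique[OF _ DERIV_const] by blast
 qed
 have th'b: "\<bar>th' n x\<bar> \<le> K * (real n + 2)" if "x \<in> {x0..x0 + 2 / (real n + 2)}" for n x
 proof -
  have "0 \<le> (real n + 2) * (x - x0)" using that by simp
  moreover have "(real n + 2) * (x - x0) \<le> 2" using that by (simp add: field_simps)
  ultimately have "\<bar>deriv step ((real n + 2) * x + (- (real n + 2) * x0 - 1))\<bar> \<le> K" by (intro K) (auto simp: algebra_simps)
  then show ?thesis unfolding th'_def by (simp add: abs_mult mult_right_mono)
 qed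
 define hn where "hn n x = h x * th n x" for n x
 define hn' where "hn' n x = deriv h x * th n x + th' n x * h x" for n x
 have hnC: "C_on k UNIV (hn n)" for k n unfolding hn_def by (intro C_on_mult h thC open_UNIV)
 have dhn: "DERIV (hn n) x :> hn' n x" for n x
  unfolding hn_def[abs_def] hn'_def th'_def by (rule DERIV_mult[OF dh dth])
 \<comment> \<open>Bounds on the collar, where everything happens.\<close>
 have "continuous_on {x0..x0+2} (\<lambda>x. (h x, deriv h x, warp1 m x, (warp m x)\<^sup>2))"
  by (rule continuous_on_subset[of UNIV]) (intro continuous_intros cont, simp)
 from continuous_on_compact_bound[OF compact_Icc this] obtain B where
  B: "\<And>x. x \<in> {x0..x0+2} \<Longrightarrow> norm (h x, deriv h x, warp1 m x, (warp m x)\<^sup>2) \<le> B" by blast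
 have Bs: "\<bar>h x\<bar> \<le> B" "\<bar>deriv h x\<bar> \<le> B" "\<bar>warp1 m x\<bar> \<le> B" "(warp m x)\<^sup>2 \<le> B" if "x \<in> {x0..x0+2}" for x
 proof -
  have a: "\<bar>h x\<bar> \<le> B" "norm (deriv h x, warp1 m x, (warp m x)\<^sup>2) \<le> B"
   using order_trans[OF norm_fst_le[of "h x"] B[OF that]] order_trans[OF norm_snd_le B[OF that]] by auto
  have b: "\<bar>deriv h x\<bar> \<le> B" "norm (warp1 m x, (warp m x)\<^sup>2) \<le> B"
   using order_trans[OF norm_fst_le[of "deriv h x"] a(2)] order_trans[OF norm_snd_le a(2)] by auto
  have c: "\<bar>warp1 m x\<bar> \<le> B" "\<bar>(warp m x)\<^sup>2\<bar> \<le> B"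
   using order_trans[OF norm_fst_le[of "warp1 m x"] b(2)] order_trans[OF norm_snd_le b(2)] by (simp_all only: real_norm_def)
  from a(1) b(1) c show "\<bar>h x\<bar> \<le> B" "\<bar>deriv h x\<bar> \<le> B" "\<bar>warp1 m x\<bar> \<le> B" "(warp m x)\<^sup>2 \<le> B" by simp_all
 qed
 have B0: "B \<ge> 0" using Bs(1)[of x0] by simp
 have hlin: "\<bar>h x\<bar> \<le> B * (x - x0)" if x: "x \<in> {x0..x0+2}" for x
 proof -
  have "norm (h x - h x0) \<le> B * norm (x - x0)"
  proof (rule field_differentiable_bound[of "{x0..x0+2}"])
   show "(h has_field_derivative deriv h z) (at z within {x0..x0+2})" for z by (rule has_field_derivative_at_within[OF dh])
  qed (use Bs x in auto)
  then show ?thesis using h0 x by simp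
 qed
 define M where "M = B + 2 * B * \<bar>K\<bar> + B + B * B"
 have dn: "2 / (real n + 2) \<le> 1" for n by (simp add: field_simps)
 have smallD: "\<bar>D (hn n) (hn' n) x - D h (deriv h) x\<bar> \<le> M" "\<bar>E (hn n) x - E h x\<bar> \<le> M" "\<bar>hn n x - h x\<bar> \<le> M"
  if x: "x \<in> {x0..x0 + 2 / (real n + 2)}" for n x
 proof -
  have x2: "x \<in> {x0..x0+2}" using x dn[of n] unfolding atLeastAtMost_iff by linarith
  have a1: "\<bar>hn n x - h x\<bar> \<le> B"
  proof -
   have "\<bar>hn n x - h x\<bar> = \<bar>h x\<bar> * \<bar>th n x - 1\<bar>" by (simp add: hn_def abs_mult[symmetric] algebra_simps)
   also have "\<dots> \<le> B * 1" using Bs(1)[OF x2] thr[of n x] B0 by (intro mult_mono) auto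
   finally show ?thesis by simp
  qed
  have "\<bar>th' n x * h x\<bar> \<le> 2 * B * \<bar>K\<bar>"
  proof -
   have "\<bar>th' n x\<bar> * \<bar>h x\<bar> \<le> (\<bar>K\<bar> * (real n + 2)) * (B * (2 / (real n + 2)))"
   proof (rule mult_mono)
    show "\<bar>th' n x\<bar> \<le> \<bar>K\<bar> * (real n + 2)"
     using th'b[OF x] mult_right_mono[OF abs_ge_self[of K], of "(real n + 2)"] by linarith
    have "B * (x - x0) \<le> B * (2 / (real n + 2))" using x B0 by (intro mult_left_mono) auto
    then show "\<bar>h x\<bar> \<le> B * (2 / (real n + 2))" using hlin[OF x2] by linarith
   qed auto
   moreover have "(\<bar>K\<bar> * (real n + 2)) * (B * (2 / (real n + 2))) = 2 * B * \<bar>K\<bar>" by (simp add: field_simps)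
   ultimately show ?thesis unfolding abs_mult by linarith
  qed
  moreover have "\<bar>deriv h x * th n x - deriv h x\<bar> \<le> B"
  proof -
   have "\<bar>deriv h x * th n x - deriv h x\<bar> = \<bar>deriv h x\<bar> * \<bar>th n x - 1\<bar>" by (simp add: abs_mult[symmetric] algebra_simps)
   also have "\<dots> \<le> B * 1" using Bs(2)[OF x2] thr[of n x] B0 by (intro mult_mono) auto
   finally show ?thesis by simp
  qed
  ultimately have a2: "\<bar>hn' n x - deriv h x\<bar> \<le> B + 2 * B * \<bar>K\<bar>" unfolding hn'_def by linarith
  have w: "warp m x \<ge> 1" "(warp m x)\<^sup>2 \<ge> 1" using warp_ge_1[of m x] by (auto simp: one_le_power)
  have "D (hn n) (hn' n) x - D h (deriv h) x = (hn' n x - deriv h x) / warp m x - (hn n x - h x) * warp1 m x / (warp m x)\<^sup>2"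
   unfolding D_def by (simp add: field_simps power2_eq_square)
  moreover have "\<bar>(hn' n x - deriv h x) / warp m x\<bar> \<le> B + 2 * B * \<bar>K\<bar>"
  proof -
   have "\<bar>hn' n x - deriv h x\<bar> / warp m x \<le> \<bar>hn' n x - deriv h x\<bar> / 1" using w by (intro divide_left_mono) auto
   then show ?thesis using a2 w by (simp add: abs_divide)
  qed
  moreover have "\<bar>(hn n x - h x) * warp1 m x / (warp m x)\<^sup>2\<bar> \<le> B * B"
  proof -
   have "\<bar>hn n x - h x\<bar> * \<bar>warp1 m x\<bar> \<le> B * B" using a1 Bs(3)[OF x2] B0 by (intro mult_mono) auto
   moreover have "(\<bar>hn n x - h x\<bar> * \<bar>warp1 m x\<bar>) / (warp m x)\<^sup>2 \<le> (\<bar>hn n x - h x\<bar> * \<bar>warp1 m x\<bar>) / 1" using w by (intro divide_left_mono) auto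
   ultimately show ?thesis by (simp add: abs_mult abs_divide)
  qed
  ultimately show "\<bar>D (hn n) (hn' n) x - D h (deriv h) x\<bar> \<le> M" using B0 unfolding M_def by linarith
  have "B \<le> M" using B0 unfolding M_def by simp
  then show "\<bar>hn n x - h x\<bar> \<le> M" using a1 by linarith
  have "E (hn n) x - E h x = (hn n x - h x) / (warp m x)\<^sup>2" by (simp add: E_def diff_divide_distrib)
  moreover have "\<bar>hn n x - h x\<bar> / (warp m x)\<^sup>2 \<le> \<bar>hn n x - h x\<bar> / 1" using w by (intro divide_left_mono) auto
  ultimately show "\<bar>E (hn n) x - E h x\<bar> \<le> M" using a1 \<open>B \<le> M\<close> by (simp add: abs_divide)
 qed
 have M0: "M \<ge> 0" using B0 unfolding M_def by simp
 have zero: "D (hn n) (hn' n) x - D h (deriv h) x = 0" "E (hn n) x - E h x = 0" "hn n x - h x = 0" if "x > x0 + 2 / (real n + 2)" for n x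
  using th1[of n x] th'0[OF that] that by (simp_all add: D_def E_def hn_def hn'_def)
 have "continuous_on S2 (\<lambda>\<omega>. (Y \<omega>, sphere_grad Y \<omega>))"
  by (intro continuous_on_Pair continuous_sphere_grad[OF Y1] C_upto_imp_continuous[OF Y1])
 from continuous_on_compact_bound[OF compact_sphere this] obtain BY where
  BY: "\<And>\<omega>. \<omega> \<in> S2 \<Longrightarrow> norm (Y \<omega>, sphere_grad Y \<omega>) \<le> BY" by blast
 have BY1: "norm (Y \<omega>) \<le> BY" "norm (sphere_grad Y \<omega>) \<le> BY" if "\<omega> \<in> S2" for \<omega>
  using order_trans[OF norm_fst_le BY[OF that]] order_trans[OF norm_snd_le BY[OF that]] by auto
 obtain \<omega>0 :: "real^3" where "\<omega>0 \<in> S2" using axis_in_S2 by blast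
 then have BY0: "BY \<ge> 0" using BY1(1)[of \<omega>0] norm_ge_zero[of "Y \<omega>0"] by linarith
 define Q where "Q = norm c * (M * BY + M * BY)"
 have gb: "norm (sepgrad c Y d e (x, \<omega>)) \<le> Q" if "\<bar>d x\<bar> \<le> M" "\<bar>e x\<bar> \<le> M" "\<omega> \<in> S2" for d e x \<omega>
 proof -
  have "(norm (sepgrad c Y d e (x, \<omega>)))\<^sup>2 \<le> (norm c)\<^sup>2 * ((M * BY)\<^sup>2 + (M * BY)\<^sup>2)"
   unfolding norm_sepgrad power_mult_distrib
   using that BY1[OF that(3)] M0 BY0 by (intro mult_left_mono add_mono mult_mono) (auto simp: abs_le_square_iff[symmetric])
  also have "\<dots> \<le> Q\<^sup>2"
  proof -
   have "(M * BY)\<^sup>2 + (M * BY)\<^sup>2 \<le> (M * BY + M * BY)\<^sup>2" using M0 BY0 by (simp add: power2_sum power_mult_distrib mult_ac)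
   then show ?thesis unfolding Q_def power_mult_distrib[of "norm c"] by (intro mult_left_mono) auto
  qed
  finally show ?thesis by (rule power2_le_imp_le) (use M0 BY0 in \<open>simp add: Q_def\<close>)
 qed
 define b where "b n = B * Q\<^sup>2 * (4 * pi) * (2 * (2 / (real n + 2)))" for n
 have Lim: "b \<longlonglongrightarrow> 0"
 proof -
  have "(\<lambda>n. B * Q\<^sup>2 * (4 * pi) * (2 * (2 * inverse (real (Suc (Suc n)))))) \<longlonglongrightarrow> B * Q\<^sup>2 * (4 * pi) * (2 * (2 * 0))"
   by (intro tendsto_intros LIMSEQ_Suc[OF LIMSEQ_inverse_real_of_nat])
  then show ?thesis by (simp add: b_def[abs_def] divide_inverse add.commute)
 qed
 have bmono: "ennreal (sqrt (B * Q\<^sup>2 * (4 * pi) * d)) \<le> ennreal (sqrt (b n))" if "0 \<le> d" "d \<le> 2 * (2 / (real n + 2))" for d n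
  unfolding b_def using B0 that by (intro ennreal_leI real_sqrt_le_mono mult_left_mono) auto
 let ?G = "sepgrad c Y (D h (deriv h)) (E h)"
 define \<phi> where "\<phi> n = (\<lambda>p. c * sep m (hn n) Y p)" for n
 have gphi: "grad m x0 (\<phi> n) p - ?G p = sepgrad c Y (\<lambda>x. D (hn n) (hn' n) x - D h (deriv h) x) (\<lambda>x. E (hn n) x - E h x) p"
  if "p \<in> {x0<..} \<times> S2" for n p
 proof -
  obtain x \<omega> where p: "p = (x, \<omega>)" "x > x0" "\<omega> \<in> S2" using \<open>p \<in> _\<close> by auto
  show ?thesis unfolding p \<phi>_def
   using grad_sep[OF m dhn Y1, of x0 x \<omega> c n] p sepgrad_diff[of c Y "D (hn n) (hn' n)" "E (hn n)" "(x, \<omega>)" "D h (deriv h)" "E h"]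
   by (simp add: D_def E_def)
 qed
 have xcase: "x \<in> {x0..x0 + 2 / (real n + 2)} \<or> x > x0 + 2 / (real n + 2)" if "x > x0" for x and n :: nat using that by auto
 have d2: "0 \<le> 2 * (2 / (real n + 2))" "2 * (2 / (real n + 2)) \<le> 2" "2 / (real n + 2) < 2 * (2 / (real n + 2))" for n :: nat
  using dn[of n] by (simp_all add: field_simps)
 have conv1: "(\<lambda>n. L2_norm (vol m x0) (\<lambda>p. grad m x0 (\<phi> n) p - ?G p)) \<longlonglongrightarrow> 0"
 proof (rule L2_normI_tendsto_0[OF _ Lim])
  fix n
  show "L2_norm (vol m x0) (\<lambda>p. grad m x0 (\<phi> n) p - ?G p) \<le> ennreal (sqrt (b n))"
   unfolding b_def
  proof (rule L2_norm_collar[OF _ _ Bs(4) d2(1,2)])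
   fix p assume p: "p \<in> {x0<..} \<times> S2"
   obtain x \<omega> where xo: "p = (x, \<omega>)" "x > x0" "\<omega> \<in> S2" using p by auto
   show "norm (grad m x0 (\<phi> n) p - ?G p) \<le> Q"
    unfolding gphi[OF p] unfolding xo
   proof (rule gb[OF _ _ xo(3)])
    show "\<bar>D (hn n) (hn' n) x - D h (deriv h) x\<bar> \<le> M" using smallD(1)[of x n] zero(1)[of n x] xcase[OF xo(2), of n] M0 by fastforce
    show "\<bar>E (hn n) x - E h x\<bar> \<le> M" using smallD(2)[of x n] zero(2)[of n x] xcase[OF xo(2), of n] M0 by fastforce
   qed
   assume "fst p \<ge> x0 + 2 * (2 / (real n + 2))"
   then have "x > x0 + 2 / (real n + 2)" using d2(3)[of n] xo by simp
   then show "grad m x0 (\<phi> n) p - ?G p = 0"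
    unfolding gphi[OF p] unfolding xo sepgrad_def split_conv using zero[of n x] by (simp add: zero_prod_def vec_eq_iff)
  qed
 qed
 have conv2: "(\<lambda>n. L2_norm (vol m x0) (\<lambda>p. indicator {q. fst q < Z} p *\<^sub>R (\<phi> n p - c * sep m h Y p))) \<longlonglongrightarrow> 0" for Z
 proof (rule L2_normI_tendsto_0[OF _ Lim])
  fix n
  show "L2_norm (vol m x0) (\<lambda>p. indicator {q. fst q < Z} p *\<^sub>R (\<phi> n p - c * sep m h Y p)) \<le> ennreal (sqrt (b n))"
   unfolding b_def
  proof (rule L2_norm_collar[OF _ _ Bs(4) d2(1,2)])
   fix p assume p: "p \<in> {x0<..} \<times> S2"
   obtain x \<omega> where xo: "p = (x, \<omega>)" "x > x0" "\<omega> \<in> S2" using p by auto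
   have e: "\<phi> n p - c * sep m h Y p = c * (of_real ((hn n x - h x) / warp m x) * Y \<omega>)"
    unfolding \<phi>_def xo sep_def by (simp add: algebra_simps diff_divide_distrib)
   have "\<bar>hn n x - h x\<bar> \<le> M" using smallD(3)[of x n] zero(3)[of n x] xcase[OF xo(2), of n] M0 by fastforce
   moreover have "\<bar>hn n x - h x\<bar> / warp m x \<le> \<bar>hn n x - h x\<bar> / 1"
    using warp_ge_1[of m x] by (intro divide_left_mono) auto
   ultimately have "\<bar>(hn n x - h x) / warp m x\<bar> \<le> M"
    using warp_ge_1[of m x] by (simp add: abs_divide)
   then have "\<bar>(hn n x - h x) / warp m x\<bar> * norm (Y \<omega>) \<le> M * BY" using BY1(1)[OF xo(3)] M0 by (intro mult_mono) auto
   then have "norm c * (\<bar>(hn n x - h x) / warp m x\<bar> * norm (Y \<omega>)) \<le> norm c * (M * BY + M * BY)"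
    using mult_nonneg_nonneg[OF M0 BY0] by (intro mult_left_mono) (linarith, simp)
   then have "norm c * (\<bar>(hn n x - h x) / warp m x\<bar> * norm (Y \<omega>)) \<le> Q" unfolding Q_def .
   then have "norm (\<phi> n p - c * sep m h Y p) \<le> Q" unfolding e norm_mult norm_of_real .
   moreover have "Q \<ge> 0" unfolding Q_def using M0 BY0 by simp
   ultimately show "norm (indicator {q. fst q < Z} p *\<^sub>R (\<phi> n p - c * sep m h Y p)) \<le> Q" by (simp add: indicator_def)
   assume "fst p \<ge> x0 + 2 * (2 / (real n + 2))"
   then have "x > x0 + 2 / (real n + 2)" using d2(3)[of n] xo by simp
   then show "indicator {q. fst q < Z} p *\<^sub>R (\<phi> n p - c * sep m h Y p) = 0"
    unfolding e using zero(3)[of n x] by simp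
  qed
 qed
 have tf: "test_fun x0 (\<phi> n)" for n
 proof -
  have "smooth_upto ({x0<..} \<times> S2) (\<phi> n)"
   unfolding smooth_upto_def \<phi>_def by (rule exI[of _ UNIV], rule exI[of _ "\<lambda>p. c * sep m (hn n) Y p"]) (use C_on_sep[OF hnC Y] in blast)
  moreover have "\<phi> n p = 0" if p: "p \<in> {x0<..} \<times> S2 - {x0 + 1 / (real n + 2)..X} \<times> S2" for p
  proof -
   obtain x \<omega> where xo: "p = (x, \<omega>)" "x > x0" "\<omega> \<in> S2" using p by auto
   have "x \<le> x0 + 1 / (real n + 2) \<or> x \<ge> X" using p xo by auto
   then have "hn n x = 0" using th0[of x n] h0(2)[of x] by (auto simp: hn_def)
   then show ?thesis by (simp add: \<phi>_def xo sep_def)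
  qed
  moreover have "compact ({x0 + 1 / (real n + 2)..X} \<times> S2)" by (intro compact_Times) auto
  moreover have "{x0 + 1 / (real n + 2)..X} \<times> S2 \<subseteq> {x0<..} \<times> S2"
  proof -
   have "1 / (real n + 2) > 0" by simp
   then have "x0 < x" if "x0 + 1 / (real n + 2) \<le> x" for x using that by linarith
   then show ?thesis by auto
  qed
  ultimately show ?thesis unfolding test_fun_def by blast
 qed
 have mf: "(\<lambda>p. c * sep m h Y p) \<in> borel_measurable (vol m x0)"
  by (rule measurable_vol_continuous) (rule continuous_on_subset[OF C_on_imp_continuous[OF C_on_sep[OF h[of 0] Y[of 0]]]], simp)
 have GL: "?G \<in> L2 (vol m x0)"
 proof -
  have cG: "continuous_on ({x0..} \<times> S2) ?G" by (rule continuous_sepgrad[OF _ _ Y1]) (rule continuous_on_subset[OF cDE(1)] continuous_on_subset[OF cDE(2)]; simp)+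
  have mG: "?G \<in> borel_measurable (vol m x0)"
   by (rule measurable_vol_continuous) (rule continuous_on_subset[OF cG], auto)
  have z: "?G (x, \<omega>) = 0" if "x \<ge> X + 1" for x \<omega>
  proof -
   have "DERIV (\<lambda>x. 0) x :> deriv h x"
    using dh[of x] by (rule has_field_derivative_transform_within_open[where S="{X<..}"]) (use that h0 in auto)
   then have "deriv h x = 0" using DERIV_unique[OF _ DERIV_const] by blast
   moreover have "h x = 0" using that by (intro h0) simp
   ultimately show ?thesis by (simp add: sepgrad_def D_def E_def zero_prod_def vec_eq_iff)
  qed
  have "continuous_on ({x0..} \<times> S2) (\<lambda>p. (norm (?G p))\<^sup>2)" by (intro continuous_intros cG)
  then have "(\<integral>\<^sup>+p. ennreal ((norm (?G p))\<^sup>2) \<partial>vol m x0) = ennreal (integral {x0..X+1} (\<lambda>x. (warp m x)\<^sup>2 * (\<integral>\<omega>. (norm (?G (x, \<omega>)))\<^sup>2 \<partial>\<sigma>)))"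
   by (rule nn_integral_vol_compact) (use X z in auto)
  then have "L2_norm (vol m x0) ?G \<le> ennreal (sqrt (integral {x0..X+1} (\<lambda>x. (warp m x)\<^sup>2 * (\<integral>\<omega>. (norm (?G (x, \<omega>)))\<^sup>2 \<partial>\<sigma>))))"
   by (intro L2_norm_le) simp
  then have "L2_norm (vol m x0) ?G < \<infinity>" by (rule le_less_trans) simp
  then show ?thesis using mG by (simp add: L2_def)
 qed
 have "H10_grad m x0 (\<lambda>p. c * sep m h Y p) ?G"
  unfolding H10_grad_def using mf GL tf conv1 conv2 by blast
 then show ?thesis unfolding D_def E_def .
qed

section \<open>Separated functions in the domain of the generator\<close>

text \<open>Normalized eigenfunctions, extended smoothly to the whole space so that products with them
 need no neighbourhoods.\<close>

definition eigenfunction :: "(real^3 \<Rightarrow> complex) \<Rightarrow> real \<Rightarrow> bool" where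
 "eigenfunction Y L \<longleftrightarrow> (\<forall>n. C_on n UNIV Y) \<and> (\<forall>\<omega>\<in>S2. sphere_lap Y \<omega> = - of_real L * Y \<omega>) \<and>
   (\<integral>\<omega>. (norm (Y \<omega>))\<^sup>2 \<partial>\<sigma>) = 1 \<and> (\<integral>\<omega>. (norm (sphere_grad Y \<omega>))\<^sup>2 \<partial>\<sigma>) = L"

lemma eigenfunctionD:
 assumes "eigenfunction Y L"
 shows "C_on n UNIV Y" "\<omega> \<in> S2 \<Longrightarrow> sphere_lap Y \<omega> = - of_real L * Y \<omega>"
  "(\<integral>\<omega>. (norm (Y \<omega>))\<^sup>2 \<partial>\<sigma>) = 1" "(\<integral>\<omega>. (norm (sphere_grad Y \<omega>))\<^sup>2 \<partial>\<sigma>) = L"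
  "C_upto n S2 Y" "continuous_on S2 Y" "continuous_on S2 (sphere_grad Y)"
proof -
 show a: "C_on n UNIV Y" for n using assms by (auto simp: eigenfunction_def)
 show u: "C_upto n S2 Y" for n by (rule C_upto_of_C_on[OF a])
 show "continuous_on S2 Y" by (rule C_upto_imp_continuous[OF u])
 show "continuous_on S2 (sphere_grad Y)" by (rule continuous_sphere_grad[OF u])
qed (use assms in \<open>auto simp: eigenfunction_def\<close>)

lemma ex_eigenfunction:
 assumes "l \<ge> 2" shows "\<exists>Y. eigenfunction Y (real (l * (l + 1)))"
proof -
 define N where "N = (\<integral>\<omega>. (norm (sph_harm l \<omega>))\<^sup>2 \<partial>\<sigma>)"
 have N: "N > 0" unfolding N_def by (rule integral_harm_pos)
 define c where "c = complex_of_real (1 / sqrt N)"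
 have c: "(norm c)\<^sup>2 = 1 / N" using N unfolding c_def norm_of_real by (simp add: power_divide)
 define Y where "Y \<omega> = c * sph_harm l \<omega>" for \<omega>
 have "C_on n UNIV Y" for n
  unfolding Y_def[abs_def] sph_harm_def[abs_def] by (intro C_on_mult C_on_const C_on_power C_on_bounded_linear zc_linear) auto
 moreover have g: "sphere_grad Y \<omega> $ i = c * sphere_grad (sph_harm l) \<omega> $ i" if "\<omega> \<in> S2" for \<omega> i
  unfolding Y_def[abs_def] by (rule sphere_grad_cmult[OF C_upto_harm[of "Suc 0"] that])
 moreover have "sphere_lap Y \<omega> = - of_real (real (l * (l + 1))) * Y \<omega>" if "\<omega> \<in> S2" for \<omega>
 proof -
  have "sphere_grad (\<lambda>\<eta>. sphere_grad Y \<eta> $ i) \<omega> $ i = c * sphere_grad (\<lambda>\<eta>. sphere_grad (sph_harm l) \<eta> $ i) \<omega> $ i" for i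
  proof -
   have "sphere_grad (\<lambda>\<eta>. sphere_grad Y \<eta> $ i) \<omega> = sphere_grad (\<lambda>\<eta>. c * sphere_grad (sph_harm l) \<eta> $ i) \<omega>"
    by (rule sphere_grad_cong[OF g that])
   then show ?thesis using sphere_grad_cmult[OF C_upto_sphere_grad[OF C_upto_harm[of "Suc (Suc 0)"]] that] by simp
  qed
  then have "sphere_lap Y \<omega> = c * sphere_lap (sph_harm l) \<omega>" by (simp add: sphere_lap_def sum_distrib_left)
  then show ?thesis using sphere_lap_harm[OF that assms] by (simp add: Y_def)
 qed
 moreover have "(\<integral>\<omega>. (norm (Y \<omega>))\<^sup>2 \<partial>\<sigma>) = 1"
  unfolding Y_def norm_mult power_mult_distrib using c N by (simp add: N_def)
 moreover have "(\<integral>\<omega>. (norm (sphere_grad Y \<omega>))\<^sup>2 \<partial>\<sigma>) = real (l * (l + 1))"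
 proof -
  have "(norm (sphere_grad Y \<omega>))\<^sup>2 = (norm c)\<^sup>2 * (norm (sphere_grad (sph_harm l) \<omega>))\<^sup>2" if "\<omega> \<in> S2" for \<omega>
  proof -
   have "(norm v)\<^sup>2 = (\<Sum>i\<in>UNIV. (norm (v $ i))\<^sup>2)" for v :: "complex^3" by (simp add: norm_vec_def L2_set_def sum_nonneg)
   then show ?thesis by (simp add: g[OF that] norm_mult power_mult_distrib sum_distrib_left)
  qed
  then have "(\<integral>\<omega>. (norm (sphere_grad Y \<omega>))\<^sup>2 \<partial>\<sigma>) = (\<integral>\<omega>. (norm c)\<^sup>2 * (norm (sphere_grad (sph_harm l) \<omega>))\<^sup>2 \<partial>\<sigma>)"
   by (intro Bochner_Integration.integral_cong) auto
  also have "\<dots> = real (l * (l + 1))" using c N integral_norm_grad_harm[OF assms] by (simp add: N_def)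
  finally show ?thesis .
 qed
 ultimately show ?thesis unfolding eigenfunction_def by blast
qed

text \<open>A test function vanishes near the boundary, so it extends by zero, and off the sphere it can
 be extended along rays. The extension satisfies the hypotheses of Green's formula up to the
 boundary.\<close>

lemma test_fun_extension:
 assumes "test_fun x0 \<phi>"
 shows "\<exists>G. C_upto 2 ({x0..} \<times> S2) G \<and> (\<forall>\<omega>. G (x0, \<omega>) = 0) \<and> (\<forall>p\<in>{x0<..} \<times> S2. G p = \<phi> p)"
proof -
 obtain U F where U: "open U" "{x0<..} \<times> S2 \<subseteq> U" "\<And>n. C_on n U F" "\<And>p. p \<in> {x0<..} \<times> S2 \<Longrightarrow> F p = \<phi> p"
  using assms unfolding test_fun_def smooth_upto_def by blast
 obtain K where K: "compact K" "K \<subseteq> {x0<..} \<times> S2" "\<And>p. p \<in> {x0<..} \<times> S2 - K \<Longrightarrow> \<phi> p = 0"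
 proof -
  obtain K where "compact K \<and> K \<subseteq> {x0<..} \<times> S2 \<and> (\<forall>p \<in> {x0<..} \<times> S2 - K. \<phi> p = 0)"
   using conjunct2[OF assms[unfolded test_fun_def]] by (elim exE)
  then show ?thesis using that[of K] by simp
 qed
 obtain c where c: "x0 < c" "\<And>p. p \<in> K \<Longrightarrow> c \<le> fst p"
 proof (cases "K = {}")
  case False
  have "compact (fst ` K)" by (intro compact_continuous_image continuous_intros K(1))
  from compact_attains_inf[OF this] obtain p where "p \<in> K" "\<forall>q\<in>K. fst p \<le> fst q" using False by blast
  then show ?thesis using that[of "fst p"] K(2) by force
 next
  case True
  have "x0 < x0 + 1" by simp
  with True that[of "x0 + 1"] show ?thesis by simp
 qed
 have small: "\<phi> p = 0" if "p \<in> {x0<..} \<times> S2" "fst p < c" for p using K(3)[of p] c(2)[of p] that by force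
 \<comment> \<open>On the overlap the second formula is zero as well: points of the sphere with \<open>x < c\<close> lie outside \<open>K\<close>.\<close>
 define G where "G p = (if fst p < c then 0 else F (fst p, sgn (snd p)))" for p
 define U1 U2 where "U1 = {p::point. fst p < c}" and "U2 = {p::point. x0 < fst p \<and> snd p \<noteq> 0}"
 have o: "open U1" "open U2" unfolding U1_def U2_def by (intro open_Collect_less open_Collect_conj open_Collect_neq continuous_intros)+
 have "C_on 2 U1 G" by (rule C_on_cong[OF o(1) _ C_on_const[OF o(1)]]) (simp add: G_def U1_def)
 moreover have "C_on 2 U2 G"
 proof (rule C_on_cong[OF o(2)])
  have sg: "(x, sgn y) \<in> {x0<..} \<times> S2" if "(x, y) \<in> U2" for x y using that by (simp add: U2_def norm_sgn)
  show "C_on 2 U2 (\<lambda>p. F (fst p, sgn (snd p)))"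
  proof (rule C_on_compose[OF o(2) _ _ U(3)])
   show "(\<lambda>p. (fst p, sgn (snd p))) ` U2 \<subseteq> U" using sg U(2) by force
   have "C_on 2 U2 (\<lambda>p::point. sgn (snd p))"
    by (rule C_on_compose[OF o(2) _ C_on_snd[OF o(2)] C_on_sgn]) (auto simp: U2_def)
   then show "C_on 2 U2 (\<lambda>p. (fst p, sgn (snd p)))" by (intro C_on_Pair C_on_fst o)
  qed
  show "F (fst p, sgn (snd p)) = G p" if "p \<in> U2" for p
  proof (cases "fst p < c")
   case True
   have "(fst p, sgn (snd p)) \<in> {x0<..} \<times> S2" using sg[of "fst p" "snd p"] that by simp
   then show ?thesis using True small[of "(fst p, sgn (snd p))"] U(4)[of "(fst p, sgn (snd p))"] by (simp add: G_def)
  qed (simp add: G_def)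
 qed
 ultimately have "C_on 2 (U1 \<union> U2) G" by (rule C_on_Un[OF o])
 moreover have "{x0..} \<times> S2 \<subseteq> U1 \<union> U2" using c(1) by (auto simp: U1_def U2_def)
 ultimately have "C_upto 2 ({x0..} \<times> S2) G" using o by (intro C_uptoI[where U="U1 \<union> U2" and F=G]) auto
 moreover have "G (x0, \<omega>) = 0" for \<omega> using c(1) by (simp add: G_def)
 moreover have "G p = \<phi> p" if "p \<in> {x0<..} \<times> S2" for p
 proof -
  have "sgn (snd p) = snd p" using that by (auto simp: sgn_div_norm)
  then show ?thesis using U(4)[OF that] small[OF that] by (simp add: G_def)
 qed
 ultimately show ?thesis by blast
qed

lemma lap_cong_interior:
 assumes "\<And>p. p \<in> {x0<..} \<times> S2 \<Longrightarrow> f p = g p" "p \<in> {x0<..} \<times> S2"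
 shows "lap m x0 f p = lap m x0 g p"
proof -
 have d: "dx x0 f q = dx x0 g q" if fg: "\<And>p. p \<in> {x0<..} \<times> S2 \<Longrightarrow> f p = g p" and q: "q \<in> {x0<..} \<times> S2" for f g q
 proof -
  obtain y \<eta> where q': "q = (y, \<eta>)" "y > x0" "\<eta> \<in> S2" using q by auto
  have "eventually (\<lambda>s. s \<in> {x0<..}) (nhds y)" by (rule eventually_nhds_in_open) (use q' in auto)
  then have "eventually (\<lambda>s. s \<in> {x0..} \<longrightarrow> f (s, \<eta>) = g (s, \<eta>)) (nhds y)"
   by eventually_elim (use fg q' in auto)
  then show ?thesis unfolding q' dx_def split_conv by (rule vector_derivative_cong_eq) (use q' in auto)
 qed
 obtain x \<omega> where p: "p = (x, \<omega>)" "x > x0" "\<omega> \<in> S2" using assms(2) by auto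
 have "dx x0 (\<lambda>q. (warp m (fst q))\<^sup>2 *\<^sub>R dx x0 f q) p = dx x0 (\<lambda>q. (warp m (fst q))\<^sup>2 *\<^sub>R dx x0 g q) p"
  by (rule d[OF _ assms(2)]) (simp only: d[OF assms(1)])
 moreover have "sphere_grad (\<lambda>\<zeta>. f (x, \<zeta>)) \<eta> = sphere_grad (\<lambda>\<zeta>. g (x, \<zeta>)) \<eta>" if "\<eta> \<in> S2" for \<eta>
  by (rule sphere_grad_cong[OF _ that]) (use p assms(1) in auto)
 then have "sphere_grad (\<lambda>\<eta>. sphere_grad (\<lambda>\<zeta>. f (x, \<zeta>)) \<eta> $ i) \<omega> = sphere_grad (\<lambda>\<eta>. sphere_grad (\<lambda>\<zeta>. g (x, \<zeta>)) \<eta> $ i) \<omega>" for i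
  by (intro sphere_grad_cong[OF _ p(3)]) simp
 then have "sphere_lap (\<lambda>\<eta>. f (x, \<eta>)) \<omega> = sphere_lap (\<lambda>\<eta>. g (x, \<eta>)) \<omega>" by (simp only: sphere_lap_def)
 ultimately show ?thesis unfolding p lap_def split_conv by simp
qed

lemma deriv_zero_beyond:
 assumes "\<And>x. x \<ge> X \<Longrightarrow> h x = 0" "x > X"
 shows "deriv h x = (0::real)"
proof (rule DERIV_imp_deriv)
 show "DERIV h x :> 0"
  by (rule has_field_derivative_transform_within_open[OF DERIV_const[of 0], where S="{X<..}"]) (use assms in auto)
qed

text \<open>Green's formula, with the test function in the place of the solution.\<close>

lemma weak_lap_sep:
 assumes m: "m \<ge> 1" and h: "\<And>n. C_on n UNIV h" and h0: "h x0 = 0" "\<And>x. x \<ge> X \<Longrightarrow> h x = 0" and X: "x0 < X"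
  and Y: "eigenfunction Y L"
 shows "weak_lap m x0 (\<lambda>p. c * sep m h Y p) (\<lambda>p. - c * sep m (Pop m L h) Y p)"
 unfolding weak_lap_def
proof (intro allI impI)
 fix \<phi> assume "test_fun x0 \<phi>"
 then obtain G where G: "C_upto 2 ({x0..} \<times> S2) G" "\<And>\<omega>. G (x0, \<omega>) = 0" "\<And>p. p \<in> {x0<..} \<times> S2 \<Longrightarrow> G p = \<phi> p"
  using test_fun_extension by blast
 have C1: "C_on n UNIV (deriv h)" and C2: "C_on n UNIV (deriv (deriv h))" for n
  using C_on_Suc_real(1)[OF h[of "Suc n"]] C_on_Suc_real(1)[OF C_on_Suc_real(1)[OF h[of "Suc (Suc n)"]]] by auto
 have z1: "deriv h x = 0" if "x > X" for x by (rule deriv_zero_beyond[OF h0(2) that])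
 have z2: "deriv (deriv h) x = 0" if "x > X + 1" for x by (rule deriv_zero_beyond[OF z1 that]) simp
 have gr: "(\<integral>p. lap m x0 G p * sep m h Y p \<partial>vol m x0) = (\<integral>p. G p * sep m (\<lambda>x. deriv (deriv h) x - pot m L x * h x) Y p \<partial>vol m x0)"
 proof (rule green_separated[OF m C_on_Suc_real(2)[OF h[of "Suc 0"]] C_on_Suc_real(2)[OF C1[of "Suc 0"]], where X="X + 2"])
  show "continuous_on UNIV (deriv (deriv h))" by (rule C_on_imp_continuous[OF C2[of 0]])
  show "deriv h (X + 2) = 0" by (rule z1) simp
  show "h x = 0" if "X + 2 \<le> x" for x using that by (intro h0) simp
  show "deriv (deriv h) x = 0" if "X + 2 \<le> x" for x using that by (intro z2) simp
  show "C_upto 2 S2 Y" by (rule eigenfunctionD(5)[OF Y])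
  show "sphere_lap Y \<omega> = - of_real L * Y \<omega>" if "\<omega> \<in> S2" for \<omega> by (rule eigenfunctionD(2)[OF Y that])
 qed (use h0 X G in auto)
 have "(\<integral>p. c * sep m h Y p * lap m x0 \<phi> p \<partial>vol m x0) = (\<integral>p. c * (lap m x0 G p * sep m h Y p) \<partial>vol m x0)"
 proof (rule Bochner_Integration.integral_cong)
  fix p assume "p \<in> space (vol m x0)"
  then have "lap m x0 G p = lap m x0 \<phi> p" by (intro lap_cong_interior G) simp_all
  then show "c * sep m h Y p * lap m x0 \<phi> p = c * (lap m x0 G p * sep m h Y p)" by simp
 qed simp
 also have "\<dots> = (\<integral>p. c * (G p * sep m (\<lambda>x. deriv (deriv h) x - pot m L x * h x) Y p) \<partial>vol m x0)"
  by (simp add: gr)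
 also have "\<dots> = (\<integral>p. - c * sep m (Pop m L h) Y p * \<phi> p \<partial>vol m x0)"
 proof (rule Bochner_Integration.integral_cong)
  fix p assume "p \<in> space (vol m x0)"
  then have "G p = \<phi> p" by (intro G) simp
  then show "c * (G p * sep m (\<lambda>x. deriv (deriv h) x - pot m L x * h x) Y p) = - c * sep m (Pop m L h) Y p * \<phi> p"
   by (cases p) (simp add: sep_def Pop_def diff_divide_distrib algebra_simps)
 qed simp
 finally show "(\<integral>p. c * sep m h Y p * lap m x0 \<phi> p \<partial>vol m x0) = (\<integral>p. - c * sep m (Pop m L h) Y p * \<phi> p \<partial>vol m x0)" .
qed

lemma integrable_sphere_continuous_norm:
 "continuous_on S2 f \<Longrightarrow> integrable sphere_measure (\<lambda>\<omega>. (norm (f \<omega>))\<^sup>2 :: real)"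
 by (rule integrable_sphere) (intro continuous_intros)

text \<open>The constant comes from the gradient: with \<open>w = a x\<close> and \<open>c = 1\<close>, the squared gradient of \<open>h Y / a\<close>,
 integrated over the sphere with weight \<open>w\<^sup>2\<close>, is \<open>(h' - h a'/w)\<^sup>2 + L h\<^sup>2 / w\<^sup>2\<close>.\<close>

lemma H10_sep:
 assumes m: "m \<ge> 1" and h: "\<And>n. C_on n UNIV h" and h0: "h x0 = 0" "\<And>x. x \<ge> X \<Longrightarrow> h x = 0" and X: "x0 < X" "X < 0"
  and Y: "eigenfunction Y L" and L: "L \<ge> 0" and A1: "\<And>x. x \<in> {x0..0} \<Longrightarrow> \<bar>warp1 m x\<bar> \<le> A1"
  and e: "\<And>x. x \<in> {x0..0} \<Longrightarrow> (h x)\<^sup>2 + (deriv h x)\<^sup>2 \<le> e x" "e integrable_on {x0..0}" "integral {x0..0} e \<le> b"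
 shows "(\<lambda>p. c * sep m h Y p) \<in> H10 m x0" (is ?A)
  and "H10_norm m x0 (\<lambda>p. c * sep m h Y p) \<le> ennreal (norm c * sqrt ((2 + 2 * A1\<^sup>2 + L) * b))" (is ?B)
  and "(\<lambda>p. c * sep m h Y p) \<in> L2 (vol m x0)" (is ?C)
  and "L2_norm (vol m x0) (\<lambda>p. c * sep m h Y p) \<le> ennreal (norm c * sqrt ((2 + 2 * A1\<^sup>2 + L) * b))" (is ?D)
proof -
 define D where "D x = (deriv h x * warp m x - h x * warp1 m x) / (warp m x)\<^sup>2" for x
 define E where "E x = h x / (warp m x)\<^sup>2" for x
 define K where "K = 2 + 2 * A1\<^sup>2 + L"
 have K: "K \<ge> 1" using L zero_le_power2[of A1] by (simp add: K_def)
 have H: "H10_grad m x0 (\<lambda>p. c * sep m h Y p) (sepgrad c Y D E)"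
  unfolding D_def[abs_def] E_def[abs_def] by (rule H10_grad_sep[OF m h h0 X(1) eigenfunctionD(1)[OF Y]])
 then show ?A unfolding H10_def by blast
 have cont: "continuous_on UNIV h" "continuous_on UNIV (deriv h)" "continuous_on UNIV (warp m)" "continuous_on UNIV (warp1 m)"
  using C_on_imp_continuous[OF h[of 0]] C_on_imp_continuous[OF C_on_Suc_real(1)[OF h[of "Suc 0"]]] continuous_on_warp
   DERIV_isCont[OF DERIV_warp1[OF m]] by (auto intro!: continuous_at_imp_continuous_on)
 have cD: "continuous_on UNIV D" "continuous_on UNIV E"
  unfolding D_def[abs_def] E_def[abs_def] by (intro continuous_intros cont; simp)+
 note ci = continuous_on_subset[OF _ subset_UNIV]
 have z: "h x = 0" "deriv h x = 0" if "x \<ge> 0" for x using h0(2)[of x] deriv_zero_beyond[of X h x, OF h0(2)] that X by auto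
 have b0: "b \<ge> 0"
 proof -
  have "0 \<le> integral {x0..0} e"
  proof (rule integral_nonneg[OF e(2)])
   fix x assume "x \<in> {x0..0}"
   then show "0 \<le> e x" using e(1)[of x] zero_le_power2[of "h x"] zero_le_power2[of "deriv h x"] by linarith
  qed
  then show ?thesis using e(3) by linarith
 qed
 have int: "integral {x0..0} g \<le> (norm c)\<^sup>2 * (K * b)"
  if g: "continuous_on UNIV g" "\<And>x. x \<in> {x0..0} \<Longrightarrow> g x \<le> (norm c)\<^sup>2 * (K * ((h x)\<^sup>2 + (deriv h x)\<^sup>2))" for g
 proof -
  have "integral {x0..0} g \<le> integral {x0..0} (\<lambda>x. (norm c)\<^sup>2 * (K * e x))"
  proof (rule integral_le)
   show "g integrable_on {x0..0}" by (rule integrable_continuous_real[OF ci[OF g(1)]])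
   show "(\<lambda>x. (norm c)\<^sup>2 * (K * e x)) integrable_on {x0..0}" by (intro integrable_on_mult_right e(2))
   fix x assume x: "x \<in> {x0..0}"
   have "(norm c)\<^sup>2 * (K * ((h x)\<^sup>2 + (deriv h x)\<^sup>2)) \<le> (norm c)\<^sup>2 * (K * e x)"
    using K by (intro mult_left_mono e(1)[OF x]) auto
   then show "g x \<le> (norm c)\<^sup>2 * (K * e x)" using g(2)[OF x] by linarith
  qed
  also have "\<dots> \<le> (norm c)\<^sup>2 * (K * b)" using e(3) K by (auto intro!: mult_left_mono)
  finally show ?thesis .
 qed
 have sq: "sqrt ((norm c)\<^sup>2 * (K * b)) = norm c * sqrt ((2 + 2 * A1\<^sup>2 + L) * b)" by (simp add: real_sqrt_mult K_def)
 have "H10_norm m x0 (\<lambda>p. c * sep m h Y p) \<le> L2_norm (vol m x0) (sepgrad c Y D E)"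
  unfolding H10_norm_def by (rule INF_lower) (use H in simp)
 also have "\<dots> \<le> ennreal (sqrt ((norm c)\<^sup>2 * (K * b)))"
 proof (rule L2_norm_le)
  have c: "continuous_on ({x0..} \<times> S2) (\<lambda>p. (norm (sepgrad c Y D E p))\<^sup>2)"
   by (intro continuous_on_power continuous_on_norm continuous_sepgrad ci[OF cD(1)] ci[OF cD(2)] eigenfunctionD(5)[OF Y])
  have sph: "(\<integral>\<omega>. (norm (sepgrad c Y D E (x, \<omega>)))\<^sup>2 \<partial>\<sigma>) = (norm c)\<^sup>2 * ((D x)\<^sup>2 + (E x)\<^sup>2 * L)" for x
   unfolding norm_sepgrad
   using integrable_sphere_continuous_norm[OF eigenfunctionD(6)[OF Y]] integrable_sphere_continuous_norm[OF eigenfunctionD(7)[OF Y]]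
   by (simp add: eigenfunctionD(3,4)[OF Y])
  have "(\<integral>\<^sup>+p. ennreal ((norm (sepgrad c Y D E p))\<^sup>2) \<partial>vol m x0)
    = ennreal (integral {x0..0} (\<lambda>x. (warp m x)\<^sup>2 * ((norm c)\<^sup>2 * ((D x)\<^sup>2 + (E x)\<^sup>2 * L))))"
   unfolding sph[symmetric]
  proof (rule nn_integral_vol_compact[OF c])
   show "(norm (sepgrad c Y D E (x, \<omega>)))\<^sup>2 = 0" if "0 \<le> x" for x \<omega>
    unfolding norm_sepgrad by (simp add: D_def E_def z[OF that])
  qed (use X in auto)
  also have "\<dots> \<le> ennreal ((norm c)\<^sup>2 * (K * b))"
  proof (intro ennreal_leI int)
   show "continuous_on UNIV (\<lambda>x. (warp m x)\<^sup>2 * ((norm c)\<^sup>2 * ((D x)\<^sup>2 + (E x)\<^sup>2 * L)))" by (intro continuous_intros cD cont)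
   fix x assume x: "x \<in> {x0..0}"
   define w where "w = warp m x"
   have w: "w \<ge> 1" using warp_ge_1 by (simp add: w_def)
   have 1: "w\<^sup>2 * (D x)\<^sup>2 = (deriv h x - h x * (warp1 m x / w))\<^sup>2"
   proof -
    have "w * D x = deriv h x - h x * (warp1 m x / w)" using w unfolding D_def w_def[symmetric] by (simp add: field_simps power2_eq_square)
    then show ?thesis by (simp add: power_mult_distrib[symmetric])
   qed
   have 2: "w\<^sup>2 * (E x)\<^sup>2 = (h x)\<^sup>2 * (1 / w)\<^sup>2"
   proof -
    have "w * E x = h x * (1 / w)" using w unfolding E_def w_def[symmetric] by (simp add: field_simps power2_eq_square)
    then show ?thesis by (simp add: power_mult_distrib[symmetric])
   qed
   have w1: "(warp1 m x / w)\<^sup>2 \<le> A1\<^sup>2"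
   proof -
    have "\<bar>warp1 m x\<bar> / w \<le> \<bar>warp1 m x\<bar> / 1" using w by (intro divide_left_mono) auto
    then have "\<bar>warp1 m x / w\<bar> \<le> A1" using A1[OF x] w by simp
    from power_mono[OF this abs_ge_zero, of 2] show ?thesis by (simp only: power2_abs)
   qed
   have w2: "(1 / w)\<^sup>2 \<le> 1" using w by (intro power_le_one) auto
   have s: "(a - y)\<^sup>2 \<le> 2 * a\<^sup>2 + 2 * y\<^sup>2" for a y :: real using zero_le_power2[of "a + y"] by (simp add: power2_eq_square algebra_simps)
   have "w\<^sup>2 * (D x)\<^sup>2 \<le> 2 * (deriv h x)\<^sup>2 + 2 * ((h x)\<^sup>2 * (warp1 m x / w)\<^sup>2)"
    unfolding 1 using s[of "deriv h x" "h x * (warp1 m x / w)"] by (simp only: power_mult_distrib)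
   moreover have "(h x)\<^sup>2 * (warp1 m x / w)\<^sup>2 \<le> (h x)\<^sup>2 * A1\<^sup>2" using w1 by (intro mult_left_mono) auto
   moreover have "w\<^sup>2 * (E x)\<^sup>2 \<le> (h x)\<^sup>2 * 1" unfolding 2 by (intro mult_left_mono w2) auto
   then have "w\<^sup>2 * (E x)\<^sup>2 * L \<le> (h x)\<^sup>2 * L" using L by (intro mult_right_mono) auto
   moreover have "(deriv h x)\<^sup>2 * 2 \<le> (deriv h x)\<^sup>2 * K" using L by (intro mult_left_mono) (auto simp: K_def)
   moreover have "0 \<le> (h x)\<^sup>2 * 2" by simp
   moreover have "K * ((h x)\<^sup>2 + (deriv h x)\<^sup>2) = (h x)\<^sup>2 * 2 + 2 * ((h x)\<^sup>2 * A1\<^sup>2) + (h x)\<^sup>2 * L + (deriv h x)\<^sup>2 * K"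
    unfolding K_def by (simp add: algebra_simps)
   ultimately have "w\<^sup>2 * (D x)\<^sup>2 + w\<^sup>2 * (E x)\<^sup>2 * L \<le> K * ((h x)\<^sup>2 + (deriv h x)\<^sup>2)" by linarith
   then have "(norm c)\<^sup>2 * (w\<^sup>2 * (D x)\<^sup>2 + w\<^sup>2 * (E x)\<^sup>2 * L) \<le> (norm c)\<^sup>2 * (K * ((h x)\<^sup>2 + (deriv h x)\<^sup>2))"
    by (rule mult_left_mono) simp
   then show "(warp m x)\<^sup>2 * ((norm c)\<^sup>2 * ((D x)\<^sup>2 + (E x)\<^sup>2 * L)) \<le> (norm c)\<^sup>2 * (K * ((h x)\<^sup>2 + (deriv h x)\<^sup>2))"
    unfolding w_def[symmetric] by (simp add: algebra_simps)
  qed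
  finally show "(\<integral>\<^sup>+p. ennreal ((norm (sepgrad c Y D E p))\<^sup>2) \<partial>vol m x0) \<le> ennreal ((norm c)\<^sup>2 * (K * b))" .
 qed
 finally show ?B unfolding sq .
 have cf: "continuous_on UNIV (\<lambda>p. c * sep m h Y p)" by (rule C_on_imp_continuous[OF C_on_sep[OF h[of 0] eigenfunctionD(1)[OF Y]]])
 have "L2_norm (vol m x0) (\<lambda>p. c * sep m h Y p) \<le> ennreal (sqrt ((norm c)\<^sup>2 * (K * b)))"
 proof (rule L2_norm_le)
  have c: "continuous_on ({x0..} \<times> S2) (\<lambda>p. (norm (c * sep m h Y p))\<^sup>2)" by (intro continuous_on_power continuous_on_norm ci[OF cf])
  have n: "(norm (c * sep m h Y (x, \<omega>)))\<^sup>2 = (norm c)\<^sup>2 * (h x / warp m x)\<^sup>2 * (norm (Y \<omega>))\<^sup>2" for x \<omega>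
   unfolding sep_def split_conv norm_mult norm_of_real power_mult_distrib power2_abs by (simp only: mult.assoc)
  have sph: "(\<integral>\<omega>. (norm (c * sep m h Y (x, \<omega>)))\<^sup>2 \<partial>\<sigma>) = (norm c)\<^sup>2 * (h x / warp m x)\<^sup>2" for x
   unfolding n by (simp add: eigenfunctionD(3)[OF Y])
  have "(\<integral>\<^sup>+p. ennreal ((norm (c * sep m h Y p))\<^sup>2) \<partial>vol m x0) = ennreal (integral {x0..0} (\<lambda>x. (warp m x)\<^sup>2 * ((norm c)\<^sup>2 * (h x / warp m x)\<^sup>2)))"
   unfolding sph[symmetric]
  proof (rule nn_integral_vol_compact[OF c])
   show "(norm (c * sep m h Y (x, \<omega>)))\<^sup>2 = 0" if "0 \<le> x" for x \<omega>
    unfolding n by (simp add: z[OF that])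
  qed (use X in auto)
  also have "\<dots> \<le> ennreal ((norm c)\<^sup>2 * (K * b))"
  proof (intro ennreal_leI int)
   show "continuous_on UNIV (\<lambda>x. (warp m x)\<^sup>2 * ((norm c)\<^sup>2 * (h x / warp m x)\<^sup>2))" by (intro continuous_intros cont) simp
   fix x
   have "(warp m x)\<^sup>2 * ((norm c)\<^sup>2 * (h x / warp m x)\<^sup>2) = (norm c)\<^sup>2 * (1 * (h x)\<^sup>2)" by (simp add: power_divide)
   also have "\<dots> \<le> (norm c)\<^sup>2 * (K * ((h x)\<^sup>2 + (deriv h x)\<^sup>2))" using K by (intro mult_left_mono mult_mono) auto
   finally show "(warp m x)\<^sup>2 * ((norm c)\<^sup>2 * (h x / warp m x)\<^sup>2) \<le> (norm c)\<^sup>2 * (K * ((h x)\<^sup>2 + (deriv h x)\<^sup>2))" .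
  qed
  finally show "(\<integral>\<^sup>+p. ennreal ((norm (c * sep m h Y p))\<^sup>2) \<partial>vol m x0) \<le> ennreal ((norm c)\<^sup>2 * (K * b))" .
 qed
 then show ?D unfolding sq .
 then have "L2_norm (vol m x0) (\<lambda>p. c * sep m h Y p) < \<infinity>" by (rule le_less_trans) simp
 then show ?C unfolding L2_def using measurable_vol_continuous[OF ci[OF cf]] by blast
qed

section \<open>The norm of the data\<close>

text \<open>Equal to \<open>1\<close> for \<open>x \<le> 3/8 x\<^sub>0\<close> and to \<open>0\<close> for \<open>x \<ge> 2/8 x\<^sub>0\<close>; the transition lies where the
 modes are exponentially small.\<close>

definition cutoff :: "real \<Rightarrow> real \<Rightarrow> real" where
 "cutoff x0 x = step (8 / x0 * x + (- 2))"

lemma cutoff_1: "x0 < 0 \<Longrightarrow> x \<le> 3/8 * x0 \<Longrightarrow> cutoff x0 x = 1"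
 unfolding cutoff_def by (rule step_1) (simp add: field_simps)

lemma cutoff_0: "x0 < 0 \<Longrightarrow> x \<ge> 2/8 * x0 \<Longrightarrow> cutoff x0 x = 0"
 unfolding cutoff_def by (rule step_0) (simp add: field_simps)

lemma C_on_cutoff: "C_on n UNIV (cutoff x0)"
 unfolding cutoff_def[abs_def] by (rule C_on_step_comp)

definition quasimode :: "real \<Rightarrow> (real \<Rightarrow> real) \<Rightarrow> real \<Rightarrow> real" where
 "quasimode x0 \<psi> = (\<lambda>x. cutoff x0 x * \<psi> x)"

lemma quasimode_powers:
 assumes mo: "mode m L \<mu> \<psi> \<psi>'" and x0: "x0 < 0" and \<psi>0: "\<psi> x0 = 0"
 shows "C_on n UNIV ((Pop m L ^^ j) (quasimode x0 \<psi>))"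
  and "(Pop m L ^^ j) (quasimode x0 \<psi>) x0 = 0"
  and "x \<ge> 1/8 * x0 \<Longrightarrow> (Pop m L ^^ j) (quasimode x0 \<psi>) x = 0"
proof -
 show "C_on n UNIV ((Pop m L ^^ j) (quasimode x0 \<psi>))"
  unfolding quasimode_def by (rule tame_comb_smooth[OF tame_comb_powers[OF C_on_cutoff] mo])
 have "(Pop m L ^^ j) (quasimode x0 \<psi>) x0 = \<mu> ^ j * 1 * \<psi> x0"
  by (rule Pop_power_mode[OF mo open_lessThan[of "3/8 * x0"]]) (use x0 in \<open>auto simp: quasimode_def cutoff_1\<close>)
 then show "(Pop m L ^^ j) (quasimode x0 \<psi>) x0 = 0" using \<psi>0 by simp
 assume "x \<ge> 1/8 * x0"
 then have "x \<in> {2/8 * x0<..}" using x0 by simp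
 then have "(Pop m L ^^ j) (quasimode x0 \<psi>) x = \<mu> ^ j * 0 * \<psi> x"
  by (rule Pop_power_mode[OF mo open_greaterThan[of "2/8 * x0"], rotated]) (use x0 in \<open>auto simp: quasimode_def cutoff_0\<close>)
 then show "(Pop m L ^^ j) (quasimode x0 \<psi>) x = 0" by simp
qed

text \<open>Add the constants and the exponents; this uses \<open>L \<ge> 1\<close>.\<close>

lemma poly_bound_uniform:
 fixes P :: "nat \<Rightarrow> real \<Rightarrow> 'a \<Rightarrow> real"
 assumes "\<And>j. \<exists>C N. C \<ge> 0 \<and> (\<forall>L\<ge>1. \<forall>a. Q L a \<longrightarrow> P j L a \<le> C * L ^ N * S a)" "\<And>a. S a \<ge> 0"
 shows "\<exists>C N. C \<ge> (0::real) \<and> (\<forall>j\<le>k. \<forall>L\<ge>1. \<forall>a. Q L a \<longrightarrow> P j L a \<le> C * L ^ N * S a)"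
proof (induction k)
 case 0
 then show ?case using assms(1)[of 0] by auto
next
 case (Suc k)
 obtain C N where 1: "C \<ge> 0" "\<And>j L a. j \<le> k \<Longrightarrow> L \<ge> 1 \<Longrightarrow> Q L a \<Longrightarrow> P j L a \<le> C * L ^ N * S a" using Suc by blast
 obtain D M where 2: "D \<ge> 0" "\<And>L a. L \<ge> 1 \<Longrightarrow> Q L a \<Longrightarrow> P (Suc k) L a \<le> D * L ^ M * S a" using assms(1)[of "Suc k"] by blast
 have m1: "C * L ^ N * S a \<le> (C + D) * L ^ (N + M) * S a" and m2: "D * L ^ M * S a \<le> (C + D) * L ^ (N + M) * S a" if "L \<ge> 1" for L :: real and a
  using that 1(1) 2(1) assms(2) by (intro mult_right_mono mult_mono power_increasing; simp)+
 show ?case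
 proof (intro exI[of _ "C + D"] exI[of _ "N + M"] conjI allI impI)
  fix j L a assume j: "j \<le> Suc k" "(1::real) \<le> L" "Q L a"
  show "P j L a \<le> (C + D) * L ^ (N + M) * S a"
  proof (cases "j = Suc k")
   case True then show ?thesis using 2(2)[OF j(2,3)] m2[OF j(2), of a] by simp
  next
   case False then show ?thesis using 1(2)[OF _ j(2,3), of j] j(1) m1[OF j(2), of a] by simp
  qed
 qed (use 1 2 in simp)
qed

lemma quasimode_energy:
 "\<exists>C N. C \<ge> 0 \<and> (\<forall>j\<le>k. \<forall>L\<ge>1. \<forall>\<mu>\<in>{0..L}. \<forall>\<psi> \<psi>'. mode m L \<mu> \<psi> \<psi>' \<longrightarrow> (\<forall>x\<in>{x0..0}.
   ((Pop m L ^^ j) (quasimode x0 \<psi>) x)\<^sup>2 + (deriv ((Pop m L ^^ j) (quasimode x0 \<psi>)) x)\<^sup>2 \<le> C * L ^ N * ((\<psi> x)\<^sup>2 + (\<psi>' x)\<^sup>2)))"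
proof -
 define Q where "Q L a = (case a of (\<mu>, \<psi>, \<psi>', x) \<Rightarrow> \<mu> \<in> {0..L} \<and> mode m L \<mu> \<psi> \<psi>' \<and> x \<in> {x0..0})"
  for L and a :: "real \<times> (real \<Rightarrow> real) \<times> (real \<Rightarrow> real) \<times> real"
 define S where "S a = (case a of (\<mu>, \<psi>, \<psi>', x) \<Rightarrow> (\<psi> x)\<^sup>2 + (\<psi>' x)\<^sup>2)"
  for a :: "real \<times> (real \<Rightarrow> real) \<times> (real \<Rightarrow> real) \<times> real"
 define P where "P j L a = (case a of (\<mu>, \<psi>, \<psi>', x) \<Rightarrow> ((Pop m L ^^ j) (quasimode x0 \<psi>) x)\<^sup>2 + (deriv ((Pop m L ^^ j) (quasimode x0 \<psi>)) x)\<^sup>2)"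
  for j L and a :: "real \<times> (real \<Rightarrow> real) \<times> (real \<Rightarrow> real) \<times> real"
 have "\<exists>C N. C \<ge> 0 \<and> (\<forall>j\<le>k. \<forall>L\<ge>1. \<forall>a. Q L a \<longrightarrow> P j L a \<le> C * L ^ N * S a)"
 proof (rule poly_bound_uniform)
  show "S a \<ge> 0" for a by (simp add: S_def split: prod.splits)
  fix j
  have tc: "tame_comb m x0 (\<lambda>L \<mu> \<psi> \<psi>'. (Pop m L ^^ j) (quasimode x0 \<psi>))"
   unfolding quasimode_def by (rule tame_comb_powers[OF C_on_cutoff])
  obtain C N where 1: "C \<ge> 0" "\<forall>L\<ge>1. \<forall>\<mu>\<in>{0..L}. \<forall>\<psi> \<psi>'. mode m L \<mu> \<psi> \<psi>' \<longrightarrow> (\<forall>x\<in>{x0..0}. ((Pop m L ^^ j) (quasimode x0 \<psi>) x)\<^sup>2 \<le> C * L ^ N * ((\<psi> x)\<^sup>2 + (\<psi>' x)\<^sup>2))"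
   using tame_comb_bound[OF tc] by blast
  obtain D M where 2: "D \<ge> 0" "\<forall>L\<ge>1. \<forall>\<mu>\<in>{0..L}. \<forall>\<psi> \<psi>'. mode m L \<mu> \<psi> \<psi>' \<longrightarrow> (\<forall>x\<in>{x0..0}. (deriv ((Pop m L ^^ j) (quasimode x0 \<psi>)) x)\<^sup>2 \<le> D * L ^ M * ((\<psi> x)\<^sup>2 + (\<psi>' x)\<^sup>2))"
   using tame_comb_bound[OF tame_comb_deriv(1)[OF tc]] by blast
  show "\<exists>C N. C \<ge> 0 \<and> (\<forall>L\<ge>1. \<forall>a. Q L a \<longrightarrow> P j L a \<le> C * L ^ N * S a)"
  proof (intro exI[of _ "C + D"] exI[of _ "N + M"] conjI allI impI)
   fix L :: real and a assume L: "L \<ge> 1" and Q: "Q L a"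
   obtain \<mu> \<psi> \<psi>' x where a: "a = (\<mu>, \<psi>, \<psi>', x)" by (metis prod_cases4)
   have q: "\<mu> \<in> {0..L}" "mode m L \<mu> \<psi> \<psi>'" "x \<in> {x0..0}" using Q by (auto simp: Q_def a)
   let ?s = "(\<psi> x)\<^sup>2 + (\<psi>' x)\<^sup>2"
   have "C * L ^ N * ?s \<le> C * L ^ (N + M) * ?s" "D * L ^ M * ?s \<le> D * L ^ (N + M) * ?s"
    using L 1(1) 2(1) by (intro mult_right_mono mult_left_mono power_increasing; simp)+
   moreover have "((Pop m L ^^ j) (quasimode x0 \<psi>) x)\<^sup>2 \<le> C * L ^ N * ?s" by (rule 1(2)[rule_format, OF L q])
   moreover have "(deriv ((Pop m L ^^ j) (quasimode x0 \<psi>)) x)\<^sup>2 \<le> D * L ^ M * ?s" by (rule 2(2)[rule_format, OF L q])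
   moreover have "(C + D) * L ^ (N + M) * ?s = C * L ^ (N + M) * ?s + D * L ^ (N + M) * ?s" by (simp only: distrib_right)
   ultimately show "P j L a \<le> (C + D) * L ^ (N + M) * S a" unfolding P_def S_def a prod.case by linarith
  qed (use 1 2 in simp)
 qed
 then obtain C N where C: "C \<ge> 0" "\<And>j L a. j \<le> k \<Longrightarrow> L \<ge> 1 \<Longrightarrow> Q L a \<Longrightarrow> P j L a \<le> C * L ^ N * S a" by blast
 show ?thesis
 proof (intro exI[of _ C] exI[of _ N] conjI allI impI ballI)
  fix j L \<mu> \<psi> \<psi>' x assume a: "j \<le> k" "L \<ge> 1" "\<mu> \<in> {0..L}" "mode m L \<mu> \<psi> \<psi>'" "x \<in> {x0..0}"
  show "((Pop m L ^^ j) (quasimode x0 \<psi>) x)\<^sup>2 + (deriv ((Pop m L ^^ j) (quasimode x0 \<psi>)) x)\<^sup>2 \<le> C * L ^ N * ((\<psi> x)\<^sup>2 + (\<psi>' x)\<^sup>2)"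
   using C(2)[OF a(1,2), of "(\<mu>, \<psi>, \<psi>', x)"] a unfolding P_def Q_def S_def by simp
 qed (rule C(1))
qed

lemma energy_norm_le:
 assumes "H10_norm m x0 f \<le> ennreal a" "L2_norm (vol m x0) g \<le> ennreal b" "0 \<le> a" "0 \<le> b"
 shows "energy_norm m x0 (f, g) \<le> ennreal (a + b)"
proof -
 have "(H10_norm m x0 f)\<^sup>2 + (L2_norm (vol m x0) g)\<^sup>2 \<le> (ennreal a)\<^sup>2 + (ennreal b)\<^sup>2"
  using assms by (intro add_mono power_mono) auto
 also have "\<dots> = ennreal (a\<^sup>2 + b\<^sup>2)" using assms by (simp add: ennreal_power)
 finally have "esqrt ((H10_norm m x0 f)\<^sup>2 + (L2_norm (vol m x0) g)\<^sup>2) \<le> ennreal (sqrt (a\<^sup>2 + b\<^sup>2))" by (rule esqrt_le)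
 also have "\<dots> \<le> ennreal (a + b)" using assms by (intro ennreal_leI sqrt_sum_squares_le_sum)
 finally show ?thesis by (simp add: energy_norm_def)
qed

lemma B_graphI:
 "f \<in> H10 m x0 \<Longrightarrow> g \<in> H10 m x0 \<Longrightarrow> g \<in> L2 (vol m x0) \<Longrightarrow> w \<in> L2 (vol m x0) \<Longrightarrow> weak_lap m x0 f w
  \<Longrightarrow> ((f, g), (\<lambda>p. \<i> * g p, \<lambda>p. \<i> * w p)) \<in> B_graph m x0"
 unfolding B_graph_def by blast

text \<open>The generator moves a separated function from one slot of the pair to the other, and every
 second application replaces \<open>h\<close> by \<open>P h\<close>. So \<open>B\<^sup>k\<close> of the data is again separated data, with at
 most \<open>k\<close> powers of \<open>P\<close>.\<close>

lemma DB_norm_quasimode: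
 assumes m: "m \<ge> 1" and x0: "x0 < 0"
 shows "\<exists>C N. C \<ge> 0 \<and> (\<forall>L\<ge>1. \<forall>\<mu>\<in>{0..L}. \<forall>\<psi> \<psi>' Y. mode m L \<mu> \<psi> \<psi>' \<longrightarrow> \<psi> x0 = 0 \<longrightarrow> eigenfunction Y L \<longrightarrow>
   integral {x0..0} (\<lambda>x. (\<psi> x)\<^sup>2) \<le> 4 \<longrightarrow> integral {x0..0} (\<lambda>x. (\<psi>' x)\<^sup>2) \<le> 4 * L \<longrightarrow>
   DB_norm m x0 k (sep m (quasimode x0 \<psi>) Y, \<lambda>p. 0) \<le> ennreal (C * L ^ N))"
proof -
 obtain C N where C: "C \<ge> 0" and en: "\<forall>j\<le>k. \<forall>L\<ge>1. \<forall>\<mu>\<in>{0..L}. \<forall>\<psi> \<psi>'. mode m L \<mu> \<psi> \<psi>' \<longrightarrow> (\<forall>x\<in>{x0..0}.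
   ((Pop m L ^^ j) (quasimode x0 \<psi>) x)\<^sup>2 + (deriv ((Pop m L ^^ j) (quasimode x0 \<psi>)) x)\<^sup>2 \<le> C * L ^ N * ((\<psi> x)\<^sup>2 + (\<psi>' x)\<^sup>2))"
  using quasimode_energy[of k m x0] by blast
 have "continuous_on {x0..0} (warp1 m)" using DERIV_isCont[OF DERIV_warp1[OF m]] by (auto intro!: continuous_at_imp_continuous_on)
 from continuous_on_compact_bound[OF compact_Icc this] obtain A1 where A1: "\<And>x. x \<in> {x0..0} \<Longrightarrow> \<bar>warp1 m x\<bar> \<le> A1"
  unfolding real_norm_def by blast
 define D where "D = 1 + (2 + 2 * A1\<^sup>2 + 1) * (C * 8)"
 have D: "D \<ge> 1" using C by (simp add: D_def)
 show ?thesis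
 proof (intro exI[of _ "2 * D"] exI[of _ "N + 2"] conjI allI ballI impI)
  fix L \<mu> \<psi> \<psi>' Y
  assume L: "1 \<le> L" and \<mu>: "\<mu> \<in> {0..L}" and mo: "mode m L \<mu> \<psi> \<psi>'" and \<psi>0: "\<psi> x0 = 0" and Y: "eigenfunction Y L"
   and I: "integral {x0..0} (\<lambda>x. (\<psi> x)\<^sup>2) \<le> 4" "integral {x0..0} (\<lambda>x. (\<psi>' x)\<^sup>2) \<le> 4 * L"
  let ?h = "\<lambda>j. (Pop m L ^^ j) (quasimode x0 \<psi>)"
  define b where "b = C * L ^ N * (8 * L)"
  define B where "B = sqrt ((2 + 2 * A1\<^sup>2 + L) * b)"
  define e where "e x = C * L ^ N * ((\<psi> x)\<^sup>2 + (\<psi>' x)\<^sup>2)" for x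
  have c\<psi>: "continuous_on {x0..0} \<psi>" "continuous_on {x0..0} \<psi>'"
   using conjunct1[OF mode_smooth[OF mo, of 0]] conjunct2[OF mode_smooth[OF mo, of 0]] by (auto intro: continuous_on_subset)
  have ei: "e integrable_on {x0..0}" unfolding e_def by (intro integrable_continuous_real continuous_intros c\<psi>)
  have "integral {x0..0} e = C * L ^ N * (integral {x0..0} (\<lambda>x. (\<psi> x)\<^sup>2) + integral {x0..0} (\<lambda>x. (\<psi>' x)\<^sup>2))"
   unfolding e_def integral_mult_right
   by (subst Henstock_Kurzweil_Integration.integral_add) (auto intro!: integrable_continuous_real continuous_intros c\<psi>)
  also have "\<dots> \<le> b" unfolding b_def using I L C by (intro mult_left_mono) auto
  finally have eb: "integral {x0..0} e \<le> b" .
  have b0: "b \<ge> 0" unfolding b_def using C L by simp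
  have B0: "B \<ge> 0" unfolding B_def using b0 L by simp
  have Bb: "B \<le> D * L ^ (N + 2)"
  proof -
   have "(2 + 2 * A1\<^sup>2 + L) * b \<le> ((2 + 2 * A1\<^sup>2 + 1) * L) * b"
   proof (rule mult_right_mono[OF _ b0])
    have "(2 + 2 * A1\<^sup>2) * 1 \<le> (2 + 2 * A1\<^sup>2) * L" using L by (intro mult_left_mono) auto
    then show "2 + 2 * A1\<^sup>2 + L \<le> (2 + 2 * A1\<^sup>2 + 1) * L" by (simp add: algebra_simps)
   qed
   also have "\<dots> = (D - 1) * L ^ (N + 2)" by (simp add: b_def D_def power_add power2_eq_square)
   also have "\<dots> \<le> (D * L ^ (N + 2))\<^sup>2"
   proof -
    have "1 \<le> L ^ (N + 2)" using L by (rule one_le_power)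
    then have "(D - 1) * L ^ (N + 2) \<le> D * L ^ (N + 2)" "1 \<le> D * L ^ (N + 2)"
     using D mult_mono[of 1 D 1 "L ^ (N + 2)"] by (auto intro!: mult_right_mono)
    moreover have "D * L ^ (N + 2) * 1 \<le> D * L ^ (N + 2) * (D * L ^ (N + 2))" using calculation(2) by (intro mult_left_mono) auto
    ultimately show ?thesis by (simp add: power2_eq_square)
   qed
   finally show ?thesis unfolding B_def using D L by (intro real_le_lsqrt) auto
  qed
  have h: "(\<lambda>p. c * sep m (?h j) Y p) \<in> H10 m x0" "H10_norm m x0 (\<lambda>p. c * sep m (?h j) Y p) \<le> ennreal (norm c * B)"
    "(\<lambda>p. c * sep m (?h j) Y p) \<in> L2 (vol m x0)" "L2_norm (vol m x0) (\<lambda>p. c * sep m (?h j) Y p) \<le> ennreal (norm c * B)"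
    "weak_lap m x0 (\<lambda>p. c * sep m (?h j) Y p) (\<lambda>p. - c * sep m (?h (Suc j)) Y p)" if j: "j \<le> k" for j c
  proof -
   note q = quasimode_powers[OF mo x0 \<psi>0, where j=j]
   have ex: "(?h j x)\<^sup>2 + (deriv (?h j) x)\<^sup>2 \<le> e x" if "x \<in> {x0..0}" for x
    unfolding e_def by (rule en[rule_format, OF j L \<mu> mo that])
   have X: "x0 < 1/8 * x0" "1/8 * x0 < 0" using x0 by auto
   have L0: "0 \<le> L" using L by simp
   note H = H10_sep[OF m q X Y L0 A1 ex ei eb, of c, folded B_def]
   show "(\<lambda>p. c * sep m (?h j) Y p) \<in> H10 m x0" by (rule H(1))
   show "H10_norm m x0 (\<lambda>p. c * sep m (?h j) Y p) \<le> ennreal (norm c * B)" by (rule H(2))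
   show "(\<lambda>p. c * sep m (?h j) Y p) \<in> L2 (vol m x0)" by (rule H(3))
   show "L2_norm (vol m x0) (\<lambda>p. c * sep m (?h j) Y p) \<le> ennreal (norm c * B)" by (rule H(4))
   show "weak_lap m x0 (\<lambda>p. c * sep m (?h j) Y p) (\<lambda>p. - c * sep m (?h (Suc j)) Y p)"
    using weak_lap_sep[OF m q X(1) Y, of c] by simp
  qed
  have zero: "(\<lambda>p. 0) \<in> H10 m x0" "H10_norm m x0 (\<lambda>p. 0) \<le> ennreal 0" "(\<lambda>p. 0::complex) \<in> L2 (vol m x0)" "L2_norm (vol m x0) (\<lambda>p. 0::complex) \<le> ennreal 0"
   using h(1-4)[of 0 0] by simp_all
  \<comment> \<open>Pairs with \<open>P\<^sup>j\<close> of the quasimode in one of the two slots, up to a factor of modulus one.\<close>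
  define Z where "Z j = {V. \<exists>c. norm c = 1 \<and> (V = (\<lambda>p. c * sep m (?h j) Y p, \<lambda>p. 0) \<or> V = (\<lambda>p. 0, \<lambda>p. c * sep m (?h j) Y p))}" for j
  have ZB: "energy_norm m x0 V \<le> ennreal B" if V: "V \<in> Z j" and jk: "j \<le> k" for V j
  proof -
   obtain c where c: "norm c = 1" "V = (\<lambda>p. c * sep m (?h j) Y p, \<lambda>p. 0) \<or> V = (\<lambda>p. 0, \<lambda>p. c * sep m (?h j) Y p)"
    using V unfolding Z_def mem_Collect_eq by (elim exE conjE)
   then show ?thesis
    using energy_norm_le[OF h(2)[OF jk, of c] zero(4)] energy_norm_le[OF zero(2) h(4)[OF jk, of c]] B0 by auto
  qed
  have step: "\<exists>W i. (V, W) \<in> B_graph m x0 \<and> W \<in> Z i \<and> i \<le> Suc j" if V: "V \<in> Z j" and jk: "j < k" for V j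
  proof -
   have j: "j \<le> k" "Suc j \<le> k" using jk by simp_all
   obtain c where c: "norm c = 1" "V = (\<lambda>p. c * sep m (?h j) Y p, \<lambda>p. 0) \<or> V = (\<lambda>p. 0, \<lambda>p. c * sep m (?h j) Y p)"
    using V unfolding Z_def mem_Collect_eq by (elim exE conjE)
   from c(2) show ?thesis
   proof
    assume V: "V = (\<lambda>p. c * sep m (?h j) Y p, \<lambda>p. 0)"
    have "(V, (\<lambda>p. \<i> * 0, \<lambda>p. \<i> * (- c * sep m (?h (Suc j)) Y p))) \<in> B_graph m x0"
     unfolding V by (rule B_graphI[OF h(1)[OF j(1)] zero(1,3) h(3)[OF j(2)] h(5)[OF j(1)]])
    moreover have "(\<lambda>p. \<i> * 0, \<lambda>p. \<i> * (- c * sep m (?h (Suc j)) Y p)) \<in> Z (Suc j)"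
     unfolding Z_def using c(1) by (intro CollectI exI[of _ "\<i> * - c"]) (simp add: norm_mult mult.assoc)
    ultimately show ?thesis by blast
   next
    assume V: "V = (\<lambda>p. 0, \<lambda>p. c * sep m (?h j) Y p)"
    have "weak_lap m x0 (\<lambda>p. 0) (\<lambda>p. 0)" by (simp add: weak_lap_def)
    then have "(V, (\<lambda>p. \<i> * (c * sep m (?h j) Y p), \<lambda>p. \<i> * 0)) \<in> B_graph m x0"
     unfolding V by (intro B_graphI[OF zero(1) h(1)[OF j(1)] h(3)[OF j(1)] zero(3)])
    moreover have "(\<lambda>p. \<i> * (c * sep m (?h j) Y p), \<lambda>p. \<i> * 0) \<in> Z j"
     unfolding Z_def using c(1) by (intro CollectI exI[of _ "\<i> * c"]) (simp add: norm_mult mult.assoc)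
    ultimately show ?thesis using le_SucI[OF order_refl] by blast
   qed
  qed
  let ?U = "(sep m (quasimode x0 \<psi>) Y, \<lambda>p. 0::complex)"
  have U: "?U \<in> Z 0" unfolding Z_def by (intro CollectI exI[of _ 1]) simp
  have pow: "n \<le> k \<Longrightarrow> \<exists>W i. (?U, W) \<in> B_graph m x0 ^^ n \<and> W \<in> Z i \<and> i \<le> n" for n
  proof (induction n)
   case 0
   then show ?case using U by auto
  next
   case (Suc n)
   then obtain W i where W: "(?U, W) \<in> B_graph m x0 ^^ n" "W \<in> Z i" "i \<le> n" by auto
   moreover obtain W' i' where "(W, W') \<in> B_graph m x0" "W' \<in> Z i'" "i' \<le> Suc i"
    using step[OF W(2)] W(3) Suc.prems by fastforce
   ultimately show ?case using relpow_Suc_I[of ?U W n "B_graph m x0" W'] by (meson Suc_le_mono order_trans)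
  qed
  obtain W i where W: "(?U, W) \<in> B_graph m x0 ^^ k" "W \<in> Z i" "i \<le> k" using pow[of k] by blast
  have "DB_norm m x0 k ?U \<le> energy_norm m x0 ?U + energy_norm m x0 W"
   unfolding DB_norm_def by (intro add_left_mono INF_lower) (use W in simp)
  also have "\<dots> \<le> ennreal B + ennreal B" by (intro add_mono ZB[OF U] ZB[OF W(2,3)]) simp
  also have "\<dots> = ennreal (2 * B)" using B0 by (simp add: ennreal_plus[symmetric] del: ennreal_plus)
  also have "\<dots> \<le> ennreal (2 * D * L ^ (N + 2))" using Bb by (intro ennreal_leI) simp
  finally show "DB_norm m x0 k ?U \<le> ennreal (2 * D * L ^ (N + 2))" .
 qed (use D in simp)
qed

section \<open>The region inside the trap\<close>

text \<open>Restriction to \<open>x \<le> 0\<close> makes the measure finite and its support bounded; the quasimode lives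
 there.\<close>

definition inner_vol :: "nat \<Rightarrow> real \<Rightarrow> point measure" where
 "inner_vol m x0 = restrict_space (vol m x0) {p. fst p \<le> 0}"

lemma space_inner_vol [simp]: "space (inner_vol m x0) = {x0<..0} \<times> S2"
 by (auto simp: inner_vol_def space_restrict_space)

lemma measurable_ident_inner_vol: "(\<lambda>p. p) \<in> inner_vol m x0 \<rightarrow>\<^sub>M borel"
 unfolding inner_vol_def by (rule measurable_restrict_space1[OF measurable_ident_vol])

lemma inner_region_measurable: "{p. fst p \<le> 0} \<inter> space (vol m x0) \<in> sets (vol m x0)"
proof -
 have f: "fst \<in> borel_measurable (vol m x0)" by (rule measurable_vol_continuous) (intro continuous_intros)
 have "{p. fst p \<le> 0} \<inter> space (vol m x0) = fst -` {..0} \<inter> space (vol m x0)" by auto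
 then show ?thesis using measurable_sets[OF f, of "{..0}"] by simp
qed

lemma nn_integral_inner_vol: "(\<integral>\<^sup>+p. f p \<partial>inner_vol m x0) = (\<integral>\<^sup>+p. f p * indicator {p. fst p \<le> 0} p \<partial>vol m x0)"
 unfolding inner_vol_def by (rule nn_integral_restrict_space[OF inner_region_measurable])

lemma integral_inner_vol:
 fixes f :: "point \<Rightarrow> 'b::{banach, second_countable_topology}"
 assumes "\<And>x \<omega>. x > 0 \<Longrightarrow> f (x, \<omega>) = 0"
 shows "(\<integral>p. f p \<partial>vol m x0) = (\<integral>p. f p \<partial>inner_vol m x0)"
proof -
 have "indicator {p. fst p \<le> 0} p *\<^sub>R f p = f p" for p
  using assms[of "fst p" "snd p"] by (simp add: indicator_def)
 then show ?thesis unfolding inner_vol_def by (subst integral_restrict_space[OF inner_region_measurable]) simp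
qed

lemma finite_inner_vol: "x0 < 0 \<Longrightarrow> finite_measure (inner_vol m x0)"
proof (rule finite_measureI)
 assume x0: "x0 < 0"
 define k where "k p = max 0 (1 - max 0 (fst p))" for p :: point
 have "emeasure (inner_vol m x0) (space (inner_vol m x0)) = (\<integral>\<^sup>+p. 1 \<partial>inner_vol m x0)" by simp
 also have "\<dots> = (\<integral>\<^sup>+p. 1 * indicator {p. fst p \<le> 0} p \<partial>vol m x0)" by (rule nn_integral_inner_vol)
 also have "\<dots> \<le> (\<integral>\<^sup>+p. ennreal (k p) \<partial>vol m x0)"
  by (intro nn_integral_mono) (auto simp: k_def indicator_def)
 also have "\<dots> = ennreal (integral {x0..1} (\<lambda>x. (warp m x)\<^sup>2 * (\<integral>\<omega>. k (x, \<omega>) \<partial>\<sigma>)))"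
 proof (rule nn_integral_vol_compact)
  show "continuous_on ({x0..} \<times> S2) k" unfolding k_def by (intro continuous_intros)
 qed (use x0 in \<open>auto simp: k_def\<close>)
 also have "\<dots> < \<infinity>" by simp
 finally show "emeasure (inner_vol m x0) (space (inner_vol m x0)) \<noteq> \<infinity>" by simp
qed

lemma compact_inner: "compact ({x0..0::real} \<times> S2)"
 by (intro compact_Times) auto

lemma inner_vol_subset: "space (inner_vol m x0) \<subseteq> {x0..0} \<times> S2" by auto

section \<open>Time derivatives\<close>

lemma dt_eqI: "t \<ge> 0 \<Longrightarrow> ((\<lambda>s. u s p) has_vector_derivative D) (at t within {0..}) \<Longrightarrow> dt u t p = D"
 by (simp add: dt_def vector_derivative_half_line)

lemma dt_cong:
 assumes "t \<ge> 0" "\<And>s. s \<ge> 0 \<Longrightarrow> u s p = v s p"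
 shows "dt u t p = dt v t p"
proof -
 have "((\<lambda>s. u s p) has_vector_derivative D) (at t within {0..}) \<longleftrightarrow> ((\<lambda>s. v s p) has_vector_derivative D) (at t within {0..})" for D
  using has_vector_derivative_transform[of t "{0..}" "\<lambda>s. u s p" "\<lambda>s. v s p" D]
   has_vector_derivative_transform[of t "{0..}" "\<lambda>s. v s p" "\<lambda>s. u s p" D] assms by auto
 then show ?thesis by (simp add: dt_def vector_derivative_def)
qed

lemma C_upto_dt:
 fixes D :: "point set"
 assumes "C_upto (Suc n) ({0..} \<times> D) (\<lambda>(t, p). u t p)"
 shows "C_upto n ({0..} \<times> D) (\<lambda>(t, p). dt u t p)"
  and "t \<ge> 0 \<Longrightarrow> p \<in> D \<Longrightarrow> ((\<lambda>s. u s p) has_vector_derivative dt u t p) (at t within {0..})"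
proof -
 obtain g where G: "(\<forall>v. C_upto n ({0..} \<times> D) (\<lambda>p. g p v)) \<and>
   (\<forall>p v S (s::real). p \<in> {0..} \<times> D \<longrightarrow> s \<in> S \<longrightarrow> (\<forall>r\<in>S. p + (r - s) *\<^sub>R v \<in> {0..} \<times> D) \<longrightarrow>
    ((\<lambda>r. (\<lambda>(t, p). u t p) (p + (r - s) *\<^sub>R v)) has_vector_derivative g p v) (at s within S))"
  using C_upto_directional[OF assms] by (elim exE)
 note g = conjunct1[OF G, rule_format] conjunct2[OF G, rule_format]
 have D: "((\<lambda>s. u s p) has_vector_derivative g (t, p) (1, 0)) (at t within {0..})" if "t \<ge> 0" "p \<in> D" for t p
  using g(2)[of "(t, p)" t "{0..}" "(1, 0)"] that by simp
 have E: "dt u t p = g (t, p) (1, 0)" if "t \<ge> 0" "p \<in> D" for t p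
  by (rule dt_eqI) (rule that, rule D[OF that])
 show "C_upto n ({0..} \<times> D) (\<lambda>(t, p). dt u t p)"
  by (rule C_upto_cong[OF _ g(1)[of "(1, 0)"]]) (use E in auto)
 show "((\<lambda>s. u s p) has_vector_derivative dt u t p) (at t within {0..})" if "t \<ge> 0" "p \<in> D"
  using D[OF that] E[OF that] by simp
qed

section \<open>Existence of the solution\<close>

text \<open>Separation of variables: the radial factor is the solution of \<open>wave_half_line\<close> for the
 potential \<open>pot m L\<close>, shifted so that the wall is at the origin. That \<open>h\<close> and \<open>h''\<close> vanish at the
 wall is the compatibility of the data.\<close>

lemma wave_existence:
 assumes m: "m \<ge> 1" and h: "\<And>n. C_on n UNIV h" and h0: "h x0 = 0" "\<And>x. x \<ge> X \<Longrightarrow> h x = 0" "deriv (deriv h) x0 = 0" and X: "x0 < X"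
  and Y: "eigenfunction Y L" and L: "L \<ge> 0"
 shows "\<exists>u. wave_solution m x0 (sep m h Y) (\<lambda>p. 0) u"
proof -
 define V where "V x = pot m L (x0 + x)" for x
 have dh: "DERIV h x :> deriv h x" "DERIV (deriv h) x :> deriv (deriv h) x" for x
  using C_on_Suc_real(2)[OF h[of "Suc 0"]] C_on_Suc_real(2)[OF C_on_Suc_real(1)[OF h[of "Suc (Suc 0)"]]] by auto
 have ch: "continuous_on UNIV (deriv (deriv h))" "continuous_on UNIV h"
  using C_on_imp_continuous[OF C_on_Suc_real(1)[OF C_on_Suc_real(1)[OF h[of "Suc (Suc 0)"]]]] C_on_imp_continuous[OF h[of 0]] by auto
 have shift: "DERIV (\<lambda>x. f (x0 + x)) x :> f' (x0 + x)" if "\<And>y. DERIV f y :> f' y" for f f' x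
  using DERIV_shift[of f "f' (x0 + x)" x x0] that[of "x0 + x"] by (simp add: add.commute)
 have sc: "continuous_on UNIV (\<lambda>x. f (x0 + x))" if "continuous_on UNIV f" for f :: "real \<Rightarrow> real"
  by (rule continuous_on_compose2[OF that]) (auto intro!: continuous_intros)
 have dV: "DERIV V x :> deriv (pot m L) (x0 + x)" for x
  unfolding V_def[abs_def] by (rule shift) (rule C_on_Suc_real(2)[OF C_on_pot])
 have cV: "continuous_on UNIV (\<lambda>x. deriv (pot m L) (x0 + x))"
  by (rule sc[OF C_on_imp_continuous[OF C_on_Suc_real(1)[OF C_on_pot[of "Suc 0"]]]])
 have bV: "\<bar>V x\<bar> \<le> real (2 * m - 1) + L" for x
 proof -
  have "curv m (x0 + x) \<le> real (2 * m - 1)" by (rule curv_le[OF m])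
  moreover have "L * bar m (x0 + x) \<le> L * 1" using L by (intro mult_left_mono bar_le_1)
  moreover have "0 \<le> pot m L (x0 + x)" by (rule pot_nonneg[OF L])
  ultimately show ?thesis unfolding V_def by (simp add: pot_def)
 qed
 obtain B where B: "B \<ge> 0" "\<And>x. x \<in> {x0..X} \<Longrightarrow> \<bar>h x\<bar> \<le> B"
  using continuous_on_compact_bound[OF compact_Icc continuous_on_subset[OF ch(2) subset_UNIV]] unfolding real_norm_def by blast
 have bh: "\<bar>h (x0 + x)\<bar> \<le> B" if "x \<ge> 0" for x
  using B h0(2)[of "x0 + x"] that by (cases "x0 + x \<ge> X") auto
 have hz: "h (x0 + 0) = 0" "deriv (deriv h) (x0 + 0) = 0" using h0 by simp_all
 obtain v vt vtt vx vxx where v: "C_on 2 UNIV v" "pd1 v vt" "pd1 vt vtt" "pd2 v vx" "pd2 vx vxx"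
  "\<And>t x. x \<ge> 0 \<Longrightarrow> vtt (t, x) = vxx (t, x) - V x * v (t, x)"
  "\<And>t. v (t, 0) = 0" "\<And>x. x \<ge> 0 \<Longrightarrow> v (0, x) = h (x0 + x)" "\<And>x. vt (0, x) = 0"
  by (rule wave_half_line[OF dV cV bV shift[OF dh(1)] shift[OF dh(2)] sc[OF ch(1)] bh hz]) (assumption, rule that)
 define u where "u t p = sep m (\<lambda>x. v (t, x - x0)) Y p" for t p
 have D: "((\<lambda>s. sep m (\<lambda>x. a (s, x - x0)) Y p) has_vector_derivative sep m (\<lambda>x. b (t, x - x0)) Y p) (at t within S)"
  if "pd1 a b" for a b t p S
 proof -
  have "DERIV (\<lambda>s. a (s, fst p - x0) / warp m (fst p)) t :> b (t, fst p - x0) / warp m (fst p)"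
   using that unfolding pd1_def by (intro DERIV_cdivide) blast
  from has_vector_derivative_of_real_mult[OF this, of "Y (snd p)" S] show ?thesis by (simp add: sep_def case_prod_unfold)
 qed
 have dtu: "dt u t p = sep m (\<lambda>x. vt (t, x - x0)) Y p" if "t \<ge> 0" for t p
  by (rule dt_eqI[OF that]) (unfold u_def, rule D[OF v(2)])
 have dttu: "dt (dt u) t p = sep m (\<lambda>x. vtt (t, x - x0)) Y p" if "t \<ge> 0" for t p
 proof -
  have "dt (dt u) t p = dt (\<lambda>s p. sep m (\<lambda>x. vt (s, x - x0)) Y p) t p" by (rule dt_cong[OF that dtu])
  also have "\<dots> = sep m (\<lambda>x. vtt (t, x - x0)) Y p" by (rule dt_eqI[OF that D[OF v(3)]])
  finally show ?thesis .
 qed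
 have sh: "DERIV (\<lambda>x. a (t, x - x0)) x :> b (t, x - x0)" if "pd2 a b" for a b t x
 proof -
  have "DERIV (\<lambda>y. a (t, y)) (x + - x0) :> b (t, x - x0)" using that unfolding pd2_def by simp
  from this[unfolded DERIV_shift] show ?thesis by simp
 qed
 have lapu: "lap m x0 (u t) p = sep m (\<lambda>x. vxx (t, x - x0) - pot m L x * v (t, x - x0)) Y p" if pp: "p \<in> {x0..} \<times> S2" for t p
 proof -
  obtain x \<omega> where p: "p = (x, \<omega>)" "x \<ge> x0" "\<omega> \<in> S2" using pp by auto
  show ?thesis unfolding p u_def
   by (rule lap_sep(1)[OF m sh[OF v(4)] sh[OF v(5)] eigenfunctionD(5)[OF Y] eigenfunctionD(2)[OF Y] p(2,3)])
 qed
 have "wave_solution m x0 (sep m h Y) (\<lambda>p. 0) u"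
  unfolding wave_solution_def
 proof (intro conjI allI impI ballI)
  note o = open_UNIV subset_UNIV
  have fx: "C_on 2 UNIV (\<lambda>q::real \<times> point. fst (snd q))"
   by (rule C_on_compose[OF o C_on_snd[OF open_UNIV] C_on_fst[OF open_UNIV]])
  have fy: "C_on 2 UNIV (\<lambda>q::real \<times> point. snd (snd q))"
   by (rule C_on_compose[OF o C_on_snd[OF open_UNIV] C_on_snd[OF open_UNIV]])
  have "C_on 2 UNIV (\<lambda>q::real \<times> point. v (fst q, fst (snd q) - x0))"
   by (rule C_on_compose[OF o _ v(1)]) (rule C_on_Pair[OF open_UNIV C_on_fst[OF open_UNIV] C_on_diff[OF open_UNIV fx C_on_const[OF open_UNIV]]])
  moreover have "C_on 2 UNIV (\<lambda>q::real \<times> point. 1 / warp m (fst (snd q)))"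
   by (rule C_on_compose[OF o fx]) (intro C_on_inverse C_on_warp warp_pos open_UNIV)
  ultimately have "C_on 2 UNIV (\<lambda>q::real \<times> point. v (fst q, fst (snd q) - x0) * (1 / warp m (fst (snd q))))"
   by (rule C_on_mult[OF open_UNIV])
  from C_on_mult[OF open_UNIV C_on_of_real[OF open_UNIV this] C_on_compose[OF o fy eigenfunctionD(1)[OF Y]]]
  have "C_on 2 UNIV (\<lambda>(t, p). u t p)" by (simp add: u_def sep_def case_prod_unfold)
  then show "C_upto 2 ({0..} \<times> {x0..} \<times> S2) (\<lambda>(t, p). u t p)" by (rule C_upto_of_C_on)
  show "- dt (dt u) t p + lap m x0 (u t) p = 0" if t: "t \<ge> 0" and p: "p \<in> {x0..} \<times> S2" for t p
  proof -
   have "vtt (t, fst p - x0) = vxx (t, fst p - x0) - pot m L (fst p) * v (t, fst p - x0)"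
    using v(6)[of "fst p - x0" t] p by (auto simp: V_def)
   then show ?thesis unfolding dttu[OF t] lapu[OF p] by (simp add: sep_def case_prod_unfold)
  qed
  show "u t (x0, \<omega>) = 0" for t \<omega> by (simp add: u_def sep_def v(7))
  show "u 0 p = sep m h Y p" if "p \<in> {x0..} \<times> S2" for p
   using v(8)[of "fst p - x0"] that by (auto simp: u_def sep_def)
  show "dt u 0 p = 0" for p by (simp add: dtu sep_def case_prod_unfold v(9))
 qed
 then show ?thesis by blast
qed

section \<open>Local energy controls the energy inside the trap\<close>

definition inner_energy :: "nat \<Rightarrow> real \<Rightarrow> (real \<Rightarrow> point \<Rightarrow> complex) \<Rightarrow> real \<Rightarrow> real" where
 "inner_energy m x0 u t = (\<integral>p. (norm (dt u t p))\<^sup>2 + (norm (u t p))\<^sup>2 \<partial>inner_vol m x0)"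

lemma esqrt_bound:
 assumes "c > 0" "ennreal c * esqrt Q \<le> ennreal E" "E \<ge> 0"
 shows "Q \<le> ennreal ((E / c)\<^sup>2)"
proof (cases "Q = \<infinity>")
 case True
 then show ?thesis using assms by (simp add: esqrt_def ennreal_mult_top top_unique)
next
 case False
 then obtain q where q: "Q = ennreal q" "q \<ge> 0" by (cases Q) auto
 then have "ennreal (c * sqrt q) \<le> ennreal E" using assms by (simp add: esqrt_def ennreal_mult)
 then have "c * sqrt q \<le> E" using assms by simp
 then have "sqrt q \<le> E / c" using assms(1) by (simp add: field_simps)
 then have "q \<le> (E / c)\<^sup>2" using q by (metis real_sqrt_ge_zero real_sqrt_pow2 power_mono)
 then show ?thesis using q by (simp add: ennreal_leI)
qed

lemma inner_integrable:
 fixes f :: "point \<Rightarrow> 'b::{banach, second_countable_topology}"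
 shows "x0 < 0 \<Longrightarrow> continuous_on ({x0..0} \<times> S2) f \<Longrightarrow> integrable (inner_vol m x0) f"
 by (rule integrable_continuous_compact[OF finite_inner_vol measurable_ident_inner_vol inner_vol_subset compact_inner])

text \<open>Finitely many dyadic annuli cover \<open>[x\<^sub>0, 0]\<close>, each term of the supremum bounds the energy in
 one of them, and the weights \<open>2\<^sup>- \<^sup>j\<close> and \<open>\<langle>x\<rangle>\<^sup>-\<^sup>2\<close> are bounded below there.\<close>

lemma inner_energy_LE1:
 assumes x0: "x0 < 0"
 shows "\<exists>C\<ge>0. \<forall>T u E. C_upto 2 ({0..} \<times> {x0..} \<times> S2) (\<lambda>(t, p). u t p) \<longrightarrow> E \<ge> 0 \<longrightarrow> LE1_norm m x0 T u \<le> ennreal E \<longrightarrow>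
   (\<lambda>t. ennreal (inner_energy m x0 u t) * indicator {0..T} t) \<in> borel_measurable lborel \<and>
   (\<integral>\<^sup>+t. ennreal (inner_energy m x0 u t) * indicator {0..T} t \<partial>lborel) \<le> ennreal (C * E\<^sup>2)"
proof -
 \<comment> \<open>The maximum of \<open>\<langle>x\<rangle>\<^sup>2\<close> on the well.\<close>
 define \<kappa> where "\<kappa> = 1 + x0\<^sup>2"
 have \<kappa>: "\<kappa> \<ge> 1" by (simp add: \<kappa>_def)
 obtain J where J: "sqrt \<kappa> < 2 ^ J" using real_arch_pow[of 2 "sqrt \<kappa>"] by auto
 have jap: "1 \<le> japanese x" "japanese x \<le> 2 ^ J" "(japanese x)\<^sup>2 \<le> \<kappa>" if "x \<in> {x0<..0}" for x
 proof -
  have "x\<^sup>2 \<le> x0\<^sup>2" using that by (simp add: abs_le_square_iff[symmetric])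
  then have "1 + x\<^sup>2 \<le> \<kappa>" by (simp add: \<kappa>_def)
  then show "(japanese x)\<^sup>2 \<le> \<kappa>" by (simp add: japanese_def)
  show "japanese x \<le> 2 ^ J" unfolding japanese_def using J real_sqrt_le_mono[OF \<open>1 + x\<^sup>2 \<le> \<kappa>\<close>] by linarith
  show "1 \<le> japanese x" by (simp add: japanese_def)
 qed
 define A where "A j = {p::point. 2 ^ j \<le> japanese (fst p) \<and> japanese (fst p) \<le> 2 ^ (j + 1)}" for j :: nat
 have cover: "\<exists>j\<le>J. p \<in> A j" if "p \<in> space (inner_vol m x0)" for p
 proof -
  have p: "1 \<le> japanese (fst p)" "japanese (fst p) \<le> 2 ^ J" using that jap[of "fst p"] by auto
  define j where "j = (LEAST j. japanese (fst p) \<le> 2 ^ j)"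
  have j: "japanese (fst p) \<le> 2 ^ j" unfolding j_def by (rule LeastI[of _ J]) (rule p)
  have jJ: "j \<le> J" unfolding j_def by (rule Least_le) (rule p)
  show ?thesis
  proof (cases j)
   case 0
   then have "p \<in> A 0" using j p by (simp add: A_def)
   then show ?thesis by blast
  next
   case (Suc i)
   then have "\<not> japanese (fst p) \<le> 2 ^ i" using not_less_Least[of i "\<lambda>j. japanese (fst p) \<le> 2 ^ j"] unfolding j_def by simp
   then have "p \<in> A i" using j Suc by (simp add: A_def)
   then show ?thesis using jJ Suc by (intro exI[of _ i]) simp
  qed
 qed
 show ?thesis
 proof (intro exI[of _ "\<kappa> * (real (Suc J) * 2 ^ J)"] conjI allI impI)
  show "0 \<le> \<kappa> * (real (Suc J) * 2 ^ J)" using \<kappa> by simp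
  fix T u E assume u2: "C_upto 2 ({0..} \<times> {x0..} \<times> S2) (\<lambda>(t, p). u t p)" and E: "(E::real) \<ge> 0" and LE: "LE1_norm m x0 T u \<le> ennreal E"
  define F where "F q = (norm (dt u (fst q) (snd q)))\<^sup>2 + (norm (u (fst q) (snd q)))\<^sup>2" for q
  have u2': "C_upto (Suc 1) ({0..} \<times> {x0..} \<times> S2) (\<lambda>(t, p). u t p)" using u2 by (simp add: numeral_2_eq_2)
  have cu: "continuous_on ({0..} \<times> {x0..} \<times> S2) (\<lambda>q. u (fst q) (snd q))" "continuous_on ({0..} \<times> {x0..} \<times> S2) (\<lambda>q. dt u (fst q) (snd q))"
   using C_upto_imp_continuous[OF u2] C_upto_imp_continuous[OF C_upto_dt(1)[OF u2']] by (simp_all add: case_prod_unfold)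
  have cF: "continuous_on ({0..} \<times> {x0..} \<times> S2) F" unfolding F_def by (intro continuous_intros cu)
  interpret M: finite_measure "inner_vol m x0" by (rule finite_inner_vol[OF x0])
  have id: "(\<lambda>q. q) \<in> lborel \<Otimes>\<^sub>M inner_vol m x0 \<rightarrow>\<^sub>M (borel :: (real \<times> point) measure)"
  proof -
   have "(\<lambda>q. (fst q, snd q)) \<in> lborel \<Otimes>\<^sub>M inner_vol m x0 \<rightarrow>\<^sub>M (borel \<Otimes>\<^sub>M borel :: (real \<times> point) measure)"
   proof (rule measurable_Pair)
    show "fst \<in> lborel \<Otimes>\<^sub>M inner_vol m x0 \<rightarrow>\<^sub>M borel" using measurable_fst[of lborel "inner_vol m x0"] by simp
    show "snd \<in> lborel \<Otimes>\<^sub>M inner_vol m x0 \<rightarrow>\<^sub>M borel" by (rule measurable_compose[OF measurable_snd[of lborel "inner_vol m x0"] measurable_ident_inner_vol])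
   qed
   then show ?thesis by (simp add: borel_prod)
  qed
  \<comment> \<open>Cut off outside the closed domain, where \<open>u\<close> carries no information, to obtain a Borel function.\<close>
  define Fc where "Fc q = indicator ({0..} \<times> {x0..} \<times> S2) q *\<^sub>R F q" for q
  have mF: "(\<lambda>q. ennreal (Fc q)) \<in> borel_measurable (lborel \<Otimes>\<^sub>M inner_vol m x0)"
  proof -
   have cl: "closed ({0::real..} \<times> {x0..} \<times> S2)" by (intro closed_Times closed_atLeast closed_sphere)
   have "Fc \<in> borel_measurable borel" unfolding Fc_def by (rule borel_measurable_continuous_on_indicator[OF borel_closed[OF cl] cF])
   from measurable_compose[OF id this] show ?thesis by simp
  qed
  have Fceq: "Fc (t, p) = F (t, p)" if "t \<ge> 0" "p \<in> space (inner_vol m x0)" for t p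
   using that by (auto simp: Fc_def)
  have S: "ennreal (inner_energy m x0 u t) * indicator {0..T} t = (\<integral>\<^sup>+p. ennreal (Fc (t, p)) \<partial>inner_vol m x0) * indicator {0..T} t" for t
  proof (cases "t \<in> {0..T}")
   case True
   then have t: "t \<ge> 0" by simp
   have "continuous_on ({x0..0} \<times> S2) (\<lambda>p. F (t, p))"
    by (rule continuous_on_compose2[OF cF]) (use t in \<open>auto intro!: continuous_intros\<close>)
   from inner_integrable[OF x0 this] have "integrable (inner_vol m x0) (\<lambda>p. F (t, p))" .
   from nn_integral_eq_integral[OF this] have "(\<integral>\<^sup>+p. ennreal (F (t, p)) \<partial>inner_vol m x0) = ennreal (inner_energy m x0 u t)"
    by (simp add: F_def inner_energy_def)
   moreover have "(\<integral>\<^sup>+p. ennreal (Fc (t, p)) \<partial>inner_vol m x0) = (\<integral>\<^sup>+p. ennreal (F (t, p)) \<partial>inner_vol m x0)"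
    by (rule nn_integral_cong) (simp add: Fceq[OF t])
   ultimately show ?thesis by simp
  qed simp
  have meas1: "(\<lambda>t. \<integral>\<^sup>+p. ennreal (Fc (t, p)) \<partial>inner_vol m x0) \<in> borel_measurable lborel"
   using M.borel_measurable_nn_integral_fst[OF mF] by simp
  have ind: "(indicator {0..T} :: real \<Rightarrow> ennreal) \<in> borel_measurable lborel" by simp
  show "(\<lambda>t. ennreal (inner_energy m x0 u t) * indicator {0..T} t) \<in> borel_measurable lborel"
   unfolding S by (intro borel_measurable_times_ennreal meas1 ind)
  have mA: "(\<lambda>p. indicator (A j) p :: ennreal) \<in> borel_measurable (inner_vol m x0)" for j
  proof -
   have "(\<lambda>p::point. japanese (fst p)) \<in> borel_measurable borel"
    unfolding japanese_def by (intro borel_measurable_continuous_onI continuous_intros)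
   then have "A j \<in> sets borel" unfolding A_def by measurable
   from borel_measurable_indicator[OF this] show ?thesis by (rule measurable_compose[OF measurable_ident_inner_vol])
  qed
  let ?g = "\<lambda>t p. (dt u t p, grad m x0 (u t) p, (1 / japanese (fst p)) *\<^sub>R u t p)"
  define Q where "Q j = (\<integral>\<^sup>+t. (\<integral>\<^sup>+p. ennreal ((norm (?g t p))\<^sup>2) * indicator (A j) p \<partial>vol m x0) * indicator {0..T} t \<partial>lborel)" for j
  have Qb: "Q j \<le> ennreal (2 ^ j * E\<^sup>2)" for j
  proof -
   have "ennreal (2 powr (- real j / 2)) * esqrt (Q j) \<le> LE1_norm m x0 T u"
    unfolding LE1_norm_def LE_norm_def Q_def A_def by (rule SUP_upper) simp
   then have "Q j \<le> ennreal ((E / 2 powr (- real j / 2))\<^sup>2)" using LE E by (intro esqrt_bound) auto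
   also have "(E / 2 powr (- real j / 2))\<^sup>2 = 2 ^ j * E\<^sup>2"
   proof -
    have "(2 powr (- real j / 2))\<^sup>2 = 2 powr (- real j)" by (simp add: power2_eq_square powr_add[symmetric])
    also have "\<dots> = 1 / 2 ^ j" by (simp add: powr_minus powr_realpow divide_inverse)
    finally show ?thesis by (simp add: power_divide)
   qed
   finally show ?thesis .
  qed
  have ptw: "ennreal (Fc (t, p)) \<le> ennreal \<kappa> * ennreal ((norm (?g t p))\<^sup>2)" if "t \<ge> 0" "p \<in> space (inner_vol m x0)" for t p
  proof -
   have j: "1 \<le> japanese (fst p)" "(japanese (fst p))\<^sup>2 \<le> \<kappa>" using that jap[of "fst p"] by auto
   have "(norm (?g t p))\<^sup>2 = (norm (dt u t p))\<^sup>2 + ((norm (grad m x0 (u t) p))\<^sup>2 + (norm (u t p))\<^sup>2 / (japanese (fst p))\<^sup>2)"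
    unfolding norm_Pair norm_scaleR by (simp add: power_mult_distrib power_divide)
   then have "\<kappa> * (norm (?g t p))\<^sup>2 = \<kappa> * (norm (dt u t p))\<^sup>2 + \<kappa> * (norm (grad m x0 (u t) p))\<^sup>2 + (\<kappa> / (japanese (fst p))\<^sup>2) * (norm (u t p))\<^sup>2"
    by (simp add: algebra_simps)
   moreover have "1 * (norm (dt u t p))\<^sup>2 \<le> \<kappa> * (norm (dt u t p))\<^sup>2" using \<kappa> by (intro mult_right_mono) auto
   moreover have "0 \<le> \<kappa> * (norm (grad m x0 (u t) p))\<^sup>2" using \<kappa> by simp
   moreover have "1 \<le> \<kappa> / (japanese (fst p))\<^sup>2" using j by (simp add: field_simps)
   then have "1 * (norm (u t p))\<^sup>2 \<le> (\<kappa> / (japanese (fst p))\<^sup>2) * (norm (u t p))\<^sup>2" by (intro mult_right_mono) auto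
   ultimately have "F (t, p) \<le> \<kappa> * (norm (?g t p))\<^sup>2" unfolding F_def fst_conv snd_conv by linarith
   then show ?thesis unfolding Fceq[OF that] using \<kappa> by (simp add: ennreal_mult[symmetric] ennreal_leI)
  qed
  define I where "I j t = (\<integral>\<^sup>+p. ennreal (Fc (t, p)) * indicator (A j) p \<partial>inner_vol m x0) * indicator {0..T} t" for j t
  have mFA: "(\<lambda>q. ennreal (Fc q) * indicator (A j) (snd q)) \<in> borel_measurable (lborel \<Otimes>\<^sub>M inner_vol m x0)" for j
   by (intro borel_measurable_times_ennreal mF measurable_compose[OF measurable_snd mA])
  have mI: "I j \<in> borel_measurable lborel" for j
  proof -
   have "(\<lambda>t. \<integral>\<^sup>+p. ennreal (Fc (t, p)) * indicator (A j) p \<partial>inner_vol m x0) \<in> borel_measurable lborel"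
    using M.borel_measurable_nn_integral_fst[OF mFA] by simp
   then show ?thesis unfolding I_def[abs_def] by (intro borel_measurable_times_ennreal ind)
  qed
  have Ib: "(\<integral>\<^sup>+t. I j t \<partial>lborel) \<le> ennreal (\<kappa> * 2 ^ J * E\<^sup>2)" if "j \<le> J" for j
  proof -
   have le: "ennreal (1 / \<kappa>) * I j t \<le> (\<integral>\<^sup>+p. ennreal ((norm (?g t p))\<^sup>2) * indicator (A j) p \<partial>vol m x0) * indicator {0..T} t" for t
   proof (cases "t \<in> {0..T}")
    case True
    then have t: "t \<ge> 0" by simp
    have mt: "(\<lambda>p. ennreal (Fc (t, p)) * indicator (A j) p) \<in> borel_measurable (inner_vol m x0)"
     using measurable_Pair2[OF mFA, of t] by simp
    have "ennreal (1 / \<kappa>) * I j t = (\<integral>\<^sup>+p. ennreal (1 / \<kappa>) * (ennreal (Fc (t, p)) * indicator (A j) p) \<partial>inner_vol m x0)"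
     using True nn_integral_cmult[OF mt] by (simp add: I_def)
    also have "\<dots> \<le> (\<integral>\<^sup>+p. ennreal ((norm (?g t p))\<^sup>2) * indicator (A j) p \<partial>inner_vol m x0)"
    proof (rule nn_integral_mono)
     fix p assume p: "p \<in> space (inner_vol m x0)"
     have "ennreal (1 / \<kappa>) * ennreal (Fc (t, p)) \<le> ennreal (1 / \<kappa>) * (ennreal \<kappa> * ennreal ((norm (?g t p))\<^sup>2))"
      by (intro mult_left_mono ptw[OF t p]) simp
     also have "\<dots> = ennreal ((norm (?g t p))\<^sup>2)"
     proof -
      have "ennreal (1 / \<kappa>) * ennreal \<kappa> = 1" using \<kappa> by (simp add: ennreal_mult[symmetric])
      then show ?thesis by (simp add: mult.assoc[symmetric])
     qed
     finally have "ennreal (1 / \<kappa>) * ennreal (Fc (t, p)) * indicator (A j) p \<le> ennreal ((norm (?g t p))\<^sup>2) * indicator (A j) p"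
      by (rule mult_right_mono) simp
     then show "ennreal (1 / \<kappa>) * (ennreal (Fc (t, p)) * indicator (A j) p) \<le> ennreal ((norm (?g t p))\<^sup>2) * indicator (A j) p"
      by (simp only: mult.assoc)
    qed
    also have "\<dots> \<le> (\<integral>\<^sup>+p. ennreal ((norm (?g t p))\<^sup>2) * indicator (A j) p \<partial>vol m x0)"
     unfolding nn_integral_inner_vol by (intro nn_integral_mono) (simp add: indicator_def)
    finally show ?thesis using True by simp
   qed (simp add: I_def)
   have "ennreal (1 / \<kappa>) * (\<integral>\<^sup>+t. I j t \<partial>lborel) = (\<integral>\<^sup>+t. ennreal (1 / \<kappa>) * I j t \<partial>lborel)"
    by (rule nn_integral_cmult[OF mI, symmetric])
   also have "\<dots> \<le> Q j" unfolding Q_def by (intro nn_integral_mono le)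
   also have "\<dots> \<le> ennreal (2 ^ j * E\<^sup>2)" by (rule Qb)
   also have "\<dots> \<le> ennreal (2 ^ J * E\<^sup>2)" using that by (intro ennreal_leI mult_right_mono power_increasing) auto
   finally have a: "ennreal (1 / \<kappa>) * (\<integral>\<^sup>+t. I j t \<partial>lborel) \<le> ennreal (2 ^ J * E\<^sup>2)" .
   have "ennreal \<kappa> * ennreal (1 / \<kappa>) = 1" using \<kappa> by (simp add: ennreal_mult[symmetric])
   then have "(\<integral>\<^sup>+t. I j t \<partial>lborel) = ennreal \<kappa> * (ennreal (1 / \<kappa>) * (\<integral>\<^sup>+t. I j t \<partial>lborel))" by (simp add: mult.assoc[symmetric])
   also have "\<dots> \<le> ennreal \<kappa> * ennreal (2 ^ J * E\<^sup>2)" by (rule mult_left_mono[OF a]) simp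
   also have "\<dots> = ennreal (\<kappa> * 2 ^ J * E\<^sup>2)" using \<kappa> by (simp add: ennreal_mult[symmetric] mult.assoc)
   finally show ?thesis .
  qed
  have "(\<integral>\<^sup>+t. ennreal (inner_energy m x0 u t) * indicator {0..T} t \<partial>lborel) \<le> (\<integral>\<^sup>+t. (\<Sum>j\<le>J. I j t) \<partial>lborel)"
  proof (rule nn_integral_mono)
   fix t
   have mt: "(\<lambda>p. ennreal (Fc (t, p)) * indicator (A j) p) \<in> borel_measurable (inner_vol m x0)" for j
    using measurable_Pair2[OF mFA, of t] by simp
   have "(\<integral>\<^sup>+p. ennreal (Fc (t, p)) \<partial>inner_vol m x0) \<le> (\<integral>\<^sup>+p. (\<Sum>j\<le>J. ennreal (Fc (t, p)) * indicator (A j) p) \<partial>inner_vol m x0)"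
   proof (rule nn_integral_mono)
    fix p assume "p \<in> space (inner_vol m x0)"
    then obtain j where j: "j \<le> J" "p \<in> A j" using cover by blast
    have "ennreal (Fc (t, p)) * indicator (A j) p \<le> (\<Sum>j\<le>J. ennreal (Fc (t, p)) * indicator (A j) p)"
     by (rule member_le_sum) (use j in auto)
    then show "ennreal (Fc (t, p)) \<le> (\<Sum>j\<le>J. ennreal (Fc (t, p)) * indicator (A j) p)" using j by simp
   qed
   also have "\<dots> = (\<Sum>j\<le>J. \<integral>\<^sup>+p. ennreal (Fc (t, p)) * indicator (A j) p \<partial>inner_vol m x0)" by (rule nn_integral_sum[OF mt])
   finally have "(\<integral>\<^sup>+p. ennreal (Fc (t, p)) \<partial>inner_vol m x0) * indicator {0..T} t \<le> (\<Sum>j\<le>J. \<integral>\<^sup>+p. ennreal (Fc (t, p)) * indicator (A j) p \<partial>inner_vol m x0) * indicator {0..T} t"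
    by (rule mult_right_mono) simp
   then show "ennreal (inner_energy m x0 u t) * indicator {0..T} t \<le> (\<Sum>j\<le>J. I j t)" unfolding S I_def sum_distrib_right .
  qed
  also have "\<dots> = (\<Sum>j\<le>J. \<integral>\<^sup>+t. I j t \<partial>lborel)" by (rule nn_integral_sum[OF mI])
  also have "\<dots> \<le> (\<Sum>j\<le>J. ennreal (\<kappa> * 2 ^ J * E\<^sup>2))" by (intro sum_mono Ib) simp
  also have "\<dots> = ennreal (\<Sum>j\<le>J. \<kappa> * 2 ^ J * E\<^sup>2)" using \<kappa> by (intro sum_ennreal) auto
  also have "(\<Sum>j\<le>J. \<kappa> * 2 ^ J * E\<^sup>2) = \<kappa> * (real (Suc J) * 2 ^ J) * E\<^sup>2" by simp
  finally show "(\<integral>\<^sup>+t. ennreal (inner_energy m x0 u t) * indicator {0..T} t \<partial>lborel) \<le> ennreal (\<kappa> * (real (Suc J) * 2 ^ J) * E\<^sup>2)" .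
 qed
qed

section \<open>Observability of the trapped component\<close>

lemma time_moment:
 fixes \<Phi> :: "point \<Rightarrow> complex"
 assumes x0: "x0 < 0" and u: "C_upto (Suc n) ({0..} \<times> {x0..} \<times> S2) (\<lambda>(t, p). u t p)" and c: "continuous_on ({x0..0} \<times> S2) \<Phi>" and t: "t \<ge> 0"
 shows "((\<lambda>t. \<integral>p. u t p * \<Phi> p \<partial>inner_vol m x0) has_vector_derivative (\<integral>p. dt u t p * \<Phi> p \<partial>inner_vol m x0)) (at t within {0..})"
proof (rule has_vector_derivative_integral_compact[OF finite_inner_vol[OF x0] measurable_ident_inner_vol inner_vol_subset compact_inner])
 have sub: "{0..} \<times> {x0..0} \<times> S2 \<subseteq> {0..} \<times> {x0..} \<times> S2" by auto
 have cu: "continuous_on ({0..} \<times> {x0..0} \<times> S2) (\<lambda>q. u (fst q) (snd q))" "continuous_on ({0..} \<times> {x0..0} \<times> S2) (\<lambda>q. dt u (fst q) (snd q))"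
  using continuous_on_subset[OF C_upto_imp_continuous[OF u] sub] continuous_on_subset[OF C_upto_imp_continuous[OF C_upto_dt(1)[OF u]] sub]
  by (simp_all add: case_prod_unfold)
 show "((\<lambda>s. u s p * \<Phi> p) has_vector_derivative dt u s p * \<Phi> p) (at s within {0..})" if "s \<in> {0..}" "p \<in> {x0..0} \<times> S2" for s p
  by (rule has_vector_derivative_mult_left[OF C_upto_dt(2)[OF u]]) (use that in auto)
 have "continuous_on ({0..} \<times> {x0..0} \<times> S2) (\<lambda>q. dt u (fst q) (snd q) * \<Phi> (snd q))"
  by (rule continuous_on_mult[OF cu(2) continuous_on_compose2[OF c]]) (auto intro!: continuous_intros)
 then show "continuous_on ({0..} \<times> {x0..0} \<times> S2) (\<lambda>(s, p). dt u s p * \<Phi> p)" by (simp add: case_prod_unfold)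
 show "continuous_on ({x0..0} \<times> S2) (\<lambda>p. u s p * \<Phi> p)" if "s \<in> {0..}" for s
  using continuous_on_mult[OF continuous_on_slice[OF cu(1) that] c] by simp
qed (use t in auto)

text \<open>The free parameter \<open>\<tau>\<close> replaces the Cauchy-Schwarz inequality, so the bound is linear in the
 energy and can be integrated in time.\<close>

lemma norm_integral_young:
 fixes f g :: "point \<Rightarrow> complex"
 assumes x0: "x0 < 0" and c: "continuous_on ({x0..0} \<times> S2) f" "continuous_on ({x0..0} \<times> S2) g" and \<tau>: "\<tau> > 0"
 shows "norm (\<integral>p. f p * g p \<partial>inner_vol m x0) \<le> (\<tau> * (\<integral>p. (norm (f p))\<^sup>2 \<partial>inner_vol m x0) + (\<integral>p. (norm (g p))\<^sup>2 \<partial>inner_vol m x0) / \<tau>) / 2"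
proof -
 have i: "integrable (inner_vol m x0) (\<lambda>p. (norm (f p))\<^sup>2)" "integrable (inner_vol m x0) (\<lambda>p. (norm (g p))\<^sup>2)"
  by (intro inner_integrable[OF x0] continuous_intros c)+
 have y: "a * b \<le> (\<tau> * a\<^sup>2 + b\<^sup>2 / \<tau>) / 2" for a b :: real
 proof -
  have "0 \<le> (\<tau> * a - b)\<^sup>2 / \<tau>" using \<tau> by simp
  also have "\<dots> = \<tau> * a\<^sup>2 - 2 * (a * b) + b\<^sup>2 / \<tau>" using \<tau> by (simp add: power2_eq_square field_simps)
  finally show ?thesis by simp
 qed
 have "norm (\<integral>p. f p * g p \<partial>inner_vol m x0) \<le> (\<integral>p. (\<tau> * (norm (f p))\<^sup>2 + (norm (g p))\<^sup>2 / \<tau>) / 2 \<partial>inner_vol m x0)"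
 proof (rule Bochner_Integration.integral_norm_bound_integral)
  show "integrable (inner_vol m x0) (\<lambda>p. f p * g p)" by (intro inner_integrable[OF x0] continuous_intros c)
  show "integrable (inner_vol m x0) (\<lambda>p. (\<tau> * (norm (f p))\<^sup>2 + (norm (g p))\<^sup>2 / \<tau>) / 2)"
   using i by simp
  show "norm (f p * g p) \<le> (\<tau> * (norm (f p))\<^sup>2 + (norm (g p))\<^sup>2 / \<tau>) / 2" for p unfolding norm_mult by (rule y)
 qed
 also have "\<dots> = (\<tau> * (\<integral>p. (norm (f p))\<^sup>2 \<partial>inner_vol m x0) + (\<integral>p. (norm (g p))\<^sup>2 \<partial>inner_vol m x0) / \<tau>) / 2"
  using i by simp
 finally show ?thesis .
qed

lemma continuous_sep:
 assumes "continuous_on UNIV g" "continuous_on S2 Z"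
 shows "continuous_on (A \<times> S2) (sep m g Z)"
 unfolding sep_def case_prod_unfold
 by (intro continuous_on_mult continuous_on_of_real continuous_on_divide continuous_on_compose2[OF assms(1)]
   continuous_on_compose2[OF continuous_on_warp[of UNIV m]] continuous_on_compose2[OF assms(2)] continuous_on_fst continuous_on_snd continuous_on_id) auto

lemma inner_sep_square:
 assumes x0: "x0 < 0" and g: "continuous_on UNIV g" "\<And>x. x \<ge> 0 \<Longrightarrow> g x = 0" and Z: "continuous_on S2 Z" "(\<integral>\<omega>. (norm (Z \<omega>))\<^sup>2 \<partial>\<sigma>) = 1"
 shows "(\<integral>p. (norm (sep m g Z p))\<^sup>2 \<partial>inner_vol m x0) = integral {x0..0} (\<lambda>x. (g x)\<^sup>2)"
proof -
 have n: "(norm (sep m g Z (x, \<omega>)))\<^sup>2 = (g x / warp m x)\<^sup>2 * (norm (Z \<omega>))\<^sup>2" for x \<omega>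
  unfolding sep_def split_conv norm_mult norm_of_real power_mult_distrib power2_abs by simp
 have "(\<integral>p. (norm (sep m g Z p))\<^sup>2 \<partial>inner_vol m x0) = (\<integral>p. (norm (sep m g Z p))\<^sup>2 \<partial>vol m x0)"
  by (rule integral_inner_vol[symmetric]) (simp add: n g)
 also have "\<dots> = integral {x0..0} (\<lambda>x. (warp m x)\<^sup>2 *\<^sub>R (\<integral>\<omega>. (norm (sep m g Z (x, \<omega>)))\<^sup>2 \<partial>\<sigma>))"
 proof (rule integral_vol_compact(2))
  show "continuous_on ({x0..} \<times> S2) (\<lambda>p. (norm (sep m g Z p))\<^sup>2)" by (intro continuous_intros continuous_sep g Z)
 qed (use x0 g in \<open>auto simp: n\<close>)
 also have "\<dots> = integral {x0..0} (\<lambda>x. (g x)\<^sup>2)" unfolding n by (simp add: Z power_divide)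
 finally show ?thesis .
qed

text \<open>The energy is only known to be measurable in time, with a bound on its Lebesgue integral;
 the function \<open>f\<close> is continuous.\<close>

lemma integral_le_energy:
 fixes f S :: "real \<Rightarrow> real"
 assumes f: "continuous_on {0..T} f" "\<And>t. t \<in> {0..T} \<Longrightarrow> 0 \<le> f t" "\<And>t. t \<in> {0..T} \<Longrightarrow> f t \<le> \<alpha> * S t + \<beta>"
  and ab: "\<alpha> \<ge> 0" "\<beta> \<ge> 0" and T: "T \<ge> 0" and K: "K \<ge> 0" and S0: "\<And>t. S t \<ge> 0"
  and S: "(\<lambda>t. ennreal (S t) * indicator {0..T} t) \<in> borel_measurable lborel" "(\<integral>\<^sup>+t. ennreal (S t) * indicator {0..T} t \<partial>lborel) \<le> ennreal K"
 shows "integral {0..T} f \<le> \<alpha> * K + \<beta> * T"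
proof -
 have si: "set_integrable lborel {0..T} f" by (rule borel_integrable_atLeastAtMost'[OF f(1)])
 have "ennreal (integral {0..T} f) = ennreal (LINT t:{0..T}|lborel. f t)"
  using set_borel_integral_eq_integral(2)[OF si] by simp
 also have "\<dots> = (\<integral>\<^sup>+t. ennreal (indicator {0..T} t *\<^sub>R f t) \<partial>lborel)"
  unfolding set_lebesgue_integral_def
  by (rule nn_integral_eq_integral[symmetric]) (use si f(2) in \<open>auto simp: set_integrable_def indicator_def\<close>)
 also have "\<dots> \<le> (\<integral>\<^sup>+t. ennreal \<alpha> * (ennreal (S t) * indicator {0..T} t) + ennreal \<beta> * indicator {0..T} t \<partial>lborel)"
 proof (rule nn_integral_mono)
  fix t
  show "ennreal (indicator {0..T} t *\<^sub>R f t) \<le> ennreal \<alpha> * (ennreal (S t) * indicator {0..T} t) + ennreal \<beta> * indicator {0..T} t"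
  proof (cases "t \<in> {0..T}")
   case True
   have "ennreal (f t) \<le> ennreal (\<alpha> * S t + \<beta>)" by (rule ennreal_leI[OF f(3)[OF True]])
   also have "\<dots> = ennreal \<alpha> * ennreal (S t) + ennreal \<beta>" using ab S0[of t] by (simp add: ennreal_mult)
   finally show ?thesis using True by simp
  qed simp
 qed
 also have "\<dots> = ennreal \<alpha> * (\<integral>\<^sup>+t. ennreal (S t) * indicator {0..T} t \<partial>lborel) + ennreal \<beta> * ennreal T"
  using S(1) T by (subst nn_integral_add) (auto simp: nn_integral_cmult)
 also have "\<dots> \<le> ennreal \<alpha> * ennreal K + ennreal \<beta> * ennreal T" by (intro add_right_mono mult_left_mono S(2)) simp
 also have "\<dots> = ennreal (\<alpha> * K + \<beta> * T)" using ab T K by (simp add: ennreal_mult)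
 finally show ?thesis using ab T K by (subst (asm) ennreal_le_iff) auto
qed

text \<open>The moment of a solution against the quasimode obeys the oscillator equation up to a small
 source. The hypothesis on \<open>h\<close> says that it is a quasimode with frequency \<open>\<omega>\<close> and residual \<open>r\<close>.
 The inequality is \<open>T \<bar>z 0\<bar> \<le> \<integral> \<bar>z t\<bar> dt + T \<integral> \<bar>e t\<bar> dt\<close> with both integrals estimated by the
 energy.\<close>

lemma trapped_observability:
 assumes m: "m \<ge> 1" and x0: "x0 < 0" and h: "\<And>n. C_on n UNIV h" and h0: "h x0 = 0" "\<And>x. x \<ge> X \<Longrightarrow> h x = 0" and X: "x0 < X" "X < 0"
  and Y: "eigenfunction Y L"
  and eq: "\<And>x. deriv (deriv h) x - pot m L x * h x = - \<omega>\<^sup>2 * h x + r x" and r: "continuous_on UNIV r" and \<omega>: "\<omega> > 0"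
  and I: "integral {x0..0} (\<lambda>x. (h x)\<^sup>2) \<ge> 1" "integral {x0..0} (\<lambda>x. (h x)\<^sup>2) \<le> 4"
  and R: "integral {x0..0} (\<lambda>x. (r x)\<^sup>2) \<le> \<epsilon>\<^sup>2" "\<epsilon> > 0"
  and sol: "wave_solution m x0 (sep m h Y) (\<lambda>p. 0) u" and T: "T > 0" and K: "K \<ge> 0" and \<tau>: "\<tau> > 0"
  and S: "(\<lambda>t. ennreal (inner_energy m x0 u t) * indicator {0..T} t) \<in> borel_measurable lborel"
   "(\<integral>\<^sup>+t. ennreal (inner_energy m x0 u t) * indicator {0..T} t \<partial>lborel) \<le> ennreal K"
 shows "T * \<omega> \<le> (1 + \<omega>) / 2 * (\<tau> * K + 4 / \<tau> * T) + T * (\<epsilon> / 2 * (K + T))"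
proof -
 let ?M = "inner_vol m x0"
 define Z where "Z \<eta> = cnj (Y \<eta>)" for \<eta>
 define \<Phi> where "\<Phi> = sep m h Z"
 define \<rho> where "\<rho> = sep m r Z"
 have ZC: "C_upto 2 S2 Z" unfolding Z_def[abs_def] by (rule C_upto_cnj[OF eigenfunctionD(5)[OF Y]])
 have Zl: "sphere_lap Z \<eta> = - of_real L * Z \<eta>" if "\<eta> \<in> S2" for \<eta>
  unfolding Z_def[abs_def] sphere_lap_cnj[OF eigenfunctionD(5)[OF Y] that] eigenfunctionD(2)[OF Y that] by simp
 have cZ: "continuous_on S2 Z" by (rule C_upto_imp_continuous[OF ZC])
 have nZ: "(\<integral>\<eta>. (norm (Z \<eta>))\<^sup>2 \<partial>\<sigma>) = 1" unfolding Z_def using eigenfunctionD(3)[OF Y] by simp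
 have ch: "continuous_on UNIV h" by (rule C_on_imp_continuous[OF h[of 0]])
 have dh: "DERIV h x :> deriv h x" "DERIV (deriv h) x :> deriv (deriv h) x" for x
  using C_on_Suc_real(2)[OF h[of "Suc 0"]] C_on_Suc_real(2)[OF C_on_Suc_real(1)[OF h[of "Suc (Suc 0)"]]] by auto
 have ch2: "continuous_on UNIV (deriv (deriv h))"
  by (rule C_on_imp_continuous[OF C_on_Suc_real(1)[OF C_on_Suc_real(1)[OF h[of "Suc (Suc 0)"]]]])
 have z0: "h x = 0" if "x \<ge> 0" for x using h0(2)[of x] that X by simp
 have z1: "deriv h x = 0" if "x > X" for x by (rule deriv_zero_beyond[OF h0(2) that])
 have z2: "deriv (deriv h) x = 0" if "x \<ge> 0" for x
  by (rule deriv_zero_beyond[of "X / 2" "deriv h", OF z1]) (use that X in auto)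
 have zr: "r x = 0" if "x \<ge> 0" for x using eq[of x] z0[OF that] z2[OF that] by simp
 have c\<Phi>: "continuous_on (A \<times> S2) \<Phi>" and c\<rho>: "continuous_on (A \<times> S2) \<rho>" for A
  unfolding \<Phi>_def \<rho>_def by (intro continuous_sep ch r cZ)+
 have n\<Phi>: "(\<integral>p. (norm (\<Phi> p))\<^sup>2 \<partial>?M) = integral {x0..0} (\<lambda>x. (h x)\<^sup>2)" unfolding \<Phi>_def by (rule inner_sep_square[OF x0 ch z0 cZ nZ])
 have n\<rho>: "(\<integral>p. (norm (\<rho> p))\<^sup>2 \<partial>?M) = integral {x0..0} (\<lambda>x. (r x)\<^sup>2)" unfolding \<rho>_def by (rule inner_sep_square[OF x0 r zr cZ nZ])
 have u2: "C_upto 2 ({0..} \<times> {x0..} \<times> S2) (\<lambda>(t, p). u t p)" using sol by (simp add: wave_solution_def)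
 have u2': "C_upto (Suc (Suc 0)) ({0..} \<times> {x0..} \<times> S2) (\<lambda>(t, p). u t p)" using u2 by (simp add: numeral_2_eq_2)
 have du: "C_upto (Suc 0) ({0..} \<times> {x0..} \<times> S2) (\<lambda>(t, p). dt u t p)" by (rule C_upto_dt(1)[OF u2'])
 have cut: "continuous_on ({x0..} \<times> S2) (u t)" "continuous_on ({x0..} \<times> S2) (dt u t)" if "t \<ge> 0" for t
  using continuous_on_slice[OF C_upto_imp_continuous[OF u2], of t] continuous_on_slice[OF C_upto_imp_continuous[OF du], of t] that by auto
 have sub: "{x0..0} \<times> S2 \<subseteq> {x0..} \<times> S2" by auto
 have cui: "continuous_on ({x0..0} \<times> S2) (u t)" "continuous_on ({x0..0} \<times> S2) (dt u t)" if "t \<ge> 0" for t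
  using continuous_on_subset[OF cut(1)[OF that] sub] continuous_on_subset[OF cut(2)[OF that] sub] by auto
 define c where "c t = (\<integral>p. u t p * \<Phi> p \<partial>?M)" for t
 define c1 where "c1 t = (\<integral>p. dt u t p * \<Phi> p \<partial>?M)" for t
 define e where "e t = (\<integral>p. u t p * \<rho> p \<partial>?M)" for t
 have D1: "(c has_vector_derivative c1 t) (at t within {0..})" if "t \<ge> 0" for t
  unfolding c_def[abs_def] c1_def by (rule time_moment[OF x0 u2' c\<Phi> that])
 have ode: "(\<integral>p. dt (dt u) t p * \<Phi> p \<partial>?M) = - \<omega>\<^sup>2 * c t + e t" if t: "t \<ge> 0" for t
 proof -
  have ut: "C_upto 2 ({x0..} \<times> S2) (u t)" using C_upto_slice[OF u2, of t] t by simp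
  have bdry: "u t (x0, \<eta>) = 0" if "\<eta> \<in> S2" for \<eta> using sol t that by (simp add: wave_solution_def)
  have pde: "dt (dt u) t p = lap m x0 (u t) p" if "p \<in> {x0..} \<times> S2" for p
  proof -
   have "- dt (dt u) t p + lap m x0 (u t) p = 0" using sol t that unfolding wave_solution_def by blast
   then show ?thesis by (simp add: add_eq_0_iff2)
  qed
  have "(\<integral>p. dt (dt u) t p * \<Phi> p \<partial>?M) = (\<integral>p. lap m x0 (u t) p * \<Phi> p \<partial>?M)"
   by (rule Bochner_Integration.integral_cong) (use pde in auto)
  also have "\<dots> = (\<integral>p. lap m x0 (u t) p * \<Phi> p \<partial>vol m x0)"
   by (rule integral_inner_vol[symmetric]) (simp add: \<Phi>_def sep_def z0)
  also have "\<dots> = (\<integral>p. u t p * sep m (\<lambda>x. deriv (deriv h) x - pot m L x * h x) Z p \<partial>vol m x0)"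
   unfolding \<Phi>_def
   by (rule green_separated[OF m dh ch2 h0(1) _ z0 z2 _ ZC Zl ut bdry]) (use z1[of 0] X x0 in auto)
  also have "\<dots> = (\<integral>p. u t p * sep m (\<lambda>x. deriv (deriv h) x - pot m L x * h x) Z p \<partial>?M)"
   by (rule integral_inner_vol) (simp add: sep_def z0 z2)
  also have "\<dots> = (\<integral>p. - \<omega>\<^sup>2 * (u t p * \<Phi> p) + u t p * \<rho> p \<partial>?M)"
   unfolding eq by (rule Bochner_Integration.integral_cong) (auto simp: sep_def \<Phi>_def \<rho>_def add_divide_distrib diff_divide_distrib algebra_simps)
  also have "\<dots> = - \<omega>\<^sup>2 * c t + e t"
  proof -
   have "integrable ?M (\<lambda>p. u t p * \<Phi> p)" "integrable ?M (\<lambda>p. u t p * \<rho> p)"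
    by (intro inner_integrable[OF x0] continuous_on_mult cui[OF t] c\<Phi> c\<rho>)+
   then show ?thesis unfolding c_def e_def by simp
  qed
  finally show ?thesis .
 qed
 have D2: "(c1 has_vector_derivative - \<omega>\<^sup>2 * c t + e t) (at t within {0..})" if "t \<ge> 0" for t
  unfolding c1_def[abs_def] ode[OF that, symmetric] by (rule time_moment[OF x0 du c\<Phi> that])
 have ce: "continuous_on {0..} e"
 proof (rule continuous_on_eq_continuous_within[THEN iffD2], rule ballI)
  fix t :: real assume "t \<in> {0..}"
  then have "t \<ge> 0" by simp
  from time_moment[OF x0 u2' c\<rho> this] show "continuous (at t within {0..}) e"
   unfolding e_def[abs_def] by (rule has_vector_derivative_continuous)
 qed
 \<comment> \<open>Factoring out the oscillation leaves a slowly varying amplitude.\<close>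
 define a where "a = - (\<i> * complex_of_real \<omega>)"
 define z where "z t = exp (t *\<^sub>R a) * (c1 t + \<i> * \<omega> * c t)" for t
 have ne: "norm (exp (t *\<^sub>R a)) = 1" for t by (simp add: a_def norm_exp_eq_Re)
 have Dz: "(z has_vector_derivative exp (t *\<^sub>R a) * e t) (at t within {0..})" if "t \<ge> 0" for t
 proof -
  have "(z has_vector_derivative exp (t *\<^sub>R a) * ((- \<omega>\<^sup>2 * c t + e t) + \<i> * \<omega> * c1 t) + (exp (t *\<^sub>R a) * a) * (c1 t + \<i> * \<omega> * c t)) (at t within {0..})"
   unfolding z_def[abs_def]
   by (rule has_vector_derivative_mult[OF exp_scaleR_has_vector_derivative_right has_vector_derivative_add[OF D2[OF that] has_vector_derivative_mult_right[OF D1[OF that]]]])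
  moreover have "exp (t *\<^sub>R a) * ((- \<omega>\<^sup>2 * c t + e t) + \<i> * \<omega> * c1 t) + (exp (t *\<^sub>R a) * a) * (c1 t + \<i> * \<omega> * c t) = exp (t *\<^sub>R a) * e t"
  proof -
   have "((- \<omega>\<^sup>2 * c t + e t) + \<i> * \<omega> * c1 t) + a * (c1 t + \<i> * \<omega> * c t) = e t"
    by (simp add: a_def algebra_simps power2_eq_square)
   then show ?thesis by (metis (no_types, lifting) distrib_left mult.assoc)
  qed
  ultimately show ?thesis by simp
 qed
 have nz: "norm (z t) \<le> (1 + \<omega>) / 2 * \<tau> * inner_energy m x0 u t + (1 + \<omega>) / 2 * (4 / \<tau>)"
  and nee: "norm (e t) \<le> \<epsilon> / 2 * inner_energy m x0 u t + \<epsilon> / 2" if t: "t \<ge> 0" for t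
 proof -
  have i: "integrable ?M (\<lambda>p. (norm (dt u t p))\<^sup>2)" "integrable ?M (\<lambda>p. (norm (u t p))\<^sup>2)"
   by (intro inner_integrable[OF x0] continuous_intros cui[OF t])+
  define S0 S1 where "S0 = (\<integral>p. (norm (u t p))\<^sup>2 \<partial>?M)" and "S1 = (\<integral>p. (norm (dt u t p))\<^sup>2 \<partial>?M)"
  have S: "inner_energy m x0 u t = S1 + S0" unfolding inner_energy_def S0_def S1_def using i by simp
  have S01: "S0 \<ge> 0" "S1 \<ge> 0" unfolding S0_def S1_def by simp_all
  define w where "w = (\<tau> * (S1 + S0) + 4 / \<tau>) / 2"
  have y: "(\<integral>p. (norm (\<Phi> p))\<^sup>2 \<partial>?M) / \<tau> \<le> 4 / \<tau>" using I(2) \<tau> unfolding n\<Phi> by (intro divide_right_mono) auto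
  have yt: "\<tau> * S0 \<le> \<tau> * (S1 + S0)" "\<tau> * S1 \<le> \<tau> * (S1 + S0)" using \<tau> S01 by (auto intro!: mult_left_mono)
  have avg: "x \<le> (a + b) / 2 \<Longrightarrow> b \<le> d \<Longrightarrow> a \<le> a' \<Longrightarrow> x \<le> (a' + d) / 2" for x a b d a' :: real
   by (rule order_trans, assumption, intro divide_right_mono add_mono) auto
  have "norm (c t) \<le> w"
   unfolding c_def w_def by (rule avg[OF norm_integral_young[OF x0 cui(1)[OF t] c\<Phi> \<tau>, of m, folded S0_def] y yt(1)])
  then have wc: "\<omega> * norm (c t) \<le> \<omega> * w" using \<omega> by (intro mult_left_mono) auto
  have "norm (c1 t) \<le> w"
   unfolding c1_def w_def by (rule avg[OF norm_integral_young[OF x0 cui(2)[OF t] c\<Phi> \<tau>, of m, folded S1_def] y yt(2)])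
  moreover have "norm (z t) \<le> norm (c1 t) + \<omega> * norm (c t)"
   unfolding z_def norm_mult ne using norm_triangle_ineq[of "c1 t" "\<i> * \<omega> * c t"] \<omega> by (simp add: norm_mult)
  ultimately have "norm (z t) \<le> w + \<omega> * w" using wc by linarith
  also have "\<dots> = (1 + \<omega>) / 2 * \<tau> * (S1 + S0) + (1 + \<omega>) / 2 * (4 / \<tau>)"
  proof -
   have "(\<tau> * s + q) / 2 + \<omega> * ((\<tau> * s + q) / 2) = (1 + \<omega>) / 2 * \<tau> * s + (1 + \<omega>) / 2 * q" for s q
    by (simp add: field_simps)
   then show ?thesis unfolding w_def .
  qed
  finally show "norm (z t) \<le> (1 + \<omega>) / 2 * \<tau> * inner_energy m x0 u t + (1 + \<omega>) / 2 * (4 / \<tau>)" unfolding S .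
  have "norm (e t) \<le> (\<epsilon> * S0 + (\<integral>p. (norm (\<rho> p))\<^sup>2 \<partial>?M) / \<epsilon>) / 2"
   unfolding e_def S0_def by (rule norm_integral_young[OF x0 cui(1)[OF t] c\<rho> R(2)])
  moreover have "(\<integral>p. (norm (\<rho> p))\<^sup>2 \<partial>?M) / \<epsilon> \<le> \<epsilon>\<^sup>2 / \<epsilon>" using R unfolding n\<rho> by (intro divide_right_mono) auto
  moreover have "\<epsilon>\<^sup>2 / \<epsilon> = \<epsilon>" using R(2) by (simp add: power2_eq_square)
  moreover have "\<epsilon> * S0 \<le> \<epsilon> * (S1 + S0)" using R(2) S01 by (intro mult_left_mono) auto
  ultimately show "norm (e t) \<le> \<epsilon> / 2 * inner_energy m x0 u t + \<epsilon> / 2" unfolding S by simp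
 qed
 have S0: "inner_energy m x0 u t \<ge> 0" for t unfolding inner_energy_def by (intro Bochner_Integration.integral_nonneg) simp
 have cz: "continuous_on {0..} z"
 proof (rule continuous_on_eq_continuous_within[THEN iffD2], rule ballI)
  fix t :: real assume "t \<in> {0..}"
  then have "t \<ge> 0" by simp
  from Dz[OF this] show "continuous (at t within {0..}) z" by (rule has_vector_derivative_continuous)
 qed
 have sT: "{0..T} \<subseteq> {0..}" by auto
 define Ie where "Ie = integral {0..T} (\<lambda>t. norm (e t))"
 have Ie: "Ie \<le> \<epsilon> / 2 * K + \<epsilon> / 2 * T"
  unfolding Ie_def
  by (rule integral_le_energy[OF _ _ _ _ _ _ K S0 S]) (use continuous_on_subset[OF ce sT] nee R T in \<open>auto intro!: continuous_intros\<close>)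
 have Iz: "integral {0..T} (\<lambda>t. norm (z t)) \<le> (1 + \<omega>) / 2 * \<tau> * K + (1 + \<omega>) / 2 * (4 / \<tau>) * T"
  by (rule integral_le_energy[OF _ _ _ _ _ _ K S0 S]) (use continuous_on_subset[OF cz sT] nz \<omega> \<tau> T in \<open>auto intro!: continuous_intros\<close>)
 have zt: "norm (z 0) \<le> norm (z t) + Ie" if t: "t \<in> {0..T}" for t
 proof -
  have st: "{0..t} \<subseteq> {0..}" "{0..t} \<subseteq> {0..T}" using t by auto
  have hi: "((\<lambda>s. exp (s *\<^sub>R a) * e s) has_integral z t - z 0) {0..t}"
   by (rule fundamental_theorem_of_calculus) (use t Dz in \<open>auto intro: has_vector_derivative_within_subset[OF _ st(1)]\<close>)
  have ne_int: "(\<lambda>s. norm (e s)) integrable_on {0..t}" "(\<lambda>s. norm (e s)) integrable_on {0..T}"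
   using continuous_on_subset[OF ce st(1)] continuous_on_subset[OF ce sT] by (auto intro!: integrable_continuous_real continuous_intros)
  have "norm (z t - z 0) \<le> integral {0..t} (\<lambda>s. norm (e s))"
  proof -
   have "norm (exp (s *\<^sub>R a) * e s) \<le> norm (e s)" for s by (simp only: norm_mult ne mult_1 order_refl)
   then show ?thesis using integral_norm_bound_integral[OF has_integral_integrable[OF hi] ne_int(1)] unfolding integral_unique[OF hi] by blast
  qed
  also have "\<dots> \<le> Ie" unfolding Ie_def by (rule integral_subset_le[OF st(2) ne_int]) simp
  finally show ?thesis using norm_triangle_ineq2[of "z 0" "z t"] by (simp add: norm_minus_commute)
 qed
 have "T * norm (z 0) = integral {0..T} (\<lambda>t. norm (z 0))" using T by simp
 also have "\<dots> \<le> integral {0..T} (\<lambda>t. norm (z t) + Ie)"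
 proof (rule integral_le)
  show "(\<lambda>t. norm (z t) + Ie) integrable_on {0..T}"
   using continuous_on_subset[OF cz sT] by (auto intro!: integrable_continuous_real continuous_intros)
 qed (use zt in auto)
 also have "\<dots> = integral {0..T} (\<lambda>t. norm (z t)) + T * Ie"
  using continuous_on_subset[OF cz sT] T by (subst Henstock_Kurzweil_Integration.integral_add) (auto intro!: integrable_continuous_real continuous_intros)
 finally have main: "T * norm (z 0) \<le> integral {0..T} (\<lambda>t. norm (z t)) + T * Ie" .
 have init: "u 0 p = sep m h Y p" "dt u 0 p = 0" if "p \<in> {x0..} \<times> S2" for p
  using sol that unfolding wave_solution_def by blast+
 have "c 0 = (\<integral>p. complex_of_real ((norm (\<Phi> p))\<^sup>2) \<partial>?M)"
  unfolding c_def
 proof (rule Bochner_Integration.integral_cong)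
  fix p assume "p \<in> space ?M"
  then have "u 0 p = cnj (\<Phi> p)" using init(1)[of p] by (auto simp: \<Phi>_def sep_def Z_def)
  then show "u 0 p * \<Phi> p = complex_of_real ((norm (\<Phi> p))\<^sup>2)" by (simp add: complex_norm_square mult.commute del: of_real_power)
 qed simp
 then have c0: "c 0 = of_real (integral {x0..0} (\<lambda>x. (h x)\<^sup>2))" by (simp only: integral_complex_of_real n\<Phi>)
 have c10: "c1 0 = 0"
 proof -
  have "c1 0 = (\<integral>p. 0 \<partial>?M)" unfolding c1_def by (rule Bochner_Integration.integral_cong) (use init in auto)
  then show ?thesis by simp
 qed
 have "norm (z 0) = \<omega> * integral {x0..0} (\<lambda>x. (h x)\<^sup>2)"
  unfolding z_def norm_mult ne c0 c10 using \<omega> I(1) by (simp add: norm_mult)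
 then have "norm (z 0) \<ge> \<omega>" using I(1) \<omega> mult_left_mono[OF I(1), of \<omega>] by simp
 then have "T * \<omega> \<le> T * norm (z 0)" using T by (intro mult_left_mono) auto
 moreover have "T * Ie \<le> T * (\<epsilon> / 2 * K + \<epsilon> / 2 * T)" using Ie T by (intro mult_left_mono) auto
 moreover have "T * (\<epsilon> / 2 * K + \<epsilon> / 2 * T) = T * (\<epsilon> / 2 * (K + T))" "(1 + \<omega>) / 2 * (\<tau> * K + 4 / \<tau> * T) = (1 + \<omega>) / 2 * \<tau> * K + (1 + \<omega>) / 2 * (4 / \<tau>) * T"
  by (simp_all only: distrib_left mult.assoc)
 ultimately show ?thesis using main Iz by linarith
qed

section \<open>Failure of the local energy estimate\<close>

lemma exp_beats_power:
 fixes c G \<delta> :: real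
 assumes "c > 0" "\<delta> > 0" "G \<ge> 0"
 shows "\<exists>l\<ge>N. G * (exp (- c * sqrt (real (l * (l + 1)))) * real (l * (l + 1)) ^ n) \<le> \<delta>"
proof -
 have "filterlim (\<lambda>l. c * real l) at_top sequentially"
  by (rule filterlim_tendsto_pos_mult_at_top[OF tendsto_const assms(1) filterlim_real_sequentially])
 from filterlim_compose[OF tendsto_power_div_exp_0[of "2 * n"] this]
 have "(\<lambda>l. (c * real l) ^ (2 * n) / exp (c * real l)) \<longlonglongrightarrow> 0" .
 from tendsto_mult_left[OF this, of "G * 2 ^ n / c ^ (2 * n)"]
 have lim: "(\<lambda>l. G * 2 ^ n / c ^ (2 * n) * ((c * real l) ^ (2 * n) / exp (c * real l))) \<longlonglongrightarrow> 0" by simp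
 from eventually_happens'[OF sequentially_bot eventually_conj[OF order_tendstoD(2)[OF lim assms(2)] eventually_ge_at_top[of "max N 1"]]]
 obtain l where l: "G * 2 ^ n / c ^ (2 * n) * ((c * real l) ^ (2 * n) / exp (c * real l)) < \<delta>" "l \<ge> max N 1"
  by (elim exE conjE)
 have l1: "real l \<ge> 1" using l(2) by simp
 have "real l \<le> sqrt (real (l * (l + 1)))" by (rule real_le_rsqrt) (simp add: power2_eq_square)
 then have "exp (- c * sqrt (real (l * (l + 1)))) \<le> exp (- (c * real l))" using assms(1) by simp
 moreover have "real (l * (l + 1)) ^ n \<le> (2 * (real l)\<^sup>2) ^ n"
 proof (rule power_mono)
  have "real l * 1 \<le> real l * real l" using l1 by (intro mult_left_mono) auto
  then show "real (l * (l + 1)) \<le> 2 * (real l)\<^sup>2" by (simp add: power2_eq_square algebra_simps)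
 qed simp
 ultimately have "exp (- c * sqrt (real (l * (l + 1)))) * real (l * (l + 1)) ^ n \<le> exp (- (c * real l)) * (2 * (real l)\<^sup>2) ^ n"
  by (intro mult_mono) auto
 then have "G * (exp (- c * sqrt (real (l * (l + 1)))) * real (l * (l + 1)) ^ n) \<le> G * (exp (- (c * real l)) * (2 * (real l)\<^sup>2) ^ n)"
  by (intro mult_left_mono assms)
 also have "\<dots> = G * 2 ^ n / c ^ (2 * n) * ((c * real l) ^ (2 * n) / exp (c * real l))"
  using assms(1) by (simp add: power_mult_distrib power_mult[symmetric] exp_minus field_simps)
 finally show ?thesis using l by (intro exI[of _ l]) auto
qed

text \<open>The residual is the commutator of the operator with the cutoff.\<close>

lemma quasimode_residual:
 assumes mo: "mode m L \<mu> \<psi> \<psi>'"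
 shows "deriv (deriv (quasimode x0 \<psi>)) x - pot m L x * quasimode x0 \<psi> x
   = - \<mu> * quasimode x0 \<psi> x + (deriv (deriv (cutoff x0)) x * \<psi> x + 2 * deriv (cutoff x0) x * \<psi>' x)"
proof -
 let ?\<theta> = "cutoff x0"
 have \<theta>: "DERIV ?\<theta> x :> deriv ?\<theta> x" "DERIV (deriv ?\<theta>) x :> deriv (deriv ?\<theta>) x" for x
  using C_on_Suc_real(2)[OF C_on_cutoff] C_on_Suc_real(2)[OF C_on_Suc_real(1)[OF C_on_cutoff]] by auto
 have \<psi>: "DERIV \<psi> x :> \<psi>' x" "DERIV \<psi>' x :> (pot m L x - \<mu>) * \<psi> x" for x
  using mo by (auto simp: mode_def)
 have 1: "deriv (quasimode x0 \<psi>) = (\<lambda>x. deriv ?\<theta> x * \<psi> x + \<psi>' x * ?\<theta> x)"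
  unfolding quasimode_def by (intro ext DERIV_imp_deriv DERIV_mult \<theta> \<psi>)
 have 2: "deriv (deriv (quasimode x0 \<psi>)) x = (deriv (deriv ?\<theta>) x * \<psi> x + \<psi>' x * deriv ?\<theta> x) + ((pot m L x - \<mu>) * \<psi> x * ?\<theta> x + deriv ?\<theta> x * \<psi>' x)"
  unfolding 1 by (intro DERIV_imp_deriv DERIV_add DERIV_mult \<theta> \<psi>)
 show ?thesis unfolding 2 by (simp add: quasimode_def algebra_simps)
qed

lemma admissible_sep:
 assumes "x0 < 0" "R > 0" "\<And>n. C_on n UNIV h" "h x0 = 0" "\<And>x. x \<ge> X \<Longrightarrow> h x = 0" "X < 0" "\<And>n. C_on n UNIV Y"
 shows "admissible_datum x0 R (sep m h Y)"
 unfolding admissible_datum_def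
proof (intro conjI ballI)
 show "smooth_upto ({x0..} \<times> S2) (sep m h Y)"
  unfolding smooth_upto_def
 proof (intro exI[of _ UNIV] exI[of _ "sep m h Y"] conjI allI ballI)
  show "C_on n UNIV (sep m h Y)" for n using C_on_sep[OF assms(3,7), where c=1 and m=m] by simp
 qed auto
 have "closure {p \<in> {x0..} \<times> S2. sep m h Y p \<noteq> 0} \<subseteq> {x0..X} \<times> S2"
 proof (rule closure_minimal)
  show "closed ({x0..X} \<times> S2)" by (intro closed_Times closed_atLeastAtMost closed_sphere)
  show "{p \<in> {x0..} \<times> S2. sep m h Y p \<noteq> 0} \<subseteq> {x0..X} \<times> S2"
  proof
   fix p assume p: "p \<in> {p \<in> {x0..} \<times> S2. sep m h Y p \<noteq> 0}"
   then have "h (fst p) \<noteq> 0" by (auto simp: sep_def)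
   then have "\<not> fst p \<ge> X" using assms(5) by blast
   then show "p \<in> {x0..X} \<times> S2" using p by (cases p) auto
  qed
 qed
 also have "{x0..X} \<times> S2 \<subseteq> {x0..<R} \<times> S2" using assms by auto
 finally show "closure {p \<in> {x0..} \<times> S2. sep m h Y p \<noteq> 0} \<subseteq> {x0..<R} \<times> S2" .
 show "sep m h Y (x0, \<omega>) = 0" for \<omega> using assms(4) by (simp add: sep_def)
qed

lemma cutoff_derivs_bounded:
 "\<exists>B\<ge>0. \<forall>x\<in>{x0..0}. \<bar>deriv (cutoff x0) x\<bar> \<le> B \<and> \<bar>deriv (deriv (cutoff x0)) x\<bar> \<le> B"
proof -
 have "continuous_on {x0..0} (deriv (cutoff x0))" "continuous_on {x0..0} (deriv (deriv (cutoff x0)))"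
  using C_on_imp_continuous[OF C_on_Suc_real(1)[OF C_on_cutoff[of "Suc 0"]]]
   C_on_imp_continuous[OF C_on_Suc_real(1)[OF C_on_Suc_real(1)[OF C_on_cutoff[of "Suc (Suc 0)"]]]] by (auto intro: continuous_on_subset)
 from continuous_on_compact_bound[OF compact_Icc this(1)] continuous_on_compact_bound[OF compact_Icc this(2)]
 obtain a b where "a \<ge> 0" "\<forall>x\<in>{x0..0}. norm (deriv (cutoff x0) x) \<le> a" "\<forall>x\<in>{x0..0}. norm (deriv (deriv (cutoff x0)) x) \<le> b" by blast
 then show ?thesis by (intro exI[of _ "max a b"]) (auto intro: max.coboundedI1 max.coboundedI2)
qed

lemma cutoff_derivs_zero:
 assumes "x0 < 0" "x \<notin> {3/8*x0..2/8*x0}"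
 shows "deriv (cutoff x0) x = 0 \<and> deriv (deriv (cutoff x0)) x = 0"
proof -
 obtain U b where U: "open U" "x \<in> U" "\<And>y. y \<in> U \<Longrightarrow> cutoff x0 y = b"
 proof (cases "x < 3/8*x0")
  case True
  show ?thesis by (rule that[of "{..<3/8*x0}" 1]) (use True assms(1) in \<open>auto simp: cutoff_1\<close>)
 next
  case False
  show ?thesis by (rule that[of "{2/8*x0<..}" 0]) (use False assms in \<open>auto simp: cutoff_0\<close>)
 qed
 have d: "deriv f y = 0" if "y \<in> U" "\<And>y. y \<in> U \<Longrightarrow> f y = a" for f :: "real \<Rightarrow> real" and y a
 proof (rule DERIV_imp_deriv)
  show "DERIV f y :> 0"
   by (rule has_field_derivative_transform_within_open[OF DERIV_const[of a] U(1) that(1)]) (simp add: that(2))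
 qed
 have 1: "deriv (cutoff x0) y = 0" if "y \<in> U" for y by (rule d[OF that U(3)])
 show ?thesis using 1[OF U(2)] d[OF U(2), of "deriv (cutoff x0)" 0, OF 1] by blast
qed

lemma residual_bound:
 assumes x0: "x0 < 0" and B: "B \<ge> 0" "\<forall>x\<in>{x0..0}. \<bar>deriv (cutoff x0) x\<bar> \<le> B \<and> \<bar>deriv (deriv (cutoff x0)) x\<bar> \<le> B"
  and s: "\<forall>y\<in>{3/8*x0..2/8*x0}. \<bar>\<psi> y\<bar> + \<bar>\<psi>' y\<bar> \<le> d" and d: "d \<ge> 0" and c: "continuous_on UNIV \<psi>" "continuous_on UNIV \<psi>'"
 defines "r \<equiv> \<lambda>x. deriv (deriv (cutoff x0)) x * \<psi> x + 2 * deriv (cutoff x0) x * \<psi>' x"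
 shows "continuous_on UNIV r" "integral {x0..0} (\<lambda>x. (r x)\<^sup>2) \<le> ((\<bar>x0\<bar> + 1) * (2 * B + 1) * d)\<^sup>2"
proof -
 have c\<theta>: "continuous_on UNIV (deriv (cutoff x0))" "continuous_on UNIV (deriv (deriv (cutoff x0)))"
  using C_on_imp_continuous[OF C_on_Suc_real(1)[OF C_on_cutoff[of "Suc 0"]]]
   C_on_imp_continuous[OF C_on_Suc_real(1)[OF C_on_Suc_real(1)[OF C_on_cutoff[of "Suc (Suc 0)"]]]] by auto
 show cr: "continuous_on UNIV r" unfolding r_def by (intro continuous_intros c c\<theta>)
 have rb: "(r x)\<^sup>2 \<le> (2 * B * d)\<^sup>2" if x: "x \<in> {x0..0}" for x
 proof (cases "x \<in> {3/8*x0..2/8*x0}")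
  case True
  have "\<bar>r x\<bar> \<le> \<bar>deriv (deriv (cutoff x0)) x\<bar> * \<bar>\<psi> x\<bar> + 2 * (\<bar>deriv (cutoff x0) x\<bar> * \<bar>\<psi>' x\<bar>)"
   unfolding r_def using abs_triangle_ineq[of "deriv (deriv (cutoff x0)) x * \<psi> x" "2 * deriv (cutoff x0) x * \<psi>' x"] by (simp add: abs_mult)
  also have "\<dots> \<le> B * \<bar>\<psi> x\<bar> + 2 * (B * \<bar>\<psi>' x\<bar>)" using B x by (intro add_mono mult_left_mono mult_right_mono) auto
  also have "\<dots> \<le> 2 * B * (\<bar>\<psi> x\<bar> + \<bar>\<psi>' x\<bar>)" using B(1) by (simp add: algebra_simps)
  also have "\<dots> \<le> 2 * B * d" using s True B(1) by (intro mult_left_mono) auto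
  finally show ?thesis using power_mono[OF _ abs_ge_zero, of "r x" "2 * B * d" 2] by (simp only: power2_abs)
 next
  case False
  then show ?thesis using cutoff_derivs_zero[OF x0 False] by (simp add: r_def)
 qed
 have "integral {x0..0} (\<lambda>x. (r x)\<^sup>2) \<le> integral {x0..0} (\<lambda>x. (2 * B * d)\<^sup>2)"
  by (intro integral_le integrable_continuous_real continuous_on_power continuous_on_subset[OF cr] rb) auto
 also have "\<dots> = \<bar>x0\<bar> * (2 * B * d)\<^sup>2" using x0 by simp
 also have "\<dots> \<le> (\<bar>x0\<bar> + 1)\<^sup>2 * ((2 * B + 1) * d)\<^sup>2"
 proof (rule mult_mono)
  show "\<bar>x0\<bar> \<le> (\<bar>x0\<bar> + 1)\<^sup>2" by (simp add: power2_eq_square algebra_simps)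
  show "(2 * B * d)\<^sup>2 \<le> ((2 * B + 1) * d)\<^sup>2" using B d by (intro power_mono mult_right_mono) auto
 qed auto
 finally show "integral {x0..0} (\<lambda>x. (r x)\<^sup>2) \<le> ((\<bar>x0\<bar> + 1) * (2 * B + 1) * d)\<^sup>2" by (simp add: power_mult_distrib)
qed

text \<open>The choices that make observability contradictory: the parameter \<open>\<tau> = 8 (1 + \<omega>) / \<omega>\<close> makes
 the term without energy a quarter of the left hand side, the size of \<open>T\<close> does the same for the
 term with \<open>K\<close>, and the smallness of \<open>\<epsilon>\<close> for the last one.\<close>

lemma time_choice:
 fixes \<omega> K L T c \<epsilon> :: real
 assumes \<omega>: "c > 0" "c \<le> \<omega>\<^sup>2" "\<omega>\<^sup>2 \<le> L" "\<omega> > 0" and L: "L \<ge> 1" and K: "K \<ge> 0" and T: "T = 64 * L * K / c + 1"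
  and \<epsilon>: "\<epsilon> * (K + T) \<le> sqrt c / 2" "T * \<omega> \<le> (1 + \<omega>) / 2 * (8 * (1 + \<omega>) / \<omega> * K + 4 / (8 * (1 + \<omega>) / \<omega>) * T) + T * (\<epsilon> / 2 * (K + T))"
 shows False
proof -
 have T0: "T > 0" unfolding T using \<omega> L K by (intro add_nonneg_pos divide_nonneg_pos mult_nonneg_nonneg) auto
 have "(1 + \<omega>)\<^sup>2 \<le> 4 * L"
 proof -
  have "(1 + \<omega>)\<^sup>2 \<le> 2 * (1 + \<omega>\<^sup>2)" using zero_le_power2[of "1 - \<omega>"] by (simp add: power2_eq_square algebra_simps)
  then show ?thesis using \<omega>(3) L by argo
 qed
 then have "16 * ((1 + \<omega>)\<^sup>2 * K) \<le> 16 * ((4 * L) * K)" using K by (intro mult_left_mono mult_right_mono) auto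
 also have "\<dots> = c * (T - 1)" using \<omega>(1) unfolding T by simp
 also have "\<dots> \<le> c * T" using \<omega>(1) by simp
 also have "\<dots> \<le> \<omega>\<^sup>2 * T" using \<omega>(2) T0 by (intro mult_right_mono) auto
 finally have a: "16 * ((1 + \<omega>)\<^sup>2 * K) \<le> \<omega>\<^sup>2 * T" .
 have e1: "(1 + \<omega>) / 2 * (8 * (1 + \<omega>) / \<omega> * K) = (16 * ((1 + \<omega>)\<^sup>2 * K)) / (4 * \<omega>)"
  using \<omega>(4) by (simp add: power2_eq_square field_simps)
 have "(16 * ((1 + \<omega>)\<^sup>2 * K)) / (4 * \<omega>) \<le> (\<omega>\<^sup>2 * T) / (4 * \<omega>)" using a \<omega>(4) by (intro divide_right_mono) auto
 also have "\<dots> = T * \<omega> / 4" using \<omega>(4) by (simp add: power2_eq_square)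
 finally have 1: "(1 + \<omega>) / 2 * (8 * (1 + \<omega>) / \<omega> * K) \<le> T * \<omega> / 4" unfolding e1 .
 have 2: "(1 + \<omega>) / 2 * (4 / (8 * (1 + \<omega>) / \<omega>) * T) = T * \<omega> / 4" using \<omega>(4) by (simp add: field_simps)
 have "sqrt c \<le> \<omega>" using \<omega>(2,4) by (intro real_le_lsqrt) auto
 then have "\<epsilon> / 2 * (K + T) \<le> \<omega> / 4" using \<epsilon>(1) by simp
 then have "T * (\<epsilon> / 2 * (K + T)) \<le> T * (\<omega> / 4)" using T0 by (intro mult_left_mono) auto
 then have 3: "T * (\<epsilon> / 2 * (K + T)) \<le> T * \<omega> / 4" by simp
 have "(1 + \<omega>) / 2 * (y * K + y' * T) = (1 + \<omega>) / 2 * (y * K) + (1 + \<omega>) / 2 * (y' * T)" for y y' by (rule distrib_left)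
 then have "T * \<omega> \<le> T * \<omega> / 4 + T * \<omega> / 4 + T * \<omega> / 4"
  using add_mono[OF add_mono[OF 1 eq_refl[OF 2]] 3] order_trans[OF \<epsilon>(2)] by metis
 moreover have "T * \<omega> > 0" using T0 \<omega>(4) by simp
 ultimately show False by simp
qed

theorem theorem3:
 fixes m k :: nat and x0 R A :: real
 assumes "m \<ge> 1" and "x0 < 0" and "R > 0" and "A > 0"
 shows "\<exists>T>0. \<exists>u0 u1. admissible_datum x0 R u0 \<and> admissible_datum x0 R u1 \<and>
      (\<exists>u. wave_solution m x0 u0 u1 u) \<and>
      (\<forall>u. wave_solution m x0 u0 u1 u \<longrightarrow>
       LE1_norm m x0 T u > ennreal A * DB_norm m x0 k (u0, u1))"
proof -
 obtain c C L0 where c: "c > 0" "C > 0" and L0: "\<forall>L\<ge>L0. \<exists>\<mu> \<psi> \<psi>'. c \<le> \<mu> \<and> \<mu> \<le> L \<and>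
   (\<forall>x. DERIV \<psi> x :> \<psi>' x) \<and> (\<forall>x. DERIV \<psi>' x :> (pot m L x - \<mu>) * \<psi> x) \<and>
   \<psi> x0 = 0 \<and> integral {x0..3/8*x0} (\<lambda>x. (\<psi> x)\<^sup>2) = 1 \<and>
   integral {x0..0} (\<lambda>x. (\<psi> x)\<^sup>2) \<le> 4 \<and> integral {x0..0} (\<lambda>x. (\<psi>' x)\<^sup>2) \<le> 4 * L \<and>
   (\<forall>y\<in>{3/8*x0..2/8*x0}. \<bar>\<psi> y\<bar> + \<bar>\<psi>' y\<bar> \<le> C * exp (- c * sqrt L))"
  using normalized_trapped_mode[OF assms(1,2)] by (elim exE conjE)
 obtain Cd N where Cd: "Cd \<ge> 0" and DB: "\<forall>L\<ge>1. \<forall>\<mu>\<in>{0..L}. \<forall>\<psi> \<psi>' Y. mode m L \<mu> \<psi> \<psi>' \<longrightarrow> \<psi> x0 = 0 \<longrightarrow> eigenfunction Y L \<longrightarrow>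
   integral {x0..0} (\<lambda>x. (\<psi> x)\<^sup>2) \<le> 4 \<longrightarrow> integral {x0..0} (\<lambda>x. (\<psi>' x)\<^sup>2) \<le> 4 * L \<longrightarrow>
   DB_norm m x0 k (sep m (quasimode x0 \<psi>) Y, \<lambda>p. 0) \<le> ennreal (Cd * L ^ N)"
  using DB_norm_quasimode[OF assms(1,2), of k] by (elim exE conjE)
 obtain C0 where C0: "C0 \<ge> 0" and LE: "\<forall>T u E. C_upto 2 ({0..} \<times> {x0..} \<times> S2) (\<lambda>(t, p). u t p) \<longrightarrow> E \<ge> 0 \<longrightarrow> LE1_norm m x0 T u \<le> ennreal E \<longrightarrow>
   (\<lambda>t. ennreal (inner_energy m x0 u t) * indicator {0..T} t) \<in> borel_measurable lborel \<and>
   (\<integral>\<^sup>+t. ennreal (inner_energy m x0 u t) * indicator {0..T} t \<partial>lborel) \<le> ennreal (C0 * E\<^sup>2)"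
  using inner_energy_LE1[OF assms(2), of m] by (elim exE conjE)
 obtain B where B: "B \<ge> 0" "\<forall>x\<in>{x0..0}. \<bar>deriv (cutoff x0) x\<bar> \<le> B \<and> \<bar>deriv (deriv (cutoff x0)) x\<bar> \<le> B"
  using cutoff_derivs_bounded[of x0] by (elim exE conjE)
 define G where "G = (\<bar>x0\<bar> + 1) * (2 * B + 1) * C"
 have G: "G > 0" unfolding G_def using B c by (intro mult_pos_pos) auto
 \<comment> \<open>If the estimate held, the energy integral would be at most \<open>a L\<^sup>2\<^sup>N\<close>.\<close>
 define a where "a = C0 * (A * Cd)\<^sup>2"
 have a: "a \<ge> 0" unfolding a_def using C0 by simp
 have "\<exists>l\<ge>max 2 (nat \<lceil>L0\<rceil>). (G * (a + 64 * a / c + 1)) * (exp (- c * sqrt (real (l * (l + 1)))) * real (l * (l + 1)) ^ (2 * N + 1)) \<le> sqrt c / 2"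
  by (rule exp_beats_power) (use c G a in auto)
 then obtain l where l: "l \<ge> 2" "l \<ge> nat \<lceil>L0\<rceil>" and small: "(G * (a + 64 * a / c + 1)) * (exp (- c * sqrt (real (l * (l + 1)))) * real (l * (l + 1)) ^ (2 * N + 1)) \<le> sqrt c / 2"
  by auto
 define L where "L = real (l * (l + 1))"
 have lL: "real l \<le> L" unfolding L_def by simp
 have L1: "L \<ge> 1" using lL l(1) by linarith
 have LL0: "L \<ge> L0" using lL l(2) by linarith
 obtain \<mu> \<psi> \<psi>' where \<mu>: "c \<le> \<mu>" "\<mu> \<le> L" and md: "\<forall>x. DERIV \<psi> x :> \<psi>' x" "\<forall>x. DERIV \<psi>' x :> (pot m L x - \<mu>) * \<psi> x"
  and \<psi>: "\<psi> x0 = 0" "integral {x0..3/8*x0} (\<lambda>x. (\<psi> x)\<^sup>2) = 1" "integral {x0..0} (\<lambda>x. (\<psi> x)\<^sup>2) \<le> 4" "integral {x0..0} (\<lambda>x. (\<psi>' x)\<^sup>2) \<le> 4 * L"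
   "\<forall>y\<in>{3/8*x0..2/8*x0}. \<bar>\<psi> y\<bar> + \<bar>\<psi>' y\<bar> \<le> C * exp (- c * sqrt L)"
  using L0[rule_format, OF LL0] by (elim exE conjE)
 have mo: "mode m L \<mu> \<psi> \<psi>'" using md by (simp add: mode_def)
 obtain Y where Y: "eigenfunction Y L" using ex_eigenfunction[OF l(1)] unfolding L_def by blast
 define h where "h = quasimode x0 \<psi>"
 note hp = quasimode_powers[OF mo assms(2) \<psi>(1), where j=0, simplified, folded h_def]
 have hC: "C_on n UNIV h" for n by (rule hp(1))
 have h00: "h x0 = 0" by (rule hp(2))
 have hX: "h x = 0" if "x \<ge> x0 / 8" for x using hp(3)[of x] that by simp
 have X: "x0 < x0 / 8" "x0 / 8 < 0" using assms(2) by auto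
 have h2: "deriv (deriv h) x0 = 0"
  using quasimode_powers(2)[OF mo assms(2) \<psi>(1), where j=1] h00 by (simp add: Pop_def h_def)
 define u0 where "u0 = sep m h Y"
 define E where "E = A * (Cd * L ^ N)"
 have E0: "E \<ge> 0" unfolding E_def using assms(4) Cd L1 by simp
 define K where "K = C0 * E\<^sup>2"
 have K0: "K \<ge> 0" unfolding K_def using C0 by simp
 \<comment> \<open>Large enough for \<open>time_choice\<close>, but polynomial in \<open>L\<close>; it depends on the data but not on the solution.\<close>
 define T where "T = 64 * L * K / c + 1"
 have T0: "T > 0" unfolding T_def using L1 K0 c by (intro add_nonneg_pos divide_nonneg_pos mult_nonneg_nonneg) auto
 define \<epsilon> where "\<epsilon> = G * exp (- c * sqrt L)"
 have \<epsilon>0: "\<epsilon> > 0" unfolding \<epsilon>_def using G by simp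
 have dbound: "DB_norm m x0 k (u0, \<lambda>p. 0) \<le> ennreal (Cd * L ^ N)"
  unfolding u0_def h_def by (rule DB[rule_format, OF L1 _ mo \<psi>(1) Y \<psi>(3,4)]) (use \<mu> c in auto)
 have \<epsilon>KT: "\<epsilon> * (K + T) \<le> sqrt c / 2"
 proof -
  have K: "K = a * L ^ (2 * N)" unfolding K_def E_def a_def by (simp add: power_mult_distrib power_mult[symmetric] mult.commute)
  have "L ^ (2 * N) \<le> L ^ (2 * N + 1)" "1 \<le> L ^ (2 * N + 1)" by (rule power_increasing[OF _ L1], simp, rule one_le_power[OF L1])
  then have "K + T \<le> (a + 64 * a / c + 1) * L ^ (2 * N + 1)"
  proof -
   have "K \<le> a * L ^ (2 * N + 1)" unfolding K using \<open>L ^ (2 * N) \<le> _\<close> a by (rule mult_left_mono)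
   moreover have "64 * L * K / c = 64 * a / c * L ^ (2 * N + 1)" unfolding K by simp
   ultimately show ?thesis using \<open>1 \<le> L ^ (2 * N + 1)\<close> unfolding T_def distrib_right by linarith
  qed
  then have "\<epsilon> * (K + T) \<le> \<epsilon> * ((a + 64 * a / c + 1) * L ^ (2 * N + 1))" using \<epsilon>0 by (intro mult_left_mono) auto
  also have "\<dots> = (G * (a + 64 * a / c + 1)) * (exp (- c * sqrt L) * L ^ (2 * N + 1))" unfolding \<epsilon>_def by (simp only: mult_ac)
  finally show ?thesis using small unfolding L_def[symmetric] by linarith
 qed
 define r where "r = (\<lambda>x. deriv (deriv (cutoff x0)) x * \<psi> x + 2 * deriv (cutoff x0) x * \<psi>' x)"
 have c\<psi>: "continuous_on UNIV \<psi>" "continuous_on UNIV \<psi>'"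
  using C_on_imp_continuous[OF conjunct1[OF mode_smooth[OF mo, of 0]]] C_on_imp_continuous[OF conjunct2[OF mode_smooth[OF mo, of 0]]] by auto
 have rr: "continuous_on UNIV r" "integral {x0..0} (\<lambda>x. (r x)\<^sup>2) \<le> \<epsilon>\<^sup>2"
 proof -
  have d: "0 \<le> C * exp (- c * sqrt L)" using c by simp
  note rb = residual_bound[OF assms(2) B \<psi>(5) d c\<psi>, folded r_def]
  show "continuous_on UNIV r" by (rule rb(1))
  show "integral {x0..0} (\<lambda>x. (r x)\<^sup>2) \<le> \<epsilon>\<^sup>2" using rb(2) unfolding r_def \<epsilon>_def G_def by (simp only: mult.assoc)
 qed
 have mass: "1 \<le> integral {x0..0} (\<lambda>x. (h x)\<^sup>2)" "integral {x0..0} (\<lambda>x. (h x)\<^sup>2) \<le> 4"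
 proof -
  have ch: "continuous_on UNIV h" by (rule C_on_imp_continuous[OF hC[of 0]])
  have ih: "(\<lambda>x. (h x)\<^sup>2) integrable_on {a..b}" "(\<lambda>x. (\<psi> x)\<^sup>2) integrable_on {a..b}" for a b
   by (intro integrable_continuous_real continuous_intros continuous_on_subset[OF ch] continuous_on_subset[OF c\<psi>(1)]; simp)+
  have "integral {x0..3/8*x0} (\<lambda>x. (h x)\<^sup>2) = integral {x0..3/8*x0} (\<lambda>x. (\<psi> x)\<^sup>2)"
   by (rule Henstock_Kurzweil_Integration.integral_cong) (use assms(2) in \<open>auto simp: h_def quasimode_def cutoff_1\<close>)
  moreover have "integral {x0..3/8*x0} (\<lambda>x. (h x)\<^sup>2) \<le> integral {x0..0} (\<lambda>x. (h x)\<^sup>2)"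
   by (rule integral_subset_le) (use assms(2) ih in auto)
  ultimately show "1 \<le> integral {x0..0} (\<lambda>x. (h x)\<^sup>2)" using \<psi>(2) by simp
  have "integral {x0..0} (\<lambda>x. (h x)\<^sup>2) \<le> integral {x0..0} (\<lambda>x. (\<psi> x)\<^sup>2)"
  proof (rule integral_le[OF ih])
   fix x
   have "(cutoff x0 x)\<^sup>2 * (\<psi> x)\<^sup>2 \<le> 1 * (\<psi> x)\<^sup>2" unfolding cutoff_def by (intro mult_right_mono power_le_one step_range) simp
   then show "(h x)\<^sup>2 \<le> (\<psi> x)\<^sup>2" by (simp add: h_def quasimode_def power_mult_distrib)
  qed
  then show "integral {x0..0} (\<lambda>x. (h x)\<^sup>2) \<le> 4" using \<psi>(3) by linarith
 qed
 have \<omega>: "(sqrt \<mu>)\<^sup>2 = \<mu>" "sqrt \<mu> > 0" using \<mu> c by auto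
 show ?thesis
 proof (rule exI[of _ T], rule conjI[OF T0], rule exI[of _ u0], rule exI[of _ "\<lambda>p. 0"], intro conjI allI impI)
  show "admissible_datum x0 R u0"
   unfolding u0_def by (rule admissible_sep[OF assms(2,3) hC h00 hX X(2) eigenfunctionD(1)[OF Y]])
  show "admissible_datum x0 R (\<lambda>p. 0)"
   using admissible_sep[OF assms(2,3) C_on_const[OF open_UNIV, of _ 0] _ _ X(2) eigenfunctionD(1)[OF Y], of m]
   by (simp add: sep_def case_prod_unfold)
  show "\<exists>u. wave_solution m x0 u0 (\<lambda>p. 0) u"
   unfolding u0_def by (rule wave_existence[OF assms(1) hC h00 hX h2 X(1) Y order_trans[OF zero_le_one L1]])
  fix u assume sol: "wave_solution m x0 u0 (\<lambda>p. 0) u"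
  show "ennreal A * DB_norm m x0 k (u0, \<lambda>p. 0) < LE1_norm m x0 T u"
  proof (rule ccontr)
   assume "\<not> ?thesis"
   then have "LE1_norm m x0 T u \<le> ennreal A * DB_norm m x0 k (u0, \<lambda>p. 0)" by simp
   also have "\<dots> \<le> ennreal A * ennreal (Cd * L ^ N)" by (rule mult_left_mono[OF dbound]) simp
   also have "\<dots> = ennreal E" unfolding E_def using assms(4) Cd L1 by (simp add: ennreal_mult)
   finally have "LE1_norm m x0 T u \<le> ennreal E" .
   moreover have "C_upto 2 ({0..} \<times> {x0..} \<times> S2) (\<lambda>(t, p). u t p)" using sol by (simp add: wave_solution_def)
   ultimately have S: "(\<lambda>t. ennreal (inner_energy m x0 u t) * indicator {0..T} t) \<in> borel_measurable lborel"
    "(\<integral>\<^sup>+t. ennreal (inner_energy m x0 u t) * indicator {0..T} t \<partial>lborel) \<le> ennreal K"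
    using LE[rule_format, of u E T] E0 unfolding K_def by auto
   have eq: "deriv (deriv h) x - pot m L x * h x = - (sqrt \<mu>)\<^sup>2 * h x + r x" for x
    unfolding \<omega>(1) h_def r_def by (rule quasimode_residual[OF mo])
   have "0 < 8 * (1 + sqrt \<mu>) / sqrt \<mu>" using \<omega>(2) by (intro divide_pos_pos mult_pos_pos add_pos_pos) simp_all
   note obs = trapped_observability[OF assms(1,2) hC h00 hX X Y eq rr(1) \<omega>(2) mass rr(2) \<epsilon>0 sol[unfolded u0_def] T0 K0 this S]
   show False
    by (rule time_choice[OF c(1) _ _ \<omega>(2) L1 K0 T_def \<epsilon>KT obs]) (use \<mu> \<omega>(1) in simp_all)
  qed
 qed
qed

end
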